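(* Let $\mathcal{G}$ be a hereditary graph class with strongly sublinear separators. Then there is a subexponential-time parameterized algorithm for Triangle Hitting on $\mathcal{G}$. More precisely, if every graph in $\mathcal{G}$ on $n$ vertices has a balanced separator of size at most $f(n)=\beta n^\delta$ for some $\delta<1$, $\beta>0$, and $\mathcal{G}$ has linear neighborhood complexity with ratio $c$, then the algorithm runs on $n$-vertex graphs of $\mathcal{G}$ with parameter $k$ in time $2^{O(\beta\gamma^\delta c^\delta k^{2\delta/(1+\delta)}\log k)}\,n^{O(1)}$, for some universal constant $\gamma$.
   Context: Triangle Hitting: given a graph $G$ and integer $k$, decide whether some set of at most $k$ vertices intersects every triangle of $G$. A hereditary class $\mathcal{G}$ has strongly sublinear separators if there is $f:\mathbb{N}\to\mathbb{R}$ with $f(n)=O(n^\delta)$ for some $\delta\in[0,1)$ such that every $G\in\mathcal{G}$ has a balanced separator (a vertex set whose removal leaves components each with at most a constant fraction, e.g. $2/3$, of the vertices) of order at most $f(|V(G)|)$. A class $\mathcal{G}$ has linear neighborhood complexity with ratio $c$ if for every $G\in\mathcal{G}$ and every $X\subseteq V(G)$, $|\{N(v)\cap X : v\in V(G)\}|\le c|X|$ (every class with strongly sublinear separators has linear neighborhood complexity). *)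

theory Defs
  imports
    "Graph_Theory.Digraph_Isomorphism"
    "HOL-Library.Landau_Symbols"
    Complex_Main
begin

section \<open>Graphs and graph classes\<close>

text \<open>
  A finite simple graph is a symmetric loop-free finite digraph without parallel arcs, i.e.
  a \<^typ>\<open>'a pair_pre_digraph\<close> satisfying \<^const>\<open>pair_graph\<close>; an edge uv is
  the pair of arcs (u,v), (v,u).
\<close>

definition neighborhood :: "'a pair_pre_digraph \<Rightarrow> 'a \<Rightarrow> 'a set" where
  "neighborhood G v = {u. (v, u) \<in> parcs G}"

text \<open>
  As usual, a graph class is closed under isomorphism; since all graphs are finite,
  it is enough to consider graphs on natural numbers.
\<close>

definition graph_class :: "nat pair_pre_digraph set \<Rightarrow> bool" where
  "graph_class \<G> \<longleftrightarrow>
     (\<forall>G\<in>\<G>. pair_graph G) \<and>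
     (\<forall>G\<in>\<G>. \<forall>H. digraph_iso (with_proj G) (with_proj H) \<longrightarrow> H \<in> \<G>)"

definition hereditary :: "nat pair_pre_digraph set \<Rightarrow> bool" where
  "hereditary \<G> \<longleftrightarrow>
     graph_class \<G> \<and>
     (\<forall>G\<in>\<G>. \<forall>H. induced_subgraph (with_proj H) (with_proj G) \<longrightarrow> H \<in> \<G>)"

text \<open>
  On a symmetric digraph the strongly connected components are the connected components
  of the undirected graph. The constant fraction is 2/3.
\<close>

definition balanced_separator :: "'a pair_pre_digraph \<Rightarrow> 'a set \<Rightarrow> bool" where
  "balanced_separator G S \<longleftrightarrow>
     S \<subseteq> pverts G \<and>
     (\<forall>K \<in> pre_digraph.sccs_verts (with_proj G \<restriction> (pverts G - S)).
        real (card K) \<le> 2 / 3 * real (card (pverts G)))"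

definition has_separators :: "nat pair_pre_digraph set \<Rightarrow> (nat \<Rightarrow> real) \<Rightarrow> bool" where
  "has_separators \<G> f \<longleftrightarrow>
     (\<forall>G\<in>\<G>. \<exists>S. balanced_separator G S \<and> real (card S) \<le> f (card (pverts G)))"

definition strongly_sublinear_separators :: "nat pair_pre_digraph set \<Rightarrow> bool" where
  "strongly_sublinear_separators \<G> \<longleftrightarrow>
     (\<exists>f \<delta>. 0 \<le> \<delta> \<and> \<delta> < 1 \<and> f \<in> O(\<lambda>n. real n powr \<delta>) \<and> has_separators \<G> f)"

text \<open>
  The empty set X has to be excluded: it has one trace but cardinality 0, so that no
  class with a nonempty graph would satisfy the condition.
\<close>

definition linear_neighborhood_complexity :: "nat pair_pre_digraph set \<Rightarrow> real \<Rightarrow> bool" where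
  "linear_neighborhood_complexity \<G> c \<longleftrightarrow>
     (\<forall>G\<in>\<G>. \<forall>X. X \<subseteq> pverts G \<and> X \<noteq> {} \<longrightarrow>
        real (card {neighborhood G v \<inter> X | v. v \<in> pverts G}) \<le> c * real (card X))"


section \<open>Triangle Hitting\<close>

definition is_triangle :: "'a pair_pre_digraph \<Rightarrow> 'a set \<Rightarrow> bool" where
  "is_triangle G T \<longleftrightarrow>
     (\<exists>u v w. T = {u, v, w} \<and> card T = 3 \<and> T \<subseteq> pverts G \<and>
        (u, v) \<in> parcs G \<and> (v, w) \<in> parcs G \<and> (u, w) \<in> parcs G)"

definition triangle_hitting :: "'a pair_pre_digraph \<Rightarrow> nat \<Rightarrow> bool" where
  "triangle_hitting G k \<longleftrightarrow>
     (\<exists>S. S \<subseteq> pverts G \<and> card S \<le> k \<and> (\<forall>T. is_triangle G T \<longrightarrow> S \<inter> T \<noteq> {}))"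


section \<open>Model of computation\<close>

text \<open>
  Algorithms are programs of a first-order Lisp: the data are binary trees, and a program
  is a finite list of (mutually recursive) function bodies, the first one being the entry point.
  Variables are de Bruijn indices into the environment of arguments and local bindings.
  The running time is the number of expression nodes that are evaluated. Trees are
  never copied by a step (a value is a pointer to a shared cell), environments have length
  bounded by the program, and the only test is the one for the empty tree. Hence each step takes
  constant time on a pointer machine, and the running time is polynomially related to that
  on a Turing machine or a RAM with logarithmic cost.
\<close>

datatype sexp = SNil | SCons sexp sexp

datatype expr =
    EVar nat
  | ENil
  | ECons expr expr
  | EHd expr
  | ETl expr
  | EIf expr expr expr
  | ELet expr expr
  | ECall nat "expr list"

type_synonym program = "expr list"

fun shd :: "sexp \<Rightarrow> sexp" where
  "shd SNil = SNil"
| "shd (SCons a b) = a"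

fun stl :: "sexp \<Rightarrow> sexp" where
  "stl SNil = SNil"
| "stl (SCons a b) = b"

inductive eval :: "program \<Rightarrow> sexp list \<Rightarrow> expr \<Rightarrow> sexp \<Rightarrow> nat \<Rightarrow> bool"
  and evals :: "program \<Rightarrow> sexp list \<Rightarrow> expr list \<Rightarrow> sexp list \<Rightarrow> nat \<Rightarrow> bool"
  for P :: program
where
  eval_Var: "i < length \<rho> \<Longrightarrow> eval P \<rho> (EVar i) (\<rho> ! i) 1"
| eval_Nil: "eval P \<rho> ENil SNil 1"
| eval_Cons: "eval P \<rho> e\<^sub>1 v\<^sub>1 t\<^sub>1 \<Longrightarrow> eval P \<rho> e\<^sub>2 v\<^sub>2 t\<^sub>2 \<Longrightarrow>
    eval P \<rho> (ECons e\<^sub>1 e\<^sub>2) (SCons v\<^sub>1 v\<^sub>2) (t\<^sub>1 + t\<^sub>2 + 1)"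
| eval_Hd: "eval P \<rho> e v t \<Longrightarrow> eval P \<rho> (EHd e) (shd v) (t + 1)"
| eval_Tl: "eval P \<rho> e v t \<Longrightarrow> eval P \<rho> (ETl e) (stl v) (t + 1)"
| eval_If_True: "eval P \<rho> b w t\<^sub>1 \<Longrightarrow> w \<noteq> SNil \<Longrightarrow> eval P \<rho> e\<^sub>1 v t\<^sub>2 \<Longrightarrow>
    eval P \<rho> (EIf b e\<^sub>1 e\<^sub>2) v (t\<^sub>1 + t\<^sub>2 + 1)"
| eval_If_False: "eval P \<rho> b SNil t\<^sub>1 \<Longrightarrow> eval P \<rho> e\<^sub>2 v t\<^sub>2 \<Longrightarrow>
    eval P \<rho> (EIf b e\<^sub>1 e\<^sub>2) v (t\<^sub>1 + t\<^sub>2 + 1)"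
| eval_Let: "eval P \<rho> e\<^sub>1 w t\<^sub>1 \<Longrightarrow> eval P (w # \<rho>) e\<^sub>2 v t\<^sub>2 \<Longrightarrow>
    eval P \<rho> (ELet e\<^sub>1 e\<^sub>2) v (t\<^sub>1 + t\<^sub>2 + 1)"
| eval_Call: "evals P \<rho> es vs t\<^sub>1 \<Longrightarrow> f < length P \<Longrightarrow> eval P vs (P ! f) v t\<^sub>2 \<Longrightarrow>
    eval P \<rho> (ECall f es) v (t\<^sub>1 + t\<^sub>2 + 1)"
| evals_Nil: "evals P \<rho> [] [] 0"
| evals_Cons: "eval P \<rho> e v t\<^sub>1 \<Longrightarrow> evals P \<rho> es vs t\<^sub>2 \<Longrightarrow>
    evals P \<rho> (e # es) (v # vs) (t\<^sub>1 + t\<^sub>2)"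

lemma eval_deterministic:
  "eval P \<rho> e v t \<Longrightarrow> eval P \<rho> e v' t' \<Longrightarrow> v = v' \<and> t = t'"
  "evals P \<rho> es vs t \<Longrightarrow> evals P \<rho> es vs' t' \<Longrightarrow> vs = vs' \<and> t = t'"
proof (induction arbitrary: v' t' and vs' t' rule: eval_evals.inducts)
  case (eval_Var i \<rho>)
  then show ?case by (auto elim: eval.cases)
next
  case (eval_Nil \<rho>)
  then show ?case by (auto elim: eval.cases)
next
  case (eval_Cons \<rho> e\<^sub>1 v\<^sub>1 t\<^sub>1 e\<^sub>2 v\<^sub>2 t\<^sub>2)
  from eval_Cons.prems show ?case by (cases rule: eval.cases) (use eval_Cons.IH in blast)+
next
  case (eval_Hd \<rho> e v t)
  from eval_Hd.prems show ?case by (cases rule: eval.cases) (use eval_Hd.IH in blast)+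
next
  case (eval_Tl \<rho> e v t)
  from eval_Tl.prems show ?case by (cases rule: eval.cases) (use eval_Tl.IH in blast)+
next
  case (eval_If_True \<rho> b w t\<^sub>1 e\<^sub>1 v t\<^sub>2 e\<^sub>2)
  from eval_If_True.prems show ?case
    by (cases rule: eval.cases) (use eval_If_True.IH eval_If_True.hyps in blast)+
next
  case (eval_If_False \<rho> b t\<^sub>1 e\<^sub>2 v t\<^sub>2 e\<^sub>1)
  from eval_If_False.prems show ?case
    by (cases rule: eval.cases) (use eval_If_False.IH in blast)+
next
  case (eval_Let \<rho> e\<^sub>1 w t\<^sub>1 e\<^sub>2 v t\<^sub>2)
  from eval_Let.prems show ?case by (cases rule: eval.cases) (use eval_Let.IH in blast)+
next
  case (eval_Call \<rho> es vs t\<^sub>1 f v t\<^sub>2)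
  from eval_Call.prems show ?case by (cases rule: eval.cases) (use eval_Call.IH in blast)+
next
  case (evals_Nil \<rho>)
  then show ?case by (auto elim: evals.cases)
next
  case (evals_Cons \<rho> e v t\<^sub>1 es vs t\<^sub>2)
  from evals_Cons.prems show ?case by (cases rule: evals.cases) (use evals_Cons.IH in blast)+
qed

definition computes_in_time :: "program \<Rightarrow> sexp \<Rightarrow> sexp \<Rightarrow> nat \<Rightarrow> bool" where
  "computes_in_time P x y t \<longleftrightarrow> eval P [x] (ECall 0 [EVar 0]) y t"

fun enc_list :: "sexp list \<Rightarrow> sexp" where
  "enc_list [] = SNil"
| "enc_list (x # xs) = SCons x (enc_list xs)"

definition enc_bool :: "bool \<Rightarrow> sexp" where
  "enc_bool b = (if b then SCons SNil SNil else SNil)"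

text \<open>The parameter is given in unary, the graph by its adjacency matrix.\<close>

definition enc_nat :: "nat \<Rightarrow> sexp" where
  "enc_nat k = enc_list (replicate k SNil)"

definition enc_graph :: "nat pair_pre_digraph \<Rightarrow> sexp" where
  "enc_graph G = (let n = card (pverts G) in
     enc_list (map (\<lambda>u. enc_list (map (\<lambda>v. enc_bool ((u, v) \<in> parcs G)) [0..<n])) [0..<n]))"

definition enc_instance :: "nat pair_pre_digraph \<Rightarrow> nat \<Rightarrow> sexp" where
  "enc_instance G k = SCons (enc_graph G) (enc_nat k)"

text \<open>
  Input graphs have vertex set {0, ..., n-1}; every graph of a graph class is isomorphic to
  such a graph of the class. The bound T takes the number of vertices and the parameter.
\<close>

definition solves_triangle_hitting_on ::
    "program \<Rightarrow> nat pair_pre_digraph set \<Rightarrow> (nat \<Rightarrow> nat \<Rightarrow> real) \<Rightarrow> bool" where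
  "solves_triangle_hitting_on P \<G> T \<longleftrightarrow>
     (\<forall>n k. \<forall>G\<in>\<G>. pverts G = {..<n} \<longrightarrow>
        (\<exists>t. computes_in_time P (enc_instance G k) (enc_bool (triangle_hitting G k)) t \<and>
             real t \<le> T n k))"

text \<open>
  Time of the form 2 to the o(k) times n to the O(1). The shift n + 2 makes the polynomial
  factor meaningful for n = 0 and n = 1; for larger n it only changes the exponent.
\<close>

definition subexponential_parameterized :: "(nat \<Rightarrow> nat \<Rightarrow> real) \<Rightarrow> bool" where
  "subexponential_parameterized T \<longleftrightarrow>
     (\<exists>g d. g \<in> o(\<lambda>k. real k) \<and> (\<forall>n k. T n k \<le> 2 powr g k * real (n + 2) ^ d))"

end

theory Submission
  imports Defs "HOL-Real_Asymp.Real_Asymp"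
begin

text \<open>
  The vertices \<open>X\<close> of a maximal family of disjoint triangles meet every triangle, and \<open>|X| \<le> 3k\<close> in
  a yes-instance. For a guess \<open>b\<close>, take the vertices \<open>v \<in> X\<close> one by one and consider the
  vertex set \<open>M\<close> of a maximal matching in the part of \<open>N(v)\<close> that is not yet reserved. If \<open>|M| < 2k/b\<close>, then \<open>M\<close> joins
  the set \<open>R\<close> of relevant vertices. Otherwise branch: either \<open>v\<close> is in the solution, or the solution
  contains half of \<open>M\<close>, which is possible at most \<open>b\<close> times; this makes \<open>k^O(b)\<close> leaves with
  \<open>|R| \<le> 5k + 6k^2/b\<close>. At a leaf every remaining triangle has two vertices in \<open>R\<close>. An edge of \<open>R\<close>
  with more than \<open>k\<close> common neighbors outside \<open>R\<close> has to be hit itself, and vertices outside \<open>R\<close> with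
  the same neighbors in \<open>R\<close> are taken or left together, so that one weighted representative of each
  trace on \<open>R\<close> remains. Separators of order \<open>b\<close>, found by brute force, give this kernel an elimination
  forest of depth \<open>O(b log k)\<close>, over which the hitting problem is solved exhaustively in time \<open>k^O(b)\<close>.
  If a separator is missing, \<open>b\<close> is increased. The kernel has at most \<open>(1 + c) |R|\<close> vertices, hence
  separators of order \<open>\<beta> (22 c k^(2/(1+\<delta>)))^\<delta>\<close> as soon as \<open>b \<ge> k^(2\<delta>/(1+\<delta>))\<close>, and both conditions
  hold for \<open>b\<close> about \<open>\<beta> (22 c)^\<delta> k^(2\<delta>/(1+\<delta>))\<close>.

  Without a given ratio \<open>c\<close>, it suffices that the number of traces is \<open>O(|R|^(1+\<eta>))\<close> for every
  \<open>\<eta> > 0\<close>. Graphs with a 1-subdivision in the class have few edges: in a densest such graph, a greedily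
  chosen subgraph of bounded degree without short cycles would have three edges per vertex, while cutting its
  subdivision into pieces of bounded size by few vertices leaves a forest in each piece. Choose a largest such
  graph on \<open>R\<close> whose edges are subdivided by distinct representatives of traces; then all other traces
  are cliques of it, and a degenerate graph has few cliques.
\<close>

text \<open>The program knows neither \<beta>, \<delta> nor c, and it is the same for every class.
  An answer other than failure is correct on every graph and for every b, and a failure comes with a
  vertex set that has no separator of order at most b. The class is therefore needed only to show
  that some small b does not fail.

  For this the time k^O(b) must hold for every b on every graph, before anything is known about
  traces. This is what the threshold k on common neighbors is for: a vertex outside R stays in a
  constraint only if its two neighbors in R have at most k common ones, which leaves at most |R| + k
  |R|^2 vertices, a polynomial in k. Brute force over separators then costs k^O(b), and the
  logarithm of the kernel size is O(log k).

  The exponent is a fixed point. If b is at least k^\<tau>, then |R| = O(k^(2 - \<tau>)), and a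
  kernel of size proportional to |R| has separators of order about k^((2 - \<tau>) \<delta>).
  Failure is excluded when this is about k^\<tau> again, and (2 - \<tau>) \<delta> = \<tau> gives
  \<tau> = 2 \<delta> / (1 + \<delta>).\<close>

abbreviation ETrue :: expr where "ETrue \<equiv> ECons ENil ENil"
text \<open>A third outcome besides the two Booleans. Like true it is a nonempty tree, but unlike
  true it has a nonempty head, which is what \<open>b_loop\<close> tests.\<close>

abbreviation EFail :: expr where "EFail \<equiv> ECons ETrue ENil"

text \<open>A left fold as a tail-recursive function number \<open>j\<close>: argument 0 is the
  list, argument 1 the accumulator, and the \<open>m\<close> further arguments are passed on
  unchanged. In \<open>step\<close> the current element is the head of argument 0. Since nearly all
  loops have this form, one lemma bounds the time of all of them.\<close>

definition fdef :: "nat \<Rightarrow> nat \<Rightarrow> expr \<Rightarrow> expr" where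
  "fdef j m step = EIf (EVar 0) (ECall j (ETl (EVar 0) # step # map EVar [2..<m+2])) (EVar 1)"

abbreviation EHead :: expr where "EHead \<equiv> EHd (EVar 0)"
abbreviation EAcc :: expr where "EAcc \<equiv> EVar 1"

text \<open>The adjacency matrix is the empty tree exactly for n = 0, where the answer is true.
  Otherwise the packing is compared with 3k, and the search starts with b = 1, written in unary as
  the last argument.\<close>

definition b_main :: expr where "b_main =
  EIf (EHd (EVar 0))
    (ELet (ETl (ECall 8 [EHd (EVar 0), ECons ENil ENil]))
      (ELet (ECall 11 [EVar 0, ENil, EHd (EVar 1), EVar 0])
        (ELet (ECall 12 [EVar 0, ENil])
          (EIf (ECall 3 [EVar 0, ECall 2 [ETl (EVar 3), ECall 2 [ETl (EVar 3), ETl (EVar 3)]]])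
            (ECall 40 [EHd (EVar 3), EVar 2, EVar 1, EVar 0, ETl (EVar 3), ECons ENil ENil])
            ENil))))
    ETrue"

definition b_drop :: expr where "b_drop = fdef 1 0 (ETl EAcc)"
definition b_rapp :: expr where "b_rapp = fdef 2 0 (ECons EHead EAcc)"
text \<open>Numbers are unary lists, so the first argument is at most the second iff nothing is left
  of it after dropping as many cells. The contents of the cells do not matter, so lengths of vertex
  lists are compared without being computed.\<close>

definition b_le :: expr where "b_le = EIf (ECall 1 [EVar 1, EVar 0]) ENil ETrue"
definition b_eq :: expr where "b_eq = EIf (ECall 3 [EVar 0, EVar 1]) (ECall 3 [EVar 1, EVar 0]) ENil"
definition b_mem :: expr where "b_mem = fdef 5 1 (EIf (ECall 4 [EHead, EVar 2]) ETrue EAcc)"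
definition b_disj :: expr where "b_disj = fdef 6 1 (EIf (ECall 5 [EVar 2, ENil, EHead]) ENil EAcc)"
definition b_adj :: expr where
  "b_adj = EHd (ECall 1 [EVar 2, EHd (ECall 1 [EVar 1, EVar 0])])"
text \<open>The accumulator is a counter consed onto the list of all smaller numbers;
  \<open>b_main\<close> removes the counter at the end.\<close>

definition b_range :: expr where
  "b_range = fdef 8 0 (ECons (ECons ENil (EHd EAcc)) (ECons (EHd EAcc) (ETl EAcc)))"
definition b_t3 :: expr where
  "b_t3 = fdef 9 3 (EIf (ECall 7 [EVar 2, EVar 4, EHead])
     (EIf (ECall 7 [EVar 2, EVar 3, EHead])
       (ECons (ECons (EVar 3) (ECons (EVar 4) (ECons EHead ENil))) EAcc) EAcc) EAcc)"
definition b_t2 :: expr where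
  "b_t2 = fdef 10 3 (EIf (ECall 7 [EVar 2, EVar 3, EHead])
     (ECall 9 [EVar 4, EAcc, EVar 2, EVar 3, EHead]) EAcc)"
definition b_t1 :: expr where
  "b_t1 = fdef 11 2 (ECall 10 [EVar 3, EAcc, EVar 2, EHead, EVar 3])"
definition b_pack :: expr where
  "b_pack = fdef 12 0 (EIf (ECall 6 [EHead, ETrue, EAcc]) (ECall 2 [EHead, EAcc]) EAcc)"
text \<open>The triangle list contains every triangle in all six orders, so the tails of the entries
  with head v are the edges inside N(v). They are matched greedily, avoiding the list of reserved
  vertices.\<close>

definition b_mtch :: expr where
  "b_mtch = fdef 13 2 (EIf (ECall 4 [EHd EHead, EVar 2])
     (EIf (ECall 6 [ETl EHead, ETrue, EVar 3])
       (EIf (ECall 6 [ETl EHead, ETrue, EAcc]) (ECall 2 [ETl EHead, EAcc]) EAcc) EAcc) EAcc)"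
definition b_mult :: expr where "b_mult = fdef 14 1 (ECall 2 [EVar 2, EAcc])"
definition b_filin :: expr where
  "b_filin = fdef 15 1 (EIf (ECall 5 [EVar 2, ENil, EHead]) (ECons EHead EAcc) EAcc)"
definition b_filout :: expr where
  "b_filout = fdef 16 1 (EIf (ECall 5 [EVar 2, ENil, EHead]) EAcc (ECons EHead EAcc))"
definition b_alladj :: expr where
  "b_alladj = fdef 17 2 (EIf (ECall 7 [EVar 2, EVar 3, EHead]) EAcc ENil)"
definition b_common :: expr where
  "b_common = fdef 18 2 (EIf (ECall 17 [EVar 3, ETrue, EVar 2, EHead]) (ECons EHead EAcc) EAcc)"
definition b_same :: expr where
  "b_same = fdef 19 3 (EIf (ECall 7 [EVar 2, EVar 3, EHead])
     (EIf (ECall 7 [EVar 2, EVar 4, EHead]) EAcc ENil)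
     (EIf (ECall 7 [EVar 2, EVar 4, EHead]) ENil EAcc))"
definition b_cls :: expr where
  "b_cls = fdef 20 3 (EIf (ECall 19 [EVar 3, ETrue, EVar 2, EVar 4, EHead]) (ECons EHead EAcc) EAcc)"
definition b_reps :: expr where
  "b_reps = fdef 21 3 (ECons (EHd (ECall 20 [EVar 4, ENil, EVar 2, EVar 3, EHead])) EAcc)"
text \<open>Environment: \<open>t g R U Y k\<close>\<close>
definition b_constr :: expr where
  "b_constr = ELet (ECall 15 [EVar 0, ENil, EVar 2])
    (ECall 16 [EIf (ECall 3 [ECall 18 [EVar 5, ENil, EVar 2, EVar 0], EVar 6])
       (ECall 21 [ECall 16 [EVar 1, ENil, EVar 3], EVar 0, EVar 2, EVar 3, EVar 5])
       (EVar 0), ENil, EVar 4])"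
text \<open>Environment: \<open>T acc g R U Y k D\<close>\<close>
definition b_constrs :: expr where
  "b_constrs = fdef 23 6 (EIf (ECall 6 [EHead, ETrue, EVar 7])
     (ECons (ECall 22 [EHead, EVar 2, EVar 3, EVar 4, EVar 5, EVar 6]) EAcc) EAcc)"
definition b_ins :: expr where
  "b_ins = fdef 24 0 (EIf (ECall 5 [EAcc, ENil, EHead]) EAcc (ECons EHead EAcc))"
definition b_verts :: expr where "b_verts = fdef 25 0 (ECall 24 [EHead, EAcc])"
definition b_touch :: expr where
  "b_touch = fdef 26 2 (EIf (ECall 7 [EVar 2, EVar 3, EHead]) ETrue EAcc)"
definition b_addv :: expr where
  "b_addv = fdef 27 2 (EIf (ECall 26 [EHead, ENil, EVar 2, EVar 3])
     (ECons (ECall 2 [EHead, EHd EAcc]) (ETl EAcc))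
     (ECons (EHd EAcc) (ECons EHead (ETl EAcc))))"
definition b_comps :: expr where
  "b_comps = fdef 28 1 (ECall 27 [EAcc, ECons (ECons EHead ENil) ENil, EVar 2, EHead])"
definition b_okc :: expr where
  "b_okc = fdef 29 1 (EIf (ECall 3 [ECall 2 [EHead, ECall 2 [EHead, EHead]], EVar 2]) EAcc ENil)"
text \<open>Environment: \<open>S K g\<close>\<close>
definition b_ok :: expr where
  "b_ok = ECall 29 [ECall 28 [ECall 16 [EVar 1, ENil, EVar 0], ENil, EVar 2], ETrue,
     ECall 2 [EVar 1, EVar 1]]"
text \<open>Environment: \<open>rest S b K g\<close>\<close>
definition b_findsep :: expr where
  "b_findsep = EIf (ECall 30 [EVar 1, EVar 3, EVar 4]) (ECons (EVar 1) ENil)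
     (EIf (EVar 0) (EIf (EVar 2)
        (ELet (ECall 31 [ETl (EVar 0), ECons (EHd (EVar 0)) (EVar 1), ETl (EVar 2), EVar 3, EVar 4])
          (EIf (EVar 0) (EVar 0) (ECall 31 [ETl (EVar 1), EVar 2, EVar 3, EVar 4, EVar 5])))
        ENil) ENil)"
definition b_path :: expr where "b_path = fdef 32 0 (ECons (ECons EHead EAcc) ENil)"
text \<open>Environment: \<open>Ks g b\<close>\<close>
definition b_bl :: expr where
  "b_bl = EIf (EVar 0)
     (ELet (ECall 33 [ETl (EVar 0), EVar 1, EVar 2])
       (EIf (EVar 0)
         (ELet (ECall 31 [EHd (EVar 1), ENil, EVar 3, EHd (EVar 1), EVar 2])
           (EIf (EVar 0)
             (ELet (ECall 33 [ECall 28 [ECall 16 [EHd (EVar 2), ENil, EHd (EVar 0)], ENil, EVar 3], EVar 3, EVar 4])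
               (EIf (EVar 0)
                 (ECons (ECall 2 [ECall 32 [EHd (EVar 1), EHd (EVar 0)], EHd (EVar 2)]) ENil)
                 ENil))
             ENil))
         ENil))
     ETrue"
definition b_hasnil :: expr where "b_hasnil = fdef 34 0 (EIf EHead EAcc ETrue)"
definition b_del :: expr where
  "b_del = fdef 35 1 (EIf (ECall 5 [EHead, ENil, EVar 2]) EAcc (ECons EHead EAcc))"
definition b_rem :: expr where
  "b_rem = fdef 36 1 (ECons (ECall 16 [EHead, ENil, ECons (EVar 2) ENil]) EAcc)"
text \<open>Environment: \<open>F C g R Y inf\<close>\<close>
definition b_solve :: expr where
  "b_solve = EIf (EVar 0)
     (ELet (EHd (EHd (EVar 0)))
       (ELet (ECall 2 [EIf (ECall 5 [EVar 4, ENil, EVar 0]) (ECons (EVar 0) ENil)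
                  (ECall 20 [EVar 5, ENil, EVar 3, EVar 4, EVar 0]),
                ECall 37 [ETl (EHd (EVar 1)), ECall 35 [EVar 2, ENil, EVar 0], EVar 3, EVar 4, EVar 5, EVar 6]])
         (ELet (ECall 37 [ETl (EHd (EVar 2)), ECall 36 [EVar 3, ENil, EVar 1], EVar 4, EVar 5, EVar 6, EVar 7])
           (ECall 2 [EIf (ECall 3 [EVar 1, EVar 0]) (EVar 1) (EVar 0),
              ECall 37 [ETl (EVar 3), EVar 4, EVar 5, EVar 6, EVar 7, EVar 8]]))))
     (EIf (ECall 34 [EVar 1, ENil]) (EVar 5) ENil)"
text \<open>Environment: \<open>g V T D U R k b\<close>\<close>
definition b_leaf :: expr where
  "b_leaf = ELet (ECall 16 [ECall 16 [EVar 1, ENil, EVar 5], ENil, EVar 3])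
     (ELet (ECall 23 [EVar 3, ENil, EVar 1, EVar 6, EVar 5, EVar 0, EVar 7, EVar 4])
       (ELet (ECall 33 [ECons (ECall 25 [EVar 0, ENil]) ENil, EVar 2, EVar 9])
         (EIf (EVar 0)
           (ECall 3 [ECall 37 [EHd (EVar 0), EVar 1, EVar 3, EVar 8, EVar 2, ECons ENil (EVar 9)], EVar 9])
           EFail)))"
text \<open>Environment: \<open>Xs D U Q R k' g V T k2 b\<close>\<close>
definition b_branch :: expr where
  "b_branch = EIf (EVar 0)
     (ELet (ECall 13 [EVar 8, ENil, EHd (EVar 0), ECall 2 [EVar 1, EVar 3]])
       (EIf (ECall 3 [EVar 10, ECall 14 [EVar 0, ENil, EVar 11]])
         (ELet (EIf (EVar 6)
                 (ECall 39 [ETl (EVar 1), ECons (EHd (EVar 1)) (EVar 2), EVar 3, EVar 4, EVar 5, ETl (EVar 6),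
                    EVar 7, EVar 8, EVar 9, EVar 10, EVar 11])
                 ENil)
           (EIf (EVar 0) (EVar 0)
             (EIf (ECall 3 [ECall 2 [EVar 1, EVar 5], EVar 11])
               (ECall 39 [ETl (EVar 2), EVar 3, ECons (EHd (EVar 2)) (EVar 4), ECall 2 [EVar 1, EVar 5],
                  ECall 2 [EVar 1, EVar 6], EVar 7, EVar 8, EVar 9, EVar 10, EVar 11, EVar 12])
               ENil)))
         (ECall 39 [ETl (EVar 1), EVar 2, EVar 3, EVar 4, ECall 2 [EVar 0, EVar 5], EVar 6,
            EVar 7, EVar 8, EVar 9, EVar 10, EVar 11])))
     (ECall 38 [EVar 6, EVar 7, EVar 8, EVar 1, EVar 2, EVar 4, EVar 5, EVar 10])"
text \<open>Environment: \<open>g V T X k b\<close>\<close>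
definition b_loop :: expr where
  "b_loop = ELet (ECall 39 [EVar 3, ENil, ENil, ENil, EVar 3, EVar 4, EVar 0, EVar 1, EVar 2,
        ECall 2 [EVar 4, EVar 4], EVar 5])
     (EIf (EHd (EVar 0))
       (ECall 40 [EVar 1, EVar 2, EVar 3, EVar 4, EVar 5, ECons ENil (EVar 6)])
       (EVar 0))"

definition prog :: program where
  "prog = [b_main, b_drop, b_rapp, b_le, b_eq, b_mem, b_disj, b_adj, b_range, b_t3,
     b_t2, b_t1, b_pack, b_mtch, b_mult, b_filin, b_filout, b_alladj, b_common, b_same,
     b_cls, b_reps, b_constr, b_constrs, b_ins, b_verts, b_touch, b_addv, b_comps, b_okc,
     b_ok, b_findsep, b_path, b_bl, b_hasnil, b_del, b_rem, b_solve, b_leaf, b_branch, b_loop]"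

lemma length_prog: "length prog = 41"
  by (simp add: prog_def)

lemma prog_nth:
  "prog ! 0 = b_main" "prog ! 1 = b_drop" "prog ! 2 = b_rapp" "prog ! 3 = b_le" "prog ! 4 = b_eq"
  "prog ! 5 = b_mem" "prog ! 6 = b_disj" "prog ! 7 = b_adj" "prog ! 8 = b_range" "prog ! 9 = b_t3"
  "prog ! 10 = b_t2" "prog ! 11 = b_t1" "prog ! 12 = b_pack" "prog ! 13 = b_mtch" "prog ! 14 = b_mult"
  "prog ! 15 = b_filin" "prog ! 16 = b_filout" "prog ! 17 = b_alladj" "prog ! 18 = b_common" "prog ! 19 = b_same"
  "prog ! 20 = b_cls" "prog ! 21 = b_reps" "prog ! 22 = b_constr" "prog ! 23 = b_constrs" "prog ! 24 = b_ins"
  "prog ! 25 = b_verts" "prog ! 26 = b_touch" "prog ! 27 = b_addv" "prog ! 28 = b_comps" "prog ! 29 = b_okc"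
  "prog ! 30 = b_ok" "prog ! 31 = b_findsep" "prog ! 32 = b_path" "prog ! 33 = b_bl" "prog ! 34 = b_hasnil"
  "prog ! 35 = b_del" "prog ! 36 = b_rem" "prog ! 37 = b_solve" "prog ! 38 = b_leaf" "prog ! 39 = b_branch"
  "prog ! 40 = b_loop"
  by (simp_all add: prog_def)

section \<open>Evaluation with time bounds\<close>

definition runs :: "sexp list \<Rightarrow> expr \<Rightarrow> sexp \<Rightarrow> nat \<Rightarrow> bool" where
  "runs \<rho> e v t \<longleftrightarrow> (\<exists>t'\<le>t. eval prog \<rho> e v t')"

definition runs_list :: "sexp list \<Rightarrow> expr list \<Rightarrow> sexp list \<Rightarrow> nat \<Rightarrow> bool" where
  "runs_list \<rho> es vs t \<longleftrightarrow> (\<exists>t'\<le>t. evals prog \<rho> es vs t')"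

lemma runs_mono: "runs \<rho> e v t \<Longrightarrow> t \<le> t' \<Longrightarrow> runs \<rho> e v t'"
  unfolding runs_def by (meson order_trans)

lemma runs_Var: "i < length \<rho> \<Longrightarrow> \<rho> ! i = v \<Longrightarrow> runs \<rho> (EVar i) v 1"
  unfolding runs_def using eval_Var by fastforce

lemma runs_Nil: "runs \<rho> ENil SNil 1"
  unfolding runs_def using eval_Nil by fastforce

lemma runs_Cons: "runs \<rho> e1 v1 t1 \<Longrightarrow> runs \<rho> e2 v2 t2 \<Longrightarrow> runs \<rho> (ECons e1 e2) (SCons v1 v2) (t1 + t2 + 1)"
  unfolding runs_def by (meson add_mono order_refl eval_Cons)

lemma runs_Hd: "runs \<rho> e v t \<Longrightarrow> shd v = w \<Longrightarrow> runs \<rho> (EHd e) w (t + 1)"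
  unfolding runs_def by (metis add_mono order_refl eval_Hd)

lemma runs_Tl: "runs \<rho> e v t \<Longrightarrow> stl v = w \<Longrightarrow> runs \<rho> (ETl e) w (t + 1)"
  unfolding runs_def by (metis add_mono order_refl eval_Tl)

lemma runs_If:
  assumes "runs \<rho> b w t1" "(w \<noteq> SNil) = c" "c \<Longrightarrow> runs \<rho> e1 v1 t2" "\<not> c \<Longrightarrow> runs \<rho> e2 v2 t2"
  shows "runs \<rho> (EIf b e1 e2) (if c then v1 else v2) (t1 + t2 + 1)"
proof (cases c)
  case True
  obtain t1' t2' where *: "t1' \<le> t1" "eval prog \<rho> b w t1'" "t2' \<le> t2" "eval prog \<rho> e1 v1 t2'"
    using assms True unfolding runs_def by meson
  have "eval prog \<rho> (EIf b e1 e2) v1 (t1' + t2' + 1)"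
    using * True assms(2) by (intro eval_If_True[where w = w]) auto
  then show ?thesis unfolding runs_def using True * by (intro exI[of _ "t1'+t2'+1"]) auto
next
  case False
  obtain t1' t2' where *: "t1' \<le> t1" "eval prog \<rho> b w t1'" "t2' \<le> t2" "eval prog \<rho> e2 v2 t2'"
    using assms False unfolding runs_def by meson
  have "eval prog \<rho> (EIf b e1 e2) v2 (t1' + t2' + 1)"
    using * False assms(2) by (intro eval_If_False) auto
  then show ?thesis unfolding runs_def using False * by (intro exI[of _ "t1'+t2'+1"]) auto
qed

lemma runs_Let: "runs \<rho> e1 w t1 \<Longrightarrow> runs (w # \<rho>) e2 v t2 \<Longrightarrow> runs \<rho> (ELet e1 e2) v (t1 + t2 + 1)"
  unfolding runs_def by (meson add_mono order_refl eval_Let)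

lemma runs_Call: "runs_list \<rho> es vs t1 \<Longrightarrow> f < 41 \<Longrightarrow> runs vs (prog ! f) v t2 \<Longrightarrow>
    runs \<rho> (ECall f es) v (t1 + t2 + 1)"
  unfolding runs_def runs_list_def by (metis add_mono order_refl eval_Call length_prog)

lemma runs_list_Nil: "runs_list \<rho> [] [] 0"
  unfolding runs_list_def using evals_Nil by fastforce

lemma runs_list_Cons: "runs \<rho> e v t1 \<Longrightarrow> runs_list \<rho> es vs t2 \<Longrightarrow> runs_list \<rho> (e # es) (v # vs) (t1 + t2)"
  unfolding runs_def runs_list_def by (meson add_mono evals_Cons)

lemma runs_list_vars: "map f is = vs \<Longrightarrow> (\<And>i. i \<in> set is \<Longrightarrow> i < length \<rho> \<and> \<rho> ! i = f i) \<Longrightarrow>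
    runs_list \<rho> (map EVar is) vs (length is)"
proof (induction "is" arbitrary: vs)
  case Nil then show ?case by (simp add: runs_list_Nil)
next
  case (Cons i xs)
  then show ?case
    using runs_list_Cons[OF runs_Var[of i \<rho> "f i"] Cons.IH[OF refl]] by simp
qed

definition EL :: "('a \<Rightarrow> sexp) \<Rightarrow> 'a list \<Rightarrow> sexp" where
  "EL e xs = enc_list (map e xs)"

lemma EL_simps [simp]: "EL e [] = SNil" "EL e (x # xs) = SCons (e x) (EL e xs)"
  by (simp_all add: EL_def)

lemma EL_Nil_iff [simp]: "EL e xs = SNil \<longleftrightarrow> xs = []" "SNil = EL e xs \<longleftrightarrow> xs = []"
  by (cases xs; simp)+

text \<open>The loop \<^const>\<open>fdef\<close> maintains an accumulator; \<open>F p\<close> is its value after the prefix \<open>p\<close>.\<close>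

lemma runs_fold:
  assumes "prog ! j = fdef j m step" "j < 41" "length ps = m"
    and "\<And>p x s. l = p @ x # s \<Longrightarrow> runs (SCons (e x) (EL e s) # F p # ps) step (F (p @ [x])) B"
  shows "runs (EL e l # F [] # ps) (prog ! j) (F l) ((length l + 1) * (B + m + 5))"
proof -
  have "l = p @ s \<Longrightarrow> runs (EL e s # F p # ps) (prog ! j) (F l) ((length s + 1) * (B + m + 5))" for p s
  proof (induction s arbitrary: p)
    case Nil
    then have "runs (EL e [] # F p # ps) (EIf (EVar 0) (ECall j (ETl (EVar 0) # step # map EVar [2..<m+2])) (EVar 1))
        (if False then undefined else F l) (1 + 1 + 1)"
      by (intro runs_If[where w = "SNil"] runs_Var) (auto)
    then show ?case unfolding assms(1) fdef_def by (auto elim!: runs_mono)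
  next
    case (Cons x s)
    let ?\<rho> = "EL e (x # s) # F p # ps"
    have 1: "runs ?\<rho> step (F (p @ [x])) B" using assms(4)[of p x s] Cons.prems by simp
    have "map (\<lambda>i. ?\<rho> ! i) [2..<m+2] = ps"
      using assms(3) by (intro nth_equalityI) (auto simp del: upt_Suc)
    then have 2: "runs_list ?\<rho> (map EVar [2..<m+2]) ps m"
      using runs_list_vars[of "\<lambda>i. ?\<rho> ! i" "[2..<m+2]" ps ?\<rho>] assms(3) by (auto simp del: upt_Suc)
    have 3: "runs_list ?\<rho> (ETl (EVar 0) # step # map EVar [2..<m+2]) (EL e s # F (p @ [x]) # ps) ((1+1) + (B + m))"
      by (intro runs_list_Cons runs_Tl runs_Var 1 2) auto
    have 4: "runs (EL e s # F (p @ [x]) # ps) (prog ! j) (F l) ((length s + 1) * (B + m + 5))"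
      using Cons by simp
    have "runs ?\<rho> (EIf (EVar 0) (ECall j (ETl (EVar 0) # step # map EVar [2..<m+2])) (EVar 1))
        (if True then F l else undefined) (1 + (((1+1) + (B + m)) + ((length s + 1) * (B + m + 5)) + 1) + 1)"
      by (rule runs_If[where w = "EL e (x # s)"], rule runs_Var, simp, simp, simp,
          rule runs_Call[OF 3 assms(2) 4], simp)
    then show ?case unfolding assms(1) fdef_def by (auto elim!: runs_mono)
  qed
  from this[of "[]" l] show ?thesis by simp
qed

text \<open>Time bounds are kept only as exponents of \<open>L + 2\<close>, where \<open>L\<close>
  bounds the lengths and numbers that occur. The base is at least 2, so sums and constants are
  absorbed by increasing the exponent, and the bound for an expression is found by adding up
  exponents along its syntax.\<close>

definition J :: "nat \<Rightarrow> sexp list \<Rightarrow> expr \<Rightarrow> sexp \<Rightarrow> nat \<Rightarrow> bool" where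
  "J L \<rho> e v d \<longleftrightarrow> runs \<rho> e v ((L + 2) ^ d)"

definition Js :: "nat \<Rightarrow> sexp list \<Rightarrow> expr list \<Rightarrow> sexp list \<Rightarrow> nat \<Rightarrow> bool" where
  "Js L \<rho> es vs d \<longleftrightarrow> runs_list \<rho> es vs ((L + 2) ^ d)"

lemma pow_one_le: "(1::nat) \<le> (L + 2) ^ d"
  by simp

lemma pow_add_le: "(L + 2) ^ a + (L + 2) ^ b + 1 \<le> (L + 2 :: nat) ^ (a + b + 2)"
proof -
  have "(L + 2) ^ a \<le> (L + 2 :: nat) ^ (a + b)" "(L + 2) ^ b \<le> (L + 2 :: nat) ^ (a + b)"
    "1 \<le> (L + 2 :: nat) ^ (a + b)"
    by (auto intro!: power_increasing)
  then have "(L + 2) ^ a + (L + 2) ^ b + 1 \<le> 4 * (L + 2 :: nat) ^ (a + b)" by linarith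
  also have "\<dots> \<le> (L + 2) ^ 2 * (L + 2) ^ (a + b)"
    by (intro mult_right_mono) (auto simp: power2_eq_square)
  also have "\<dots> = (L + 2) ^ (a + b + 2)" by (simp add: power_add power2_eq_square algebra_simps)
  finally show ?thesis .
qed

lemma pow_Suc_le: "(L + 2) ^ d + 1 \<le> (L + 2 :: nat) ^ (d + 1)"
proof -
  have "(L + 2 :: nat) ^ d + 1 \<le> 2 * (L + 2) ^ d" using pow_one_le[of L d] by linarith
  also have "\<dots> \<le> (L + 2) * (L + 2) ^ d" by (intro mult_right_mono) auto
  finally show ?thesis by simp
qed

lemma J_mono: "J L \<rho> e v d \<Longrightarrow> d \<le> d' \<Longrightarrow> J L \<rho> e v d'"
  unfolding J_def by (erule runs_mono) (auto intro!: power_increasing)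

text \<open>The syntax-directed rules determine some value and some exponent. Only at the end are
  these compared with the intended ones, which may be given generously.\<close>

lemma J_fin: "J L \<rho> e v' d' \<Longrightarrow> v' = v \<Longrightarrow> d' \<le> d \<Longrightarrow> J L \<rho> e v d"
  using J_mono by blast

lemma J_Var: "i < length \<rho> \<Longrightarrow> \<rho> ! i = v \<Longrightarrow> J L \<rho> (EVar i) v 0"
  unfolding J_def using runs_Var by simp

lemma J_Nil: "J L \<rho> ENil SNil 0"
  unfolding J_def using runs_Nil by simp

lemma J_Cons: "J L \<rho> e1 v1 d1 \<Longrightarrow> J L \<rho> e2 v2 d2 \<Longrightarrow> J L \<rho> (ECons e1 e2) (SCons v1 v2) (d1 + d2 + 2)"
  unfolding J_def by (rule runs_mono[OF runs_Cons pow_add_le])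

lemma J_Hd: "J L \<rho> e v d \<Longrightarrow> shd v = w \<Longrightarrow> J L \<rho> (EHd e) w (d + 1)"
  unfolding J_def by (rule runs_mono[OF runs_Hd pow_Suc_le])

lemma J_Tl: "J L \<rho> e v d \<Longrightarrow> stl v = w \<Longrightarrow> J L \<rho> (ETl e) w (d + 1)"
  unfolding J_def by (rule runs_mono[OF runs_Tl pow_Suc_le])

lemma J_If:
  assumes "J L \<rho> b w d1" "(w \<noteq> SNil) = c" "c \<Longrightarrow> J L \<rho> e1 v1 d2" "\<not> c \<Longrightarrow> J L \<rho> e2 v2 d3"
  shows "J L \<rho> (EIf b e1 e2) (if c then v1 else v2) (d1 + (d2 + d3) + 2)"
proof -
  have "c \<Longrightarrow> J L \<rho> e1 v1 (d2 + d3)" "\<not> c \<Longrightarrow> J L \<rho> e2 v2 (d2 + d3)"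
    using assms(3,4) J_mono by auto
  with assms(1,2) show ?thesis unfolding J_def by (intro runs_mono[OF runs_If pow_add_le]) auto
qed

lemma J_Let: "J L \<rho> e1 w d1 \<Longrightarrow> J L (w # \<rho>) e2 v d2 \<Longrightarrow> J L \<rho> (ELet e1 e2) v (d1 + d2 + 2)"
  unfolding J_def by (rule runs_mono[OF runs_Let pow_add_le])

lemma J_Call: "Js L \<rho> es vs d1 \<Longrightarrow> J L vs (prog ! f) v d2 \<Longrightarrow> f < 41 \<Longrightarrow> J L \<rho> (ECall f es) v (d1 + d2 + 2)"
  unfolding J_def Js_def by (rule runs_mono[OF runs_Call pow_add_le])

lemma Js_Nil: "Js L \<rho> [] [] 0"
  unfolding Js_def by (metis runs_list_def runs_list_Nil le_zero_eq zero_le)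

lemma Js_Cons: "J L \<rho> e v d1 \<Longrightarrow> Js L \<rho> es vs d2 \<Longrightarrow> Js L \<rho> (e # es) (v # vs) (d1 + d2 + 2)"
proof -
  assume a: "J L \<rho> e v d1" "Js L \<rho> es vs d2"
  have "runs_list \<rho> (e # es) (v # vs) ((L+2)^d1 + (L+2)^d2)"
    using a unfolding J_def Js_def by (rule runs_list_Cons)
  moreover have "(L+2)^d1 + (L+2)^d2 \<le> (L + 2) ^ (d1 + d2 + 2)" using pow_add_le[of L d1 d2] by linarith
  ultimately show ?thesis unfolding Js_def runs_list_def by (meson order_trans)
qed

text \<open>At most \<open>L + 1\<close> rounds contribute one factor, and the overhead
  \<open>m + 5\<close> of a round is absorbed by \<open>m + 3\<close> further factors, because
  \<open>m + 6\<close> is at most 2^(m + 3).\<close>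

lemma J_fold:
  assumes "prog ! j = fdef j m step" "j < 41" "length ps = m" "length l \<le> L" "a = F []" "v = F l"
    and "\<And>p x s. l = p @ x # s \<Longrightarrow> J L (SCons (e x) (EL e s) # F p # ps) step (F (p @ [x])) d"
  shows "J L (EL e l # a # ps) (prog ! j) v (d + m + 4)"
proof -
  have "runs (EL e l # F [] # ps) (prog ! j) (F l) ((length l + 1) * ((L+2)^d + m + 5))"
    by (rule runs_fold[OF assms(1,2,3)]) (use assms(7) in \<open>auto simp: J_def\<close>)
  moreover have "(length l + 1) * ((L+2)^d + m + 5) \<le> (L + 2) ^ (d + m + 4)"
  proof -
    have "m + 6 \<le> (2::nat) ^ (m + 3)"
    proof (induction m)
      case (Suc m)
      have "(1::nat) \<le> 2 ^ (m + 3)" by simp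
      moreover have "2 ^ (Suc m + 3) = 2 * (2::nat) ^ (m + 3)" by (simp only: add_Suc power_Suc)
      ultimately show ?case using Suc by linarith
    qed simp
    also have "\<dots> \<le> (L + 2) ^ (m + 3)" by (intro power_mono) auto
    finally have 1: "m + 6 \<le> (L + 2) ^ (m + 3)" .
    have "X + m + 5 \<le> X * (m + 6)" if "1 \<le> X" for X :: nat
      using that by (cases X) auto
    from this[OF pow_one_le] have "(L+2)^d + m + 5 \<le> (L+2)^d * (m + 6)" .
    also have "\<dots> \<le> (L+2)^d * (L + 2) ^ (m + 3)" using 1 by simp
    finally have "(length l + 1) * ((L+2)^d + m + 5) \<le> (L + 2) * ((L+2)^d * (L + 2) ^ (m + 3))"
      using assms(4) by (intro mult_le_mono) auto
    also have "\<dots> = (L + 2) ^ Suc (d + (m + 3))" by (simp only: power_Suc power_add)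
    also have "Suc (d + (m + 3)) = d + m + 4" by simp
    finally show ?thesis .
  qed
  ultimately show ?thesis unfolding J_def assms(5,6) using runs_mono by blast
qed

section \<open>Lists and unary numbers\<close>

fun sl :: "sexp \<Rightarrow> nat" where
  "sl SNil = 0"
| "sl (SCons a b) = Suc (sl b)"

fun dl :: "sexp \<Rightarrow> sexp list" where
  "dl SNil = []"
| "dl (SCons a b) = a # dl b"

lemma EL_dl: "EL (\<lambda>x. x) (dl a) = a"
  by (induction a) auto

lemma length_dl [simp]: "length (dl a) = sl a"
  by (induction a) auto

lemma sl_EL [simp]: "sl (EL e xs) = length xs"
  by (induction xs) auto

lemma sl_enc_list [simp]: "sl (enc_list xs) = length xs"
  by (induction xs) auto

lemma sl_enc_nat [simp]: "sl (enc_nat k) = k"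
  by (simp add: enc_nat_def)

lemma enc_nat_simps [simp]: "enc_nat 0 = SNil" "enc_nat (Suc k) = SCons SNil (enc_nat k)"
  by (simp_all add: enc_nat_def)

lemma enc_nat_Nil_iff [simp]: "enc_nat k = SNil \<longleftrightarrow> k = 0"
  by (cases k) auto

lemma stl_enc_nat [simp]: "stl (enc_nat k) = enc_nat (k - 1)"
  by (cases k) auto

lemma enc_bool_Nil_iff [simp]: "enc_bool b = SNil \<longleftrightarrow> \<not> b"
  by (simp add: enc_bool_def)

lemma stl_pow_SNil [simp]: "(stl ^^ k) SNil = SNil"
  by (induction k) auto

lemma stl_pow_Nil_iff: "(stl ^^ k) a = SNil \<longleftrightarrow> sl a \<le> k"
proof (induction k arbitrary: a)
  case 0
  then show ?case by (cases a) auto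
next
  case (Suc k)
  then show ?case by (cases a) (auto simp: funpow_Suc_right simp del: funpow.simps)
qed

lemma stl_pow_EL [simp]: "(stl ^^ k) (EL e ys) = EL e (drop k ys)"
proof (induction k arbitrary: ys)
  case (Suc k)
  then show ?case by (cases ys) (auto simp: funpow_Suc_right simp del: funpow.simps)
qed auto

lemma shd_EL: "shd (EL e ys) = (if ys = [] then SNil else e (hd ys))"
  by (cases ys) auto

lemma stl_EL [simp]: "stl (EL e ys) = EL e (tl ys)"
  by (cases ys) auto

lemma EL_eq_Nil: "SNil = EL e []"
  by simp

lemma EL_eq_Cons: "a = e x \<Longrightarrow> b = EL e xs \<Longrightarrow> SCons a b = EL e (x # xs)"
  by simp

lemmas eqi = refl EL_eq_Nil EL_eq_Cons

lemmas jr = J_Var J_Nil J_Cons J_Hd J_Tl J_If J_Let J_Call Js_Nil Js_Cons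

lemma J_drop: "sl a \<le> L \<Longrightarrow> J L [a, l] (prog ! 1) ((stl ^^ sl a) l) 20"
proof -
  assume a: "sl a \<le> L"
  have "J L (EL (\<lambda>x. x) (dl a) # l # []) (prog ! 1) ((stl ^^ sl a) l) 20"
    apply (rule J_fin, rule J_fold[OF prog_nth(2)[unfolded b_drop_def], where F = "\<lambda>p. (stl ^^ length p) l" and d = 16])
    using a apply ((simp; fail)+)[5]
      apply (rule J_fin, (rule jr | (simp; fail))+)
    done
  then show ?thesis by (simp add: EL_dl)
qed

lemma J_rapp_gen: "length xs \<le> L \<Longrightarrow> J L [EL e xs, a] (prog ! 2) (fold (\<lambda>x. SCons (e x)) xs a) 20"
  apply (rule J_fin, rule J_fold[OF prog_nth(3)[unfolded b_rapp_def], where F = "\<lambda>p. fold (\<lambda>x. SCons (e x)) p a" and d = 16])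
         apply ((simp; fail)+)[5]
    apply (rule J_fin, (rule jr | (simp; fail))+)
  done

lemma fold_SCons_EL: "fold (\<lambda>x. SCons (e x)) xs (EL e ys) = EL e (rev xs @ ys)"
  by (induction xs arbitrary: ys) (auto simp flip: EL_simps(2))

lemma J_rapp: "v1 = EL e xs \<Longrightarrow> v2 = EL e ys \<Longrightarrow> length xs \<le> L \<Longrightarrow>
    J L [v1, v2] (prog ! 2) (EL e (rev xs @ ys)) 20"
  using J_rapp_gen[of xs L e "EL e ys"] by (simp add: fold_SCons_EL)

lemma J_rapp_nat: "v1 = enc_nat a \<Longrightarrow> v2 = enc_nat b \<Longrightarrow> a \<le> L \<Longrightarrow>
    J L [v1, v2] (prog ! 2) (enc_nat (a + b)) 20"
proof -
  have "enc_nat a = EL (\<lambda>_. SNil) (replicate a ())" for a by (induction a) auto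
  moreover have "rev (replicate a ()) @ replicate b () = replicate (a + b) ()"
    by (simp add: replicate_add)
  ultimately show "v1 = enc_nat a \<Longrightarrow> v2 = enc_nat b \<Longrightarrow> a \<le> L \<Longrightarrow> ?thesis"
    using J_rapp[of _ "(\<lambda>_. SNil)" "replicate a ()" _ "replicate b ()" L] by (metis length_replicate)
qed

lemma J_le: "sl b \<le> L \<Longrightarrow> J L [a, b] (prog ! 3) (enc_bool (sl a \<le> sl b)) 60"
  unfolding prog_nth b_le_def
  by (rule J_fin, (rule jr J_drop | (simp; fail))+) (auto simp: enc_bool_def stl_pow_Nil_iff)

lemma J_eq: "v1 = enc_nat a \<Longrightarrow> v2 = enc_nat b \<Longrightarrow> a \<le> L \<Longrightarrow> b \<le> L \<Longrightarrow>
    J L [v1, v2] (prog ! 4) (enc_bool (a = b)) 200"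
  unfolding prog_nth(5) b_eq_def
  by (rule J_fin, (rule jr J_le | (simp; fail))+) (auto simp: enc_bool_def)

definition VL :: "nat \<Rightarrow> nat list \<Rightarrow> bool" where
  "VL L l \<longleftrightarrow> length l \<le> L \<and> (\<forall>y\<in>set l. y \<le> L)"

lemma J_mem: "v1 = EL enc_nat l \<Longrightarrow> v2 = SNil \<Longrightarrow> v3 = enc_nat x \<Longrightarrow> VL L l \<Longrightarrow> x \<le> L \<Longrightarrow>
    J L [v1, v2, v3] (prog ! 5) (enc_bool (x \<in> set l)) 300"
  apply (simp only:)
  apply (rule J_fin, rule J_fold[OF prog_nth(6)[unfolded b_mem_def], where F = "\<lambda>p. enc_bool (x \<in> set p)" and d = 290])
  apply ((simp add: VL_def enc_bool_def; fail)+)[5]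
    apply (rule J_fin, (rule jr J_eq eqi | (simp add: VL_def; fail))+)
  by (auto simp: enc_bool_def)

lemma J_disj: "v1 = EL enc_nat t \<Longrightarrow> v2 = SCons SNil SNil \<Longrightarrow> v3 = EL enc_nat l \<Longrightarrow> VL L t \<Longrightarrow> VL L l \<Longrightarrow>
    J L [v1, v2, v3] (prog ! 6) (enc_bool (set t \<inter> set l = {})) 400"
  apply (simp only:)
  apply (rule J_fin, rule J_fold[OF prog_nth(7)[unfolded b_disj_def], where F = "\<lambda>p. enc_bool (set p \<inter> set l = {})" and d = 390])
  apply ((simp add: VL_def enc_bool_def; fail)+)[5]
    apply (rule J_fin, (rule jr J_mem eqi | (simp add: VL_def; fail))+)
  by (auto simp: enc_bool_def)

section \<open>Graph operations of the program and their cost\<close>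

locale graph_ctx =
  fixes n :: nat and E :: "(nat \<times> nat) set" and L :: nat
  assumes E_sub: "E \<subseteq> {..<n} \<times> {..<n}" and n_le: "n \<le> L"
begin

definition g :: sexp where
  "g = EL (\<lambda>u. EL (\<lambda>v. enc_bool ((u, v) \<in> E)) [0..<n]) [0..<n]"

lemma J_adj: "v1 = g \<Longrightarrow> v2 = enc_nat u \<Longrightarrow> v3 = enc_nat v \<Longrightarrow> u \<le> L \<Longrightarrow> v \<le> L \<Longrightarrow>
    J L [v1, v2, v3] (prog ! 7) (enc_bool ((u, v) \<in> E)) 150"
  unfolding prog_nth b_adj_def
  apply (simp only:)
  apply (rule J_fin, (rule jr J_drop | (simp; fail))+)
  using E_sub
  by (auto simp: g_def shd_EL enc_bool_def hd_drop_conv_nth)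

lemma J_range: "J L [g, SCons SNil SNil] (prog ! 8) (SCons (enc_nat n) (EL enc_nat (rev [0..<n]))) 50"
proof -
  have "J L [EL (\<lambda>u. EL (\<lambda>v. enc_bool ((u, v) \<in> E)) [0..<n]) [0..<n], SCons SNil SNil] (prog ! 8)
     (SCons (enc_nat n) (EL enc_nat (rev [0..<n]))) 50"
    apply (rule J_fin, rule J_fold[OF prog_nth(9)[unfolded b_range_def],
         where F = "\<lambda>p. SCons (enc_nat (length p)) (EL enc_nat (rev [0..<length p]))" and d = 40])
    using n_le apply ((simp; fail)+)[5]
      apply (rule J_fin, (rule jr | (simp; fail))+)
    done
  then show ?thesis by (simp add: g_def)
qed

definition tri3 :: "nat list \<Rightarrow> nat \<Rightarrow> nat \<Rightarrow> nat list list \<Rightarrow> nat list list" where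
  "tri3 V u v a = rev (map (\<lambda>w. [u, v, w]) (filter (\<lambda>w. (v, w) \<in> E \<and> (u, w) \<in> E) V)) @ a"

definition tri2 :: "nat list \<Rightarrow> nat \<Rightarrow> nat list list \<Rightarrow> nat list list" where
  "tri2 V u a = fold (\<lambda>v a. if (u, v) \<in> E then tri3 V u v a else a) V a"

definition tris :: "nat list \<Rightarrow> nat list list" where
  "tris V = fold (tri2 V) V []"

lemma J_t3: "v1 = EL enc_nat V \<Longrightarrow> v2 = EL (EL enc_nat) a \<Longrightarrow> v3 = g \<Longrightarrow> v4 = enc_nat u \<Longrightarrow> v5 = enc_nat v \<Longrightarrow>
    VL L V \<Longrightarrow> u \<le> L \<Longrightarrow> v \<le> L \<Longrightarrow>
    J L [v1, v2, v3, v4, v5] (prog ! 9) (EL (EL enc_nat) (tri3 V u v a)) 600"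
  apply (simp only:)
  apply (rule J_fin, rule J_fold[OF prog_nth(10)[unfolded b_t3_def], where F = "\<lambda>p. EL (EL enc_nat) (tri3 p u v a)" and d = 590])
  apply ((simp add: VL_def tri3_def; fail)+)[5]
    apply (rule J_fin, (rule jr J_adj eqi | (simp add: VL_def; fail))+)
  by (auto simp: tri3_def)

lemma J_t2: "v1 = EL enc_nat V \<Longrightarrow> v2 = EL (EL enc_nat) a \<Longrightarrow> v3 = g \<Longrightarrow> v4 = enc_nat u \<Longrightarrow> v5 = EL enc_nat V \<Longrightarrow>
    VL L V \<Longrightarrow> u \<le> L \<Longrightarrow>
    J L [v1, v2, v3, v4, v5] (prog ! 10) (EL (EL enc_nat) (tri2 V u a)) 1000"
  apply (simp only:)
  apply (rule J_fin, rule J_fold[OF prog_nth(11)[unfolded b_t2_def], where F = "\<lambda>p. EL (EL enc_nat) (fold (\<lambda>v a. if (u, v) \<in> E then tri3 V u v a else a) p a)" and d = 990])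
  apply ((simp add: VL_def tri2_def; fail)+)[5]
    apply (rule J_fin, (rule jr J_adj J_t3 eqi | (simp add: VL_def; fail))+)
  by (auto simp: tri2_def)

lemma J_t1: "v1 = EL enc_nat V \<Longrightarrow> v2 = SNil \<Longrightarrow> v3 = g \<Longrightarrow> v4 = EL enc_nat V \<Longrightarrow> VL L V \<Longrightarrow>
    J L [v1, v2, v3, v4] (prog ! 11) (EL (EL enc_nat) (tris V)) 2000"
  apply (simp only:)
  apply (rule J_fin, rule J_fold[OF prog_nth(12)[unfolded b_t1_def], where F = "\<lambda>p. EL (EL enc_nat) (fold (tri2 V) p [])" and d = 1900])
  apply ((simp add: VL_def tris_def; fail)+)[5]
    apply (rule J_fin, (rule jr J_t2 eqi | (simp add: VL_def; fail))+)
  by (auto simp: tris_def)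

end

lemma VL_tl [simp]: "VL L x \<Longrightarrow> VL L (tl x)"
  by (cases x) (auto simp: VL_def)

lemma VL_length_tl: "VL L x \<Longrightarrow> length (tl x) \<le> L"
  by (cases x) (auto simp: VL_def)

lemma VL_hd: "VL L x \<Longrightarrow> x \<noteq> [] \<Longrightarrow> hd x \<le> L"
  by (cases x) (auto simp: VL_def)

lemma VL_rev_filter: "VL L x \<Longrightarrow> VL L (rev (filter P x))"
  by (auto simp: VL_def intro: order_trans[OF length_filter_le])

lemma EL_if: "a = EL e x \<Longrightarrow> b = EL e y \<Longrightarrow> (if c then a else b) = EL e (if c then x else y)"
  by simp

lemma J_filin: "v1 = EL enc_nat t \<Longrightarrow> v2 = SNil \<Longrightarrow> v3 = EL enc_nat R \<Longrightarrow> VL L t \<Longrightarrow> VL L R \<Longrightarrow>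
    J L [v1, v2, v3] (prog ! 15) (EL enc_nat (rev (filter (\<lambda>x. x \<in> set R) t))) 400"
  apply (simp only:)
  apply (rule J_fin, rule J_fold[OF prog_nth(16)[unfolded b_filin_def], where F = "\<lambda>p. EL enc_nat (rev (filter (\<lambda>x. x \<in> set R) p))" and d = 390])
  apply ((simp add: VL_def enc_bool_def; fail)+)[5]
    apply (rule J_fin, (rule jr J_mem | (simp add: VL_def; fail) | rule eqi)+)
  apply (auto simp: enc_bool_def)?
  done

lemma J_filout: "v1 = EL enc_nat t \<Longrightarrow> v2 = SNil \<Longrightarrow> v3 = EL enc_nat R \<Longrightarrow> VL L t \<Longrightarrow> VL L R \<Longrightarrow>
    J L [v1, v2, v3] (prog ! 16) (EL enc_nat (rev (filter (\<lambda>x. x \<notin> set R) t))) 400"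
  apply (simp only:)
  apply (rule J_fin, rule J_fold[OF prog_nth(17)[unfolded b_filout_def], where F = "\<lambda>p. EL enc_nat (rev (filter (\<lambda>x. x \<notin> set R) p))" and d = 390])
  apply ((simp add: VL_def enc_bool_def; fail)+)[5]
    apply (rule J_fin, (rule jr J_mem | (simp add: VL_def; fail) | rule eqi)+)
  apply (auto simp: enc_bool_def)?
  done

context graph_ctx
begin

definition vs :: "nat list \<Rightarrow> bool" where
  "vs l \<longleftrightarrow> distinct l \<and> set l \<subseteq> {..<n}"

lemma vs_length: "vs l \<Longrightarrow> length l \<le> n"
  unfolding vs_def by (metis card_lessThan card_mono distinct_card finite_lessThan)

lemma vs_VL: "vs l \<Longrightarrow> VL L l"
  using vs_length[of l] n_le by (fastforce simp: VL_def vs_def)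

lemma vs_Nil [simp]: "vs []" by (simp add: vs_def)

definition pkf :: "nat list \<Rightarrow> nat list \<Rightarrow> nat list" where
  "pkf t X = (if set t \<inter> set X = {} then rev t @ X else X)"

definition pk :: "nat list list \<Rightarrow> nat list" where
  "pk T = fold pkf T []"

lemma vs_pk: "\<forall>t\<in>set T. vs t \<Longrightarrow> vs (pk T)"
proof (induction T rule: rev_induct)
  case (snoc t T)
  then show ?case by (auto simp: pk_def pkf_def vs_def)
qed (simp add: pk_def)

lemma J_pack:
  assumes "v1 = EL (EL enc_nat) T" "v2 = SNil" "\<forall>t\<in>set T. vs t" "length T \<le> L"
  shows "J L [v1, v2] (prog ! 12) (EL enc_nat (pk T)) 500"
proof -
  have *: "VL L x" "VL L (pk p)" if "T = p @ x # s" for p x s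
    using assms(3) that by (auto intro!: vs_VL vs_pk)
  show ?thesis
    unfolding assms(1,2)
    apply (rule J_fin, rule J_fold[OF prog_nth(13)[unfolded b_pack_def], where F = "\<lambda>p. EL enc_nat (pk p)" and d = 490])
    using assms apply ((simp add: pk_def; fail)+)[5]
      apply (frule *(1), drule *(2))
      apply (rule J_fin, (rule jr J_disj J_rapp | (simp add: VL_def; fail) | rule eqi)+)
    by (auto simp: pk_def pkf_def)
qed

definition mtf :: "nat \<Rightarrow> nat list \<Rightarrow> nat list \<Rightarrow> nat list \<Rightarrow> nat list" where
  "mtf v A t M = (if hd t = v \<and> set (tl t) \<inter> set A = {} \<and> set (tl t) \<inter> set M = {} then rev (tl t) @ M else M)"

definition mt :: "nat \<Rightarrow> nat list \<Rightarrow> nat list list \<Rightarrow> nat list" where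
  "mt v A T = fold (mtf v A) T []"

lemma vs_tl: "vs t \<Longrightarrow> vs (tl t)"
  by (cases t) (auto simp: vs_def)

lemma vs_mt: "\<forall>t\<in>set T. vs t \<Longrightarrow> vs (mt v A T)"
proof (induction T rule: rev_induct)
  case (snoc t T)
  then have "vs (tl t)" "vs (mt v A T)" by (auto intro: vs_tl)
  then show ?case by (auto simp: mt_def mtf_def vs_def)
qed (simp add: mt_def)

lemma J_mtch:
  assumes "v1 = EL (EL enc_nat) T" "v2 = SNil" "v3 = enc_nat v" "v4 = EL enc_nat A"
    "\<forall>t\<in>set T. vs t \<and> t \<noteq> []" "length T \<le> L" "v \<le> L" "VL L A"
  shows "J L [v1, v2, v3, v4] (prog ! 13) (EL enc_nat (mt v A T)) 1600"
proof -
  have *: "VL L x" "x \<noteq> []" "hd x \<le> L" "VL L (mt v A p)" if "T = p @ x # s" for p x s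
    using assms(5) that by (auto intro!: vs_VL vs_mt VL_hd)
  show ?thesis
    unfolding assms(1-4)
    apply (rule J_fin, rule J_fold[OF prog_nth(14)[unfolded b_mtch_def], where F = "\<lambda>p. EL enc_nat (mt v A p)" and d = 1500])
    using assms(6-8) apply ((simp add: mt_def; fail)+)[5]
      apply (frule *(1), frule *(2), frule *(3), drule *(4))
    using assms(7,8) apply -
      apply (frule VL_length_tl)
      apply (rule J_fin, (rule jr J_disj J_rapp J_eq | (simp add: shd_EL; fail) | rule eqi)+)
    by (auto simp: mt_def mtf_def)
qed

lemma J_mult: "v1 = EL e M \<Longrightarrow> v2 = SNil \<Longrightarrow> v3 = enc_nat b \<Longrightarrow> length M \<le> L \<Longrightarrow> b \<le> L \<Longrightarrow>
    J L [v1, v2, v3] (prog ! 14) (enc_nat (length M * b)) 100"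
  apply (simp only:)
  apply (rule J_fin, rule J_fold[OF prog_nth(15)[unfolded b_mult_def], where F = "\<lambda>p. enc_nat (length p * b)" and d = 50])
  apply ((simp add: VL_def enc_bool_def; fail)+)[5]
    apply (rule J_fin, (rule jr J_rapp_nat | (simp add: VL_def; fail) | rule eqi)+)
  apply (auto simp: enc_bool_def)?
  done

lemma J_alladj: "v1 = EL enc_nat c \<Longrightarrow> v2 = SCons SNil SNil \<Longrightarrow> v3 = g \<Longrightarrow> v4 = enc_nat y \<Longrightarrow> VL L c \<Longrightarrow> y \<le> L \<Longrightarrow>
    J L [v1, v2, v3, v4] (prog ! 17) (enc_bool (\<forall>x\<in>set c. (y, x) \<in> E)) 400"
  apply (simp only:)
  apply (rule J_fin, rule J_fold[OF prog_nth(18)[unfolded b_alladj_def], where F = "\<lambda>p. enc_bool (\<forall>x\<in>set p. (y, x) \<in> E)" and d = 390])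
  apply ((simp add: VL_def enc_bool_def; fail)+)[5]
    apply (rule J_fin, (rule jr J_adj | (simp add: VL_def; fail) | rule eqi)+)
  apply (auto simp: enc_bool_def)?
  done

lemma J_common: "v1 = EL enc_nat Y \<Longrightarrow> v2 = SNil \<Longrightarrow> v3 = g \<Longrightarrow> v4 = EL enc_nat c \<Longrightarrow> VL L Y \<Longrightarrow> VL L c \<Longrightarrow>
    J L [v1, v2, v3, v4] (prog ! 18) (EL enc_nat (rev (filter (\<lambda>y. \<forall>x\<in>set c. (y, x) \<in> E) Y))) 600"
  apply (simp only:)
  apply (rule J_fin, rule J_fold[OF prog_nth(19)[unfolded b_common_def], where F = "\<lambda>p. EL enc_nat (rev (filter (\<lambda>y. \<forall>x\<in>set c. (y, x) \<in> E) p))" and d = 590])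
  apply ((simp add: VL_def enc_bool_def; fail)+)[5]
    apply (rule J_fin, (rule jr J_alladj | (simp add: VL_def; fail) | rule eqi)+)
  apply (auto simp: enc_bool_def)?
  done

lemma J_same: "v1 = EL enc_nat R \<Longrightarrow> v2 = SCons SNil SNil \<Longrightarrow> v3 = g \<Longrightarrow> v4 = enc_nat y \<Longrightarrow> v5 = enc_nat z \<Longrightarrow> VL L R \<Longrightarrow> y \<le> L \<Longrightarrow> z \<le> L \<Longrightarrow>
    J L [v1, v2, v3, v4, v5] (prog ! 19) (enc_bool (\<forall>r\<in>set R. (y, r) \<in> E \<longleftrightarrow> (z, r) \<in> E)) 800"
  apply (simp only:)
  apply (rule J_fin, rule J_fold[OF prog_nth(20)[unfolded b_same_def], where F = "\<lambda>p. enc_bool (\<forall>r\<in>set p. (y, r) \<in> E \<longleftrightarrow> (z, r) \<in> E)" and d = 790])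
  apply ((simp add: VL_def enc_bool_def; fail)+)[5]
    apply (rule J_fin, (rule jr J_adj | (simp add: VL_def; fail) | rule eqi)+)
  apply (auto simp: enc_bool_def)?
  done

definition cl :: "nat list \<Rightarrow> nat list \<Rightarrow> nat \<Rightarrow> nat list" where
  "cl R Y y = rev (filter (\<lambda>z. \<forall>r\<in>set R. (y, r) \<in> E \<longleftrightarrow> (z, r) \<in> E) Y)"

lemma J_cls: "v1 = EL enc_nat Y \<Longrightarrow> v2 = SNil \<Longrightarrow> v3 = g \<Longrightarrow> v4 = EL enc_nat R \<Longrightarrow> v5 = enc_nat y \<Longrightarrow> VL L Y \<Longrightarrow> VL L R \<Longrightarrow> y \<le> L \<Longrightarrow>
    J L [v1, v2, v3, v4, v5] (prog ! 20) (EL enc_nat (cl R Y y)) 1000"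
  apply (simp only:)
  apply (rule J_fin, rule J_fold[OF prog_nth(21)[unfolded b_cls_def], where F = "\<lambda>p. EL enc_nat (cl R p y)" and d = 990])
  apply ((simp add: VL_def cl_def; fail)+)[5]
    apply (rule J_fin, (rule jr J_same | (simp add: VL_def; fail) | rule eqi)+)
  apply (auto simp: cl_def)?
  done

lemma cl_self: "y \<in> set Y \<Longrightarrow> y \<in> set (cl R Y y)" by (auto simp: cl_def)

lemma cl_not_Nil: "y \<in> set Y \<Longrightarrow> cl R Y y \<noteq> []" by (metis cl_self empty_iff empty_set)

lemma J_reps: "v1 = EL enc_nat os \<Longrightarrow> v2 = EL enc_nat a \<Longrightarrow> v3 = g \<Longrightarrow> v4 = EL enc_nat R \<Longrightarrow> v5 = EL enc_nat Y \<Longrightarrow> VL L os \<Longrightarrow> VL L Y \<Longrightarrow> VL L R \<Longrightarrow> set os \<subseteq> set Y \<Longrightarrow>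
    J L [v1, v2, v3, v4, v5] (prog ! 21) (EL enc_nat (rev (map (\<lambda>y. hd (cl R Y y)) os) @ a)) 1200"
  apply (simp only:)
  apply (rule J_fin, rule J_fold[OF prog_nth(22)[unfolded b_reps_def], where F = "\<lambda>p. EL enc_nat (rev (map (\<lambda>y. hd (cl R Y y)) p) @ a)" and d = 1190])
  apply ((simp add: VL_def enc_bool_def; fail)+)[5]
    apply (rule J_fin, (rule jr J_cls | (simp add: VL_def cl_not_Nil; fail) | rule eqi)+)
  apply (auto simp: shd_EL cl_not_Nil)?
  done

end

context graph_ctx
begin

text \<open>The constraint that a triangle t imposes on the kernel. Its part c in R always belongs
  to it. The outer vertex, replaced by the representative of its class, is included only if c has at
  most k common neighbors in Y: otherwise they cannot all be taken, and c must be hit itself.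
  Vertices of U are excluded from the solution and are dropped; an empty constraint means that there
  is no solution.\<close>

definition cn :: "nat list \<Rightarrow> nat list \<Rightarrow> nat list \<Rightarrow> nat \<Rightarrow> nat list \<Rightarrow> nat list" where
  "cn R U Y k t = (let c = rev (filter (\<lambda>x. x \<in> set R) t) in
     rev (filter (\<lambda>x. x \<notin> set U)
       (if length (rev (filter (\<lambda>y. \<forall>x\<in>set c. (y, x) \<in> E) Y)) \<le> k
        then rev (map (\<lambda>y. hd (cl R Y y)) (rev (filter (\<lambda>x. x \<notin> set R) t))) @ c else c)))"

lemma set_cl_subset: "set (cl R Y y) \<subseteq> set Y"
  unfolding cl_def by simp

lemma hd_cl_self: "y \<in> set Y \<Longrightarrow> hd (cl R Y y) \<in> set (cl R Y y)"
  by (rule hd_in_set[OF cl_not_Nil])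

lemma hd_cl_in: "y \<in> set Y \<Longrightarrow> hd (cl R Y y) \<in> set Y"
  using hd_cl_self set_cl_subset by blast

lemma J_constr:
  assumes "v1 = EL enc_nat t" "v2 = g" "v3 = EL enc_nat R" "v4 = EL enc_nat U" "v5 = EL enc_nat Y" "v6 = enc_nat k"
    "VL L t" "VL L R" "VL L U" "VL L Y" "k \<le> L" "set t - set R \<subseteq> set Y"
  shows "J L [v1, v2, v3, v4, v5, v6] (prog ! 22) (EL enc_nat (cn R U Y k t)) 3500"
proof -
  let ?c = "rev (filter (\<lambda>x. x \<in> set R) t)"
  let ?o = "rev (filter (\<lambda>x. x \<notin> set R) t)"
  let ?r = "rev (map (\<lambda>y. hd (cl R Y y)) ?o) @ ?c"
  have c: "VL L ?c" "VL L ?o" using assms(7) by (auto intro: VL_rev_filter)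
  have o: "set ?o \<subseteq> set Y" using assms(12) by auto
  have "length ?r = length t"
    using sum_length_filter_compl[of "\<lambda>x. x \<in> set R" t] by simp
  moreover have "y \<le> L" if "y \<in> set ?r" for y
  proof (cases "y \<in> set ?c")
    case True
    then show ?thesis using assms(7) by (auto simp: VL_def)
  next
    case False
    then obtain x where "x \<in> set ?o" "y = hd (cl R Y x)" using \<open>y \<in> set ?r\<close> by auto
    then have "y \<in> set Y" using o hd_cl_in[of x Y R] by blast
    then show ?thesis using assms(10) by (auto simp: VL_def)
  qed
  ultimately have r: "VL L ?r" using assms(7) unfolding VL_def by metis
  have i: "VL L (if b then ?r else ?c)" for b by (cases b) (simp_all only: r c if_True if_False)
  have k: "sl (enc_nat k) \<le> L" using assms(11) by simp
  show ?thesis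
    unfolding assms(1-6) prog_nth(23) b_constr_def
    apply (rule J_fin)
      apply (rule jr J_filin J_filout J_common J_reps J_le | rule c o i k assms(7-11) | (simp; fail) | rule eqi EL_if)+
    apply (auto simp: cn_def Let_def)?
    done
qed

lemma J_constrs:
  assumes "v1 = EL (EL enc_nat) T" "v2 = SNil" "v3 = g" "v4 = EL enc_nat R" "v5 = EL enc_nat U" "v6 = EL enc_nat Y" "v7 = enc_nat k"
    "v8 = EL enc_nat D"
    "\<forall>t\<in>set T. VL L t \<and> (set t \<inter> set D = {} \<longrightarrow> set t - set R \<subseteq> set Y)" "VL L R" "VL L U" "VL L Y" "VL L D" "k \<le> L" "length T \<le> L"
  shows "J L [v1, v2, v3, v4, v5, v6, v7, v8] (prog ! 23)
    (EL (EL enc_nat) (rev (map (cn R U Y k) (filter (\<lambda>t. set t \<inter> set D = {}) T)))) 4500"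
proof -
  have *: "VL L x \<and> (set x \<inter> set D = {} \<longrightarrow> set x - set R \<subseteq> set Y)" if "T = p @ x # s" for p x s
    using assms(9) that by auto
  show ?thesis
    unfolding assms(1-8)
    apply (rule J_fin, rule J_fold[OF prog_nth(24)[unfolded b_constrs_def], where d = 4400 and
        F = "\<lambda>p. EL (EL enc_nat) (rev (map (cn R U Y k) (filter (\<lambda>t. set t \<inter> set D = {}) p)))"])
    using assms apply ((simp; fail)+)[5]
      apply (drule *)
    using assms(10-14)
      apply - apply (rule J_fin, (rule jr J_disj J_constr | (simp; fail) | rule eqi)+)
    done
qed

definition insv :: "nat list \<Rightarrow> nat list \<Rightarrow> nat list" where
  "insv c a = fold (\<lambda>x a. if x \<in> set a then a else x # a) c a"

lemma set_insv: "set (insv c a) = set c \<union> set a"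
  unfolding insv_def by (induction c arbitrary: a) auto

lemma vs_insv: "vs a \<Longrightarrow> set c \<subseteq> {..<n} \<Longrightarrow> vs (insv c a)"
  unfolding insv_def by (induction c arbitrary: a) (auto simp: vs_def)

lemma J_ins:
  assumes "v1 = EL enc_nat c" "v2 = EL enc_nat a" "VL L c" "vs a" "set c \<subseteq> {..<n}"
  shows "J L [v1, v2] (prog ! 24) (EL enc_nat (insv c a)) 500"
proof -
  have *: "VL L (insv p a)" if "c = p @ x # s" for p x s
    using assms(4,5) that by (intro vs_VL vs_insv) auto
  show ?thesis
    unfolding assms(1,2)
    apply (rule J_fin, rule J_fold[OF prog_nth(25)[unfolded b_ins_def], where F = "\<lambda>p. EL enc_nat (insv p a)" and d = 490])
    using assms(3) apply ((simp add: VL_def insv_def; fail)+)[5]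
      apply (frule *)
    using assms(3) apply - apply (rule J_fin, (rule jr J_mem | (simp; fail) | (simp add: VL_def; fail) | rule eqi)+)
    by (auto simp: insv_def)
qed

definition verts_of :: "nat list list \<Rightarrow> nat list" where
  "verts_of C = fold insv C []"

lemma verts_of_snoc: "verts_of (C @ [c]) = insv c (verts_of C)"
  by (simp add: verts_of_def)

lemma set_verts_of: "set (verts_of C) = \<Union> (set ` set C)"
  by (induction C rule: rev_induct) (auto simp: verts_of_snoc set_insv, simp add: verts_of_def)

lemma vs_verts_of: "\<forall>c\<in>set C. set c \<subseteq> {..<n} \<Longrightarrow> vs (verts_of C)"
  by (induction C rule: rev_induct) (auto simp: verts_of_snoc intro!: vs_insv, simp add: verts_of_def)

lemma J_verts:
  assumes "v1 = EL (EL enc_nat) C" "v2 = SNil" "\<forall>c\<in>set C. VL L c \<and> set c \<subseteq> {..<n}" "length C \<le> L"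
  shows "J L [v1, v2] (prog ! 25) (EL enc_nat (verts_of C)) 700"
proof -
  have *: "VL L x \<and> set x \<subseteq> {..<n} \<and> vs (verts_of p)" if "C = p @ x # s" for p x s
    using assms(3) that by (auto intro!: vs_verts_of)
  show ?thesis
    unfolding assms(1,2)
    apply (rule J_fin, rule J_fold[OF prog_nth(26)[unfolded b_verts_def], where F = "\<lambda>p. EL enc_nat (verts_of p)" and d = 690])
    using assms(4) apply ((simp add: verts_of_def; fail)+)[5]
      apply (drule *)
      apply (rule J_fin, (rule jr J_ins | (simp; fail) | rule eqi)+)
    by (auto simp: verts_of_def)
qed

lemma J_touch: "v1 = EL enc_nat c \<Longrightarrow> v2 = SNil \<Longrightarrow> v3 = g \<Longrightarrow> v4 = enc_nat v \<Longrightarrow> VL L c \<Longrightarrow> v \<le> L \<Longrightarrow>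
    J L [v1, v2, v3, v4] (prog ! 26) (enc_bool (\<exists>x\<in>set c. (v, x) \<in> E)) 400"
  apply (simp only:)
  apply (rule J_fin, rule J_fold[OF prog_nth(27)[unfolded b_touch_def], where F = "\<lambda>p. enc_bool (\<exists>x\<in>set p. (v, x) \<in> E)" and d = 390])
  apply ((simp add: VL_def enc_bool_def; fail)+)[5]
    apply (rule J_fin, (rule jr J_adj | (simp add: VL_def; fail) | rule eqi)+)
  apply (auto simp: enc_bool_def)?
  done

text \<open>The head of the accumulator is the growing component of the new vertex. Every old
  component adjacent to the vertex is merged into it, the others are kept behind it.\<close>

definition adf :: "nat \<Rightarrow> nat list \<Rightarrow> nat list list \<Rightarrow> nat list list" where
  "adf v c a = (if \<exists>x\<in>set c. (v, x) \<in> E then (rev c @ hd a) # tl a else hd a # c # tl a)"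

definition addv :: "nat \<Rightarrow> nat list list \<Rightarrow> nat list list" where
  "addv v cs = fold (adf v) cs [[v]]"

lemma addv_snoc: "addv v (cs @ [c]) = adf v c (addv v cs)"
  by (simp add: addv_def)

lemma addv_not_Nil: "addv v cs \<noteq> []"
  by (induction cs rule: rev_induct) (auto simp: addv_snoc adf_def, simp add: addv_def)

lemma J_addv:
  assumes "v1 = EL (EL enc_nat) cs" "v2 = SCons (SCons (enc_nat v) SNil) SNil" "v3 = g" "v4 = enc_nat v"
    "\<forall>c\<in>set cs. VL L c" "length cs \<le> L" "v \<le> L"
  shows "J L [v1, v2, v3, v4] (prog ! 27) (EL (EL enc_nat) (addv v cs)) 700"
proof -
  have *: "VL L x \<and> length x \<le> L" if "cs = p @ x # s" for p x s
    using assms(5) that by (auto simp: VL_def)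
  show ?thesis
    unfolding assms(1-4)
    apply (rule J_fin, rule J_fold[OF prog_nth(28)[unfolded b_addv_def], where F = "\<lambda>p. EL (EL enc_nat) (addv v p)" and d = 690])
    using assms(6,7) apply ((simp add: addv_def del: fold_simps; fail)+)[4]
         apply (simp add: addv_def)
      apply (drule *)
    using assms(7) apply - apply (rule J_fin, (rule jr J_touch J_rapp | (simp add: shd_EL addv_not_Nil; fail) | rule eqi)+)
    apply (auto simp: addv_snoc adf_def addv_not_Nil shd_EL)?
    apply (simp_all add: addv_def)?
    done
qed

definition comps :: "nat list \<Rightarrow> nat list list" where
  "comps V = fold addv V []"

lemma comps_snoc: "comps (V @ [v]) = addv v (comps V)"
  by (simp add: comps_def)

lemma addv_concat: "set (concat (addv v cs)) = insert v (set (concat cs))"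
  "length (concat (addv v cs)) = Suc (length (concat cs))"
  "[] \<notin> set cs \<Longrightarrow> [] \<notin> set (addv v cs)"
proof (induction cs rule: rev_induct)
  case (snoc c cs)
  obtain a r where ar: "addv v cs = a # r" using addv_not_Nil by (meson neq_Nil_conv)
  {
    case 1 then show ?case using snoc ar by (auto simp: addv_snoc adf_def)
  next
    case 2 then show ?case using snoc ar by (auto simp: addv_snoc adf_def)
  next
    case 3 then show ?case using snoc ar by (auto simp: addv_snoc adf_def)
  }
qed (auto simp: addv_def)

lemma comps_concat: "set (concat (comps V)) = set V" "length (concat (comps V)) = length V" "[] \<notin> set (comps V)"
proof (induction V rule: rev_induct)
  case (snoc v V)
  { case 1 then show ?case using snoc addv_concat(1)[of v "comps V"] by (simp add: comps_snoc) }
  { case 2 then show ?case using snoc addv_concat(2)[of v "comps V"] by (simp add: comps_snoc) }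
  { case 3 then show ?case using snoc addv_concat(3)[of "comps V" v] by (simp add: comps_snoc) }
qed (auto simp: comps_def)

lemma length_le_concat: "c \<in> set cs \<Longrightarrow> length c \<le> length (concat cs)"
  by (induction cs) auto

lemma length_outer_le_concat: "[] \<notin> set cs \<Longrightarrow> length cs \<le> length (concat cs)"
proof (induction cs)
  case (Cons c cs)
  then show ?case by (cases c) auto
qed auto

lemma comps_VL:
  assumes "VL L V"
  shows "\<forall>c\<in>set (comps V). VL L c" "length (comps V) \<le> L"
proof -
  show "\<forall>c\<in>set (comps V). VL L c"
  proof
    fix c assume c: "c \<in> set (comps V)"
    have "set c \<subseteq> set V" using c comps_concat(1)[of V] by auto
    moreover have "length c \<le> length V" using length_le_concat[OF c] comps_concat(2)[of V] by simp
    ultimately show "VL L c" using assms by (auto simp: VL_def)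
  qed
  show "length (comps V) \<le> L"
    using length_outer_le_concat[OF comps_concat(3)[of V]] comps_concat(2)[of V] assms by (auto simp: VL_def)
qed

lemma J_comps:
  assumes "v1 = EL enc_nat V" "v2 = SNil" "v3 = g" "VL L V"
  shows "J L [v1, v2, v3] (prog ! 28) (EL (EL enc_nat) (comps V)) 900"
proof -
  have *: "(\<forall>c\<in>set (comps p). VL L c) \<and> length (comps p) \<le> L \<and> x \<le> L" if "V = p @ x # s" for p x s
    using assms(4) that comps_VL[of p] by (auto simp: VL_def)
  show ?thesis
    unfolding assms(1-3)
    apply (rule J_fin, rule J_fold[OF prog_nth(29)[unfolded b_comps_def], where F = "\<lambda>p. EL (EL enc_nat) (comps p)" and d = 890])
    using assms(4) apply ((simp add: comps_def VL_def; fail)+)[5]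
      apply (drule *)
      apply (rule J_fin, (rule jr J_addv | (simp; fail) | rule eqi)+)
    by (auto simp: comps_def)
qed

lemma J_okc:
  assumes "v1 = EL (EL e) cs" "v2 = SCons SNil SNil" "sl v3 \<le> L" "length cs \<le> L" "\<forall>c\<in>set cs. length c \<le> L"
  shows "J L [v1, v2, v3] (prog ! 29) (enc_bool (\<forall>c\<in>set cs. 3 * length c \<le> sl v3)) 400"
proof -
  have *: "length x \<le> L" if "cs = p @ x # s" for p x s
    using assms(5) that by auto
  show ?thesis
    unfolding assms(1,2)
    apply (rule J_fin, rule J_fold[OF prog_nth(30)[unfolded b_okc_def], where F = "\<lambda>p. enc_bool (\<forall>c\<in>set p. 3 * length c \<le> sl v3)" and d = 390])
    using assms(3,4) apply ((simp add: enc_bool_def; fail)+)[5]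
      apply (drule *)
    using assms(3) apply - apply (rule J_fin, (rule jr J_le J_rapp | (simp; fail) | rule eqi)+)
    by (auto simp: enc_bool_def)
qed

definition okS :: "nat list \<Rightarrow> nat set \<Rightarrow> bool" where
  "okS K S \<longleftrightarrow> (\<forall>c\<in>set (comps (rev (filter (\<lambda>x. x \<notin> S) K))). 3 * length c \<le> 2 * length K)"

lemma J_ok:
  assumes "v1 = EL enc_nat S" "v2 = EL enc_nat K" "v3 = g" "VL L S" "VL L K" "2 * length K \<le> L"
  shows "J L [v1, v2, v3] (prog ! 30) (enc_bool (okS K (set S))) 2000"
proof -
  have 1: "VL L (rev (filter (\<lambda>x. x \<notin> set S) K))" using assms(5) by (rule VL_rev_filter)
  note 2 = comps_VL[OF 1]
  have 3: "\<forall>c\<in>set (comps (rev (filter (\<lambda>x. x \<notin> set S) K))). length c \<le> L" using 2 by (auto simp: VL_def)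
  have 4: "length K \<le> L" using assms(5) by (simp add: VL_def)
  show ?thesis
    unfolding assms(1-3) prog_nth(31) b_ok_def
    apply (rule J_fin)
      apply (rule jr J_okc J_comps J_filout J_rapp | rule 1 2 3 4 assms(4,5) | (use assms(6) in \<open>simp; fail\<close>) | rule eqi)+
    by (auto simp: okS_def mult_2)
qed

end

section \<open>Forests and constraint lists as data\<close>

datatype tr = Tr nat "tr list"

primrec encT :: "tr \<Rightarrow> sexp" where
  "encT (Tr v ch) = SCons (enc_nat v) (enc_list (map encT ch))"

lemma encT_EL [simp]: "encT (Tr v ch) = SCons (enc_nat v) (EL encT ch)"
  by (simp add: EL_def)

declare encT.simps [simp del]

text \<open>The vertices of a separator are stacked above the forest of the pieces, so that every
  root-to-leaf path through a piece also contains the separator.\<close>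

definition path :: "nat list \<Rightarrow> tr list \<Rightarrow> tr list" where
  "path S F = fold (\<lambda>s F. [Tr s F]) S F"


lemma J_path: "v1 = EL enc_nat S \<Longrightarrow> v2 = EL encT F \<Longrightarrow> length S \<le> L \<Longrightarrow>
    J L [v1, v2] (prog ! 32) (EL encT (path S F)) 50"
  apply (simp only:)
  apply (rule J_fin, rule J_fold[OF prog_nth(33)[unfolded b_path_def], where F = "\<lambda>p. EL encT (path p F)" and d = 40])
  apply ((simp add: path_def; fail)+)[5]
    apply (rule J_fin, (rule jr  | (simp add: VL_def; fail) | rule eqi)+)
  apply (auto simp: path_def)?
  done

lemma J_hasnil: "v1 = EL (EL e) C \<Longrightarrow> v2 = SNil \<Longrightarrow> length C \<le> L \<Longrightarrow>
    J L [v1, v2] (prog ! 34) (enc_bool ([] \<in> set C)) 50"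
  apply (simp only:)
  apply (rule J_fin, rule J_fold[OF prog_nth(35)[unfolded b_hasnil_def], where F = "\<lambda>p. enc_bool ([] \<in> set p)" and d = 40])
  apply ((simp add: VL_def enc_bool_def; fail)+)[5]
    apply (rule J_fin, (rule jr  | (simp add: VL_def; fail) | rule eqi)+)
  apply (auto simp: enc_bool_def)?
  done

lemma J_del: "v1 = EL (EL enc_nat) C \<Longrightarrow> v2 = SNil \<Longrightarrow> v3 = enc_nat v \<Longrightarrow> length C \<le> L \<Longrightarrow> \<forall>c\<in>set C. VL L c \<Longrightarrow> v \<le> L \<Longrightarrow>
    J L [v1, v2, v3] (prog ! 35) (EL (EL enc_nat) (rev (filter (\<lambda>c. v \<notin> set c) C))) 500"
  apply (simp only:)
  apply (rule J_fin, rule J_fold[OF prog_nth(36)[unfolded b_del_def], where F = "\<lambda>p. EL (EL enc_nat) (rev (filter (\<lambda>c. v \<notin> set c) p))" and d = 490])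
  apply ((simp add: VL_def enc_bool_def; fail)+)[5]
    apply (rule J_fin, (rule jr J_mem | (simp add: VL_def; fail) | rule eqi)+)
  apply (auto simp: enc_bool_def)?
  done

lemma J_rem: "v1 = EL (EL enc_nat) C \<Longrightarrow> v2 = SNil \<Longrightarrow> v3 = enc_nat v \<Longrightarrow> length C \<le> L \<Longrightarrow> \<forall>c\<in>set C. VL L c \<Longrightarrow> v \<le> L \<Longrightarrow> 1 \<le> L \<Longrightarrow>
    J L [v1, v2, v3] (prog ! 36) (EL (EL enc_nat) (rev (map (\<lambda>c. rev (filter (\<lambda>x. x \<notin> set [v]) c)) C))) 600"
  apply (simp only:)
  apply (rule J_fin, rule J_fold[OF prog_nth(37)[unfolded b_rem_def], where F = "\<lambda>p. EL (EL enc_nat) (rev (map (\<lambda>c. rev (filter (\<lambda>x. x \<notin> set [v]) c)) p))" and d = 590])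
  apply ((simp add: VL_def enc_bool_def; fail)+)[5]
    apply (rule J_fin, (rule jr J_filout | (simp add: VL_def; fail) | rule eqi)+)
  apply (auto simp: enc_bool_def)?
  done

section \<open>Components and separators\<close>

locale sgraph_ctx = graph_ctx +
  assumes E_sym: "(u, v) \<in> E \<Longrightarrow> (v, u) \<in> E" and E_irrefl: "(u, u) \<notin> E"
    and L_ge: "2 * n \<le> L"
begin

definition touches :: "nat \<Rightarrow> nat list \<Rightarrow> bool" where
  "touches v c \<longleftrightarrow> (\<exists>x\<in>set c. (v, x) \<in> E)"

lemma addv_sets:
  "set (hd (addv v cs)) = insert v (\<Union>c\<in>{c\<in>set cs. touches v c}. set c)"
  "set (tl (addv v cs)) = {c\<in>set cs. \<not> touches v c}"
proof (induction cs rule: rev_induct)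
  case (snoc c cs)
  { case 1 then show ?case using snoc by (auto simp: addv_snoc adf_def touches_def) }
  { case 2 then show ?case using snoc by (auto simp: addv_snoc adf_def touches_def) }
qed (auto simp: addv_def)

lemma set_comps_snoc:
  "set (comps (V @ [v])) = insert (hd (addv v (comps V))) {c\<in>set (comps V). \<not> touches v c}"
  using addv_sets(2)[of v "comps V"] addv_not_Nil[of v "comps V"]
  by (metis comps_snoc list.collapse list.simps(15))

lemma comps_closed: "c \<in> set (comps V) \<Longrightarrow> x \<in> set c \<Longrightarrow> y \<in> set V \<Longrightarrow> (x, y) \<in> E \<Longrightarrow> y \<in> set c"
proof (induction V arbitrary: c x y rule: rev_induct)
  case (snoc v V)
  have cover: "\<exists>c\<in>set (comps V). z \<in> set c" if "z \<in> set V" for z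
    using comps_concat(1)[of V] that by auto
  from snoc.prems(1) consider (new) "c = hd (addv v (comps V))" | (old) "c \<in> set (comps V)" "\<not> touches v c"
    by (auto simp: set_comps_snoc)
  then show ?case
  proof cases
    case new
    then have c: "set c = insert v (\<Union>c\<in>{c\<in>set (comps V). touches v c}. set c)" by (simp add: addv_sets)
    show ?thesis
    proof (cases "y = v")
      case False
      then have y: "y \<in> set V" using snoc.prems by auto
      show ?thesis
      proof (cases "x = v")
        case True
        obtain d where "d \<in> set (comps V)" "y \<in> set d" using cover[OF y] by blast
        moreover have "touches v d" using True snoc.prems(4) calculation by (auto simp: touches_def)
        ultimately show ?thesis using c by auto
      next
        case False
        then obtain d where d: "d \<in> set (comps V)" "touches v d" "x \<in> set d" using c snoc.prems(2) by auto
        then have "y \<in> set d" using snoc.IH y snoc.prems(4) by blast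
        then show ?thesis using c d by auto
      qed
    qed (use c in auto)
  next
    case old
    have "y \<noteq> v" using old snoc.prems(2,4) E_sym by (auto simp: touches_def)
    then show ?thesis using old snoc by auto
  qed
qed (simp add: comps_def)

text \<open>Connectedness without paths: a set that is closed under edges within V and meets a
  component contains it. A component that becomes part of a merged one is reached through the new
  vertex. Together with \<open>comps_closed\<close> this identifies the lists as the connected
  components.\<close>

lemma comps_connected:
  "c \<in> set (comps V) \<Longrightarrow> (\<And>x y. x \<in> A \<Longrightarrow> y \<in> set V \<Longrightarrow> (x, y) \<in> E \<Longrightarrow> y \<in> A) \<Longrightarrow>
    A \<inter> set c \<noteq> {} \<Longrightarrow> set c \<subseteq> A"
proof (induction V arbitrary: c rule: rev_induct)
  case (snoc v V)
  have IH: "set d \<subseteq> A" if "d \<in> set (comps V)" "A \<inter> set d \<noteq> {}" for d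
    using snoc.IH[OF that(1) _ that(2)] snoc.prems(2) by auto
  from snoc.prems(1) consider (new) "c = hd (addv v (comps V))" | (old) "c \<in> set (comps V)"
    by (auto simp: set_comps_snoc)
  then show ?case
  proof cases
    case new
    then have c: "set c = insert v (\<Union>c\<in>{c\<in>set (comps V). touches v c}. set c)" by (simp add: addv_sets)
    have v: "v \<in> A"
    proof (rule ccontr)
      assume "v \<notin> A"
      then obtain d where d: "d \<in> set (comps V)" "touches v d" "A \<inter> set d \<noteq> {}" using c snoc.prems(3) by auto
      then obtain z where "z \<in> A" "(z, v) \<in> E" using IH E_sym unfolding touches_def by blast
      with snoc.prems(2) \<open>v \<notin> A\<close> show False by auto
    qed
    have "set d \<subseteq> A" if d: "d \<in> set (comps V)" "touches v d" for d
    proof -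
      obtain z where z: "z \<in> set d" "(v, z) \<in> E" using d by (auto simp: touches_def)
      then have "z \<in> set V" using comps_concat(1)[of V] d by auto
      then have "z \<in> A" using snoc.prems(2)[OF v _ z(2)] by auto
      then show ?thesis using IH d z by blast
    qed
    then show ?thesis using c v by auto
  next
    case old
    then show ?thesis using IH snoc.prems by blast
  qed
qed (simp add: comps_def)

lemma distinct_concat_comps: "distinct V \<Longrightarrow> distinct (concat (comps V))"
  using comps_concat[of V] by (intro card_distinct) (simp add: distinct_card)

text \<open>Components do not occur: each remaining vertex only has to lie in some edge-closed set
  of at most 2/3 of the vertices. Such a set contains the component of the vertex, so the pieces
  found by \<open>comps\<close> are at least as small.\<close>

definition balS :: "nat set \<Rightarrow> nat set \<Rightarrow> bool" where
  "balS W S \<longleftrightarrow> S \<subseteq> W \<and> (\<forall>x\<in>W - S. \<exists>A\<subseteq>W - S. x \<in> A \<and>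
     (\<forall>u\<in>A. \<forall>v\<in>W - S. (u, v) \<in> E \<longrightarrow> v \<in> A) \<and> 3 * card A \<le> 2 * card W)"

lemma distinct_concat_elem: "distinct (concat cs) \<Longrightarrow> c \<in> set cs \<Longrightarrow> distinct c"
  by (induction cs) auto

lemma okS_of_balS:
  assumes "distinct K" "balS (set K) S"
  shows "okS K S"
  unfolding okS_def
proof
  let ?V = "rev (filter (\<lambda>x. x \<notin> S) K)"
  fix c assume c: "c \<in> set (comps ?V)"
  have V: "set ?V = set K - S" by auto
  have "c \<noteq> []" using c comps_concat(3)[of ?V] by metis
  then obtain x where x: "x \<in> set c" by (cases c) auto
  then have "x \<in> set K - S" using comps_concat(1)[of ?V] c V by auto
  then obtain A where A: "A \<subseteq> set K - S" "x \<in> A" "\<And>u v. u \<in> A \<Longrightarrow> v \<in> set K - S \<Longrightarrow> (u, v) \<in> E \<Longrightarrow> v \<in> A"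
    "3 * card A \<le> 2 * card (set K)"
    using assms(2) unfolding balS_def by metis
  have "set c \<subseteq> A" using comps_connected[OF c, of A] A(2,3) x V by blast
  moreover have "distinct c"
    using distinct_concat_elem[OF distinct_concat_comps c] assms(1) by simp
  ultimately have "length c \<le> card A"
    by (metis A(1) card_mono distinct_card finite_Diff finite_set finite_subset)
  then show "3 * length c \<le> 2 * length K" using A(4) assms(1) by (simp add: distinct_card)
qed

end

section \<open>Elimination forests\<close>

fun fverts :: "tr list \<Rightarrow> nat set" where
  "fverts [] = {}"
| "fverts (Tr v ch # r) = insert v (fverts ch \<union> fverts r)"

fun fnodes :: "tr list \<Rightarrow> nat" where
  "fnodes [] = 0"
| "fnodes (Tr v ch # r) = Suc (fnodes ch + fnodes r)"

fun fdepth :: "tr list \<Rightarrow> nat" where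
  "fdepth [] = 0"
| "fdepth (Tr v ch # r) = max (Suc (fdepth ch)) (fdepth r)"

fun fdist :: "tr list \<Rightarrow> bool" where
  "fdist [] \<longleftrightarrow> True"
| "fdist (Tr v ch # r) \<longleftrightarrow> v \<notin> fverts ch \<and> v \<notin> fverts r \<and> fverts ch \<inter> fverts r = {} \<and> fdist ch \<and> fdist r"

text \<open>\<open>chain F c\<close>: the vertices \<open>c\<close> lie on a common path from a root to a leaf of \<open>F\<close>.\<close>

fun chain :: "tr list \<Rightarrow> nat set \<Rightarrow> bool" where
  "chain [] c \<longleftrightarrow> c = {}"
| "chain (Tr v ch # r) c \<longleftrightarrow> c \<subseteq> insert v (fverts ch) \<and> chain ch (c - {v}) \<or> c \<subseteq> fverts r \<and> chain r c"

lemma chain_empty [simp]: "chain F {}"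
  by (induction F rule: fverts.induct) auto

lemma chain_subset: "chain F c \<Longrightarrow> c \<subseteq> fverts F"
  by (cases F rule: fverts.cases) auto

lemma finite_fverts [simp]: "finite (fverts F)"
  by (induction F rule: fverts.induct) auto

lemma fappend:
  "fverts (F @ G) = fverts F \<union> fverts G"
  "fnodes (F @ G) = fnodes F + fnodes G"
  "fdepth (F @ G) = max (fdepth F) (fdepth G)"
  "fdist (F @ G) \<longleftrightarrow> fdist F \<and> fdist G \<and> fverts F \<inter> fverts G = {}"
  by (induction F rule: fverts.induct) auto

lemma chain_append: "chain F c \<or> chain G c \<Longrightarrow> chain (F @ G) c"
proof (induction F rule: fverts.induct)
  case (2 v ch r)
  then show ?case using chain_subset[of r c] chain_subset[of G c] by (auto simp: fappend)
qed auto

lemma frev: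
  "fverts (rev F) = fverts F" "fnodes (rev F) = fnodes F" "fdepth (rev F) = fdepth F"
  "fdist (rev F) = fdist F" "chain F c \<Longrightarrow> chain (rev F) c"
proof (induction F rule: fverts.induct)
  case (2 v ch r)
  { case 1 then show ?case using 2 by (auto simp: fappend) }
  { case 2 then show ?case using "2.IH" by (auto simp: fappend) }
  { case 3 then show ?case using "2.IH" by (auto simp: fappend) }
  { case 4 then show ?case using "2.IH" by (auto simp: fappend) }
  { case 5 then show ?case using "2.IH" by (auto intro!: chain_append) }
qed auto

lemma length_le_fnodes: "length F \<le> fnodes F"
  by (induction F rule: fverts.induct) auto

lemma path_snoc: "path (S @ [s]) F = [Tr s (path S F)]"
  by (simp add: path_def)

lemma path_props:
  "fverts (path S F) = set S \<union> fverts F"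
  "fnodes (path S F) = length S + fnodes F"
  "fdepth (path S F) \<le> length S + fdepth F"
  "distinct S \<Longrightarrow> set S \<inter> fverts F = {} \<Longrightarrow> fdist F \<Longrightarrow> fdist (path S F)"
proof (induction S rule: rev_induct)
  case (snoc s S)
  { case 1 then show ?case using snoc by (auto simp: path_snoc) }
  { case 2 then show ?case using snoc by (auto simp: path_snoc) }
  { case 3 then show ?case using snoc by (auto simp: path_snoc) }
  { case 4 then show ?case using snoc by (auto simp: path_snoc) }
qed (auto simp: path_def)

lemma chain_path: "c \<subseteq> set S \<union> fverts F \<Longrightarrow> chain F (c - set S) \<Longrightarrow> chain (path S F) c"
proof (induction S arbitrary: c rule: rev_induct)
  case (snoc s S)
  have "chain (path S F) (c - {s})"
    using snoc.prems by (intro snoc.IH) (auto simp: Diff_insert2 Diff_insert insert_commute set_diff_eq conj_commute conj_left_commute)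
  then show ?case using snoc.prems by (auto simp: path_snoc path_props)
qed (simp add: path_def)

section \<open>The search for separators\<close>

lemma runs_fin: "runs \<rho> e v' t' \<Longrightarrow> v' = v \<Longrightarrow> t' \<le> t \<Longrightarrow> runs \<rho> e v t"
  using runs_mono by blast

text \<open>Eight exponents more, a factor of at least 256, pay for a fixed number of calls and
  administrative steps. The exponents 2000, 2200, 3000, 4000, 4900 and 5000 below are round numbers
  that leave such gaps.\<close>

lemma pow_gap: "a + 8 \<le> b \<Longrightarrow> 50 * (L + 2) ^ a + 200 \<le> (L + 2 :: nat) ^ b"
proof -
  assume "a + 8 \<le> b"
  have "50 * (L + 2) ^ a + 200 \<le> (L + 2 :: nat) ^ a * 256" using pow_one_le[of L a] by linarith
  also have "\<dots> \<le> (L + 2) ^ a * (L + 2) ^ 8"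
    using power_mono[of 2 "L + 2" 8] by (intro mult_left_mono) auto
  also have "\<dots> = (L + 2) ^ (a + 8)" by (simp add: power_add)
  also have "\<dots> \<le> (L + 2) ^ b" using \<open>a + 8 \<le> b\<close> by (intro power_increasing) auto
  finally show ?thesis .
qed

lemma runs_IfT: "runs \<rho> b w t1 \<Longrightarrow> w \<noteq> SNil \<Longrightarrow> runs \<rho> e1 v t2 \<Longrightarrow> runs \<rho> (EIf b e1 e2) v (t1 + t2 + 1)"
  using runs_If[of \<rho> b w t1 True e1 v t2] by simp

lemma runs_IfF: "runs \<rho> b w t1 \<Longrightarrow> w = SNil \<Longrightarrow> runs \<rho> e2 v t2 \<Longrightarrow> runs \<rho> (EIf b e1 e2) v (t1 + t2 + 1)"
  using runs_If[of \<rho> b w t1 False e1 v t2] by simp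

text \<open>The number of calls of the exhaustive search for a separator with \<open>l\<close>
  candidates left and \<open>b\<close> vertices still allowed: a candidate is taken or skipped. The
  bound in \<open>fsN_bound\<close> holds because (l + 1)^b + (l + 1)^(b + 1) = (l + 1)^b (l +
  2).\<close>

fun fsN :: "nat \<Rightarrow> nat \<Rightarrow> nat" where
  "fsN 0 b = 1"
| "fsN (Suc l) 0 = 1"
| "fsN (Suc l) (Suc b) = 1 + fsN l b + fsN l (Suc b)"

lemma fsN_bound: "fsN l b + 1 \<le> 2 * (l + 1) ^ b"
proof (induction l b rule: fsN.induct)
  case (3 l b)
  have "fsN (Suc l) (Suc b) + 1 \<le> 2 * (l + 1) ^ b + 2 * (l + 1) ^ Suc b" using 3 by simp
  also have "\<dots> = 2 * (l + 1) ^ b * (l + 2)" by (simp add: algebra_simps)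
  also have "\<dots> \<le> 2 * (l + 2) ^ b * (l + 2)" by (intro mult_right_mono mult_left_mono power_mono) auto
  finally show ?case by (simp add: algebra_simps)
qed auto

lemmas rr = runs_Var runs_Nil runs_Cons runs_Hd runs_Tl runs_Let runs_Call runs_list_Nil runs_list_Cons

context sgraph_ctx
begin

text \<open>The current set \<open>S\<close> is tested at every call, before a candidate is taken or
  skipped, so extensions of every size up to \<open>b\<close> are covered and not only those of size
  \<open>b\<close>. The negative outcome is exact; it is what later certifies that a piece has no
  separator of order \<open>b\<close>.\<close>

lemma runs_findsep:
  assumes "VL L K" "2 * length K \<le> L"
  shows "VL L (rest @ S) \<Longrightarrow> \<exists>r. runs [EL enc_nat rest, EL enc_nat S, enc_nat b, EL enc_nat K, g] (prog ! 31) r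
      (fsN (length rest) b * (L + 2) ^ 2200) \<and>
    (r = SNil \<and> (\<forall>Z\<subseteq>set rest. card Z \<le> b \<longrightarrow> \<not> okS K (set S \<union> Z)) \<or>
     (\<exists>S'. r = SCons (EL enc_nat S') SNil \<and> okS K (set S') \<and> set S' \<subseteq> set S \<union> set rest \<and>
        length S' \<le> length S + b \<and> (distinct (rest @ S) \<longrightarrow> distinct S')))"
proof (induction rest arbitrary: S b)
  case (Nil S b)
  let ?\<rho> = "[EL enc_nat [], EL enc_nat S, enc_nat b, EL enc_nat K, g]"
  have ok: "runs ?\<rho> (ECall 30 [EVar 1, EVar 3, EVar 4]) (enc_bool (okS K (set S))) ((L + 2) ^ 2100)"
    unfolding J_def[symmetric]
    using Nil assms by - (rule J_fin, (rule jr J_ok | (simp; fail) | rule eqi)+)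
  have t: "(L + 2) ^ 2100 + 10 \<le> (L + 2) ^ 2200"
    using pow_gap[of 2100 2200 L] by simp
  show ?case
  proof (cases "okS K (set S)")
    case True
    have "runs ?\<rho> (prog ! 31) (SCons (EL enc_nat S) SNil) (fsN (length []) b * (L + 2) ^ 2200)"
      unfolding prog_nth b_findsep_def
      apply (rule runs_fin, rule runs_IfT[OF ok], simp add: True, (rule rr | (simp; fail))+)
      using t by simp
    then show ?thesis using True by (intro exI conjI) auto
  next
    case False
    have "runs ?\<rho> (prog ! 31) SNil (fsN (length []) b * (L + 2) ^ 2200)"
      unfolding prog_nth b_findsep_def
      apply (rule runs_fin, rule runs_IfF[OF ok], simp add: False, rule runs_IfF, (rule rr | (simp; fail))+)
      using t by simp
    then show ?thesis using False by (intro exI conjI) auto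
  qed
next
  case (Cons x rest S b)
  let ?\<rho> = "[EL enc_nat (x # rest), EL enc_nat S, enc_nat b, EL enc_nat K, g]"
  let ?A = "(L + 2) ^ 2200"
  have S: "VL L S" "VL L (rest @ x # S)" "VL L (rest @ S)" using Cons.prems by (auto simp: VL_def)
  have ok: "runs ?\<rho> (ECall 30 [EVar 1, EVar 3, EVar 4]) (enc_bool (okS K (set S))) ((L + 2) ^ 2100)"
    unfolding J_def[symmetric]
    using S(1) assms by - (rule J_fin, (rule jr J_ok | (simp; fail) | rule eqi)+)
  have t: "(L + 2) ^ 2100 + 50 \<le> (L + 2) ^ 2200"
    using pow_gap[of 2100 2200 L] by simp
  consider (ok) "okS K (set S)" | (zero) "\<not> okS K (set S)" "b = 0" | (suc) b' where "\<not> okS K (set S)" "b = Suc b'"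
    by (cases b) auto
  then show ?case
  proof cases
    case ok': ok
    have "(1::nat) \<le> fsN (length (x # rest)) b" by (cases b) auto
    then have "?A \<le> fsN (length (x # rest)) b * ?A" by simp
    then have "runs ?\<rho> (prog ! 31) (SCons (EL enc_nat S) SNil) (fsN (length (x # rest)) b * ?A)"
      unfolding prog_nth b_findsep_def
      apply - apply (rule runs_fin, rule runs_IfT[OF ok], simp add: ok', (rule rr | (simp; fail))+)
      using t by linarith
    then show ?thesis using ok' by (intro exI conjI) auto
  next
    case zero
    have "runs ?\<rho> (prog ! 31) SNil (fsN (length (x # rest)) b * ?A)"
      unfolding prog_nth b_findsep_def
      apply (rule runs_fin, rule runs_IfF[OF ok], simp add: zero, rule runs_IfT, rule rr, simp, simp, simp,
          rule runs_IfF, rule rr, simp, simp, simp add: zero, (rule rr | (simp; fail))+)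
      using t zero by simp
    moreover have "\<forall>Z\<subseteq>set (x # rest). card Z \<le> b \<longrightarrow> \<not> okS K (set S \<union> Z)"
    proof (intro allI impI)
      fix Z assume "Z \<subseteq> set (x # rest)" "card Z \<le> b"
      then have "Z = {}" using zero finite_subset[of Z "set (x # rest)"] by (simp add: card_eq_0_iff)
      then show "\<not> okS K (set S \<union> Z)" using zero by simp
    qed
    ultimately show ?thesis by blast
  next
    case suc
    obtain r1 where r1: "runs [EL enc_nat rest, EL enc_nat (x # S), enc_nat b', EL enc_nat K, g] (prog ! 31) r1
        (fsN (length rest) b' * ?A)"
      "r1 = SNil \<and> (\<forall>Z\<subseteq>set rest. card Z \<le> b' \<longrightarrow> \<not> okS K (set (x # S) \<union> Z)) \<or>
       (\<exists>S'. r1 = SCons (EL enc_nat S') SNil \<and> okS K (set S') \<and> set S' \<subseteq> set (x # S) \<union> set rest \<and>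
        length S' \<le> length (x # S) + b' \<and> (distinct (rest @ x # S) \<longrightarrow> distinct S'))"
      using Cons.IH[OF S(2), of b'] by blast
    obtain r2 where r2: "runs [EL enc_nat rest, EL enc_nat S, enc_nat b, EL enc_nat K, g] (prog ! 31) r2
        (fsN (length rest) (Suc b') * ?A)"
      "r2 = SNil \<and> (\<forall>Z\<subseteq>set rest. card Z \<le> b \<longrightarrow> \<not> okS K (set S \<union> Z)) \<or>
       (\<exists>S'. r2 = SCons (EL enc_nat S') SNil \<and> okS K (set S') \<and> set S' \<subseteq> set S \<union> set rest \<and>
        length S' \<le> length S + b \<and> (distinct (rest @ S) \<longrightarrow> distinct S'))"
      using Cons.IH[OF S(3), of b] suc by blast
    have e: "b' = b - Suc 0" using suc by simp
    have r1': "runs ?\<rho> (ECall 31 [ETl (EVar 0), ECons (EHd (EVar 0)) (EVar 1), ETl (EVar 2), EVar 3, EVar 4]) r1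
        (fsN (length rest) b' * ?A + 20)"
      apply (rule runs_fin, (rule rr | (simp; fail))+)
        apply (rule r1(1)[simplified, unfolded e])
      using suc by auto
    have r2': "runs (r1 # ?\<rho>) (ECall 31 [ETl (EVar 1), EVar 2, EVar 3, EVar 4, EVar 5]) r2
        (fsN (length rest) (Suc b') * ?A + 20)"
      apply (rule runs_fin, (rule rr | (simp; fail))+)
        apply (rule r2(1)[simplified])
      using suc by auto
    show ?thesis
    proof (cases "r1 = SNil")
      case False
      then have "runs ?\<rho> (prog ! 31) r1 (fsN (length (x # rest)) b * ?A)"
        unfolding prog_nth b_findsep_def
        apply - apply (rule runs_fin, rule runs_IfF[OF ok], simp add: suc, rule runs_IfT, rule rr, simp, simp, simp,
          rule runs_IfT, rule rr, simp, simp, simp add: suc, rule runs_Let, rule r1', rule runs_IfT, (rule rr | (simp; fail))+)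
        using t suc by (simp add: algebra_simps)
      then show ?thesis using r1(2) False suc by (intro exI conjI) auto
    next
      case True
      then have "runs ?\<rho> (prog ! 31) r2 (fsN (length (x # rest)) b * ?A)"
        unfolding prog_nth b_findsep_def
        apply - apply (rule runs_fin, rule runs_IfF[OF ok], simp add: suc, rule runs_IfT, rule rr, simp, simp, simp,
          rule runs_IfT, rule rr, simp, simp, simp add: suc, rule runs_Let, rule r1', rule runs_IfF, rule rr, simp, simp, simp,
          rule r2', simp)
        using t suc by (simp add: algebra_simps)
      moreover have "\<not> okS K (set S \<union> Z)" if r2n: "r2 = SNil" and Z: "Z \<subseteq> set (x # rest)" "card Z \<le> b" for Z
      proof (cases "x \<in> Z")
        case True
        have "card (Z - {x}) \<le> b'" "Z - {x} \<subseteq> set rest"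
          using Z suc True finite_subset[of Z "set (x # rest)"] by auto
        then have "\<not> okS K (set (x # S) \<union> (Z - {x}))" using r1(2) \<open>r1 = SNil\<close> by auto
        moreover have "set (x # S) \<union> (Z - {x}) = set S \<union> Z" using True by auto
        ultimately show ?thesis by simp
      next
        case False
        then have "Z \<subseteq> set rest" using Z by auto
        then show ?thesis using r2(2) r2n Z by auto
      qed
      moreover have "\<exists>S'. r2 = SCons (EL enc_nat S') SNil \<and> okS K (set S') \<and> set S' \<subseteq> set S \<union> set (x # rest) \<and>
        length S' \<le> length S + b \<and> (distinct ((x # rest) @ S) \<longrightarrow> distinct S')" if "r2 \<noteq> SNil"
        using r2(2) that by auto
      ultimately show ?thesis by blast
    qed
  qed
qed

end

context sgraph_ctx
begin

definition clique :: "nat set \<Rightarrow> bool" where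
  "clique c \<longleftrightarrow> (\<forall>x\<in>c. \<forall>y\<in>c. x \<noteq> y \<longrightarrow> (x, y) \<in> E)"

lemma clique_Diff: "clique c \<Longrightarrow> clique (c - A)"
  by (simp add: clique_def)

lemma clique_comps:
  assumes "clique c" "c \<subseteq> set V" "c \<noteq> {}"
  shows "\<exists>d\<in>set (comps V). c \<subseteq> set d"
proof -
  obtain x where x: "x \<in> c" using assms(3) by auto
  then obtain d where d: "d \<in> set (comps V)" "x \<in> set d"
    using comps_concat(1)[of V] assms(2) by auto
  have "c \<subseteq> set d"
  proof
    fix y assume y: "y \<in> c"
    show "y \<in> set d"
    proof (cases "y = x")
      case False
      then have "(x, y) \<in> E" using assms(1) x y by (auto simp: clique_def)
      then show ?thesis using comps_closed[OF d] assms(2) y by blast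
    qed (use d in simp)
  qed
  then show ?thesis using d by blast
qed

text \<open>Each level of separators adds at most \<open>b\<close> to the depth and shrinks the
  pieces to 2/3. After h levels nothing is left of a piece with (2/3)^h |K| < 1, which is the
  condition on \<open>h\<close> without fractions. Quantifying over all \<open>h\<close> makes the
  clause inductive. The clause on cliques is what the constraints need later.\<close>

definition forest_for :: "nat \<Rightarrow> nat list list \<Rightarrow> tr list \<Rightarrow> bool" where
  "forest_for b Ks F \<longleftrightarrow> fverts F = set (concat Ks) \<and> fnodes F = length (concat Ks) \<and> fdist F \<and>
     (\<forall>K\<in>set Ks. \<forall>c\<subseteq>set K. clique c \<longrightarrow> chain F c) \<and>
     (\<forall>h. (\<forall>K\<in>set Ks. 2 ^ h * length K < 3 ^ h) \<longrightarrow> fdepth F \<le> b * h)"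

text \<open>A potential that serves both as termination measure and as bound on the number of calls.
  If pieces of size at most 2m/3 have total size at most m, their squares contribute at most 6
  (2m/3) m = 4 m^2, and the summands 2 at most 2m, together at most 6 m^2. The 2 of the split piece
  then pays for the call itself and also makes empty pieces decrease the measure.\<close>

definition wsize :: "nat list list \<Rightarrow> nat" where
  "wsize Ks = (\<Sum>K\<leftarrow>Ks. 6 * (length K)\<^sup>2 + 2)"

lemma wsize_Cons: "wsize (K # Ks) = 6 * (length K)\<^sup>2 + 2 + wsize Ks"
  by (simp add: wsize_def)

lemma wsize_pieces:
  assumes "\<forall>c\<in>set cs. 3 * length c \<le> 2 * m" "length (concat cs) \<le> m" "[] \<notin> set cs"
  shows "wsize cs + 2 \<le> 6 * m\<^sup>2 + 2"
proof -
  have "wsize cs \<le> 4 * m * length (concat cs) + 2 * length cs"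
    using assms(1)
  proof (induction cs)
    case (Cons c cs)
    have "length c * (3 * length c) \<le> length c * (2 * m)" using Cons.prems by (intro mult_left_mono) auto
    then have "6 * (length c)\<^sup>2 \<le> 4 * m * length c" by (simp add: power2_eq_square)
    then show ?case using Cons by (auto simp: wsize_Cons algebra_simps)
  qed (simp add: wsize_def)
  moreover have "length cs \<le> m" using length_outer_le_concat[OF assms(3)] assms(2) by simp
  moreover have "4 * m * length (concat cs) \<le> 4 * m * m" using assms(2) by simp
  ultimately have "wsize cs \<le> 4 * m * m + 2 * m" by linarith
  moreover have "m \<le> m * m" by (cases m) auto
  ultimately show ?thesis unfolding power2_eq_square by linarith
qed

lemma forest_for_Nil: "forest_for b [] []"
  by (simp add: forest_for_def)

text \<open>A clique of \<open>K\<close> has its vertices in \<open>S\<close> on the new path, and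
  the others form a clique of \<open>K - S\<close>. That clique lies in one component, hence on one
  chain of \<open>F1\<close>, which the path extends upwards.\<close>

lemma forest_for_step:
  assumes d: "distinct (concat (K # Ks))" and F2: "forest_for b Ks F2"
    and S: "set S \<subseteq> set K" "length S \<le> b" "distinct S" "okS K (set S)"
    and F1: "forest_for b (comps (rev (filter (\<lambda>x. x \<notin> set S) K))) F1"
  shows "forest_for b (K # Ks) (rev (path S F1) @ F2)"
proof -
  let ?V = "rev (filter (\<lambda>x. x \<notin> set S) K)"
  note c = comps_concat[of ?V]
  have F1v: "fverts F1 = set K - set S" using F1 c by (auto simp: forest_for_def)
  have dK: "distinct K" using d by simp
  have len: "length S + length ?V = length K"
  proof -
    have "length ?V = card (set K - set S)" using dK by (simp add: distinct_card[symmetric] set_diff_eq)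
    moreover have "length S = card (set S)" using S by (simp add: distinct_card)
    ultimately show ?thesis using S dK by (metis card_Diff_subset card_mono distinct_card finite_set le_add_diff_inverse)
  qed
  have v: "fverts (rev (path S F1)) = set K" using F1v S by (auto simp: frev path_props)
  have 1: "fverts (rev (path S F1) @ F2) = set (concat (K # Ks))"
    using v F2 by (simp add: fappend forest_for_def)
  have 2: "fnodes (rev (path S F1) @ F2) = length (concat (K # Ks))"
    using F1 F2 len c by (simp add: fappend frev path_props forest_for_def)
  have 3: "fdist (rev (path S F1) @ F2)"
    using F1 F2 S F1v v d by (auto simp: fappend frev forest_for_def intro!: path_props(4))
  have 4: "chain (rev (path S F1) @ F2) c" if cl: "clique c" "X \<in> set (K # Ks)" "c \<subseteq> set X" for c X
  proof (cases "X = K")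
    case True
    have "chain F1 (c - set S)"
    proof (cases "c - set S = {}")
      case False
      then obtain e where "e \<in> set (comps ?V)" "c - set S \<subseteq> set e"
        using clique_comps[of "c - set S" ?V] cl True by (auto simp: clique_Diff)
      then show ?thesis using F1 clique_Diff[OF cl(1)] unfolding forest_for_def by blast
    next
      case True
      show ?thesis unfolding True by simp
    qed
    then have "chain (path S F1) c" using cl True F1v by (intro chain_path) auto
    then show ?thesis by (auto intro!: chain_append frev)
  next
    case False
    then have "chain F2 c" using F2 cl unfolding forest_for_def by auto
    then show ?thesis by (auto intro!: chain_append)
  qed
  have 5: "fdepth (rev (path S F1) @ F2) \<le> b * h" if h: "\<forall>X\<in>set (K # Ks). 2 ^ h * length X < 3 ^ h" for h
  proof -
    have f2: "fdepth F2 \<le> b * h" using F2 h unfolding forest_for_def by simp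
    have "length S + fdepth F1 \<le> b * h"
    proof (cases "K = []")
      case True
      then have "S = []" "comps ?V = []" using S by (auto simp: comps_def)
      then have "fdepth F1 \<le> b * 0" using F1 unfolding forest_for_def by (metis empty_iff empty_set)
      then show ?thesis using \<open>S = []\<close> by simp
    next
      case False
      \<comment> \<open>A nonempty piece violates the condition for h = 0, so one level is available
        to pay for the separator. The pieces satisfy the condition for h - 1, as they have at most
        2/3 of the size.\<close>
      then have "h \<noteq> 0" using h by (intro notI) simp
      then obtain h' where h': "h = Suc h'" by (cases h) auto
      have "2 ^ h' * length e < 3 ^ h'" if e: "e \<in> set (comps ?V)" for e
      proof -
        have "3 * length e \<le> 2 * length K" using S(4) e unfolding okS_def by blast
        then have "2 ^ h' * (3 * length e) \<le> 2 ^ h' * (2 * length K)" by (rule mult_left_mono) simp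
        also have "\<dots> = 2 ^ h * length K" by (simp add: h')
        also have "\<dots> < 3 ^ h" using h by simp
        finally show ?thesis by (simp add: h')
      qed
      then have "fdepth F1 \<le> b * h'" using F1 unfolding forest_for_def by blast
      then show ?thesis using S(2) by (simp add: h')
    qed
    then have "fdepth (path S F1) \<le> b * h" using path_props(3)[of S F1] by linarith
    then show ?thesis using f2 by (simp add: fappend frev)
  qed
  show ?thesis unfolding forest_for_def using 1 2 3 4 5 by blast
qed

lemma bl_time:
  fixes f Y B Z A :: nat
  assumes "f + Y \<le> 2 * B * Y" "50 * Y + 200 \<le> Z" "1 \<le> B" "A = 2 * B * Z"
  shows "f + 5 * Y + 200 \<le> A"
proof -
  have "2 * B * (50 * Y + 200) \<le> A" unfolding assms(4) using assms(2) by (rule mult_left_mono) simp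
  moreover have "2 * B * (50 * Y + 200) = 100 * (B * Y) + 400 * B" by (simp add: algebra_simps)
  moreover have "1 * Y \<le> B * Y" using assms(3) by (rule mult_right_mono) simp
  moreover have "2 * B * Y = 2 * (B * Y)" by simp
  ultimately show ?thesis using assms(1,3) by linarith
qed

text \<open>The recursion goes to the remaining pieces and to the components of the current one;
  both have smaller potential. \<open>A\<close> is the cost charged to one call, dominated by the
  search among at most (M + 1)^b separators up to a factor. The empty result carries a witness
  \<open>W\<close> of some piece without separators of order \<open>b\<close>, which is passed up
  unchanged.\<close>

lemma runs_bl:
  assumes A: "A = 2 * (M + 1) ^ b * (L + 2) ^ 3000"
  shows "distinct (concat Ks) \<Longrightarrow> set (concat Ks) \<subseteq> {..<n} \<Longrightarrow> \<forall>K\<in>set Ks. length K \<le> M \<Longrightarrow>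
    \<exists>r. runs [EL (EL enc_nat) Ks, g, enc_nat b] (prog ! 33) r ((1 + wsize Ks) * A) \<and>
      (r = SNil \<and> (\<exists>W\<subseteq>set (concat Ks). \<forall>S. balS W S \<longrightarrow> b < card S) \<or> (\<exists>F. r = SCons (EL encT F) SNil \<and> forest_for b Ks F))"
proof (induction "wsize Ks" arbitrary: Ks rule: less_induct)
  case less
  let ?\<rho> = "[EL (EL enc_nat) Ks, g, enc_nat b]"
  have Mb: "(1::nat) \<le> (M + 1) ^ b" by simp
  have "200 \<le> (L + 2) ^ 3000" using pow_gap[of 2900 3000 L] by linarith
  moreover have "1 * (L + 2) ^ 3000 \<le> (M + 1) ^ b * (L + 2) ^ 3000" using Mb by (rule mult_right_mono) simp
  moreover have "A = 2 * ((M + 1) ^ b * (L + 2) ^ 3000)" unfolding A by (simp only: mult.assoc)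
  ultimately have A0: "200 \<le> A" by linarith
  show ?case
  proof (cases Ks)
    case Nil
    have "runs ?\<rho> (prog ! 33) (SCons (EL encT []) SNil) ((1 + wsize Ks) * A)"
      unfolding prog_nth b_bl_def
      apply (rule runs_fin, rule runs_IfF, rule rr, simp, simp, simp add: Nil, (rule rr | (simp; fail))+)
      using A0 by (simp add: Nil wsize_def)
    then show ?thesis using forest_for_Nil Nil by blast
  next
    case (Cons K Ks')
    have dc: "distinct (concat Ks')" "distinct K" "set (concat Ks') \<subseteq> {..<n}" "set K \<subseteq> {..<n}"
      using less.prems Cons by auto
    have vK: "vs K" using dc by (simp add: vs_def)
    have VK: "VL L K" by (rule vs_VL[OF vK])
    have lK: "2 * length K \<le> L" using vs_length[OF vK] L_ge by simp
    have "wsize Ks' < wsize Ks" by (simp add: Cons wsize_Cons)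
    then obtain r2 where r2: "runs [EL (EL enc_nat) Ks', g, enc_nat b] (prog ! 33) r2 ((1 + wsize Ks') * A)"
      "r2 = SNil \<and> (\<exists>W\<subseteq>set (concat Ks'). \<forall>S. balS W S \<longrightarrow> b < card S) \<or>
       (\<exists>F. r2 = SCons (EL encT F) SNil \<and> forest_for b Ks' F)"
      using less.hyps[of Ks'] dc less.prems(3) Cons by auto
    have r2': "runs ?\<rho> (ECall 33 [ETl (EVar 0), EVar 1, EVar 2]) r2 ((1 + wsize Ks') * A + 20)"
      by (rule runs_fin, (rule rr | (simp add: Cons; fail) | rule r2(1))+)
    show ?thesis
    proof (cases "r2 = SNil")
      case True
      have "runs ?\<rho> (prog ! 33) SNil ((1 + wsize Ks) * A)"
        unfolding prog_nth b_bl_def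
        apply (rule runs_fin, rule runs_IfT, rule rr, simp, simp, simp add: Cons, rule runs_Let, rule r2', rule runs_IfF,
           rule rr, simp, simp, simp add: True, (rule rr | (simp; fail))+)
        using A0 by (simp add: Cons wsize_Cons algebra_simps)
      moreover have "\<exists>W\<subseteq>set (concat Ks). \<forall>S. balS W S \<longrightarrow> b < card S"
      proof -
        have "\<exists>W\<subseteq>set (concat Ks'). \<forall>S. balS W S \<longrightarrow> b < card S" using r2(2) True by auto
        moreover have "set (concat Ks') \<subseteq> set (concat Ks)" by (simp add: Cons)
        ultimately show ?thesis by (meson order_trans)
      qed
      ultimately show ?thesis by blast
    next
      case False
      then obtain F2 where F2: "r2 = SCons (EL encT F2) SNil" "forest_for b Ks' F2" using r2 by auto
      let ?\<rho>1 = "r2 # ?\<rho>"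
      obtain r where r: "runs [EL enc_nat K, EL enc_nat [], enc_nat b, EL enc_nat K, g] (prog ! 31) r
          (fsN (length K) b * (L + 2) ^ 2200)"
        "r = SNil \<and> (\<forall>Z\<subseteq>set K. card Z \<le> b \<longrightarrow> \<not> okS K (set [] \<union> Z)) \<or>
         (\<exists>S'. r = SCons (EL enc_nat S') SNil \<and> okS K (set S') \<and> set S' \<subseteq> set [] \<union> set K \<and>
            length S' \<le> length ([]::nat list) + b \<and> (distinct (K @ []) \<longrightarrow> distinct S'))"
        using runs_findsep[OF VK lK, of K "[]" b] VK by auto
      have fs: "fsN (length K) b * (L + 2) ^ 2200 + (L + 2) ^ 2200 \<le> 2 * (M + 1) ^ b * (L + 2) ^ 2200"
      proof -
        have "fsN (length K) b + 1 \<le> 2 * (length K + 1) ^ b" by (rule fsN_bound)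
        also have "\<dots> \<le> 2 * (M + 1) ^ b" using less.prems(3) Cons by (intro mult_left_mono power_mono) auto
        finally have "(fsN (length K) b + 1) * (L + 2) ^ 2200 \<le> 2 * (M + 1) ^ b * (L + 2) ^ 2200" by (rule mult_right_mono) simp
        then show ?thesis by (simp add: algebra_simps)
      qed
      have r': "runs ?\<rho>1 (ECall 31 [EHd (EVar 1), ENil, EVar 3, EHd (EVar 1), EVar 2]) r (fsN (length K) b * (L + 2) ^ 2200 + 20)"
        by (rule runs_fin, (rule rr | (simp add: Cons; fail) | rule r(1)[simplified])+)
      show ?thesis
      proof (cases "r = SNil")
        case True
        have "fsN (length K) b * (L + 2) ^ 2200 + 100 \<le> A"
          using bl_time[OF fs pow_gap[of 2200 3000 L] Mb A] by simp
        then have "runs ?\<rho> (prog ! 33) SNil ((1 + wsize Ks) * A)"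
          unfolding prog_nth b_bl_def
          apply - apply (rule runs_fin, rule runs_IfT, rule rr, simp, simp, simp add: Cons, rule runs_Let, rule r2', rule runs_IfT,
             rule rr, simp, simp, simp add: False, rule runs_Let, rule r', rule runs_IfF, rule rr, simp, simp, simp add: True,
             (rule rr | (simp; fail))+)
          by (simp add: Cons wsize_Cons algebra_simps)
        moreover have "\<forall>S. balS (set K) S \<longrightarrow> b < card S"
        proof (intro allI impI)
          fix S assume S: "balS (set K) S"
          then have "okS K S" "S \<subseteq> set K" using okS_of_balS[OF dc(2)] by (auto simp: balS_def)
          then show "b < card S" using r(2) True by (auto simp: not_less[symmetric])
        qed
        moreover have "set K \<subseteq> set (concat Ks)" by (simp add: Cons)
        ultimately show ?thesis by blast
      next
        case r0: False
        then obtain S where S: "r = SCons (EL enc_nat S) SNil" "okS K (set S)" "set S \<subseteq> set K" "length S \<le> b" "distinct S"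
          using r dc by auto
        let ?\<rho>2 = "r # ?\<rho>1"
        let ?V = "rev (filter (\<lambda>x. x \<notin> set S) K)"
        have cv: "\<forall>c\<in>set (comps ?V). 3 * length c \<le> 2 * length K" using S(2) by (simp add: okS_def)
        have ws: "wsize (comps ?V) + 2 \<le> 6 * (length K)\<^sup>2 + 2"
          using wsize_pieces[OF cv] comps_concat[of ?V] by auto
        have dV: "distinct (concat (comps ?V))" using dc(2) by (intro distinct_concat_comps) simp
        have sV: "set (concat (comps ?V)) \<subseteq> set K" using comps_concat(1)[of ?V] by auto
        have lV: "\<forall>c\<in>set (comps ?V). length c \<le> M"
        proof
          fix c assume "c \<in> set (comps ?V)"
          then have "length c \<le> length (concat (comps ?V))" by (rule length_le_concat)
          also have "\<dots> \<le> length K" using comps_concat(2)[of ?V] by (simp del: length_concat)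
          finally show "length c \<le> M" using less.prems(3) Cons by auto
        qed
        have wl: "wsize (comps ?V) < wsize Ks" using ws by (simp add: Cons wsize_Cons)
        have sn: "set (concat (comps ?V)) \<subseteq> {..<n}" using sV dc(4) by (rule order_trans)
        obtain r1 where r1: "runs [EL (EL enc_nat) (comps ?V), g, enc_nat b] (prog ! 33) r1 ((1 + wsize (comps ?V)) * A)"
          "r1 = SNil \<and> (\<exists>W\<subseteq>set (concat (comps ?V)). \<forall>S. balS W S \<longrightarrow> b < card S) \<or>
           (\<exists>F. r1 = SCons (EL encT F) SNil \<and> forest_for b (comps ?V) F)"
          using less.hyps[OF wl dV sn lV] by (elim exE conjE) (rule that)
        have VS: "VL L S" using VK S dc unfolding VL_def by (metis card_mono distinct_card finite_set order_trans subsetD)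
        have VV: "VL L ?V" using VK by (rule VL_rev_filter)
        have c1: "runs ?\<rho>2 (ECall 28 [ECall 16 [EHd (EVar 2), ENil, EHd (EVar 0)], ENil, EVar 3]) (EL (EL enc_nat) (comps ?V)) ((L + 2) ^ 2200)"
          unfolding J_def[symmetric]
          using VK VS VV by - (rule J_fin, (rule jr J_comps J_filout | (simp add: Cons S; fail) | rule eqi)+)
        have r1': "runs ?\<rho>2 (ECall 33 [ECall 28 [ECall 16 [EHd (EVar 2), ENil, EHd (EVar 0)], ENil, EVar 3], EVar 3, EVar 4]) r1
          ((1 + wsize (comps ?V)) * A + (L + 2) ^ 2200 + 20)"
          by (rule runs_fin, rule runs_Call, rule runs_list_Cons, rule c1, (rule rr | (simp; fail) | rule r1(1))+)
        have t: "fsN (length K) b * (L + 2) ^ 2200 + 5 * (L + 2) ^ 2200 + 200 \<le> A"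
          by (rule bl_time[OF fs pow_gap[of 2200 3000 L] Mb A]) simp
        have t2: "(1 + wsize (comps ?V)) * A + (1 + wsize Ks') * A + A \<le> (1 + wsize Ks) * A"
        proof -
          have "(1 + wsize (comps ?V)) + (1 + wsize Ks') + 1 \<le> 1 + wsize Ks" using ws by (simp add: Cons wsize_Cons)
          then have "((1 + wsize (comps ?V)) + (1 + wsize Ks') + 1) * A \<le> (1 + wsize Ks) * A" by (rule mult_right_mono) simp
          then show ?thesis by (simp only: add_mult_distrib mult_1)
        qed
        show ?thesis
        proof (cases "r1 = SNil")
          case True
          have "runs ?\<rho> (prog ! 33) SNil ((1 + wsize Ks) * A)"
            unfolding prog_nth b_bl_def
            apply (rule runs_fin, rule runs_IfT, rule rr, simp, simp, simp add: Cons, rule runs_Let, rule r2', rule runs_IfT,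
             rule rr, simp, simp, simp add: False, rule runs_Let, rule r', rule runs_IfT, rule rr, simp, simp, simp add: r0,
             rule runs_Let, rule r1', rule runs_IfF, rule rr, simp, simp, simp add: True,
             (rule rr | (simp; fail))+)
            using t t2 by linarith
          moreover obtain W where W: "W \<subseteq> set (concat (comps ?V))" "\<forall>S. balS W S \<longrightarrow> b < card S"
            using r1(2) True by auto
          moreover have "W \<subseteq> set (concat Ks)"
            using order_trans[OF W(1) sV] by (auto simp: Cons)
          ultimately show ?thesis by blast
        next
          case r10: False
          then obtain F1 where F1: "r1 = SCons (EL encT F1) SNil" "forest_for b (comps ?V) F1" using r1 by auto
          have ff: "forest_for b Ks (rev (path S F1) @ F2)"
            unfolding Cons using less.prems(1) Cons F2 S F1 by (intro forest_for_step) auto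
          have lp: "length (path S F1) \<le> L"
          proof -
            have "length (path S F1) \<le> fnodes (path S F1)" by (rule length_le_fnodes)
            also have "\<dots> \<le> fnodes (rev (path S F1) @ F2)" by (simp add: fappend frev)
            also have "\<dots> = length (concat Ks)" using ff by (simp add: forest_for_def)
            also have "\<dots> \<le> n" using less.prems by (intro vs_length) (simp add: vs_def)
            finally show ?thesis using n_le by simp
          qed
          have c2: "runs (r1 # ?\<rho>2) (ECons (ECall 2 [ECall 32 [EHd (EVar 1), EHd (EVar 0)], EHd (EVar 2)]) ENil)
              (SCons (EL encT (rev (path S F1) @ F2)) SNil) ((L + 2) ^ 2200)"
            unfolding J_def[symmetric]
            using VS lp by - (rule J_fin, (rule jr J_path J_rapp | (simp add: F1 F2 S VL_def; fail) | rule eqi)+)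
          have "runs ?\<rho> (prog ! 33) (SCons (EL encT (rev (path S F1) @ F2)) SNil) ((1 + wsize Ks) * A)"
            unfolding prog_nth b_bl_def
            apply (rule runs_fin, rule runs_IfT, rule rr, simp, simp, simp add: Cons, rule runs_Let, rule r2', rule runs_IfT,
             rule rr, simp, simp, simp add: False, rule runs_Let, rule r', rule runs_IfT, rule rr, simp, simp, simp add: r0,
             rule runs_Let, rule r1', rule runs_IfT, rule rr, simp, simp, simp add: r10, rule c2, simp)
            using t t2 by linarith
          then show ?thesis using ff by blast
        qed
      qed
    qed
  qed
qed

end

section \<open>Minimum weight hitting sets over an elimination forest\<close>

lemma J_rapp_any:
  assumes "sl a \<le> L"
  shows "\<exists>v. J L [a, c] (prog ! 2) v 20 \<and> sl v = sl a + sl c"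
proof -
  have "J L [EL (\<lambda>x. x) (dl a), c] (prog ! 2) (fold (\<lambda>x. SCons ((\<lambda>x. x) x)) (dl a) c) 20"
    using assms by (intro J_rapp_gen) simp
  moreover have "sl (fold (\<lambda>x. SCons ((\<lambda>x. x) x)) xs c) = length xs + sl c" for xs
    by (induction xs arbitrary: c) auto
  ultimately show ?thesis by (metis EL_dl length_dl)
qed

text \<open>The children of v are solved twice, once for each decision on v, so a node with j proper
  ancestors is visited 2^j times. This gives the factor exponential in the depth in
  \<open>sN_bound\<close>.\<close>

fun sN :: "tr list \<Rightarrow> nat" where
  "sN [] = 1"
| "sN (Tr v ch # r) = 1 + 2 * sN ch + sN r"

lemma sN_bound: "sN F + 1 \<le> (fnodes F + 1) * 2 ^ (fdepth F + 1)"
proof (induction F rule: sN.induct)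
  case (2 v ch r)
  let ?d = "max (Suc (fdepth ch)) (fdepth r)"
  have "sN (Tr v ch # r) + 1 \<le> 2 * (sN ch + 1) + (sN r + 1)" by simp
  also have "\<dots> \<le> 2 * ((fnodes ch + 1) * 2 ^ (fdepth ch + 1)) + (fnodes r + 1) * 2 ^ (fdepth r + 1)"
    by (intro add_mono mult_le_mono2 2)
  also have "2 * ((fnodes ch + 1) * 2 ^ (fdepth ch + 1)) = (fnodes ch + 1) * 2 ^ (Suc (fdepth ch) + 1)" by simp
  also have "(fnodes ch + 1) * 2 ^ (Suc (fdepth ch) + 1) \<le> (fnodes ch + 1) * 2 ^ (?d + 1)"
    by (intro mult_left_mono power_increasing) auto
  also have "(fnodes r + 1) * 2 ^ (fdepth r + 1) \<le> (fnodes r + 1) * 2 ^ (?d + 1)"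
    by (intro mult_left_mono power_increasing) auto
  also have "(fnodes ch + 1) * 2 ^ (?d + 1) + (fnodes r + 1) * 2 ^ (?d + 1) =
      (fnodes (Tr v ch # r) + 1) * 2 ^ (fdepth (Tr v ch # r) + 1)"
    by (simp only: fnodes.simps fdepth.simps flip: add_mult_distrib) simp
  finally show ?case by simp
qed simp

text \<open>Only constraints inside the forest count. A constraint on a chain lies within a single
  tree, so the others are the business of another part of the forest. The empty constraint is inside
  every forest and makes each of them unsatisfiable.\<close>

definition sat :: "tr list \<Rightarrow> nat list list \<Rightarrow> nat set \<Rightarrow> bool" where
  "sat F C Z \<longleftrightarrow> Z \<subseteq> fverts F \<and> (\<forall>c\<in>set C. set c \<subseteq> fverts F \<longrightarrow> set c \<inter> Z \<noteq> {})"

definition chains :: "tr list \<Rightarrow> nat list list \<Rightarrow> bool" where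
  "chains F C \<longleftrightarrow> (\<forall>c\<in>set C. set c \<subseteq> fverts F \<longrightarrow> chain F (set c))"

definition delc :: "nat \<Rightarrow> nat list list \<Rightarrow> nat list list" where
  "delc v C = rev (filter (\<lambda>c. v \<notin> set c) C)"

definition remc :: "nat \<Rightarrow> nat list list \<Rightarrow> nat list list" where
  "remc v C = rev (map (\<lambda>c. rev (filter (\<lambda>x. x \<notin> set [v]) c)) C)"

text \<open>\<open>value_upto k w F C s\<close>: up to the cutoff \<open>k\<close>, \<open>s\<close> is the least weight of a solution of the
  constraints \<open>C\<close> inside \<open>F\<close>; every larger \<open>s\<close> stands for infinity.\<close>

definition value_upto :: "nat \<Rightarrow> (nat \<Rightarrow> nat) \<Rightarrow> tr list \<Rightarrow> nat list list \<Rightarrow> nat \<Rightarrow> bool" where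
  "value_upto k w F C s \<longleftrightarrow> (\<forall>j\<le>k. s \<le> j \<longleftrightarrow> (\<exists>Z. sat F C Z \<and> sum w Z \<le> j))"

lemma value_uptoD: "value_upto k w F C s \<Longrightarrow> s \<le> k \<Longrightarrow> \<exists>Z. sat F C Z \<and> sum w Z \<le> s"
  unfolding value_upto_def using order_refl by blast

lemma value_Nil:
  assumes "chains [] C"
  shows "value_upto k w [] C (if [] \<in> set C then Suc k else 0)"
  unfolding value_upto_def sat_def by (auto intro!: exI[of _ "{}"])

context
  fixes v ch r C
  assumes d: "fdist (Tr v ch # r)" and c: "chains (Tr v ch # r) C"
begin

lemma chain_cases:
  assumes "x \<in> set C" "set x \<subseteq> fverts (Tr v ch # r)"
  shows "set x \<subseteq> insert v (fverts ch) \<and> chain ch (set x - {v}) \<or> set x \<subseteq> fverts r \<and> chain r (set x)"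
  using c assms by (auto simp: chains_def)

text \<open>A constraint that lies on the other side of the forest as well is contained in two
  disjoint vertex sets. It is therefore empty, and the empty set is a chain everywhere.\<close>

lemma chains_sub:
  "chains ch (delc v C)" "chains ch (remc v C)" "chains r C"
proof -
  show "chains ch (delc v C)"
    unfolding chains_def
  proof (intro ballI impI)
    fix x assume x: "x \<in> set (delc v C)" "set x \<subseteq> fverts ch"
    then have x': "x \<in> set C" "v \<notin> set x" "set x \<subseteq> fverts (Tr v ch # r)" by (auto simp: delc_def)
    from chain_cases[OF x'(1,3)] show "chain ch (set x)"
    proof
      assume "set x \<subseteq> fverts r \<and> chain r (set x)"
      then have "set x \<subseteq> fverts ch \<inter> fverts r" using x(2) by (intro Int_greatest) simp_all
      moreover have "fverts ch \<inter> fverts r = {}" using d by simp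
      ultimately have "set x = {}" by (metis subset_empty)
      then show ?thesis by simp
    qed (use x' in simp)
  qed
  show "chains ch (remc v C)"
    unfolding chains_def
  proof (intro ballI impI)
    fix y assume y: "y \<in> set (remc v C)" "set y \<subseteq> fverts ch"
    then obtain x where x': "x \<in> set C" "y = rev (filter (\<lambda>z. z \<notin> set [v]) x)" by (auto simp: remc_def)
      have x: "x \<in> set C" "set y = set x - {v}" using x' by auto
    have "set x \<subseteq> fverts (Tr v ch # r)" using x y by auto
    from chain_cases[OF x(1) this] show "chain ch (set y)"
    proof
      assume "set x \<subseteq> fverts r \<and> chain r (set x)"
      then have "set y \<subseteq> fverts ch \<inter> fverts r" using x(2) y(2) by auto
      moreover have "fverts ch \<inter> fverts r = {}" using d by simp
      ultimately have "set y = {}" by (metis subset_empty)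
      then show ?thesis by simp
    qed (use x in simp)
  qed
  show "chains r C"
    unfolding chains_def
  proof (intro ballI impI)
    fix x assume x: "x \<in> set C" "set x \<subseteq> fverts r"
    then have "set x \<subseteq> fverts (Tr v ch # r)" by auto
    from chain_cases[OF x(1) this] show "chain r (set x)"
    proof
      assume "set x \<subseteq> insert v (fverts ch) \<and> chain ch (set x - {v})"
      moreover have "v \<notin> fverts r" using d by simp
      ultimately have "set x \<subseteq> fverts ch \<inter> fverts r" using x(2) by auto
      moreover have "fverts ch \<inter> fverts r = {}" using d by simp
      ultimately have "set x = {}" by (metis subset_empty)
      then show ?thesis by simp
    qed simp
  qed
qed

text \<open>A constraint lies either in the tree of v or in \<open>r\<close>, so solutions combine
  from the two sides and restrict to them. Within the tree, taking v deletes the constraints through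
  v (\<open>delc\<close>), and rejecting v deletes v from the constraints (\<open>remc\<close>).
  Values above \<open>k\<close> are never interpreted, so sums with an infinite summand do no
  harm.\<close>

lemma value_step:
  assumes a: "value_upto k w ch (delc v C) sa" and b: "value_upto k w ch (remc v C) sb" and rr: "value_upto k w r C sr"
  shows "value_upto k w (Tr v ch # r) C (min (w v + sa) sb + sr)"
  unfolding value_upto_def
proof (intro allI impI iffI)
  fix j assume j: "j \<le> k" and le: "min (w v + sa) sb + sr \<le> j"
  have "sr \<le> k" using le j by simp
  then obtain Zr where Zr: "sat r C Zr" "sum w Zr \<le> sr" using value_uptoD[OF rr] by blast
  have fr: "finite Zr" using Zr finite_subset[of Zr "fverts r"] by (auto simp: sat_def)
  show "\<exists>Z. sat (Tr v ch # r) C Z \<and> sum w Z \<le> j"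
  proof (cases "w v + sa \<le> sb")
    case True
    then have "sa \<le> k" using le j by simp
    then obtain Zc where Zc: "sat ch (delc v C) Zc" "sum w Zc \<le> sa" using value_uptoD[OF a] by blast
    have fc: "finite Zc" using Zc finite_subset[of Zc "fverts ch"] by (auto simp: sat_def)
    let ?Z = "insert v (Zc \<union> Zr)"
    have "v \<notin> Zc \<union> Zr" "Zc \<inter> Zr = {}" using Zc Zr d by (auto simp: sat_def)
    then have "sum w ?Z = w v + (sum w Zc + sum w Zr)" using fc fr by (simp add: sum.union_disjoint)
    then have "sum w ?Z \<le> j" using Zc Zr le True by simp
    moreover have "sat (Tr v ch # r) C ?Z"
      unfolding sat_def
    proof (intro conjI ballI impI)
      show "?Z \<subseteq> fverts (Tr v ch # r)" using Zc Zr by (auto simp: sat_def)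
      fix x assume x: "x \<in> set C" "set x \<subseteq> fverts (Tr v ch # r)"
      from chain_cases[OF x] show "set x \<inter> ?Z \<noteq> {}"
      proof
        assume h: "set x \<subseteq> insert v (fverts ch) \<and> chain ch (set x - {v})"
        show ?thesis
        proof (cases "v \<in> set x")
          case False
          then have "x \<in> set (delc v C)" "set x \<subseteq> fverts ch" using x h by (auto simp: delc_def)
          then show ?thesis using Zc(1) unfolding sat_def by blast
        qed auto
      next
        assume "set x \<subseteq> fverts r \<and> chain r (set x)"
        then show ?thesis using Zr(1) x(1) unfolding sat_def by blast
      qed
    qed
    ultimately show ?thesis by blast
  next
    case False
    then have "sb \<le> k" using le j by simp
    then obtain Zc where Zc: "sat ch (remc v C) Zc" "sum w Zc \<le> sb" using value_uptoD[OF b] by blast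
    have fc: "finite Zc" using Zc finite_subset[of Zc "fverts ch"] by (auto simp: sat_def)
    let ?Z = "Zc \<union> Zr"
    have "Zc \<inter> Zr = {}" using Zc Zr d by (auto simp: sat_def)
    then have "sum w ?Z = sum w Zc + sum w Zr" using fc fr by (simp add: sum.union_disjoint)
    then have "sum w ?Z \<le> j" using Zc Zr le False by simp
    moreover have "sat (Tr v ch # r) C ?Z"
      unfolding sat_def
    proof (intro conjI ballI impI)
      show "?Z \<subseteq> fverts (Tr v ch # r)" using Zc Zr by (auto simp: sat_def)
      fix x assume x: "x \<in> set C" "set x \<subseteq> fverts (Tr v ch # r)"
      from chain_cases[OF x] show "set x \<inter> ?Z \<noteq> {}"
      proof
        assume h: "set x \<subseteq> insert v (fverts ch) \<and> chain ch (set x - {v})"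
        let ?y = "rev (filter (\<lambda>z. z \<notin> set [v]) x)"
        have "?y \<in> set (remc v C)" using x(1) by (auto simp: remc_def)
        moreover have "set ?y \<subseteq> fverts ch" using h by auto
        ultimately have "set ?y \<inter> Zc \<noteq> {}" using Zc(1) unfolding sat_def by blast
        then show ?thesis by auto
      next
        assume "set x \<subseteq> fverts r \<and> chain r (set x)"
        then show ?thesis using Zr(1) x(1) unfolding sat_def by blast
      qed
    qed
    ultimately show ?thesis by blast
  qed
next
  fix j assume j: "j \<le> k" and "\<exists>Z. sat (Tr v ch # r) C Z \<and> sum w Z \<le> j"
  then obtain Z where Z: "sat (Tr v ch # r) C Z" "sum w Z \<le> j" by blast
  have fZ: "finite Z" using Z(1) finite_subset[of Z "fverts (Tr v ch # r)"] by (auto simp: sat_def simp del: fverts.simps)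
  let ?Zc = "Z \<inter> fverts ch" and ?Zr = "Z \<inter> fverts r"
  have hit: "set x \<inter> Z \<noteq> {}" if "x \<in> set C" "set x \<subseteq> fverts (Tr v ch # r)" for x
    using Z(1) that unfolding sat_def by blast
  have dj: "?Zc \<inter> ?Zr = {}" "v \<notin> ?Zc \<union> ?Zr" using d by auto
  have s2: "sum w (?Zc \<union> ?Zr) = sum w ?Zc + sum w ?Zr" using fZ dj by (simp add: sum.union_disjoint)
  have "sat r C ?Zr"
    unfolding sat_def
  proof (intro conjI ballI impI)
    fix x assume x: "x \<in> set C" "set x \<subseteq> fverts r"
    then have "set x \<inter> Z \<noteq> {}" by (intro hit) auto
    then show "set x \<inter> ?Zr \<noteq> {}" using x by auto
  qed auto
  moreover have "sum w (?Zc \<union> ?Zr) \<le> sum w Z" using fZ by (intro sum_mono2) auto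
  ultimately have sr: "sr \<le> sum w ?Zr"
    using rr j Z(2) s2 unfolding value_upto_def by (metis (no_types, lifting) add_leD2 order_trans order_refl)
  show "min (w v + sa) sb + sr \<le> j"
  proof (cases "v \<in> Z")
    case True
    have "insert v (?Zc \<union> ?Zr) \<subseteq> Z" using True by auto
    then have s3: "sum w (insert v (?Zc \<union> ?Zr)) \<le> sum w Z" using fZ by (intro sum_mono2) auto
    have s4: "sum w (insert v (?Zc \<union> ?Zr)) = w v + (sum w ?Zc + sum w ?Zr)"
      using s2 dj(2) fZ by (subst sum.insert) auto
    have "sat ch (delc v C) ?Zc"
      unfolding sat_def
    proof (intro conjI ballI impI)
      fix x assume x: "x \<in> set (delc v C)" "set x \<subseteq> fverts ch"
      then have "set x \<inter> Z \<noteq> {}" by (intro hit) (auto simp: delc_def)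
      then show "set x \<inter> ?Zc \<noteq> {}" using x by auto
    qed auto
    moreover have "sum w ?Zc \<le> k" using s3 s4 Z(2) j by linarith
    ultimately have "sa \<le> sum w ?Zc" using a unfolding value_upto_def by blast
    then show ?thesis using sr s3 s4 Z(2) by linarith
  next
    case False
    have s3: "sum w (?Zc \<union> ?Zr) \<le> sum w Z" using fZ by (intro sum_mono2) auto
    have "sat ch (remc v C) ?Zc"
      unfolding sat_def
    proof (intro conjI ballI impI)
      fix y assume y: "y \<in> set (remc v C)" "set y \<subseteq> fverts ch"
      then obtain x where x': "x \<in> set C" "y = rev (filter (\<lambda>z. z \<notin> set [v]) x)" by (auto simp: remc_def)
      have x: "x \<in> set C" "set y = set x - {v}" using x' by auto
      have "set x \<inter> Z \<noteq> {}" using x y by (intro hit) auto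
      then show "set y \<inter> ?Zc \<noteq> {}" using x y False by auto
    qed auto
    moreover have "sum w ?Zc \<le> k" using s3 s2 Z(2) j by linarith
    ultimately have "sb \<le> sum w ?Zc" using b unfolding value_upto_def by blast
    then show ?thesis using sr s3 s2 Z(2) by linarith
  qed
qed

end

context sgraph_ctx
begin

text \<open>The vertices that a kernel vertex stands for: itself inside R, its whole class
  otherwise. The list doubles as its weight in unary, and the solver adds a weight by prepending
  this list to a result.\<close>

definition wts :: "nat list \<Rightarrow> nat list \<Rightarrow> nat \<Rightarrow> nat list" where
  "wts R Y v = (if v \<in> set R then [v] else cl R Y v)"

text \<open>The bound on \<open>sl z\<close> is needed because the infinite values Suc k of
  different leaves add up, and the results must remain short enough for comparing and copying. It
  does not involve the weights, since the minimum never exceeds the value of the branch that rejects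
  v.\<close>

lemma runs_solve:
  assumes RY: "VL L R" "VL L Y" "length Y \<le> n" and k: "(n + 2) * (k + 1) + n \<le> L" "k < L"
  shows "fdist F \<Longrightarrow> fverts F \<subseteq> {..<n} \<Longrightarrow> fnodes F \<le> n \<Longrightarrow> length C \<le> L \<Longrightarrow> \<forall>c\<in>set C. VL L c \<Longrightarrow> chains F C \<Longrightarrow>
    \<exists>z. runs [EL encT F, EL (EL enc_nat) C, g, EL enc_nat R, EL enc_nat Y, enc_nat (Suc k)] (prog ! 37) z (sN F * (L + 2) ^ 4000)
      \<and> sl z \<le> (fnodes F + 1) * (k + 1) \<and> value_upto k (\<lambda>v. length (wts R Y v)) F C (sl z)"
proof (induction F arbitrary: C rule: sN.induct)
  case (1 C)
  let ?\<rho> = "[EL encT [], EL (EL enc_nat) C, g, EL enc_nat R, EL enc_nat Y, enc_nat (Suc k)]"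
  have h: "runs ?\<rho> (ECall 34 [EVar 1, ENil]) (enc_bool ([] \<in> set C)) ((L + 2) ^ 100)"
    unfolding J_def[symmetric]
    using 1 by - (rule J_fin, (rule jr J_hasnil | (simp; fail) | rule eqi)+)
  let ?z = "if [] \<in> set C then enc_nat (Suc k) else SNil"
  have "runs ?\<rho> (prog ! 37) ?z (sN [] * (L + 2) ^ 4000)"
  proof (cases "[] \<in> set C")
    case True
    show ?thesis
      unfolding prog_nth b_solve_def
      apply (rule runs_fin, rule runs_IfF, rule rr, simp, simp, simp, rule runs_IfT[OF h], simp add: True, rule rr, simp, simp)
      using pow_gap[of 100 4000 L] by (simp_all add: True)
  next
    case False
    show ?thesis
      unfolding prog_nth b_solve_def
      apply (rule runs_fin, rule runs_IfF, rule rr, simp, simp, simp, rule runs_IfF[OF h], simp add: False, rule rr)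
      using pow_gap[of 100 4000 L] by (simp_all add: False)
  qed
  moreover have "sl ?z = (if [] \<in> set C then Suc k else 0)" by simp
  ultimately show ?case using value_Nil[OF 1(6), of k] by (intro exI[of _ ?z]) auto
next
  case (2 v ch r C)
  let ?F = "Tr v ch # r"
  let ?\<rho> = "[EL encT ?F, EL (EL enc_nat) C, g, EL enc_nat R, EL enc_nat Y, enc_nat (Suc k)]"
  let ?A = "(L + 2) ^ 4000"
  have v: "v < n" "v \<le> L" "1 \<le> L" using 2 n_le by auto
  have lC: "length (delc v C) \<le> L" "length (remc v C) \<le> L" "\<forall>c\<in>set (delc v C). VL L c" "\<forall>c\<in>set (remc v C). VL L c"
    using 2 by (auto simp: delc_def remc_def VL_def intro: order_trans[OF length_filter_le])
  note cs = chains_sub[OF 2(3) 2(8)]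
  have sub: "fdist ch" "fverts ch \<subseteq> {..<n}" "fnodes ch \<le> n" "fdist r" "fverts r \<subseteq> {..<n}" "fnodes r \<le> n"
    using 2(3-5) by auto
  obtain za where za: "runs [EL encT ch, EL (EL enc_nat) (delc v C), g, EL enc_nat R, EL enc_nat Y, enc_nat (Suc k)] (prog ! 37) za (sN ch * ?A)"
    "sl za \<le> (fnodes ch + 1) * (k + 1)" "value_upto k (\<lambda>v. length (wts R Y v)) ch (delc v C) (sl za)"
    using 2(1)[OF sub(1-3) lC(1,3) cs(1)] by blast
  obtain zb where zb: "runs [EL encT ch, EL (EL enc_nat) (remc v C), g, EL enc_nat R, EL enc_nat Y, enc_nat (Suc k)] (prog ! 37) zb (sN ch * ?A)"
    "sl zb \<le> (fnodes ch + 1) * (k + 1)" "value_upto k (\<lambda>v. length (wts R Y v)) ch (remc v C) (sl zb)"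
    using 2(1)[OF sub(1-3) lC(2,4) cs(2)] by blast
  obtain zr where zr: "runs [EL encT r, EL (EL enc_nat) C, g, EL enc_nat R, EL enc_nat Y, enc_nat (Suc k)] (prog ! 37) zr (sN r * ?A)"
    "sl zr \<le> (fnodes r + 1) * (k + 1)" "value_upto k (\<lambda>v. length (wts R Y v)) r C (sl zr)"
    using 2(2)[OF sub(4-6) 2(6,7) cs(3)] by blast
  have lw: "length (wts R Y v) \<le> n"
    using v RY(3) by (auto simp: wts_def cl_def intro: order_trans[OF length_filter_le])
  obtain a where a: "J L [EL enc_nat (wts R Y v), za] (prog ! 2) a 20" "sl a = length (wts R Y v) + sl za"
    using J_rapp_any[of "EL enc_nat (wts R Y v)" L za] lw n_le by auto
  have bb: "sl zb \<le> L"
  proof -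
    have "(fnodes ch + 1) * (k + 1) \<le> (n + 2) * (k + 1)" using sub by (intro mult_right_mono) auto
    then show ?thesis using zb(2) k by linarith
  qed
  define m where "m = (if sl a \<le> sl zb then a else zb)"
  have slm: "sl m = min (length (wts R Y v) + sl za) (sl zb)" using a by (simp add: m_def)
  have mL: "sl m \<le> L" using slm bb by simp
  obtain z where z: "J L [m, zr] (prog ! 2) z 20" "sl z = sl m + sl zr"
    using J_rapp_any[OF mL] by blast
  let ?\<rho>1 = "enc_nat v # ?\<rho>"
  have e: "runs ?\<rho> (EHd (EHd (EVar 0))) (enc_nat v) 3"
    by (rule runs_fin, (rule rr | (simp; fail))+)
  have w1: "runs ?\<rho>1 (EIf (ECall 5 [EVar 4, ENil, EVar 0]) (ECons (EVar 0) ENil)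
      (ECall 20 [EVar 5, ENil, EVar 3, EVar 4, EVar 0])) (EL enc_nat (wts R Y v)) ((L + 2) ^ 2000)"
    unfolding J_def[symmetric]
    using RY v by - (rule J_fin, (rule jr J_mem J_cls | (simp; fail) | rule eqi)+, auto simp: wts_def)
  have d1: "runs ?\<rho>1 (ECall 35 [EVar 2, ENil, EVar 0]) (EL (EL enc_nat) (delc v C)) ((L + 2) ^ 2000)"
    unfolding J_def[symmetric]
    using 2(6,7) v by - (rule J_fin, (rule jr J_del | (simp; fail) | rule eqi)+, auto simp: delc_def)
  have za': "runs ?\<rho>1 (ECall 37 [ETl (EHd (EVar 1)), ECall 35 [EVar 2, ENil, EVar 0], EVar 3, EVar 4, EVar 5, EVar 6]) za
      (sN ch * ?A + (L + 2) ^ 2000 + 30)"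
    by (rule runs_fin, (rule d1 rr | (simp; fail) | rule za(1)[simplified])+)
  have a': "runs ?\<rho>1 (ECall 2 [EIf (ECall 5 [EVar 4, ENil, EVar 0]) (ECons (EVar 0) ENil)
                  (ECall 20 [EVar 5, ENil, EVar 3, EVar 4, EVar 0]),
                ECall 37 [ETl (EHd (EVar 1)), ECall 35 [EVar 2, ENil, EVar 0], EVar 3, EVar 4, EVar 5, EVar 6]]) a
      (sN ch * ?A + 2 * (L + 2) ^ 2000 + (L + 2) ^ 20 + 50)"
    by (rule runs_fin, (rule w1 za' rr | (simp; fail) | rule a(1)[unfolded J_def])+)
  let ?\<rho>2 = "a # ?\<rho>1"
  have d2: "runs ?\<rho>2 (ECall 36 [EVar 3, ENil, EVar 1]) (EL (EL enc_nat) (remc v C)) ((L + 2) ^ 2000)"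
    unfolding J_def[symmetric]
    using 2(6,7) v by - (rule J_fin, (rule jr J_rem | (simp; fail) | rule eqi)+, auto simp: remc_def)
  have b': "runs ?\<rho>2 (ECall 37 [ETl (EHd (EVar 2)), ECall 36 [EVar 3, ENil, EVar 1], EVar 4, EVar 5, EVar 6, EVar 7]) zb
      (sN ch * ?A + (L + 2) ^ 2000 + 30)"
    by (rule runs_fin, (rule d2 rr | (simp; fail) | rule zb(1)[simplified])+)
  let ?\<rho>3 = "zb # ?\<rho>2"
  have m': "runs ?\<rho>3 (EIf (ECall 3 [EVar 1, EVar 0]) (EVar 1) (EVar 0)) m ((L + 2) ^ 2000)"
    unfolding J_def[symmetric]
    using bb by - (rule J_fin, (rule jr J_le | (simp; fail) | rule eqi)+, auto simp: m_def)
  have r': "runs ?\<rho>3 (ECall 37 [ETl (EVar 3), EVar 4, EVar 5, EVar 6, EVar 7, EVar 8]) zr (sN r * ?A + 30)"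
    by (rule runs_fin, (rule rr | (simp; fail) | rule zr(1)[simplified])+)
  have p: "50 * (L + 2) ^ 20 + 200 \<le> (L + 2) ^ 2000" by (rule pow_gap) simp
  have "runs ?\<rho> (prog ! 37) z (sN ?F * ?A)"
    unfolding prog_nth b_solve_def
    apply (rule runs_fin, rule runs_IfT, rule rr, simp, simp, simp, rule runs_Let, rule e, rule runs_Let, rule a',
        rule runs_Let, rule b', (rule m' r' rr | rule z(1)[unfolded J_def] | (simp; fail))+)
    using pow_gap[of 2000 4000 L] p by (simp add: algebra_simps)
  moreover have "sl z \<le> (fnodes ?F + 1) * (k + 1)"
  proof -
    have "sl z \<le> (fnodes ch + 1) * (k + 1) + (fnodes r + 1) * (k + 1)" using z(2) slm zb(2) zr(2) by linarith
    also have "\<dots> = (fnodes ?F + 1) * (k + 1)" by (simp add: algebra_simps)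
    finally show ?thesis .
  qed
  moreover have "value_upto k (\<lambda>v. length (wts R Y v)) ?F C (sl z)"
    unfolding z(2) slm using value_step[OF 2(3) 2(8) za(3) zb(3) zr(3)] by simp
  ultimately show ?case by blast
qed

end

section \<open>Triangle packings and matchings in neighborhoods\<close>

context sgraph_ctx
begin

abbreviation V0 :: "nat list" where "V0 \<equiv> rev [0..<n]"

definition TT :: "nat list list" where "TT = tris V0"

lemma set_tri3: "set (tri3 V u v a) = {[u, v, w] |w. w \<in> set V \<and> (v, w) \<in> E \<and> (u, w) \<in> E} \<union> set a"
  by (auto simp: tri3_def)

lemma set_tri2: "set (tri2 V u a) = {[u, v, w] |v w. v \<in> set V \<and> w \<in> set V \<and> (u, v) \<in> E \<and> (v, w) \<in> E \<and> (u, w) \<in> E} \<union> set a"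
proof -
  have "set (fold (\<lambda>v a. if (u, v) \<in> E then tri3 V u v a else a) xs a) =
     {[u, v, w] |v w. v \<in> set xs \<and> w \<in> set V \<and> (u, v) \<in> E \<and> (v, w) \<in> E \<and> (u, w) \<in> E} \<union> set a" for xs
    by (induction xs arbitrary: a) (auto simp: set_tri3)
  then show ?thesis by (simp add: tri2_def)
qed

lemma set_tris: "set (fold (tri2 V) xs a) =
    {[u, v, w] |u v w. u \<in> set xs \<and> v \<in> set V \<and> w \<in> set V \<and> (u, v) \<in> E \<and> (v, w) \<in> E \<and> (u, w) \<in> E} \<union> set a"
  by (induction xs arbitrary: a) (auto simp: set_tri2)

lemma in_TT: "t \<in> set TT \<longleftrightarrow> (\<exists>u v w. t = [u, v, w] \<and> (u, v) \<in> E \<and> (v, w) \<in> E \<and> (u, w) \<in> E)"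
  using E_sub by (auto simp: TT_def tris_def set_tris)

lemma length_tri3: "length (tri3 V u v a) \<le> length V + length a"
  by (simp add: tri3_def)

lemma length_tri2: "length (tri2 V u a) \<le> length V * length V + length a"
proof -
  have "length (fold (\<lambda>v a. if (u, v) \<in> E then tri3 V u v a else a) xs a) \<le> length xs * length V + length a" for xs
  proof (induction xs arbitrary: a)
    case (Cons v xs)
    show ?case using Cons[of "tri3 V u v a"] Cons[of a] length_tri3[of V u v a] by auto
  qed simp
  then show ?thesis by (simp add: tri2_def)
qed

lemma length_TT: "length TT \<le> n * (n * n)"
proof -
  have "length (fold (tri2 V) xs a) \<le> length xs * (length V * length V) + length a" for xs V a
  proof (induction xs arbitrary: a)
    case (Cons u xs)
    show ?case using Cons[of "tri2 V u a"] length_tri2[of V u a] by simp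
  qed simp
  from this[of V0 V0 "[]"] show ?thesis by (simp add: TT_def tris_def)
qed

lemma E_neq: "(u, v) \<in> E \<Longrightarrow> u \<noteq> v"
  using E_irrefl by auto

lemma E_lt: "(u, v) \<in> E \<Longrightarrow> u < n \<and> v < n"
  using E_sub by auto

lemma TT_vs: "t \<in> set TT \<Longrightarrow> vs t \<and> t \<noteq> []"
  by (auto simp: in_TT vs_def dest: E_neq E_lt)

definition hits :: "nat set \<Rightarrow> bool" where
  "hits S \<longleftrightarrow> (\<forall>t\<in>set TT. set t \<inter> S \<noteq> {})"

lemma hitsD: "hits S \<Longrightarrow> (u, v) \<in> E \<Longrightarrow> (v, w) \<in> E \<Longrightarrow> (u, w) \<in> E \<Longrightarrow> u \<in> S \<or> v \<in> S \<or> w \<in> S"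
  unfolding hits_def using in_TT[of "[u, v, w]"] by auto

lemma pk_hits_TT: "hits (set (pk TT))"
proof -
  have "\<forall>t\<in>set T. set t \<inter> set (pk T) \<noteq> {}" if "\<forall>t\<in>set T. t \<noteq> []" for T
    using that by (induction T rule: rev_induct) (auto simp: pk_def pkf_def)
  then show ?thesis using TT_vs by (auto simp: hits_def)
qed

text \<open>The packed triangles are disjoint and each contains a vertex of S, which pays for its
  three vertices.\<close>

lemma pk_length:
  assumes "hits S" "finite S"
  shows "length (pk TT) \<le> 3 * card S"
proof -
  have "length (pk T) \<le> 3 * card (S \<inter> set (pk T))" if "set T \<subseteq> set TT" for T
    using that
  proof (induction T rule: rev_induct)
    case (snoc t T)
    let ?X = "pk T"
    show ?case
    proof (cases "set t \<inter> set ?X = {}")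
      case True
      have "length t = 3" "set t \<inter> S \<noteq> {}" using snoc.prems in_TT[of t] assms by (auto simp: hits_def)
      then have "1 \<le> card (S \<inter> set t)" using assms(2) by (simp add: Suc_le_eq card_gt_0_iff Int_commute)
      moreover have "S \<inter> (set t \<union> set ?X) = (S \<inter> set t) \<union> (S \<inter> set ?X)" by auto
      moreover have "card ((S \<inter> set t) \<union> (S \<inter> set ?X)) = card (S \<inter> set t) + card (S \<inter> set ?X)"
        using True assms(2) by (intro card_Un_disjoint) auto
      ultimately show ?thesis using snoc True \<open>length t = 3\<close> by (simp add: pk_def pkf_def)
    qed (use snoc in \<open>simp add: pk_def pkf_def\<close>)
  qed (simp add: pk_def)
  then have "length (pk TT) \<le> 3 * card (S \<inter> set (pk TT))" by simp
  also have "\<dots> \<le> 3 * card S" using assms(2) by (simp add: card_mono)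
  finally show ?thesis .
qed

lemma mt_disjoint: "set (mt v A T) \<inter> set A = {}"
  by (induction T rule: rev_induct) (auto simp: mt_def mtf_def)

lemma mt_maximal_gen:
  "[v, a, b] \<in> set T \<Longrightarrow> a \<notin> set A \<Longrightarrow> b \<notin> set A \<Longrightarrow> a \<in> set (mt v A T) \<or> b \<in> set (mt v A T)"
  by (induction T rule: rev_induct) (auto simp: mt_def mtf_def)

lemma mt_maximal:
  "(v, a) \<in> E \<Longrightarrow> (a, b) \<in> E \<Longrightarrow> (v, b) \<in> E \<Longrightarrow> a \<notin> set A \<Longrightarrow> b \<notin> set A \<Longrightarrow>
    a \<in> set (mt v A TT) \<or> b \<in> set (mt v A TT)"
  by (rule mt_maximal_gen) (auto simp: in_TT)

text \<open>Each matched edge ab forms a triangle with v. As v is not in S, the triangle is hit in a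
  or b, and different matching edges are disjoint.\<close>

lemma mt_hit:
  assumes "hits S" "finite S" "v \<notin> S"
  shows "length (mt v A TT) \<le> 2 * card (S \<inter> set (mt v A TT))"
proof -
  have "length (mt v A T) \<le> 2 * card (S \<inter> set (mt v A T))" if "set T \<subseteq> set TT" for T
    using that
  proof (induction T rule: rev_induct)
    case (snoc t T)
    let ?X = "mt v A T"
    show ?case
    proof (cases "hd t = v \<and> set (tl t) \<inter> set A = {} \<and> set (tl t) \<inter> set ?X = {}")
      case True
      have "length (tl t) = 2" "set (tl t) \<inter> S \<noteq> {}"
        using snoc.prems in_TT[of t] assms True by (auto simp: hits_def)
      then have "1 \<le> card (S \<inter> set (tl t))" using assms(2) by (simp add: Suc_le_eq card_gt_0_iff Int_commute)
      moreover have "S \<inter> (set (tl t) \<union> set ?X) = (S \<inter> set (tl t)) \<union> (S \<inter> set ?X)" by auto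
      moreover have "card ((S \<inter> set (tl t)) \<union> (S \<inter> set ?X)) = card (S \<inter> set (tl t)) + card (S \<inter> set ?X)"
        using True assms(2) by (intro card_Un_disjoint) auto
      moreover have "mt v A (T @ [t]) = rev (tl t) @ ?X" using True by (simp add: mt_def mtf_def)
      ultimately show ?thesis using snoc \<open>length (tl t) = 2\<close> by simp
    next
      case False
      then have "mt v A (T @ [t]) = ?X" by (auto simp: mt_def mtf_def)
      then show ?thesis using snoc by simp
    qed
  qed (simp add: mt_def)
  then show ?thesis by simp
qed

section \<open>The kernel\<close>

text \<open>Vertices with the same neighbors in R filter \<open>Y\<close> by the same test and
  obtain the same list. Its head is therefore a canonical representative of the class.\<close>

lemma hd_cl_same:
  assumes "z \<in> set (cl R Y y)"
  shows "cl R Y z = cl R Y y"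
proof -
  have "\<forall>r\<in>set R. (y, r) \<in> E \<longleftrightarrow> (z, r) \<in> E" using assms by (auto simp: cl_def)
  then show ?thesis by (auto simp: cl_def intro!: filter_cong)
qed

definition ntr :: "nat set \<Rightarrow> nat" where
  "ntr X = card ((\<lambda>v. {u \<in> X. (v, u) \<in> E}) ` {..<n})"

end

text \<open>The situation after branching: D has been taken into the solution, U is excluded from
  it, and Y are the vertices outside R and D. The assumption \<open>two\<close> is the achievement
  of the branching; each remaining triangle has at most one vertex outside R. Here k is what is left
  of the budget.\<close>

locale leaf_ctx = sgraph_ctx +
  fixes D U R Y :: "nat list" and k :: nat
  assumes DUR: "set D \<subseteq> {..<n}" "set U \<subseteq> set R" "set R \<subseteq> {..<n}"
    and Y: "distinct Y" "set Y = {..<n} - set R - set D"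
    and two: "\<And>a b c. (a, b) \<in> E \<Longrightarrow> (b, c) \<in> E \<Longrightarrow> (a, c) \<in> E \<Longrightarrow> a \<notin> set D \<Longrightarrow> b \<notin> set D \<Longrightarrow> c \<notin> set D \<Longrightarrow>
      (a \<in> set R \<and> b \<in> set R) \<or> (a \<in> set R \<and> c \<in> set R) \<or> (b \<in> set R \<and> c \<in> set R)"
begin

definition com :: "nat set \<Rightarrow> nat set" where
  "com c = {y \<in> set Y. \<forall>x\<in>c. (y, x) \<in> E}"

definition rep :: "nat \<Rightarrow> nat" where
  "rep y = hd (cl R Y y)"

definition CC :: "nat list list" where
  "CC = rev (map (cn R U Y k) (filter (\<lambda>t. set t \<inter> set D = {}) TT))"

lemma set_cn:
  "set (cn R U Y k t) = ((set t \<inter> set R) \<union>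
     (if card (com (set t \<inter> set R)) \<le> k then rep ` (set t - set R) else {})) - set U"
proof -
  have "length (rev (filter (\<lambda>y. \<forall>x\<in>set (rev (filter (\<lambda>x. x \<in> set R) t)). (y, x) \<in> E) Y)) =
      card (set (filter (\<lambda>y. \<forall>x\<in>set (rev (filter (\<lambda>x. x \<in> set R) t)). (y, x) \<in> E) Y))"
    using Y(1) by (simp only: distinct_card distinct_filter length_rev)
  also have "set (filter (\<lambda>y. \<forall>x\<in>set (rev (filter (\<lambda>x. x \<in> set R) t)). (y, x) \<in> E) Y) = com (set t \<inter> set R)"
    by (auto simp: com_def)
  finally show ?thesis unfolding cn_def Let_def by (auto simp: rep_def)
qed

lemma rep_props:
  assumes "y \<in> set Y"
  shows "rep y \<in> set Y" "cl R Y (rep y) = cl R Y y" "rep (rep y) = rep y" "y \<in> set (cl R Y (rep y))"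
    "\<forall>r\<in>set R. (rep y, r) \<in> E \<longleftrightarrow> (y, r) \<in> E"
proof -
  have in_cl: "rep y \<in> set (cl R Y y)" unfolding rep_def by (rule hd_cl_self[OF assms])
  then show 1: "cl R Y (rep y) = cl R Y y" by (rule hd_cl_same)
  show "rep y \<in> set Y" unfolding rep_def by (rule hd_cl_in[OF assms])
  show "rep (rep y) = rep y" unfolding rep_def[of "rep y"] 1 by (simp add: rep_def)
  show "y \<in> set (cl R Y (rep y))" unfolding 1 by (rule cl_self[OF assms])
  show "\<forall>r\<in>set R. (rep y, r) \<in> E \<longleftrightarrow> (y, r) \<in> E" using in_cl by (auto simp: cl_def)
qed

lemma tri_cases:
  assumes "t \<in> set TT" "set t \<inter> set D = {}"
  obtains (inside) "set t \<subseteq> set R"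
  | (out) y p q where "set t = {y, p, q}" "y \<in> set Y" "p \<in> set R" "q \<in> set R" "(p, q) \<in> E" "(y, p) \<in> E" "(y, q) \<in> E"
      "set t \<inter> set R = {p, q}" "set t - set R = {y}"
proof -
  obtain a b c where t: "t = [a, b, c]" "(a, b) \<in> E" "(b, c) \<in> E" "(a, c) \<in> E" using assms(1) in_TT by blast
  note s = E_sym[OF t(2)] E_sym[OF t(3)] E_sym[OF t(4)]
  have lt: "a < n" "b < n" "c < n" using t E_lt by auto
  have nD: "a \<notin> set D" "b \<notin> set D" "c \<notin> set D" using assms(2) t by auto
  have inY: "x \<in> set Y" if "x \<in> {a, b, c}" "x \<notin> set R" for x using that Y lt nD by auto
  from two[OF t(2-4) nD] consider "a \<in> set R" "b \<in> set R" "c \<in> set R" | "a \<notin> set R" "b \<in> set R" "c \<in> set R"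
    | "a \<in> set R" "b \<notin> set R" "c \<in> set R" | "a \<in> set R" "b \<in> set R" "c \<notin> set R" by blast
  then show thesis
  proof cases
    case 1 then show ?thesis using inside t by auto
  next
    case 2 then show ?thesis using out[of a b c] t s inY[of a] by auto
  next
    case 3 then show ?thesis using out[of b a c] t s inY[of b] by auto
  next
    case 4 then show ?thesis using out[of c a b] t s inY[of c] by auto
  qed
qed

lemma in_CC: "c \<in> set CC \<longleftrightarrow> (\<exists>t\<in>set TT. set t \<inter> set D = {} \<and> c = cn R U Y k t)"
  by (auto simp: CC_def)

text \<open>A representative has the same neighbors in R as the vertex it replaces, so it forms a
  triangle with p and q again. Constraints are thus cliques, and the elimination forest puts each of
  them on a chain.\<close>

lemma CC_clique: "c \<in> set CC \<Longrightarrow> clique (set c)"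
proof -
  assume "c \<in> set CC"
  then obtain t where t: "t \<in> set TT" "set t \<inter> set D = {}" "c = cn R U Y k t" by (auto simp: in_CC)
  from t(1,2) show "clique (set c)"
  proof (cases rule: tri_cases)
    case inside
    then have "set c \<subseteq> set t" unfolding t(3) set_cn by auto
    moreover have "clique (set t)" using t(1) E_sym by (auto simp: in_TT clique_def)
    ultimately show ?thesis unfolding clique_def by (meson subsetD)
  next
    case (out y p q)
    have r: "(rep y, p) \<in> E" "(rep y, q) \<in> E" using rep_props(5)[OF out(2)] out by auto
    have "set c \<subseteq> {rep y, p, q}" unfolding t(3) set_cn out(8,9) by auto
    moreover have "clique {rep y, p, q}" using r out(5) E_sym unfolding clique_def by auto
    ultimately show ?thesis unfolding clique_def by (meson subsetD)
  qed
qed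

lemma CC_sub: "c \<in> set CC \<Longrightarrow> set c \<subseteq> {..<n}"
proof -
  assume "c \<in> set CC"
  then obtain t where t: "t \<in> set TT" "set t \<inter> set D = {}" "c = cn R U Y k t" by (auto simp: in_CC)
  from t(1,2) show ?thesis
  proof (cases rule: tri_cases)
    case inside
    then show ?thesis unfolding t(3) set_cn using DUR by auto
  next
    case (out y p q)
    have "rep y < n" using rep_props(1)[OF out(2)] Y(2) by auto
    then show ?thesis unfolding t(3) set_cn using DUR out by auto
  qed
qed

definition HV :: "nat set" where "HV = \<Union> (set ` set CC)"

lemma HV_out:
  assumes "z \<in> HV" "z \<notin> set R"
  obtains p q where "z \<in> set Y" "rep z = z" "p \<in> set R" "q \<in> set R" "z \<in> com {p, q}" "card (com {p, q}) \<le> k"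
proof -
  obtain t where t: "t \<in> set TT" "set t \<inter> set D = {}" "z \<in> set (cn R U Y k t)"
    using assms(1) by (auto simp: HV_def in_CC)
  from t(1,2) show ?thesis
  proof (cases rule: tri_cases)
    case inside
    then show ?thesis using t(3) assms(2) unfolding set_cn by (auto split: if_splits)
  next
    case (out y p q)
    then have z: "z = rep y" "card (com {p, q}) \<le> k" using t(3) assms(2) unfolding set_cn out(8,9) by (auto split: if_splits)
    have "z \<in> com {p, q}" using rep_props(1,5)[OF out(2)] out z by (auto simp: com_def)
    then show ?thesis using that[of p q] z rep_props[OF out(2)] out by auto
  qed
qed

lemma finite_HV: "finite HV" by (simp add: HV_def)

lemma card_HV_le: "card HV \<le> card (set R) + card (HV - set R)"
proof -
  have "card HV \<le> card (set R \<union> (HV - set R))" using finite_HV by (intro card_mono) auto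
  then show ?thesis using card_Un_le[of "set R" "HV - set R"] by linarith
qed

lemma card_HV_ntr: "card HV \<le> card (set R) + ntr (set R)"
proof -
  let ?f = "\<lambda>v. {u \<in> set R. (v, u) \<in> E}"
  have inj: "inj_on ?f (HV - set R)"
  proof (rule inj_onI)
    fix z z' assume z: "z \<in> HV - set R" "z' \<in> HV - set R" "?f z = ?f z'"
    have "\<forall>r\<in>set R. (z, r) \<in> E \<longleftrightarrow> (z', r) \<in> E" using z(3) by (metis (mono_tags, lifting) mem_Collect_eq)
    then have "cl R Y z = cl R Y z'" by (auto simp: cl_def intro!: filter_cong)
    moreover have "rep z = z" "rep z' = z'" using z HV_out[of z] HV_out[of z'] by blast+
    ultimately show "z = z'" by (simp add: rep_def)
  qed
  have "HV - set R \<subseteq> {..<n}" using CC_sub by (auto simp: HV_def)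
  then have "card (?f ` (HV - set R)) \<le> ntr (set R)"
    unfolding ntr_def by (intro card_mono finite_imageI image_mono) auto
  then have "card (HV - set R) \<le> ntr (set R)" using card_image[OF inj] by simp
  then show ?thesis using card_HV_le by linarith
qed

text \<open>This holds in every graph. An outer vertex of the kernel is a common neighbor of a pair
  in R with at most k common neighbors, so each pair accounts for at most k of them. The running
  time rests on this bound, the existence of separators on \<open>card_HV_ntr\<close>.\<close>

lemma card_HV_poly: "card HV \<le> length R + k * (length R)\<^sup>2"
proof -
  let ?f = "\<lambda>(p, q). if card (com {p, q}) \<le> k then com {p, q} else {}"
  have fc: "finite (com c)" for c by (simp add: com_def)
  have "HV - set R \<subseteq> (\<Union>x\<in>set R \<times> set R. ?f x)"
  proof
    fix z assume z: "z \<in> HV - set R"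
    then obtain p q where "p \<in> set R" "q \<in> set R" "z \<in> com {p, q}" "card (com {p, q}) \<le> k"
      using HV_out[of z] by blast
    then show "z \<in> (\<Union>x\<in>set R \<times> set R. ?f x)" by (intro UN_I[of "(p, q)"]) auto
  qed
  then have "card (HV - set R) \<le> card (\<Union>x\<in>set R \<times> set R. ?f x)" by (intro card_mono) (auto simp: fc)
  also have "\<dots> \<le> (\<Sum>x\<in>set R \<times> set R. card (?f x))" by (rule card_UN_le) simp
  also have "\<dots> \<le> (\<Sum>x\<in>set R \<times> set R. k)" by (rule sum_mono) auto
  also have "\<dots> = k * (card (set R))\<^sup>2" by (simp add: card_cartesian_product power2_eq_square)
  also have "\<dots> \<le> k * (length R)\<^sup>2" by (intro mult_left_mono power_mono card_length) auto
  finally have "card (HV - set R) \<le> k * (length R)\<^sup>2" .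
  then show ?thesis using card_HV_le card_length[of R] by linarith
qed

abbreviation wt :: "nat \<Rightarrow> nat" where "wt z \<equiv> length (wts R Y z)"

text \<open>The solution consists of the classes of the chosen kernel vertices. A constraint hit in
  R means that the triangle is hit at the same vertex; a constraint hit in the representative of y
  means that y itself is taken with its class.\<close>

lemma sound:
  assumes Z: "Z \<subseteq> HV" "\<forall>c\<in>set CC. set c \<inter> Z \<noteq> {}" "sum wt Z \<le> k"
  shows "\<exists>S\<subseteq>{..<n}. card S \<le> k \<and> hits (S \<union> set D)"
proof -
  let ?S = "\<Union>z\<in>Z. set (wts R Y z)"
  have fZ: "finite Z" using Z(1) finite_HV finite_subset by blast
  have "card ?S \<le> (\<Sum>z\<in>Z. card (set (wts R Y z)))" by (rule card_UN_le[OF fZ])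
  also have "\<dots> \<le> sum wt Z" by (rule sum_mono) (rule card_length)
  finally have "card ?S \<le> k" using Z(3) by simp
  moreover have "?S \<subseteq> {..<n}"
  proof (rule UN_least)
    fix z assume "z \<in> Z"
    show "set (wts R Y z) \<subseteq> {..<n}"
      using DUR(3) set_cl_subset[of R Y z] Y(2) by (auto simp: wts_def)
  qed
  moreover have "hits (?S \<union> set D)"
    unfolding hits_def
  proof
    fix t assume t: "t \<in> set TT"
    show "set t \<inter> (?S \<union> set D) \<noteq> {}"
    proof (cases "set t \<inter> set D = {}")
      case True
      then have "set (cn R U Y k t) \<inter> Z \<noteq> {}" using Z(2) t in_CC by blast
      then obtain z where z: "z \<in> Z" "z \<in> set (cn R U Y k t)" by blast
      show ?thesis
      proof (cases "z \<in> set R")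
        case zR: True
        from t True have "z \<in> set t"
        proof (cases rule: tri_cases)
          case inside
          then show ?thesis using z(2) unfolding set_cn by (auto split: if_splits)
        next
          case (out y p q)
          have "rep y \<notin> set R" using rep_props(1)[OF out(2)] Y(2) by auto
          then show ?thesis using z(2) zR unfolding set_cn out(8,9) by (auto simp: out(1) split: if_splits)
        qed
        moreover have "z \<in> ?S" using z(1) zR by (force simp: wts_def)
        ultimately show ?thesis by blast
      next
        case zR: False
        from t True show ?thesis
        proof (cases rule: tri_cases)
          case inside
          then show ?thesis using z(2) zR unfolding set_cn by (auto split: if_splits)
        next
          case (out y p q)
          then have "z = rep y" using z(2) zR unfolding set_cn out(8,9) by (auto split: if_splits)
          then have "y \<in> set (wts R Y z)" using rep_props(4)[OF out(2)] zR by (simp add: wts_def)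
          then have "y \<in> ?S" using z(1) by blast
          then show ?thesis using out(1) by blast
        qed
      qed
    qed blast
  qed
  ultimately show ?thesis by blast
qed

text \<open>\<open>Z\<close> keeps the kernel vertices whose whole class lies in S; partly taken
  classes are given up. This loses nothing: if a triangle y, p, q is not hit in p or q, then S
  contains all common neighbors of p and q in \<open>Y\<close>, in particular the class of y. It
  also follows that there are at most k of them, so that the constraint does contain the
  representative of y.\<close>

lemma complete:
  assumes S: "S \<subseteq> {..<n}" "hits S" "set D \<subseteq> S" "S \<inter> set U = {}" "card (S - set D) \<le> k"
  shows "\<exists>Z\<subseteq>HV. (\<forall>c\<in>set CC. set c \<inter> Z \<noteq> {}) \<and> sum wt Z \<le> k"
proof -
  let ?S = "S - set D"
  define Z where "Z = {z \<in> HV. set (wts R Y z) \<subseteq> ?S}"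
  have fS: "finite ?S" using S(1) finite_subset by blast
  have fZ: "finite Z" using finite_HV by (simp add: Z_def)
  have dw: "distinct (wts R Y z)" for z using Y(1) by (simp add: wts_def cl_def)
  have "sum wt Z = (\<Sum>z\<in>Z. card (set (wts R Y z)))" using dw by (simp add: distinct_card)
  also have "\<dots> = card (\<Union>z\<in>Z. set (wts R Y z))"
  proof (rule card_UN_disjoint[symmetric, OF fZ])
    show "\<forall>i\<in>Z. \<forall>j\<in>Z. i \<noteq> j \<longrightarrow> set (wts R Y i) \<inter> set (wts R Y j) = {}"
    proof (intro ballI impI, rule ccontr)
      fix i j assume ij: "i \<in> Z" "j \<in> Z" "i \<noteq> j" "set (wts R Y i) \<inter> set (wts R Y j) \<noteq> {}"
      then obtain x where x: "x \<in> set (wts R Y i)" "x \<in> set (wts R Y j)" by blast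
      have cR: "y \<notin> set R" if "y \<in> set (cl R Y z)" for y z using that set_cl_subset[of R Y z] Y(2) by auto
      show False
      proof (cases "i \<in> set R")
        case True
        then show False using x ij(3) cR by (auto simp: wts_def split: if_splits)
      next
        case iR: False
        show False
        proof (cases "j \<in> set R")
          case True
          then show False using x ij(3) cR by (auto simp: wts_def split: if_splits)
        next
          case False
          have i: "i \<in> HV" and j: "j \<in> HV" using ij by (auto simp: Z_def)
          have i': "rep i = i" by (rule HV_out[OF i iR])
          have j': "rep j = j" by (rule HV_out[OF j False])
          have "x \<in> set (cl R Y i)" "x \<in> set (cl R Y j)" using x iR False by (simp_all add: wts_def)
          then have "rep i = rep j" using hd_cl_same[of x R Y i] hd_cl_same[of x R Y j] by (simp add: rep_def)
          then show False using i' j' ij(3) by simp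
        qed
      qed
    qed
  qed simp
  also have "\<dots> \<le> card ?S" by (rule card_mono[OF fS]) (auto simp: Z_def)
  finally have "sum wt Z \<le> k" using S(5) by simp
  moreover have "set c \<inter> Z \<noteq> {}" if c: "c \<in> set CC" for c
  proof -
    from c obtain t where t: "t \<in> set TT" "set t \<inter> set D = {}" "c = cn R U Y k t" by (auto simp: in_CC)
    have cH: "set c \<subseteq> HV" using c by (auto simp: HV_def)
    show ?thesis
    proof (cases "set t \<inter> set R \<inter> S = {}")
      case False
      then obtain z where z: "z \<in> set t" "z \<in> set R" "z \<in> S" by blast
      then have "z \<in> set c" unfolding t(3) set_cn using S(4) by blast
      moreover have "set (wts R Y z) \<subseteq> ?S" using z t(2) by (auto simp: wts_def)
      ultimately have "z \<in> Z" using cH by (auto simp: Z_def)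
      then show ?thesis using \<open>z \<in> set c\<close> by blast
    next
      case True
      from t(1,2) show ?thesis
      proof (cases rule: tri_cases)
        case inside
        then have "set t \<inter> S = {}" using True by blast
        then show ?thesis using S(2) t(1) by (auto simp: hits_def)
      next
        case (out y p q)
        have pq: "p \<notin> S" "q \<notin> S" using True out by auto
        have cS: "com {p, q} \<subseteq> ?S"
        proof
          fix x assume x: "x \<in> com {p, q}"
          then have "x \<in> S" using hitsD[OF S(2), of x p q] out(5) pq by (auto simp: com_def)
          then show "x \<in> ?S" using x Y(2) by (auto simp: com_def)
        qed
        then have ck: "card (com {p, q}) \<le> k" using card_mono[OF fS cS] S(5) by simp
        have rY: "rep y \<notin> set R" using rep_props(1)[OF out(2)] Y(2) by auto
        then have rc: "rep y \<in> set c" unfolding t(3) set_cn out(8,9) using ck DUR(2) by auto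
        have "set (wts R Y (rep y)) \<subseteq> com {p, q}"
        proof
          fix x assume "x \<in> set (wts R Y (rep y))"
          then have x: "x \<in> set (cl R Y y)" using rY rep_props(2)[OF out(2)] by (simp add: wts_def)
          then have "x \<in> set Y" "\<forall>r\<in>set R. (y, r) \<in> E \<longleftrightarrow> (x, r) \<in> E" by (auto simp: cl_def)
          then show "x \<in> com {p, q}" using out by (auto simp: com_def)
        qed
        then have "rep y \<in> Z" using rc cH cS by (auto simp: Z_def)
        then show ?thesis using rc by blast
      qed
    qed
  qed
  ultimately show ?thesis by (intro exI[of _ Z]) (auto simp: Z_def)
qed

end

section \<open>Solving a leaf of the branching\<close>

abbreviation Fail :: sexp where "Fail \<equiv> SCons (SCons SNil SNil) SNil"

text \<open>The first summand is the construction of the forest, with 6 N^2 + 3 bounding the number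
  of calls and 2 (N + 1)^b the separator search in each. The second is the solver on a forest with
  at most N nodes and depth at most b h.\<close>

definition leafT :: "nat \<Rightarrow> nat \<Rightarrow> nat \<Rightarrow> nat \<Rightarrow> nat" where
  "leafT L N b h = ((6 * N\<^sup>2 + 3) * (2 * (N + 1) ^ b) + (N + 1) * 2 ^ (b * h + 1)) * (L + 2) ^ 5000"

context sgraph_ctx
begin

lemma vs_rev_filter: "vs l \<Longrightarrow> vs (rev (filter P l))"
  by (auto simp: vs_def)

lemma vs_V0: "vs V0"
  by (auto simp: vs_def)

text \<open>A witness that the class has no separators of order \<open>b\<close> where they are needed.\<close>

definition bad :: "nat \<Rightarrow> nat set \<Rightarrow> bool" where
  "bad b X \<longleftrightarrow> (\<exists>W\<subseteq>{..<n}. card W \<le> card X + ntr X \<and> (\<forall>S. balS W S \<longrightarrow> b < card S))"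

lemma leaf_time:
  fixes X Z P Q R S :: nat
  assumes "1 \<le> X" "1 \<le> Z" "50 * P + 200 \<le> S" "50 * R + 200 \<le> S" "Q \<le> R"
  shows "X * P + 10 * R + Z * Q + 200 \<le> (X + Z) * S"
proof -
  have "X * (50 * P + 200) \<le> X * S" "Z * (50 * R + 200) \<le> Z * S" "Z * Q \<le> Z * R"
    using assms by (auto intro!: mult_left_mono)
  moreover have "1 * R \<le> Z * R" using assms(2) by (rule mult_right_mono) simp
  moreover have "X * (50 * P + 200) = 50 * (X * P) + 200 * X" "Z * (50 * R + 200) = 50 * (Z * R) + 200 * Z"
    "(X + Z) * S = X * S + Z * S" by (simp_all add: algebra_simps)
  ultimately show ?thesis using assms(1,2) by linarith
qed

text \<open>The forest is built for a single piece, the vertices of all constraints. This set has at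
  most \<open>N\<close> elements by \<open>card_HV_poly\<close>, which bounds the time for arbitrary
  \<open>b\<close>. If the construction fails, its witness is small in terms of the traces on R by
  \<open>card_HV_ntr\<close>, so that the failure shows \<open>bad\<close>.\<close>

lemma runs_leaf:
  assumes DUR: "set D \<subseteq> {..<n}" "set U \<subseteq> set R" "set R \<subseteq> {..<n}"
    and VL: "VL L D" "VL L U" "VL L R"
    and two: "\<And>a b c. (a, b) \<in> E \<Longrightarrow> (b, c) \<in> E \<Longrightarrow> (a, c) \<in> E \<Longrightarrow> a \<notin> set D \<Longrightarrow> b \<notin> set D \<Longrightarrow> c \<notin> set D \<Longrightarrow>
      (a \<in> set R \<and> b \<in> set R) \<or> (a \<in> set R \<and> c \<in> set R) \<or> (b \<in> set R \<and> c \<in> set R)"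
    and L: "(n + 2) * (k + 1) + n \<le> L" "k < L" "length TT \<le> L" "3 \<le> L"
    and N: "length R + k * (length R)\<^sup>2 \<le> N" "2 ^ h * N < 3 ^ h"
  shows "\<exists>r. runs [g, EL enc_nat V0, EL (EL enc_nat) TT, EL enc_nat D, EL enc_nat U, EL enc_nat R, enc_nat k, enc_nat b] (prog ! 38) r
      (leafT L N b h) \<and>
    (r = enc_bool True \<and> (\<exists>S\<subseteq>{..<n}. card S \<le> k \<and> hits (S \<union> set D)) \<or>
     r = SNil \<and> (\<forall>S. S \<subseteq> {..<n} \<and> hits S \<and> set D \<subseteq> S \<and> S \<inter> set U = {} \<longrightarrow> k < card (S - set D)) \<or>
     r = Fail \<and> bad b (set R))"
proof -
  define Y1 where "Y1 = rev (filter (\<lambda>x. x \<notin> set R) V0)"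
  define Y where "Y = rev (filter (\<lambda>x. x \<notin> set D) Y1)"
  have vY: "vs Y1" "vs Y" unfolding Y_def Y1_def by (intro vs_rev_filter vs_V0)+
  have VY: "VL L V0" "VL L Y1" "VL L Y" using vY vs_V0 vs_VL by blast+
  interpret leaf_ctx n E L D U R Y k
  proof unfold_locales
    show "distinct Y" using vY by (simp add: vs_def)
    show "set Y = {..<n} - set R - set D" by (auto simp: Y_def Y1_def)
  qed (use DUR two in auto)
  let ?\<rho> = "[g, EL enc_nat V0, EL (EL enc_nat) TT, EL enc_nat D, EL enc_nat U, EL enc_nat R, enc_nat k, enc_nat b]"
  let ?\<rho>1 = "EL enc_nat Y # ?\<rho>"
  let ?\<rho>2 = "EL (EL enc_nat) CC # ?\<rho>1"
  have y: "runs ?\<rho> (ECall 16 [ECall 16 [EVar 1, ENil, EVar 5], ENil, EVar 3]) (EL enc_nat Y) ((L + 2) ^ 4900)"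
    unfolding J_def[symmetric]
    using VL VY by - (rule J_fin, (rule jr J_filout[of _ V0 _ _ R] J_filout[of _ Y1 _ _ D] | (simp add: Y1_def; fail) | rule eqi)+,
       auto simp: Y_def Y1_def)
  have TD: "\<forall>t\<in>set TT. VL L t \<and> (set t \<inter> set D = {} \<longrightarrow> set t - set R \<subseteq> set Y)"
    using TT_vs vs_VL Y(2) by (auto simp: vs_def)
  have c: "runs ?\<rho>1 (ECall 23 [EVar 3, ENil, EVar 1, EVar 6, EVar 5, EVar 0, EVar 7, EVar 4]) (EL (EL enc_nat) CC) ((L + 2) ^ 4900)"
    unfolding J_def[symmetric]
    using TD VL VY L by - (rule J_fin, (rule jr J_constrs | (simp; fail) | rule eqi)+, auto simp: CC_def)
  have CCn: "\<forall>c\<in>set CC. set c \<subseteq> {..<n}" using CC_sub by blast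
  have vHV: "vs (verts_of CC)" using CCn by (rule vs_verts_of)
  have sHV: "set (verts_of CC) = HV" by (simp add: set_verts_of HV_def)
  have lCC: "length CC \<le> L" using L(3) by (auto simp: CC_def intro: order_trans[OF length_filter_le])
  have len3: "length c \<le> 3" if c: "c \<in> set CC" for c
  proof -
    obtain t where t: "t \<in> set TT" "c = cn R U Y k t" using c by (auto simp: in_CC)
    have "length (cn R U Y k t) \<le> length t"
    proof -
      have *: "length (rev (filter P (if b then x @ c else c))) \<le> length x + length c" for P b and x c :: "nat list"
        unfolding length_rev by (rule order_trans[OF length_filter_le]) auto
      show ?thesis
        unfolding cn_def Let_def
        by (rule order_trans[OF *]) (use sum_length_filter_compl[of "\<lambda>x. x \<in> set R" t] in simp)
    qed
    then show ?thesis using t by (auto simp: in_TT)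
  qed
  have VCC: "\<forall>c\<in>set CC. VL L c" using len3 CCn L(4) n_le by (fastforce simp: VL_def)
  have lHV: "length (verts_of CC) \<le> N" "length (verts_of CC) = card HV"
  proof -
    show *: "length (verts_of CC) = card HV" using vHV sHV by (metis distinct_card vs_def)
    show "length (verts_of CC) \<le> N" unfolding * using card_HV_poly N(1) by (rule order_trans)
  qed
  define A where "A = 2 * (N + 1) ^ b * (L + 2) ^ 3000"
  obtain rf where rf: "runs [EL (EL enc_nat) [verts_of CC], g, enc_nat b] (prog ! 33) rf ((1 + wsize [verts_of CC]) * A)"
    "rf = SNil \<and> (\<exists>W\<subseteq>HV. \<forall>S. balS W S \<longrightarrow> b < card S) \<or> (\<exists>F. rf = SCons (EL encT F) SNil \<and> forest_for b [verts_of CC] F)"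
  proof -
    have "distinct (concat [verts_of CC])" "set (concat [verts_of CC]) \<subseteq> {..<n}" "\<forall>K\<in>set [verts_of CC]. length K \<le> N"
      using vHV lHV by (auto simp: vs_def)
    from runs_bl[OF A_def this] that show thesis unfolding sHV[symmetric] by auto
  qed
  have A5: "50 * (L + 2) ^ 4900 + 200 \<le> (L + 2) ^ 5000" "50 * (L + 2) ^ 3000 + 200 \<le> (L + 2) ^ 5000"
     "50 * (L + 2) ^ 4000 + 200 \<le> (L + 2) ^ 5000" by (rule pow_gap, simp)+
  have f: "runs ?\<rho>2 (ECall 33 [ECons (ECall 25 [EVar 0, ENil]) ENil, EVar 2, EVar 9]) rf
     ((1 + wsize [verts_of CC]) * A + (L + 2) ^ 4900 + 20)"
  proof -
    have v: "runs ?\<rho>2 (ECall 25 [EVar 0, ENil]) (EL enc_nat (verts_of CC)) ((L + 2) ^ 4900)"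
      unfolding J_def[symmetric]
      using VCC CCn lCC by - (rule J_fin, (rule jr J_verts | (simp; fail) | rule eqi)+)
    show ?thesis
      by (rule runs_fin, (rule v rr | (simp; fail) | rule rf(1)[simplified])+)
  qed
  have W: "(1 + wsize [verts_of CC]) * A \<le> (6 * N\<^sup>2 + 3) * A"
  proof -
    have "(length (verts_of CC))\<^sup>2 \<le> N\<^sup>2" using lHV(1) by (rule power_mono) simp
    then show ?thesis by (intro mult_right_mono) (auto simp: wsize_def)
  qed
  define X where "X = (6 * N\<^sup>2 + 3) * (2 * (N + 1) ^ b)"
  define Z where "Z = (N + 1) * 2 ^ (b * h + 1)"
  have X1: "1 \<le> X" by (simp add: X_def)
  have "0 < Z" unfolding Z_def by (intro mult_pos_pos) auto
  then have Z1: "1 \<le> Z" by linarith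
  have leafT: "leafT L N b h = (X + Z) * (L + 2) ^ 5000" by (simp add: leafT_def X_def Z_def)
  have XA: "(6 * N\<^sup>2 + 3) * A = X * (L + 2) ^ 3000" by (simp add: X_def A_def algebra_simps)
  have T1: "X * (L + 2) ^ 3000 + 10 * (L + 2) ^ 4900 + Z * (L + 2) ^ 4000 + 200 \<le> leafT L N b h"
    unfolding leafT using X1 Z1 A5(2,1) by (rule leaf_time) (auto intro!: power_increasing)
  have T2: "(1 + wsize [verts_of CC]) * A \<le> X * (L + 2) ^ 3000" using W XA by simp
  show ?thesis
  proof (cases "rf = SNil")
    case True
    have "runs ?\<rho> (prog ! 38) Fail (leafT L N b h)"
      unfolding prog_nth b_leaf_def
      apply (rule runs_fin, rule runs_Let, rule y, rule runs_Let, rule c, rule runs_Let, rule f, rule runs_IfF, rule rr, simp, simp,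
          simp add: True, (rule rr | (simp; fail))+)
      using T1 T2 by linarith
    moreover have "bad b (set R)"
    proof -
      obtain W where W: "W \<subseteq> HV" "\<forall>S. balS W S \<longrightarrow> b < card S" using rf(2) True by auto
      have "card W \<le> card (set R) + ntr (set R)"
        using card_mono[OF finite_HV W(1)] card_HV_ntr by (rule order_trans)
      moreover have "W \<subseteq> {..<n}" using W(1) CCn by (auto simp: HV_def)
      ultimately show ?thesis unfolding bad_def using W(2) by blast
    qed
    ultimately show ?thesis by blast
  next
    case False
    then obtain F where F: "rf = SCons (EL encT F) SNil" "forest_for b [verts_of CC] F" using rf(2) by auto
    have F1: "fdist F" "fverts F = HV" "fnodes F = card HV" using F(2) lHV sHV by (auto simp: forest_for_def)
    have F2: "fdepth F \<le> b * h"
    proof -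
      have "2 ^ h * length (verts_of CC) \<le> 2 ^ h * N" using lHV(1) by (rule mult_left_mono) simp
      then have "2 ^ h * length (verts_of CC) < 3 ^ h" using N(2) by (rule le_less_trans)
      moreover have "\<forall>h. 2 ^ h * length (verts_of CC) < 3 ^ h \<longrightarrow> fdepth F \<le> b * h"
        using F(2) by (simp add: forest_for_def)
      ultimately show ?thesis by blast
    qed
    have ch: "chains F CC"
      unfolding chains_def
    proof (intro ballI impI)
      fix x assume x: "x \<in> set CC"
      then have "set x \<subseteq> set (verts_of CC)" unfolding sHV by (auto simp: HV_def)
      then show "chain F (set x)" using F(2) CC_clique[OF x] unfolding forest_for_def by auto
    qed
    have lY: "length Y \<le> n" using vY vs_length by blast
    have Fn: "fverts F \<subseteq> {..<n}" "fnodes F \<le> n"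
      using F1 CCn vs_length[OF vHV] lHV(2) by (auto simp: HV_def)
    obtain z where z: "runs [EL encT F, EL (EL enc_nat) CC, g, EL enc_nat R, EL enc_nat Y, enc_nat (Suc k)] (prog ! 37) z (sN F * (L + 2) ^ 4000)"
      "value_upto k wt F CC (sl z)"
      using runs_solve[OF VL(3) VY(3) lY L(1,2) F1(1) Fn lCC VCC ch] by blast
    let ?\<rho>3 = "rf # ?\<rho>2"
    have s: "runs ?\<rho>3 (ECall 37 [EHd (EVar 0), EVar 1, EVar 3, EVar 8, EVar 2, ECons ENil (EVar 9)]) z (sN F * (L + 2) ^ 4000 + 20)"
      by (rule runs_fin, (rule rr | (simp add: F; fail) | rule z(1)[simplified])+)
    have q: "runs [z, enc_nat k] (prog ! 3) (enc_bool (sl z \<le> k)) ((L + 2) ^ 4900)"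
      using J_le[of "enc_nat k" L z] J_mono[of L _ _ _ 60 4900] L(2) unfolding J_def by simp
    have sz: "sN F \<le> Z"
    proof -
      have "sN F + 1 \<le> (fnodes F + 1) * 2 ^ (fdepth F + 1)" by (rule sN_bound)
      also have "\<dots> \<le> (N + 1) * 2 ^ (b * h + 1)"
        using F1(3) lHV F2 by (intro mult_le_mono power_increasing) auto
      finally show ?thesis by (simp add: Z_def)
    qed
    then have sz': "sN F * (L + 2) ^ 4000 \<le> Z * (L + 2) ^ 4000" by (rule mult_right_mono) simp
    have "runs ?\<rho> (prog ! 38) (enc_bool (sl z \<le> k)) (leafT L N b h)"
      unfolding prog_nth b_leaf_def
      apply (rule runs_fin, rule runs_Let, rule y, rule runs_Let, rule c, rule runs_Let, rule f, rule runs_IfT, rule rr, simp, simp,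
          simp add: False, (rule s q rr | (simp; fail))+)
      using T1 T2 sz' by linarith
    moreover have "\<exists>S\<subseteq>{..<n}. card S \<le> k \<and> hits (S \<union> set D)" if le: "sl z \<le> k"
    proof -
      obtain Q where Q: "sat F CC Q" "sum wt Q \<le> sl z" using value_uptoD[OF z(2) le] by blast
      have "set c \<subseteq> fverts F" if "c \<in> set CC" for c using that unfolding F1 by (auto simp: HV_def)
      then show ?thesis using Q le unfolding sat_def F1 by (intro sound[of Q]) auto
    qed
    moreover have "k < card (S - set D)" if nz: "\<not> sl z \<le> k" and S: "S \<subseteq> {..<n}" "hits S" "set D \<subseteq> S" "S \<inter> set U = {}" for S
    proof (rule ccontr)
      assume "\<not> k < card (S - set D)"
      then obtain Q where Q: "Q \<subseteq> HV" "\<forall>c\<in>set CC. set c \<inter> Q \<noteq> {}" "sum wt Q \<le> k"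
        using complete[OF S] by auto
      then have "sat F CC Q" unfolding sat_def F1 by blast
      then have "sl z \<le> k" using Q(3) z(2) unfolding value_upto_def by blast
      then show False using nz by simp
    qed
    ultimately show ?thesis
      by (cases "sl z \<le> k") (auto simp: enc_bool_def intro!: exI[of _ "enc_bool (sl z \<le> k)"])
  qed
qed

end

section \<open>Branching over the packed vertices\<close>

fun brN :: "nat \<Rightarrow> nat \<Rightarrow> nat" where
  "brN 0 q = 1"
| "brN (Suc l) 0 = 1 + brN l 0"
| "brN (Suc l) (Suc q) = 1 + brN l (Suc q) + brN l q"

text \<open>Taking or skipping a vertex keeps \<open>q\<close>, excluding it lowers
  \<open>q\<close>. So the tree is counted by the at most \<open>q\<close> levels among
  \<open>l\<close> at which a vertex is excluded, which gives a polynomial in \<open>l\<close> of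
  degree q + 1 instead of 2^l.\<close>

lemma brN_bound: "brN l q \<le> (l + 2) ^ (q + 1)"
proof (induction l q rule: brN.induct)
  case (3 l q)
  have 1: "(l + 2) ^ (q + 1) + 1 \<le> (l + 3) ^ (q + 1)"
  proof -
    have "(l + 2) ^ (q + 1) < (l + 3) ^ (q + 1)" by (rule power_strict_mono) auto
    then show ?thesis by linarith
  qed
  have "brN (Suc l) (Suc q) \<le> 1 + (l + 2) * (l + 2) ^ (q + 1) + (l + 2) ^ (q + 1)" using 3 by simp
  also have "\<dots> \<le> (l + 2) * (l + 3) ^ (q + 1) + (l + 3) ^ (q + 1)"
    using 1 mult_left_mono[of "(l + 2) ^ (q + 1)" "(l + 3) ^ (q + 1)" "l + 2"] by linarith
  also have "\<dots> = (l + 3) * (l + 3) ^ (q + 1)"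
  proof -
    have "(l + 2) * X + X = (l + 3) * X" for X :: nat by (simp add: algebra_simps)
    then show ?thesis .
  qed
  also have "\<dots> = (l + 3) ^ (Suc q + 1)" by simp
  also have "l + 3 = Suc l + 2" by simp
  finally show ?case .
qed (auto simp: Suc_le_eq)

locale run_ctx = sgraph_ctx +
  fixes k b N h :: nat
  assumes b1: "1 \<le> b"
    and L: "(n + 2) * (k + 1) + n \<le> L" "k < L" "n * (n * n) \<le> L" "3 \<le> L" "n * b \<le> L" "b \<le> L" "5 * k + 6 * k\<^sup>2 \<le> L"
    and N: "(5 * k + 6 * k\<^sup>2) + k * (5 * k + 6 * k\<^sup>2)\<^sup>2 \<le> N" "2 ^ h * N < 3 ^ h"
    and X3: "length (pk TT) \<le> 3 * k"
begin

abbreviation X0 :: "nat list" where "X0 \<equiv> pk TT"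

definition yes :: bool where
  "yes \<longleftrightarrow> (\<exists>S\<subseteq>{..<n}. card S \<le> k \<and> hits S)"

text \<open>The condition on X is |X| <= 5k + 6 k^2 / b without division, the size of the relevant
  set at a leaf.\<close>

definition failing :: bool where
  "failing \<longleftrightarrow> (\<exists>X\<subseteq>{..<n}. card X * b \<le> 5 * k * b + 6 * k\<^sup>2 \<and> bad b X)"

text \<open>A positive answer certifies a solution regardless of D and U, whereas a negative one
  speaks only of solutions that contain D and avoid U. So a positive answer of either branch can be
  returned at once, and two negative ones cover the case distinction on v.\<close>

definition bspec :: "nat set \<Rightarrow> nat set \<Rightarrow> sexp \<Rightarrow> bool" where
  "bspec D U r \<longleftrightarrow> r = enc_bool True \<and> yes \<or>
     r = SNil \<and> (\<forall>S. S \<subseteq> {..<n} \<and> hits S \<and> D \<subseteq> S \<and> S \<inter> U = {} \<longrightarrow> k < card S) \<or>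
     r = Fail \<and> failing"

definition cov :: "nat list \<Rightarrow> nat list \<Rightarrow> nat list \<Rightarrow> bool" where
  "cov Xs D R \<longleftrightarrow> (\<forall>v\<in>set X0 - set Xs. v \<in> set D \<or> (\<forall>x y. (v, x) \<in> E \<and> (x, y) \<in> E \<and> (v, y) \<in> E \<and> x \<notin> set D \<and> y \<notin> set D \<longrightarrow>
         x \<in> set R \<or> y \<in> set R))"

lemma covD:
  "cov Xs D R \<Longrightarrow> v \<in> set X0 \<Longrightarrow> v \<notin> set Xs \<Longrightarrow> v \<notin> set D \<Longrightarrow> (v, x) \<in> E \<Longrightarrow> (x, y) \<in> E \<Longrightarrow> (v, y) \<in> E \<Longrightarrow>
    x \<notin> set D \<Longrightarrow> y \<notin> set D \<Longrightarrow> x \<in> set R \<or> y \<in> set R"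
  unfolding cov_def by blast

lemma covI:
  "(\<And>v x y. v \<in> set X0 \<Longrightarrow> v \<notin> set Xs \<Longrightarrow> v \<notin> set D \<Longrightarrow> (v, x) \<in> E \<Longrightarrow> (x, y) \<in> E \<Longrightarrow> (v, y) \<in> E \<Longrightarrow>
    x \<notin> set D \<Longrightarrow> y \<notin> set D \<Longrightarrow> x \<in> set R \<or> y \<in> set R) \<Longrightarrow> cov Xs D R"
  unfolding cov_def by blast

text \<open>Xs are the packed vertices still to be treated. Q collects the matchings of the excluded
  vertices, and a solution avoiding U contains half of Q; a solution of size k thus forces |Q| <=
  2k. R consists of the packing, Q, and fewer than 2k/b vertices for each skipped vertex. An
  exclusion adds at least 2k/b vertices to Q, so \<open>q\<close> bounds the exclusions that are
  still possible. That strict inequality cannot hold for k = 0, where there is nothing to branch on,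
  hence the guard on Xs.\<close>

definition binv :: "nat \<Rightarrow> nat list \<Rightarrow> nat list \<Rightarrow> nat list \<Rightarrow> nat list \<Rightarrow> nat list \<Rightarrow> nat \<Rightarrow> bool" where
  "binv q Xs D U Q R k' \<longleftrightarrow>
     vs (Xs @ D @ U) \<and> set (Xs @ D @ U) \<subseteq> set X0 \<and> set X0 \<subseteq> set R \<and> set R \<subseteq> {..<n} \<and> vs Q \<and> set Q \<subseteq> set R \<and>
     k = k' + length D \<and> length Q \<le> 2 * k \<and>
     (\<forall>S. hits S \<and> finite S \<and> S \<inter> set U = {} \<longrightarrow> length Q \<le> 2 * card (S \<inter> set Q)) \<and>
     length R * b \<le> (length X0 + length Q) * b + (length X0 - length Xs) * (2 * k) \<and>
     (Xs \<noteq> [] \<longrightarrow> (2 * k - length Q) * b < (q + 1) * (2 * k)) \<and>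
     cov Xs D R \<and>
     length Xs \<le> length X0"

lemma vs_X0: "vs X0"
  using vs_pk[of TT] TT_vs by blast

lemma binvD:
  assumes "binv q Xs D U Q R k'"
  shows "vs (Xs @ D @ U)" "set (Xs @ D @ U) \<subseteq> set X0" "set X0 \<subseteq> set R" "set R \<subseteq> {..<n}" "vs Q" "set Q \<subseteq> set R"
    "k = k' + length D" "length Q \<le> 2 * k"
    "\<forall>S. hits S \<and> finite S \<and> S \<inter> set U = {} \<longrightarrow> length Q \<le> 2 * card (S \<inter> set Q)"
    "length R * b \<le> (length X0 + length Q) * b + (length X0 - length Xs) * (2 * k)"
    "Xs \<noteq> [] \<longrightarrow> (2 * k - length Q) * b < (q + 1) * (2 * k)"
    "cov Xs D R" "length Xs \<le> length X0"
  using assms unfolding binv_def by - (elim conjE, assumption)+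

text \<open>The term 5k is 3k for the packing and 2k for Q; the term 6 k^2 is at most 3k skipped
  vertices times 2k, before division by b. Replacing b by 1 gives the bound on |R| that is used for
  the kernel size.\<close>

lemma binv_R:
  assumes "binv q Xs D U Q R k'"
  shows "length R * b \<le> 5 * k * b + 6 * k\<^sup>2" "length R \<le> 5 * k + 6 * k\<^sup>2" "VL L R"
proof -
  note D = binvD[OF assms]
  have "(length X0 + length Q) * b \<le> (5 * k) * b" using D(8) X3 by (intro mult_right_mono) auto
  moreover have "(length X0 - length Xs) * (2 * k) \<le> (3 * k) * (2 * k)" using X3 by (intro mult_right_mono) auto
  moreover have "(3 * k) * (2 * k) = 6 * k\<^sup>2" by (simp add: power2_eq_square)
  ultimately show 2: "length R * b \<le> 5 * k * b + 6 * k\<^sup>2" using D(10) by linarith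
  have "length R * b \<le> (5 * k + 6 * k\<^sup>2) * b"
  proof -
    have "6 * k\<^sup>2 * 1 \<le> 6 * k\<^sup>2 * b" using b1 by (rule mult_left_mono) simp
    then show ?thesis using 2 unfolding add_mult_distrib by linarith
  qed
  then show 3: "length R \<le> 5 * k + 6 * k\<^sup>2" using b1 by simp
  show "VL L R" using 3 D(4) L(7) n_le by (auto simp: VL_def)
qed

lemma binv_len_mono:
  "length R * b \<le> c + (length X0 - length (v # Xs)) * (2 * k) \<Longrightarrow> length R * b \<le> c + (length X0 - length Xs) * (2 * k)"
  by (erule order_trans) (intro add_left_mono mult_right_mono, auto)

lemma binv_step_D:
  assumes "binv q (v # Xs) D U Q R (Suc k')"
  shows "binv q Xs (v # D) U Q R k'"
proof -
  note D = binvD[OF assms]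
  have "cov Xs (v # D) R"
  proof (rule covI)
    fix w x y
    assume w: "w \<in> set X0" "w \<notin> set Xs" "w \<notin> set (v # D)" "(w, x) \<in> E" "(x, y) \<in> E" "(w, y) \<in> E"
      "x \<notin> set (v # D)" "y \<notin> set (v # D)"
    show "x \<in> set R \<or> y \<in> set R"
      by (rule covD[OF D(12) w(1) _ _ w(4-6)]) (use w in auto)
  qed
  moreover have "vs (Xs @ (v # D) @ U)" using D(1) by (auto simp: vs_def)
  moreover have "set (Xs @ (v # D) @ U) \<subseteq> set X0" using D(2) by auto
  moreover have "k = k' + length (v # D)" using D(7) by simp
  moreover have "Xs \<noteq> [] \<longrightarrow> (2 * k - length Q) * b < (q + 1) * (2 * k)"
    using D(11)[rule_format, OF list.distinct(2)] by blast
  moreover have "length Xs \<le> length X0" using D(13) by simp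
  ultimately show ?thesis
    unfolding binv_def using D(3-6,8,9) binv_len_mono[OF D(10)] by (intro conjI)
qed

text \<open>A triangle v, x, y that avoids D either meets Q, which is part of R, or its edge xy
  competes with the matching M, which is maximal outside D and Q.\<close>

lemma cov_step:
  assumes "cov (v # Xs) D R" "set Q \<subseteq> set R" "M = mt v (rev D @ Q) TT"
  shows "cov Xs D (rev M @ R)"
proof (rule covI)
  fix w x y
  assume w: "w \<in> set X0" "w \<notin> set Xs" "w \<notin> set D" "(w, x) \<in> E" "(x, y) \<in> E" "(w, y) \<in> E" "x \<notin> set D" "y \<notin> set D"
  show "x \<in> set (rev M @ R) \<or> y \<in> set (rev M @ R)"
  proof (cases "w = v")
    case True
    show ?thesis
    proof (cases "x \<in> set Q \<or> y \<in> set Q")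
      case False
      then have "x \<notin> set (rev D @ Q)" "y \<notin> set (rev D @ Q)" using w by auto
      then have "x \<in> set M \<or> y \<in> set M"
        unfolding assms(3) using mt_maximal[OF w(4-6)] True by blast
      then show ?thesis by auto
    qed (use assms(2) in auto)
  next
    case False
    then have "x \<in> set R \<or> y \<in> set R" using covD[OF assms(1) w(1) _ w(3-8)] w(2) by simp
    then show ?thesis by auto
  qed
qed

lemma binv_step_skip:
  assumes a: "binv q (v # Xs) D U Q R k'" and M: "M = mt v (rev D @ Q) TT" "\<not> 2 * k \<le> length M * b"
  shows "binv q Xs D U Q (rev M @ R) k'"
proof -
  note D = binvD[OF a]
  have vM: "vs M" unfolding M(1) using TT_vs by (intro vs_mt) blast
  have "vs (Xs @ D @ U)" using D(1) by (auto simp: vs_def)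
  moreover have "set (Xs @ D @ U) \<subseteq> set X0" using D(2) by auto
  moreover have "set (rev M @ R) \<subseteq> {..<n}" using D(4) vM by (auto simp: vs_def)
  moreover have "length (rev M @ R) * b \<le> (length X0 + length Q) * b + (length X0 - length Xs) * (2 * k)"
  proof -
    have "length X0 - length Xs = Suc (length X0 - length (v # Xs))" using D(13) by simp
    then have "(length X0 - length Xs) * (2 * k) = 2 * k + (length X0 - length (v # Xs)) * (2 * k)" by simp
    moreover have "length (rev M @ R) * b = length M * b + length R * b" by (simp add: add_mult_distrib)
    ultimately show ?thesis using M(2) D(10) by linarith
  qed
  moreover have "Xs \<noteq> [] \<longrightarrow> (2 * k - length Q) * b < (q + 1) * (2 * k)"
    using D(11)[rule_format, OF list.distinct(2)] by blast
  moreover have "length Xs \<le> length X0" using D(13) by simp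
  moreover have "set X0 \<subseteq> set (rev M @ R)" "set Q \<subseteq> set (rev M @ R)" using D(3,6) by auto
  ultimately show ?thesis
    unfolding binv_def using D(5,7-9) cov_step[OF D(12,6) M(1)] by (intro conjI)
qed

lemma U_hit:
  assumes a: "binv q (v # Xs) D U Q R k'" and M: "M = mt v (rev D @ Q) TT" and S: "hits S" "finite S" "S \<inter> set (v # U) = {}"
  shows "length (rev M @ Q) \<le> 2 * card (S \<inter> set (rev M @ Q))"
proof -
  have "length Q \<le> 2 * card (S \<inter> set Q)" using binvD(9)[OF a] S by auto
  moreover have "length M \<le> 2 * card (S \<inter> set M)" unfolding M using S by (intro mt_hit) auto
  moreover have "set M \<inter> set Q = {}" using mt_disjoint[of v "rev D @ Q" TT] unfolding M by auto
  then have "card (S \<inter> set M \<union> S \<inter> set Q) = card (S \<inter> set M) + card (S \<inter> set Q)"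
    using S(2) by (intro card_Un_disjoint) auto
  moreover have "S \<inter> set (rev M @ Q) = S \<inter> set M \<union> S \<inter> set Q" by auto
  ultimately show ?thesis by simp
qed

text \<open>M takes at least 2k/b of the 2k - |Q| vertices by which Q may still grow. This excludes
  q = 0 and leaves room for one exclusion less.\<close>

lemma binv_step_U:
  assumes a: "binv q (v # Xs) D U Q R k'" and M: "M = mt v (rev D @ Q) TT" "2 * k \<le> length M * b" "length (rev M @ Q) \<le> 2 * k"
  shows "\<exists>q'. q = Suc q' \<and> binv q' Xs D (v # U) (rev M @ Q) (rev M @ R) k'"
proof -
  note D = binvD[OF a]
  have vM: "vs M" unfolding M(1) using TT_vs by (intro vs_mt) blast
  have lt: "(2 * k - length Q) * b < (q + 1) * (2 * k)" by (rule D(11)[rule_format, OF list.distinct(2)])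
  have "length M \<le> 2 * k - length Q" using M(3) by simp
  then have le: "length M * b \<le> (2 * k - length Q) * b" by (rule mult_right_mono) simp
  have "q \<noteq> 0"
  proof
    assume "q = 0"
    then have "(2 * k - length Q) * b < 2 * k" using lt by simp
    then show False using M(2) le by linarith
  qed
  then obtain q' where q': "q = Suc q'" using not0_implies_Suc by blast
  have "(2 * k - length (rev M @ Q)) * b = (2 * k - length Q) * b - length M * b"
    by (simp add: diff_mult_distrib add_mult_distrib)
  moreover have "(q + 1) * (2 * k) = (q' + 1) * (2 * k) + 2 * k" by (simp add: q')
  ultimately have lt': "(2 * k - length (rev M @ Q)) * b < (q' + 1) * (2 * k)"
    using lt M(2) le by linarith
  have "vs (Xs @ D @ v # U)" using D(1) by (auto simp: vs_def)
  moreover have "set (Xs @ D @ v # U) \<subseteq> set X0" using D(2) by auto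
  moreover have "set (rev M @ R) \<subseteq> {..<n}" using D(4) vM by (auto simp: vs_def)
  moreover have "vs (rev M @ Q)" using D(5) vM mt_disjoint[of v "rev D @ Q" TT] unfolding M(1) vs_def by auto
  moreover have "\<forall>S. hits S \<and> finite S \<and> S \<inter> set (v # U) = {} \<longrightarrow> length (rev M @ Q) \<le> 2 * card (S \<inter> set (rev M @ Q))"
    using U_hit[OF a M(1)] by blast
  moreover have "length (rev M @ R) * b \<le> (length X0 + length (rev M @ Q)) * b + (length X0 - length Xs) * (2 * k)"
    using binv_len_mono[OF D(10)] by (simp add: add_mult_distrib)
  moreover have "Xs \<noteq> [] \<longrightarrow> (2 * k - length (rev M @ Q)) * b < (q' + 1) * (2 * k)" using lt' by blast
  moreover have "length Xs \<le> length X0" using D(13) by simp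
  moreover have "set X0 \<subseteq> set (rev M @ R)" "set (rev M @ Q) \<subseteq> set (rev M @ R)" using D(3,6) by auto
  ultimately have "binv q' Xs D (v # U) (rev M @ Q) (rev M @ R) k'"
    unfolding binv_def using D(7) M(3) cov_step[OF D(12,6) M(1)] by (intro conjI)
  then show ?thesis using q' by blast
qed

text \<open>Every triangle has a vertex in the packing, hence in R. Once all packed vertices are
  treated, coverage at this vertex provides a second one.\<close>

lemma leaf_two:
  assumes "binv q [] D U Q R k'" "(a, b') \<in> E" "(b', c) \<in> E" "(a, c) \<in> E" "a \<notin> set D" "b' \<notin> set D" "c \<notin> set D"
  shows "(a \<in> set R \<and> b' \<in> set R) \<or> (a \<in> set R \<and> c \<in> set R) \<or> (b' \<in> set R \<and> c \<in> set R)"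
proof -
  note D = binvD[OF assms(1)]
  have P: "x \<in> set R \<or> y \<in> set R" if "v \<in> set X0" "v \<notin> set D" "(v, x) \<in> E" "(x, y) \<in> E" "(v, y) \<in> E" "x \<notin> set D" "y \<notin> set D" for v x y
    by (rule covD[OF D(12) that(1) _ that(2-7)]) simp
  note s = E_sym[OF assms(2)] E_sym[OF assms(3)] E_sym[OF assms(4)]
  from hitsD[OF pk_hits_TT assms(2-4)] consider "a \<in> set X0" | "b' \<in> set X0" | "c \<in> set X0" by blast
  then show ?thesis
  proof cases
    case 1 then show ?thesis using P[of a b' c] assms D(3) by blast
  next
    case 2 then show ?thesis using P[of b' a c] assms s D(3) by blast
  next
    case 3 then show ?thesis using P[of c a b'] assms s D(3) by blast
  qed
qed

definition CB :: nat where "CB = leafT L N b h + (L + 2) ^ 5000"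

text \<open>The three kinds of calls correspond to the three steps of the invariant. A small
  matching skips v with no decision about it; a large one tries first v in the solution and, if this
  is denied, v outside it. Failure in a branch is passed on like a positive answer.\<close>

lemma runs_branch:
  "binv q Xs D U Q R k' \<Longrightarrow> \<exists>r. runs [EL enc_nat Xs, EL enc_nat D, EL enc_nat U, EL enc_nat Q, EL enc_nat R, enc_nat k', g,
      EL enc_nat V0, EL (EL enc_nat) TT, enc_nat (2 * k), enc_nat b] (prog ! 39) r (brN (length Xs) q * CB) \<and> bspec (set D) (set U) r"
proof (induction Xs arbitrary: q D U Q R k')
  case (Nil q D U Q R k')
  let ?\<rho> = "[EL enc_nat [], EL enc_nat D, EL enc_nat U, EL enc_nat Q, EL enc_nat R, enc_nat k', g,
      EL enc_nat V0, EL (EL enc_nat) TT, enc_nat (2 * k), enc_nat b]"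
  note i = binvD[OF Nil]
  note R = binv_R[OF Nil]
  have kk: "k' \<le> k" using i(7) by simp
  have v: "vs D" "vs U" using i(1) by (auto simp: vs_def)
  have n1: "length R + k' * (length R)\<^sup>2 \<le> N"
  proof -
    have "k' * (length R)\<^sup>2 \<le> k * (5 * k + 6 * k\<^sup>2)\<^sup>2" using kk R(2) by (intro mult_le_mono power_mono) auto
    then show ?thesis using R(2) N(1) by linarith
  qed
  have l1: "(n + 2) * (k' + 1) + n \<le> L"
  proof -
    have "(n + 2) * (k' + 1) \<le> (n + 2) * (k + 1)" using kk by (intro mult_left_mono) auto
    then show ?thesis using L(1) by linarith
  qed
  have d: "set D \<subseteq> {..<n}" "set U \<subseteq> set R" "set R \<subseteq> {..<n}" using i(1-4) by (auto simp: vs_def)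
  have l2: "k' < L" "length TT \<le> L" using kk L(2,3) length_TT by auto
  have ex: "\<exists>r. runs [g, EL enc_nat V0, EL (EL enc_nat) TT, EL enc_nat D, EL enc_nat U, EL enc_nat R, enc_nat k', enc_nat b] (prog ! 38) r
      (leafT L N b h) \<and>
     (r = enc_bool True \<and> (\<exists>S\<subseteq>{..<n}. card S \<le> k' \<and> hits (S \<union> set D)) \<or>
     r = SNil \<and> (\<forall>S. S \<subseteq> {..<n} \<and> hits S \<and> set D \<subseteq> S \<and> S \<inter> set U = {} \<longrightarrow> k' < card (S - set D)) \<or>
     r = Fail \<and> bad b (set R))"
    by (rule runs_leaf[OF d vs_VL[OF v(1)] vs_VL[OF v(2)] R(3) _ l1 l2 L(4) n1 N(2)], rule leaf_two[OF Nil], assumption+)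
  obtain r where r: "runs [g, EL enc_nat V0, EL (EL enc_nat) TT, EL enc_nat D, EL enc_nat U, EL enc_nat R, enc_nat k', enc_nat b] (prog ! 38) r
      (leafT L N b h)"
    "r = enc_bool True \<and> (\<exists>S\<subseteq>{..<n}. card S \<le> k' \<and> hits (S \<union> set D)) \<or>
     r = SNil \<and> (\<forall>S. S \<subseteq> {..<n} \<and> hits S \<and> set D \<subseteq> S \<and> S \<inter> set U = {} \<longrightarrow> k' < card (S - set D)) \<or>
     r = Fail \<and> bad b (set R)"
    using ex by (elim exE conjE) (rule that)
  have "runs ?\<rho> (prog ! 39) r (brN (length []) q * CB)"
    unfolding prog_nth b_branch_def
    apply (rule runs_fin, rule runs_IfF, rule rr, simp, simp, simp, (rule rr | (simp; fail) | rule r(1)[simplified])+)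
    using pow_gap[of 4900 5000 L] by (simp add: CB_def)
  moreover have "bspec (set D) (set U) r"
    using r(2)
  proof (elim disjE conjE)
    assume "r = enc_bool True" "\<exists>S\<subseteq>{..<n}. card S \<le> k' \<and> hits (S \<union> set D)"
    then obtain S where S: "S \<subseteq> {..<n}" "card S \<le> k'" "hits (S \<union> set D)" by blast
    have "card (S \<union> set D) \<le> k" using card_Un_le[of S "set D"] S(2) card_length[of D] i(7) by linarith
    moreover have "S \<union> set D \<subseteq> {..<n}" using S v by (auto simp: vs_def)
    ultimately have yes using S(3) unfolding yes_def by blast
    then show ?thesis using \<open>r = enc_bool True\<close> by (simp add: bspec_def)
  next
    assume "r = SNil" and no: "\<forall>S. S \<subseteq> {..<n} \<and> hits S \<and> set D \<subseteq> S \<and> S \<inter> set U = {} \<longrightarrow> k' < card (S - set D)"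
    have "k < card S" if S: "S \<subseteq> {..<n}" "hits S" "set D \<subseteq> S" "S \<inter> set U = {}" for S
    proof -
      have "k' < card (S - set D)" using no S by blast
      moreover have "card (S - set D) = card S - length D"
        using S(3) v(1) by (simp add: card_Diff_subset vs_def distinct_card)
      ultimately show ?thesis using i(7) by linarith
    qed
    then show ?thesis using \<open>r = SNil\<close> by (auto simp: bspec_def)
  next
    assume "r = Fail" "bad b (set R)"
    moreover have "card (set R) * b \<le> 5 * k * b + 6 * k\<^sup>2"
      using R(1) mult_right_mono[OF card_length[of R], of b] by linarith
    ultimately have failing unfolding failing_def using i(4) by blast
    then show ?thesis using \<open>r = Fail\<close> by (simp add: bspec_def)
  qed
  ultimately show ?case by blast
next
  case (Cons v Xs q D U Q R k')
  let ?\<rho> = "[EL enc_nat (v # Xs), EL enc_nat D, EL enc_nat U, EL enc_nat Q, EL enc_nat R, enc_nat k', g,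
      EL enc_nat V0, EL (EL enc_nat) TT, enc_nat (2 * k), enc_nat b]"
  note i = binvD[OF Cons.prems]
  define M where "M = mt v (rev D @ Q) TT"
  let ?\<rho>1 = "EL enc_nat M # ?\<rho>"
  have v: "vs D" "vs U" "vs Q" "v < n" using i(1,5) by (auto simp: vs_def)
  have vM: "vs M" unfolding M_def using TT_vs by (intro vs_mt) blast
  have VLs: "VL L D" "VL L U" "VL L Q" "VL L R" "VL L M" "v \<le> L" "length TT \<le> L"
    using v vs_VL vM binv_R(3)[OF Cons.prems] n_le L(3) length_TT by auto
  have lens: "length D \<le> L" "length Q \<le> L" "length M \<le> L" "length M * b \<le> L" "2 * k \<le> L"
  proof -
    show "length D \<le> L" "length Q \<le> L" "length M \<le> L" using VLs by (auto simp: VL_def)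
    have "length M * b \<le> n * b" using vs_length[OF vM] by (rule mult_right_mono) simp
    then show "length M * b \<le> L" using L(5) by linarith
    show "2 * k \<le> L" using L(7) by linarith
  qed
  have VA: "VL L (rev D @ Q)"
  proof -
    have "length D + length Q \<le> 2 * n" using vs_length[OF v(1)] vs_length[OF v(3)] by simp
    then show ?thesis using VLs L_ge by (auto simp: VL_def)
  qed
  have m: "runs ?\<rho> (ECall 13 [EVar 8, ENil, EHd (EVar 0), ECall 2 [EVar 1, EVar 3]]) (EL enc_nat M) ((L + 2) ^ 2000)"
    unfolding J_def[symmetric]
    using VA VLs lens TT_vs by - (rule J_fin, (rule jr J_mtch J_rapp | (simp; fail) | rule eqi)+, auto simp: M_def)
  have cond: "runs ?\<rho>1 (ECall 3 [EVar 10, ECall 14 [EVar 0, ENil, EVar 11]]) (enc_bool (2 * k \<le> length M * b)) ((L + 2) ^ 2000)"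
    unfolding J_def[symmetric]
    using lens L(6) by - (rule J_fin, (rule jr J_mult J_le | (simp; fail) | rule eqi)+)
  have P: "50 * (L + 2) ^ 2000 + 200 \<le> CB"
    using pow_gap[of 2000 5000 L] unfolding CB_def by linarith
  show ?case
  proof (cases "2 * k \<le> length M * b")
    case False
    have "binv q Xs D U Q (rev M @ R) k'" by (rule binv_step_skip[OF Cons.prems M_def False])
    then obtain r where r: "runs [EL enc_nat Xs, EL enc_nat D, EL enc_nat U, EL enc_nat Q, EL enc_nat (rev M @ R), enc_nat k', g,
      EL enc_nat V0, EL (EL enc_nat) TT, enc_nat (2 * k), enc_nat b] (prog ! 39) r (brN (length Xs) q * CB)" "bspec (set D) (set U) r"
      using Cons.IH by blast
    have x: "runs ?\<rho>1 (ECall 2 [EVar 0, EVar 5]) (EL enc_nat (rev M @ R)) ((L + 2) ^ 2000)"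
      unfolding J_def[symmetric]
      using lens by - (rule J_fin, (rule jr J_rapp | (simp; fail) | rule eqi)+)
    have "brN (length Xs) q * CB + CB \<le> brN (length (v # Xs)) q * CB" by (cases q) (simp_all add: algebra_simps)
    then have "runs ?\<rho> (prog ! 39) r (brN (length (v # Xs)) q * CB)"
      unfolding prog_nth b_branch_def
      apply -
      apply (rule runs_fin, rule runs_IfT, rule rr, simp, simp, simp, rule runs_Let, rule m, rule runs_IfF[OF cond], simp add: False,
          (rule x rr | (simp; fail) | rule r(1))+)
      using P by linarith
    then show ?thesis using r(2) by blast
  next
    case True
    have "\<exists>r1. runs ?\<rho>1 (EIf (EVar 6)
                 (ECall 39 [ETl (EVar 1), ECons (EHd (EVar 1)) (EVar 2), EVar 3, EVar 4, EVar 5, ETl (EVar 6),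
                    EVar 7, EVar 8, EVar 9, EVar 10, EVar 11])
                 ENil) r1 (brN (length Xs) q * CB + 60) \<and> bspec (set (v # D)) (set U) r1"
    proof (cases k')
      case 0
      \<comment> \<open>No budget is left, so D already has k elements and v would be one too
        many.\<close>
      have "k < card S" if "S \<subseteq> {..<n}" "set (v # D) \<subseteq> S" for S
      proof -
        have "distinct (v # D)" using i(1) by (auto simp: vs_def)
        then have "length (v # D) \<le> card S" using that by (metis card_mono distinct_card finite_lessThan finite_subset)
        then show ?thesis using i(7) 0 by simp
      qed
      then have "bspec (set (v # D)) (set U) SNil" by (auto simp: bspec_def)
      moreover have "runs ?\<rho>1 (EIf (EVar 6)
                 (ECall 39 [ETl (EVar 1), ECons (EHd (EVar 1)) (EVar 2), EVar 3, EVar 4, EVar 5, ETl (EVar 6),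
                    EVar 7, EVar 8, EVar 9, EVar 10, EVar 11])
                 ENil) SNil (brN (length Xs) q * CB + 60)"
        by (rule runs_fin, rule runs_IfF, rule rr, simp, simp, simp add: 0, (rule rr | (simp; fail))+)
      ultimately show ?thesis by blast
    next
      case (Suc k'')
      have "binv q Xs (v # D) U Q R k''" using binv_step_D[of q v Xs D U Q R k''] Cons.prems Suc by simp
      then obtain r where r: "runs [EL enc_nat Xs, EL enc_nat (v # D), EL enc_nat U, EL enc_nat Q, EL enc_nat R, enc_nat k'', g,
        EL enc_nat V0, EL (EL enc_nat) TT, enc_nat (2 * k), enc_nat b] (prog ! 39) r (brN (length Xs) q * CB)" "bspec (set (v # D)) (set U) r"
        using Cons.IH by blast
      have "runs ?\<rho>1 (EIf (EVar 6)
                 (ECall 39 [ETl (EVar 1), ECons (EHd (EVar 1)) (EVar 2), EVar 3, EVar 4, EVar 5, ETl (EVar 6),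
                    EVar 7, EVar 8, EVar 9, EVar 10, EVar 11])
                 ENil) r (brN (length Xs) q * CB + 60)"
        by (rule runs_fin, rule runs_IfT, rule rr, simp, simp, simp add: Suc, (rule rr | (simp add: Suc; fail) | rule r(1)[simplified])+)
      then show ?thesis using r(2) by blast
    qed
    then obtain r1 where r1: "runs ?\<rho>1 (EIf (EVar 6)
                 (ECall 39 [ETl (EVar 1), ECons (EHd (EVar 1)) (EVar 2), EVar 3, EVar 4, EVar 5, ETl (EVar 6),
                    EVar 7, EVar 8, EVar 9, EVar 10, EVar 11])
                 ENil) r1 (brN (length Xs) q * CB + 60)" "bspec (set (v # D)) (set U) r1" by blast
    have bq: "brN (length Xs) q * CB + CB \<le> brN (length (v # Xs)) q * CB" by (cases q) (simp_all add: algebra_simps)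
    show ?thesis
    proof (cases "r1 = SNil")
      case r1n: False
      then have "runs ?\<rho> (prog ! 39) r1 (brN (length (v # Xs)) q * CB)"
        unfolding prog_nth b_branch_def
        apply -
        apply (rule runs_fin, rule runs_IfT, rule rr, simp, simp, simp, rule runs_Let, rule m, rule runs_IfT[OF cond], simp add: True,
            rule runs_Let, rule r1(1), rule runs_IfT, (rule rr | (simp; fail))+)
        using P bq by linarith
      moreover have "bspec (set D) (set U) r1" using r1(2) r1n by (auto simp: bspec_def)
      ultimately show ?thesis by blast
    next
      case r1n: True
      have noD: "k < card S" if "S \<subseteq> {..<n}" "hits S" "set (v # D) \<subseteq> S" "S \<inter> set U = {}" for S
        using r1(2) r1n that by (auto simp: bspec_def enc_bool_def)
      let ?\<rho>2 = "r1 # ?\<rho>1"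
      have q: "runs ?\<rho>2 (ECall 2 [EVar 1, EVar 5]) (EL enc_nat (rev M @ Q)) ((L + 2) ^ 2000)"
        unfolding J_def[symmetric]
        using lens by - (rule J_fin, (rule jr J_rapp | (simp; fail) | rule eqi)+)
      have x: "runs ?\<rho>2 (ECall 2 [EVar 1, EVar 6]) (EL enc_nat (rev M @ R)) ((L + 2) ^ 2000)"
        unfolding J_def[symmetric]
        using lens by - (rule J_fin, (rule jr J_rapp | (simp; fail) | rule eqi)+)
      have c2: "runs ?\<rho>2 (ECall 3 [ECall 2 [EVar 1, EVar 5], EVar 11]) (enc_bool (length (rev M @ Q) \<le> 2 * k)) ((L + 2) ^ 2000)"
        unfolding J_def[symmetric]
        using lens by - (rule J_fin, (rule jr J_rapp J_le | (simp; fail) | rule eqi)+)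
      show ?thesis
      proof (cases "length (rev M @ Q) \<le> 2 * k")
        case False
        have "runs ?\<rho> (prog ! 39) SNil (brN (length (v # Xs)) q * CB)"
          unfolding prog_nth b_branch_def
          apply (rule runs_fin, rule runs_IfT, rule rr, simp, simp, simp, rule runs_Let, rule m, rule runs_IfT[OF cond], simp add: True,
              rule runs_Let, rule r1(1), rule runs_IfF, rule rr, simp, simp, rule r1n, rule runs_IfF[OF c2])
          using False apply simp
          apply ((rule rr | (simp; fail))+)
          using P bq by linarith
        \<comment> \<open>If v is not in S, then S contains at least half of M and Q together, which
          is more than k.\<close>
        moreover have "k < card S" if S: "S \<subseteq> {..<n}" "hits S" "set D \<subseteq> S" "S \<inter> set U = {}" for S
        proof (cases "v \<in> S")
          case vS: False
          have fS: "finite S" using S(1) finite_subset by blast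
          have "length (rev M @ Q) \<le> 2 * card (S \<inter> set (rev M @ Q))"
            using S vS by (intro U_hit[OF Cons.prems M_def _ fS]) auto
          also have "\<dots> \<le> 2 * card S" using fS by (intro mult_left_mono card_mono) auto
          finally show ?thesis using False by linarith
        qed (use noD S in auto)
        then have "bspec (set D) (set U) SNil" by (auto simp: bspec_def enc_bool_def)
        ultimately show ?thesis by blast
      next
        case c: True
        obtain q' where q': "q = Suc q'" "binv q' Xs D (v # U) (rev M @ Q) (rev M @ R) k'"
          using binv_step_U[OF Cons.prems M_def True c] by blast
        obtain r where r: "runs [EL enc_nat Xs, EL enc_nat D, EL enc_nat (v # U), EL enc_nat (rev M @ Q), EL enc_nat (rev M @ R), enc_nat k', g,
          EL enc_nat V0, EL (EL enc_nat) TT, enc_nat (2 * k), enc_nat b] (prog ! 39) r (brN (length Xs) q' * CB)" "bspec (set D) (set (v # U)) r"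
          using Cons.IH[OF q'(2)] by blast
        have bq2: "brN (length Xs) q * CB + brN (length Xs) q' * CB + CB \<le> brN (length (v # Xs)) q * CB"
          by (simp add: q' algebra_simps)
        have "runs ?\<rho> (prog ! 39) r (brN (length (v # Xs)) q * CB)"
          unfolding prog_nth b_branch_def
          apply (rule runs_fin, rule runs_IfT, rule rr, simp, simp, simp, rule runs_Let, rule m, rule runs_IfT[OF cond], simp add: True,
              rule runs_Let, rule r1(1), rule runs_IfF, rule rr, simp, simp, rule r1n, rule runs_IfT[OF c2])
          using c apply simp
          apply ((rule q x rr | (simp; fail) | rule r(1)[simplified] | rule r(1))+)
          using P bq2 by linarith
        moreover have "bspec (set D) (set U) r"
        proof -
          have "k < card S" if "r = SNil" and S: "S \<subseteq> {..<n}" "hits S" "set D \<subseteq> S" "S \<inter> set U = {}" for S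
          proof (cases "v \<in> S")
            case False
            then show ?thesis using r(2) \<open>r = SNil\<close> S by (auto simp: bspec_def enc_bool_def)
          qed (use noD S in auto)
          then show ?thesis using r(2) by (auto simp: bspec_def enc_bool_def)
        qed
        ultimately show ?thesis by blast
      qed
    qed
  qed
qed

end

context run_ctx
begin

text \<open>With Q empty, 2k b < (q + 1) 2k holds for q = b: at most b exclusions fit, each
  reserving at least 2k/b of 2k vertices.\<close>

lemma binv_init: "binv b X0 [] [] [] X0 k"
proof -
  have "X0 \<noteq> [] \<longrightarrow> 0 < k" using X3 by (cases k) auto
  then have "X0 \<noteq> [] \<longrightarrow> (2 * k - length ([] :: nat list)) * b < (b + 1) * (2 * k)" by simp
  moreover have "cov X0 [] X0" by (simp add: cov_def)
  ultimately show ?thesis using vs_X0 by (simp add: binv_def vs_def)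
qed

lemma runs_iter:
  "\<exists>r. runs [EL enc_nat X0, SNil, SNil, SNil, EL enc_nat X0, enc_nat k, g, EL enc_nat V0, EL (EL enc_nat) TT, enc_nat (2 * k), enc_nat b]
     (prog ! 39) r ((3 * k + 2) ^ (b + 1) * CB) \<and> bspec {} {} r"
proof -
  obtain r where r: "runs [EL enc_nat X0, EL enc_nat [], EL enc_nat [], EL enc_nat [], EL enc_nat X0, enc_nat k, g, EL enc_nat V0,
      EL (EL enc_nat) TT, enc_nat (2 * k), enc_nat b] (prog ! 39) r (brN (length X0) b * CB)" "bspec (set []) (set []) r"
    using runs_branch[OF binv_init] by blast
  have "brN (length X0) b \<le> (length X0 + 2) ^ (b + 1)" by (rule brN_bound)
  also have "\<dots> \<le> (3 * k + 2) ^ (b + 1)" using X3 by (intro power_mono) auto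
  finally have "brN (length X0) b * CB \<le> (3 * k + 2) ^ (b + 1) * CB" by (rule mult_right_mono) simp
  then show ?thesis using r(2) runs_mono[OF r(1)] by (intro exI[of _ r]) (simp add: mult.commute)
qed

end

section \<open>The loop over the order of separators\<close>

lemma leafT_mono: "b \<le> b' \<Longrightarrow> leafT L N b h \<le> leafT L N b' h"
  unfolding leafT_def
  by (intro mult_right_mono add_mono mult_left_mono power_increasing) auto

context sgraph_ctx
begin

definition has_hs :: "nat \<Rightarrow> bool" where
  "has_hs k \<longleftrightarrow> (\<exists>S\<subseteq>{..<n}. card S \<le> k \<and> hits S)"

definition fails :: "nat \<Rightarrow> nat \<Rightarrow> bool" where
  "fails k b \<longleftrightarrow> (\<exists>X\<subseteq>{..<n}. card X * b \<le> 5 * k * b + 6 * k\<^sup>2 \<and> bad b X)"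

definition iterT :: "nat \<Rightarrow> nat \<Rightarrow> nat \<Rightarrow> nat \<Rightarrow> nat" where
  "iterT k N h B = (3 * k + 2) ^ (B + 1) * (leafT L N B h + (L + 2) ^ 5000) + (L + 2) ^ 5000"

context
  fixes k N h B :: nat
  assumes L: "(n + 2) * (k + 1) + n \<le> L" "k < L" "n * (n * n) \<le> L" "3 \<le> L" "n * B \<le> L" "B \<le> L" "5 * k + 6 * k\<^sup>2 \<le> L" "3 * k \<le> L"
    and N: "(5 * k + 6 * k\<^sup>2) + k * (5 * k + 6 * k\<^sup>2)\<^sup>2 \<le> N" "2 ^ h * N < 3 ^ h"
    and B: "1 \<le> B" "\<not> fails k B"
begin

text \<open>The loop may stop at any b, since every answer other than failure is correct.
  \<open>B\<close> is not known to the program; it is a value at which failure is impossible, so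
  that the loop ends there at the latest, and all rounds are charged at the cost for
  \<open>B\<close>.\<close>

lemma runs_loop:
  assumes X3: "length (pk TT) \<le> 3 * k"
  shows "1 \<le> b \<Longrightarrow> b \<le> B \<Longrightarrow> runs [g, EL enc_nat V0, EL (EL enc_nat) TT, EL enc_nat (pk TT), enc_nat k, enc_nat b] (prog ! 40)
      (enc_bool (has_hs k)) ((B + 1 - b) * iterT k N h B)"
proof (induction "B - b" arbitrary: b rule: less_induct)
  case less
  let ?\<rho> = "[g, EL enc_nat V0, EL (EL enc_nat) TT, EL enc_nat (pk TT), enc_nat k, enc_nat b]"
  have "n * b \<le> n * B" using less.prems by simp
  then have nb: "n * b \<le> L" using L(5) by (rule order_trans)
  interpret R: run_ctx n E L k b N h
    by unfold_locales (use L N X3 less.prems nb in simp_all)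
  obtain r where r: "runs [EL enc_nat (pk TT), SNil, SNil, SNil, EL enc_nat (pk TT), enc_nat k, g, EL enc_nat V0, EL (EL enc_nat) TT, enc_nat (2 * k), enc_nat b]
     (prog ! 39) r ((3 * k + 2) ^ (b + 1) * R.CB)" "R.bspec {} {} r"
    using R.runs_iter by blast
  have y: "R.yes \<longleftrightarrow> has_hs k" by (simp add: R.yes_def has_hs_def)
  have f: "R.failing \<longleftrightarrow> fails k b" by (simp add: R.failing_def fails_def)
  have spec: "r = enc_bool True \<and> has_hs k \<or> r = SNil \<and> \<not> has_hs k \<or> r = Fail \<and> fails k b"
    using r(2) unfolding R.bspec_def y f has_hs_def by (auto simp: not_le[symmetric])
  have T: "(3 * k + 2) ^ (b + 1) * R.CB + (L + 2) ^ 5000 \<le> iterT k N h B"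
    unfolding iterT_def R.CB_def using less.prems leafT_mono[of b B L N h]
    by (intro add_right_mono mult_le_mono add_mono power_increasing) auto
  have kk: "k + k = 2 * k" by simp
  have "runs ?\<rho> (ECall 2 [EVar 4, EVar 4]) (enc_nat (k + k)) ((L + 2) ^ 3000)"
    unfolding J_def[symmetric]
    using L(2) by - (rule J_fin, (rule jr J_rapp_nat | (simp; fail) | rule refl)+)
  then have k2: "runs ?\<rho> (ECall 2 [EVar 4, EVar 4]) (enc_nat (2 * k)) ((L + 2) ^ 3000)"
    unfolding kk .
  have call: "runs ?\<rho> (ECall 39 [EVar 3, ENil, ENil, ENil, EVar 3, EVar 4, EVar 0, EVar 1, EVar 2,
        ECall 2 [EVar 4, EVar 4], EVar 5]) r ((3 * k + 2) ^ (b + 1) * R.CB + (L + 2) ^ 3000 + 30)"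
    by (rule runs_fin, (rule k2 rr | (simp; fail) | rule r(1))+)
  have P: "50 * (L + 2) ^ 3000 + 200 \<le> (L + 2) ^ 5000" by (rule pow_gap) simp
  show ?case
  proof (cases "r = Fail")
    case False
    have res: "r = enc_bool (has_hs k)" "shd r = SNil" using spec False by (auto simp: enc_bool_def)
    have "1 * iterT k N h B \<le> (B + 1 - b) * iterT k N h B" using less.prems by (intro mult_right_mono) auto
    then show ?thesis
      unfolding prog_nth b_loop_def
      apply -
      apply (rule runs_fin, rule runs_Let, rule call, rule runs_IfF, rule rr, rule rr, simp, simp, rule refl, rule res(2), (rule rr | (simp; fail))+)
       apply (rule res(1))
      using T P by linarith
  next
    case True
    then have "fails k b" using spec by (auto simp: enc_bool_def)
    then have "b \<noteq> B" using B(2) by auto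
    then have b: "1 \<le> b + 1" "b + 1 \<le> B" "B - (b + 1) < B - b" using less.prems by auto
    note IH = less.hyps[OF b(3,1,2)]
    have e: "B + 1 - (b + 1) = B - b" by simp
    have "runs ?\<rho> (prog ! 40) (enc_bool (has_hs k)) ((B + 1 - (b + 1)) * iterT k N h B + iterT k N h B)"
      unfolding prog_nth b_loop_def
      apply (rule runs_fin, rule runs_Let, rule call, rule runs_IfT, rule rr, rule rr, simp, simp, rule refl, simp add: True,
          (rule rr | (simp; fail) | rule IH[simplified])+)
      unfolding e using T P by linarith
    moreover have "(B + 1 - (b + 1)) * iterT k N h B + iterT k N h B = (B + 1 - b) * iterT k N h B"
    proof -
      have "B + 1 - b = Suc (B + 1 - (b + 1))" using b by simp
      then show ?thesis by simp
    qed
    ultimately show ?thesis by simp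
  qed
qed

lemma runs_main:
  assumes n: "1 \<le> n"
  shows "runs [SCons g (enc_nat k)] (ECall 0 [EVar 0]) (enc_bool (has_hs k)) (B * iterT k N h B + (L + 2) ^ 5000)"
proof -
  let ?x = "SCons g (enc_nat k)"
  have g: "g \<noteq> SNil" using n by (simp add: g_def)
  have VV: "VL L V0" by (rule vs_VL[OF vs_V0])
  have TL: "length TT \<le> L" using length_TT L(3) by linarith
  have v: "runs [?x] (ETl (ECall 8 [EHd (EVar 0), ECons ENil ENil])) (EL enc_nat V0) ((L + 2) ^ 4000)"
    unfolding J_def[symmetric]
    by (rule J_fin, (rule jr J_range | (simp; fail))+)
  have t: "runs [EL enc_nat V0, ?x] (ECall 11 [EVar 0, ENil, EHd (EVar 1), EVar 0]) (EL (EL enc_nat) TT) ((L + 2) ^ 4000)"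
    unfolding J_def[symmetric] TT_def
    using VV by - (rule J_fin, (rule jr J_t1[of _ V0] | (simp; fail) | rule eqi)+)
  have p: "runs [EL (EL enc_nat) TT, EL enc_nat V0, ?x] (ECall 12 [EVar 0, ENil]) (EL enc_nat (pk TT)) ((L + 2) ^ 4000)"
    unfolding J_def[symmetric]
    using TL TT_vs by - (rule J_fin, (rule jr J_pack[of _ TT] | (simp; fail) | rule eqi)+)
  let ?\<rho> = "[EL enc_nat (pk TT), EL (EL enc_nat) TT, EL enc_nat V0, ?x]"
  have c: "runs ?\<rho> (ECall 3 [EVar 0, ECall 2 [ETl (EVar 3), ECall 2 [ETl (EVar 3), ETl (EVar 3)]]])
      (enc_bool (length (pk TT) \<le> 3 * k)) ((L + 2) ^ 4000)"
  proof -
    have k3: "J L ?\<rho> (ECall 2 [ETl (EVar 3), ECall 2 [ETl (EVar 3), ETl (EVar 3)]]) (enc_nat (k + (k + k))) 3000"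
      using L(2,8) by - (rule J_fin, (rule jr J_rapp_nat | (simp; fail) | rule refl)+)
    have e: "k + (k + k) = 3 * k" by simp
    show ?thesis
      unfolding J_def[symmetric]
      using L(8) by - (rule J_fin, (rule k3[unfolded e] jr J_le | (simp; fail))+)
  qed
  have P: "50 * (L + 2) ^ 4000 + 200 \<le> (L + 2) ^ 5000" by (rule pow_gap) simp
  show ?thesis
  proof (cases "length (pk TT) \<le> 3 * k")
    case True
    have l: "runs [g, EL enc_nat V0, EL (EL enc_nat) TT, EL enc_nat (pk TT), enc_nat k, enc_nat 1] (prog ! 40)
      (enc_bool (has_hs k)) (B * iterT k N h B)"
      using runs_loop[OF True, of 1] B(1) by simp
    show ?thesis
      apply (rule runs_fin, rule runs_Call, (rule rr | (simp; fail))+)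
        apply (unfold prog_nth b_main_def)
        apply (rule runs_IfT, rule rr, rule rr, simp, simp, rule refl, simp add: g,
          rule runs_Let, rule v, rule runs_Let, rule t, rule runs_Let, rule p, rule runs_IfT[OF c], simp add: True,
          (rule rr | (simp; fail) | rule l[simplified])+)
      using P by linarith
  next
    case False
    have "\<not> has_hs k"
    proof
      assume "has_hs k"
      then obtain S where S: "S \<subseteq> {..<n}" "card S \<le> k" "hits S" by (auto simp: has_hs_def)
      then have "length (pk TT) \<le> 3 * card S" using pk_length finite_subset[OF S(1)] by simp
      then show False using False S(2) by linarith
    qed
    then have e: "SNil = enc_bool (has_hs k)" by (simp add: enc_bool_def)
    show ?thesis
      apply (rule runs_fin, rule runs_Call, (rule rr | (simp; fail))+)
        apply (unfold prog_nth b_main_def)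
        apply (rule runs_IfT, rule rr, rule rr, simp, simp, rule refl, simp add: g,
          rule runs_Let, rule v, rule runs_Let, rule t, rule runs_Let, rule p, rule runs_IfF[OF c], simp add: False,
          rule rr, rule e)
      using P by linarith
  qed
qed

end

end

lemma runs_main_empty: "runs [SCons SNil k] (ECall 0 [EVar 0]) (enc_bool True) 20"
  apply (rule runs_fin, rule runs_Call, (rule rr | (simp; fail))+)
    apply (unfold prog_nth b_main_def)
    apply (rule runs_IfF, rule rr, rule rr, simp, simp, rule refl, simp, (rule rr | (simp; fail))+)
  by (simp_all add: enc_bool_def)

section \<open>Separators as partitions\<close>

definition parts_of :: "(nat \<times> nat) set \<Rightarrow> nat set \<Rightarrow> nat set set \<Rightarrow> bool" where
  "parts_of E W K \<longleftrightarrow> \<Union>K = W \<and> pairwise disjnt K \<and> (\<forall>A\<in>K. \<forall>u\<in>A. \<forall>v\<in>W. (u, v) \<in> E \<longrightarrow> v \<in> A)"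

text \<open>Heredity is turned into a quantification over the subsets W of a single graph, so that
  what follows can forget the class. The parts are closed under edges, but need not be
  connected.\<close>

definition sepprop :: "(nat \<Rightarrow> real) \<Rightarrow> (nat \<times> nat) set \<Rightarrow> nat set \<Rightarrow> bool" where
  "sepprop f E V \<longleftrightarrow> finite V \<and> (\<forall>W\<subseteq>V. \<exists>S K. S \<subseteq> W \<and> parts_of E (W - S) K \<and>
     (\<forall>A\<in>K. real (card A) \<le> 2 / 3 * real (card W)) \<and> real (card S) \<le> f (card W))"

lemma parts_of_subset: "parts_of E W K \<Longrightarrow> A \<in> K \<Longrightarrow> A \<subseteq> W"
  by (auto simp: parts_of_def)

definition sub :: "nat pair_pre_digraph \<Rightarrow> nat set \<Rightarrow> nat pair_pre_digraph" where
  "sub G W = \<lparr> pverts = W, parcs = {e \<in> parcs G. fst e \<in> W \<and> snd e \<in> W} \<rparr>"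

lemma sub_in_class:
  assumes "hereditary \<G>" "G \<in> \<G>" "W \<subseteq> pverts G"
  shows "sub G W \<in> \<G>"
proof -
  have "pair_graph G" using assms unfolding hereditary_def graph_class_def by blast
  then interpret pair_graph G .
  have 1: "wf_digraph (with_proj G)" by unfold_locales
  have 2: "wf_digraph (with_proj (sub G W))" by unfold_locales (auto simp: sub_def)
  have "induced_subgraph (with_proj (sub G W)) (with_proj G)"
    unfolding induced_subgraph_def subgraph_def compatible_def
    using 1 2 assms(3) by (auto simp: sub_def)
  then show ?thesis using assms(1,2) unfolding hereditary_def by blast
qed

lemma parcs_sym: "pair_graph G \<Longrightarrow> (u, v) \<in> parcs G \<Longrightarrow> (v, u) \<in> parcs G"
proof -
  assume "pair_graph G" and uv: "(u, v) \<in> parcs G"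
  then interpret pair_graph G by simp
  have "sym (parcs G)" using pair_sym_arcs by (simp add: symmetric_def)
  then show ?thesis using uv by (rule symD)
qed

lemma class_sepprop:
  assumes "hereditary \<G>" "has_separators \<G> f" "G \<in> \<G>"
  shows "sepprop f (parcs G) (pverts G)"
proof -
  have "pair_graph G" using assms unfolding hereditary_def graph_class_def by blast
  then interpret pair_graph G .
  show ?thesis
    unfolding sepprop_def
  proof (intro conjI allI impI)
    show "finite (pverts G)" by (rule pair_finite_verts)
    fix W assume W: "W \<subseteq> pverts G"
    define H where "H = sub G W"
    have H: "H \<in> \<G>" unfolding H_def using sub_in_class[OF assms(1,3) W] .
    then obtain S where S: "balanced_separator H S" "real (card S) \<le> f (card W)"
      using assms(2) by (auto simp: has_separators_def H_def sub_def)
    define D where "D = with_proj H \<restriction> (W - S)"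
    have arcs: "arcs D = {e \<in> parcs G. fst e \<in> W - S \<and> snd e \<in> W - S}"
      by (auto simp: D_def induce_subgraph_def H_def sub_def)
    interpret D: wf_digraph D by unfold_locales (auto simp: D_def induce_subgraph_def)
    have vD: "verts D = W - S" by (simp add: D_def)
    have ends: "arcs_ends D = {e \<in> parcs G. fst e \<in> W - S \<and> snd e \<in> W - S}"
      unfolding arcs_ends_def arcs by (auto simp: arc_to_ends_def D_def induce_subgraph_def image_iff)
    let ?K = "D.sccs_verts"
    have "parts_of (parcs G) (W - S) ?K"
      unfolding parts_of_def
    proof (intro conjI ballI impI)
      show "\<Union> ?K = W - S"
      proof
        show "\<Union> ?K \<subseteq> W - S" using D.sccs_verts_subsets vD by blast
        show "W - S \<subseteq> \<Union> ?K"
        proof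
          fix u assume "u \<in> W - S"
          then have "u \<in> verts D" by (simp add: vD)
          then show "u \<in> \<Union> ?K" using D.scc_of_in_sccs_verts D.in_scc_of_self by blast
        qed
      qed
      show "pairwise disjnt ?K"
        unfolding pairwise_def disjnt_def using D.sccs_verts_disjoint by blast
      fix A u v assume A: "A \<in> ?K" "u \<in> A" "v \<in> W - S" "(u, v) \<in> parcs G"
      have "u \<in> W - S" using A D.sccs_verts_subsets vD by blast
      \<comment> \<open>By symmetry an arc goes both ways, so its ends are in the same strong
        component and the strong components are closed under arcs.\<close>
      moreover have "(v, u) \<in> parcs G" using A(4) by (rule parcs_sym[OF \<open>pair_graph G\<close>])
      ultimately have "u \<rightarrow>\<^bsub>D\<^esub> v" "v \<rightarrow>\<^bsub>D\<^esub> u" using A ends by auto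
      then have "u \<rightarrow>\<^sup>*\<^bsub>D\<^esub> v" "v \<rightarrow>\<^sup>*\<^bsub>D\<^esub> u" by (auto intro: D.reachable_adjI)
      then show "v \<in> A" using A(1,2) unfolding D.in_sccs_verts_conv_reachable by blast
    qed
    moreover have "\<forall>A\<in>?K. real (card A) \<le> 2 / 3 * real (card W)" "S \<subseteq> W"
      using S(1) unfolding balanced_separator_def D_def by (auto simp: H_def sub_def)
    ultimately show "\<exists>S K. S \<subseteq> W \<and> parts_of (parcs G) (W - S) K \<and>
       (\<forall>A\<in>K. real (card A) \<le> 2 / 3 * real (card W)) \<and> real (card S) \<le> f (card W)"
      using S(2) by blast
  qed
qed

section \<open>Fragmentation\<close>

text \<open>Charging a separator of a piece of size m to the vertices of the piece, each vertex pays a geometric series.\<close>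

lemma fragmentation:
  assumes "0 \<le> \<delta>" "\<delta> < 1" "0 < \<beta>" "0 < (\<epsilon>::real)"
  shows "\<exists>r::nat. \<forall>E V. sepprop (\<lambda>n. \<beta> * real n powr \<delta>) E V \<longrightarrow>
    (\<forall>W\<subseteq>V. \<exists>S K. S \<subseteq> W \<and> parts_of E (W - S) K \<and> (\<forall>A\<in>K. card A \<le> r) \<and> real (card S) \<le> \<epsilon> * real (card W))"
proof -
  define c where "c = (3/2::real) powr (1 - \<delta>)"
  have c: "1 < c" unfolding c_def using assms by (intro gr_one_powr) auto
  \<comment> \<open>When a size shrinks to 2/3, its power with exponent \<delta> - 1 grows by the
    factor c. The choice of \<kappa> makes \<kappa> c = \<kappa> + \<beta>, so that passing to the
    parts releases exactly the cost of one separator.\<close>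
  define \<kappa> where "\<kappa> = \<beta> / (c - 1)"
  have \<kappa>: "0 < \<kappa>" "\<kappa> * c = \<kappa> + \<beta>" using c assms by (auto simp: \<kappa>_def field_simps)
  define q where "q x = x powr (\<delta> - 1)" for x :: real
  define r0 where "r0 = max 1 ((\<epsilon> / \<kappa>) powr (1 / (\<delta> - 1)))"
  have r0: "1 \<le> r0" by (simp add: r0_def)
  have qmono: "q y \<le> q x" if "0 < x" "x \<le> y" for x y
    unfolding q_def using that assms by (intro powr_mono2') auto
  have "q r0 \<le> \<epsilon> / \<kappa>"
  proof -
    have "q r0 \<le> q ((\<epsilon> / \<kappa>) powr (1 / (\<delta> - 1)))" using assms \<kappa> by (intro qmono) (auto simp: r0_def)
    also have "\<dots> = \<epsilon> / \<kappa>" unfolding q_def using assms \<kappa> by (simp add: powr_powr)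
    finally show ?thesis .
  qed
  then have kq: "\<kappa> * q r0 \<le> \<epsilon>" using \<kappa> by (simp add: field_simps)
  define r where "r = nat \<lceil>2 * r0\<rceil>"
  have q0: "0 \<le> q x" for x by (simp add: q_def)
  show ?thesis
  proof (intro exI[of _ r] allI impI)
    fix E V W
    assume sp: "sepprop (\<lambda>n. \<beta> * real n powr \<delta>) E V" and "W \<subseteq> V"
    \<comment> \<open>Each vertex pays \<kappa> times the increase of \<open>q\<close> from the
      current size down to \<open>r0\<close>. The subtracted term is what closes the induction; in
      the end it is dropped, and \<kappa> \<open>q r0\<close> is at most \<epsilon>.\<close>
    have "\<exists>S K. S \<subseteq> W \<and> parts_of E (W - S) K \<and> (\<forall>A\<in>K. card A \<le> r) \<and>
        real (card S) \<le> real (card W) * \<kappa> * (q r0 - q (max (real (card W)) r0))"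
      using \<open>W \<subseteq> V\<close>
    proof (induction "card W" arbitrary: W rule: less_induct)
      case less
      let ?m = "real (card W)"
      have fW: "finite W" using less.prems sp finite_subset by (auto simp: sepprop_def)
      show ?case
      proof (cases "?m \<le> 2 * r0")
        case True
        have "card W \<le> r" unfolding r_def using True by linarith
        moreover have "parts_of E (W - {}) {W}" by (auto simp: parts_of_def)
        moreover have "0 \<le> q r0 - q (max ?m r0)" using qmono[of r0 "max ?m r0"] r0 by simp
        ultimately show ?thesis using \<kappa> by (intro exI[of _ "{}"] exI[of _ "{W}"]) auto
      next
        case False
        obtain S0 K0 where S0: "S0 \<subseteq> W" "parts_of E (W - S0) K0" "\<forall>A\<in>K0. real (card A) \<le> 2 / 3 * ?m"
          "real (card S0) \<le> \<beta> * ?m powr \<delta>"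
          using sp less.prems unfolding sepprop_def by meson
        have m: "0 < ?m" "2 * r0 < ?m" using False r0 by auto
        have AW: "A \<subseteq> W" if "A \<in> K0" for A using parts_of_subset[OF S0(2) that] by auto
        have "\<exists>S K. S \<subseteq> A \<and> parts_of E (A - S) K \<and> (\<forall>B\<in>K. card B \<le> r) \<and>
            real (card S) \<le> real (card A) * \<kappa> * (q r0 - q (2 / 3 * ?m))" if A: "A \<in> K0" for A
        proof -
          have "real (card A) \<le> 2 / 3 * ?m" using S0(3) A by blast
          then have "card A < card W" using m by linarith
          then obtain S K where SK: "S \<subseteq> A" "parts_of E (A - S) K" "\<forall>B\<in>K. card B \<le> r"
            "real (card S) \<le> real (card A) * \<kappa> * (q r0 - q (max (real (card A)) r0))"
            using less.hyps[of A] AW[OF A] less.prems by (meson order_trans)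
          have "q (2 / 3 * ?m) \<le> q (max (real (card A)) r0)"
            using S0(3) A r0 m by (intro qmono) auto
          then have "real (card A) * \<kappa> * (q r0 - q (max (real (card A)) r0)) \<le> real (card A) * \<kappa> * (q r0 - q (2 / 3 * ?m))"
            using \<kappa> by (intro mult_left_mono) auto
          then show ?thesis using SK by (meson order_trans)
        qed
        then obtain SS KK where SK: "\<And>A. A \<in> K0 \<Longrightarrow> SS A \<subseteq> A" "\<And>A. A \<in> K0 \<Longrightarrow> parts_of E (A - SS A) (KK A)"
          "\<And>A B. A \<in> K0 \<Longrightarrow> B \<in> KK A \<Longrightarrow> card B \<le> r"
          "\<And>A. A \<in> K0 \<Longrightarrow> real (card (SS A)) \<le> real (card A) * \<kappa> * (q r0 - q (2 / 3 * ?m))"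
          by metis
        define S where "S = S0 \<union> (\<Union>A\<in>K0. SS A)"
        define K where "K = (\<Union>A\<in>K0. KK A)"
        have dj: "A = B" if "A \<in> K0" "B \<in> K0" "x \<in> A" "x \<in> B" for A B x
          using S0(2) that unfolding parts_of_def pairwise_def disjnt_def by blast
        have U0: "\<Union> K0 = W - S0" using S0(2) by (simp add: parts_of_def)
        have fK0: "finite K0" using fW U0 by (metis finite_Diff finite_UnionD)
        have KA: "\<Union> (KK A) = A - SS A" if "A \<in> K0" for A using SK(2)[OF that] by (simp add: parts_of_def)
        have inS: "x \<in> S \<longleftrightarrow> x \<in> SS A" if "A \<in> K0" "x \<in> A" for x A
          using that dj SK(1) U0 by (fastforce simp: S_def)
        have "parts_of E (W - S) K"
          unfolding parts_of_def
        proof (intro conjI ballI impI)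
          show "\<Union> K = W - S"
          proof (intro set_eqI iffI)
            fix x assume "x \<in> \<Union> K"
            then obtain A where A: "A \<in> K0" "x \<in> A - SS A" using KA by (fastforce simp: K_def)
            then show "x \<in> W - S" using inS[of A x] AW by auto
          next
            fix x assume x: "x \<in> W - S"
            then have "x \<in> \<Union> K0" using U0 by (auto simp: S_def)
            then obtain A where A: "A \<in> K0" "x \<in> A" by auto
            then have "x \<in> \<Union> (KK A)" using KA inS[OF A] x by auto
            then show "x \<in> \<Union> K" using A by (auto simp: K_def)
          qed
          show "pairwise disjnt K"
            unfolding pairwise_def disjnt_def
          proof (intro ballI impI)
            fix B C assume B: "B \<in> K" "C \<in> K" "B \<noteq> C"
            then obtain A A' where A: "A \<in> K0" "B \<in> KK A" "A' \<in> K0" "C \<in> KK A'" by (auto simp: K_def)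
            show "B \<inter> C = {}"
            proof (cases "A = A'")
              case True
              then show ?thesis using SK(2)[OF A(1)] A B(3) by (auto simp: parts_of_def pairwise_def disjnt_def)
            next
              case False
              have "B \<subseteq> A" "C \<subseteq> A'" using KA A by auto
              then show ?thesis using dj[OF A(1,3)] False by blast
            qed
          qed
          fix B u v assume B: "B \<in> K" "u \<in> B" "v \<in> W - S" "(u, v) \<in> E"
          then obtain A where A: "A \<in> K0" "B \<in> KK A" by (auto simp: K_def)
          have uA: "u \<in> A" using KA[OF A(1)] A B by auto
          have "v \<in> W - S0" using B by (auto simp: S_def)
          then have vA: "v \<in> A" using S0(2) A(1) uA B(4) unfolding parts_of_def by blast
          then have "v \<in> A - SS A" using inS[OF A(1) vA] B(3) by auto
          then show "v \<in> B" using SK(2)[OF A(1)] A(2) B(2,4) unfolding parts_of_def by blast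
        qed
        moreover have "S \<subseteq> W" using S0(1) SK(1) AW unfolding S_def by blast
        moreover have "\<forall>A\<in>K. card A \<le> r" using SK(3) by (auto simp: K_def)
        moreover have "real (card S) \<le> ?m * \<kappa> * (q r0 - q (max ?m r0))"
        proof -
          have "card S \<le> card S0 + (\<Sum>A\<in>K0. card (SS A))"
            unfolding S_def by (rule order_trans[OF card_Un_le add_left_mono[OF card_UN_le[OF fK0]]])
          then have "real (card S) \<le> real (card S0) + (\<Sum>A\<in>K0. real (card (SS A)))"
            by (metis of_nat_add of_nat_le_iff of_nat_sum)
          also have "(\<Sum>A\<in>K0. real (card (SS A))) \<le> (\<Sum>A\<in>K0. real (card A) * \<kappa> * (q r0 - q (2 / 3 * ?m)))"
            using SK(4) by (rule sum_mono)
          also have "\<dots> = real (\<Sum>A\<in>K0. card A) * \<kappa> * (q r0 - q (2 / 3 * ?m))"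
            by (simp add: sum_distrib_right)
          also have "\<dots> \<le> ?m * \<kappa> * (q r0 - q (2 / 3 * ?m))"
          proof -
            have "(\<Sum>A\<in>K0. card A) = card (\<Union> K0)"
              using S0(2) finite_subset[OF AW fW] by (subst card_Union_disjoint) (auto simp: parts_of_def)
            also have "\<dots> \<le> card W" unfolding U0 using fW by (intro card_mono) auto
            finally have "real (\<Sum>A\<in>K0. card A) \<le> ?m" by linarith
            moreover have "0 \<le> q r0 - q (2 / 3 * ?m)" using qmono[of r0 "2 / 3 * ?m"] r0 m by simp
            ultimately show ?thesis using \<kappa> by (intro mult_right_mono) auto
          qed
          also have "q (2 / 3 * ?m) = c * q ?m"
          proof -
            have e1: "(2/3::real) powr (\<delta> - 1) = c"
              using powr_minus_divide[of "2/3::real" "1 - \<delta>"] by (simp add: c_def powr_divide)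
            have e2: "(2 / 3 * ?m) powr (\<delta> - 1) = (2 / 3) powr (\<delta> - 1) * ?m powr (\<delta> - 1)"
              by (rule powr_mult)
            show ?thesis unfolding q_def e2 e1 by (rule refl)
          qed
          also have "real (card S0) \<le> \<beta> * (?m * q ?m)"
          proof -
            have "?m * q ?m = ?m powr \<delta>" using m powr_add[of ?m 1 "\<delta> - 1"] by (simp add: q_def)
            then show ?thesis using S0(4) by simp
          qed
          finally have "real (card S) \<le> \<beta> * (?m * q ?m) + ?m * \<kappa> * (q r0 - c * q ?m)" by simp
          also have "\<dots> = ?m * \<kappa> * q r0 + ?m * q ?m * (\<beta> - \<kappa> * c)" by (simp add: algebra_simps)
          also have "\<dots> = ?m * \<kappa> * (q r0 - q ?m)" using \<kappa>(2) by (simp add: algebra_simps)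
          finally show ?thesis using m r0 by (simp add: max_def)
        qed
        ultimately show ?thesis by blast
      qed
    qed
    then obtain S K where SK: "S \<subseteq> W" "parts_of E (W - S) K" "\<forall>A\<in>K. card A \<le> r"
      "real (card S) \<le> real (card W) * \<kappa> * (q r0 - q (max (real (card W)) r0))" by blast
    have "real (card W) * \<kappa> * (q r0 - q (max (real (card W)) r0)) \<le> real (card W) * (\<kappa> * q r0)"
      using q0 \<kappa> by (simp add: algebra_simps)
    also have "\<dots> \<le> \<epsilon> * real (card W)" using mult_left_mono[OF kq, of "real (card W)"] by (simp add: mult.commute)
    finally show "\<exists>S K. S \<subseteq> W \<and> parts_of E (W - S) K \<and> (\<forall>A\<in>K. card A \<le> r) \<and> real (card S) \<le> \<epsilon> * real (card W)"
      using SK by (meson order_trans)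
  qed
qed

section \<open>Locally sparse subgraphs\<close>

lemma card_fibres:
  assumes "finite A" "finite X" "f ` A \<subseteq> X"
  shows "(\<Sum>x\<in>X. card {e \<in> A. f e = x}) = card A"
proof -
  have "(\<Sum>x\<in>X. card {e \<in> A. f e = x}) = card (\<Union>x\<in>X. {e \<in> A. f e = x})"
    using assms by (subst card_UN_disjoint) auto
  also have "(\<Union>x\<in>X. {e \<in> A. f e = x}) = A" using assms(3) by auto
  finally show ?thesis .
qed

definition dg :: "(nat \<times> nat) set \<Rightarrow> nat \<Rightarrow> nat" where
  "dg A x = card {e \<in> A. fst e = x \<or> snd e = x}"

lemma sum_dg:
  assumes "finite A" "finite X" "A \<subseteq> X \<times> X"
  shows "(\<Sum>x\<in>X. dg A x) \<le> 2 * card A"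
proof -
  have "dg A x \<le> card {e \<in> A. fst e = x} + card {e \<in> A. snd e = x}" for x
  proof -
    have "{e \<in> A. fst e = x \<or> snd e = x} = {e \<in> A. fst e = x} \<union> {e \<in> A. snd e = x}" by auto
    then show ?thesis unfolding dg_def by (simp only: card_Un_le)
  qed
  then have "(\<Sum>x\<in>X. dg A x) \<le> (\<Sum>x\<in>X. card {e \<in> A. fst e = x} + card {e \<in> A. snd e = x})"
    by (rule sum_mono)
  also have "\<dots> = card A + card A"
    using assms by (subst sum.distrib, subst card_fibres, simp, simp, force, subst card_fibres, simp, simp, force, simp)
  finally show ?thesis by simp
qed

lemma dg_fst: "finite A \<Longrightarrow> card {e \<in> A. fst e = x} \<le> dg A x"
  unfolding dg_def by (intro card_mono) auto

lemma dg_insert: "finite A \<Longrightarrow> dg (insert e A) x \<le> dg A x + (if fst e = x \<or> snd e = x then 1 else 0)"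
proof -
  assume A: "finite A"
  show ?thesis
  proof (cases "fst e = x \<or> snd e = x")
    case True
    then have "{e' \<in> insert e A. fst e' = x \<or> snd e' = x} = insert e {e' \<in> A. fst e' = x \<or> snd e' = x}" by auto
    then show ?thesis using True A by (simp add: dg_def card_insert_if)
  next
    case False
    then have "{e' \<in> insert e A. fst e' = x \<or> snd e' = x} = {e' \<in> A. fst e' = x \<or> snd e' = x}" by auto
    then show ?thesis using False by (simp add: dg_def)
  qed
qed

definition uadj :: "(nat \<times> nat) set \<Rightarrow> (nat \<times> nat) set" where
  "uadj A = A \<union> A\<inverse>"

lemma finite_uadj [simp]: "finite A \<Longrightarrow> finite (uadj A)"
  by (simp add: uadj_def)

lemma card_uadj_image: "finite A \<Longrightarrow> card (uadj A `` {x}) \<le> dg A x"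
proof -
  assume A: "finite A"
  have "uadj A `` {x} \<subseteq> (\<lambda>e. if fst e = x then snd e else fst e) ` {e \<in> A. fst e = x \<or> snd e = x}"
    by (force simp: uadj_def image_iff)
  then have "card (uadj A `` {x}) \<le> card ((\<lambda>e. if fst e = x then snd e else fst e) ` {e \<in> A. fst e = x \<or> snd e = x})"
    using A by (intro card_mono) auto
  also have "\<dots> \<le> dg A x" unfolding dg_def using A by (intro card_image_le) auto
  finally show ?thesis .
qed

text \<open>Greedily built subgraphs of maximum degree \<open>d\<close> without short cycles.\<close>

inductive sparse :: "(nat \<times> nat) set \<Rightarrow> nat \<Rightarrow> nat \<Rightarrow> (nat \<times> nat) set \<Rightarrow> bool" for F d l where
  sparse_empty: "sparse F d l {}"
| sparse_insert: "sparse F d l A \<Longrightarrow> (x, y) \<in> F \<Longrightarrow> dg A x < d \<Longrightarrow> dg A y < d \<Longrightarrow>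
    (\<And>j. j \<le> l \<Longrightarrow> (x, y) \<notin> uadj A ^^ j) \<Longrightarrow> sparse F d l (insert (x, y) A)"

lemma sparse_subset: "sparse F d l A \<Longrightarrow> A \<subseteq> F"
  by (induction rule: sparse.induct) auto

lemma sparse_finite: "sparse F d l A \<Longrightarrow> finite A"
  by (induction rule: sparse.induct) auto

lemma sparse_dg: "sparse F d l A \<Longrightarrow> dg A z \<le> d"
proof (induction rule: sparse.induct)
  case sparse_empty
  then show ?case by (simp add: dg_def)
next
  case (sparse_insert A x y)
  then show ?case using dg_insert[OF sparse_finite[OF sparse_insert(1)], of "(x, y)" z] by (auto split: if_splits)
qed

lemma relpow_mono': "(R :: (nat \<times> nat) set) \<subseteq> S \<Longrightarrow> R ^^ j \<subseteq> S ^^ j"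
  by (induction j) (auto dest: subsetD)

text \<open>The function f names the components of A inside Z. A new edge joins different names, for
  otherwise a walk inside Z of length at most |Z|^2, hence at most \<open>l\<close>, would already
  connect its ends. Each edge therefore merges two names, and edges plus names never exceed
  |Z|.\<close>

lemma sparse_forest:
  assumes "sparse F d l A" "finite Z" "card Z * card Z \<le> l"
  shows "card (A \<inter> Z \<times> Z) \<le> card Z"
proof -
  have "\<exists>f :: nat \<Rightarrow> nat. (\<forall>u\<in>Z. \<forall>v\<in>Z. f u = f v \<longrightarrow> (u, v) \<in> (uadj (A \<inter> Z \<times> Z))\<^sup>*) \<and> card (A \<inter> Z \<times> Z) + card (f ` Z) \<le> card Z"
    using assms(1)
  proof (induction rule: sparse.induct)
    case sparse_empty
    then show ?case by (intro exI[of _ "\<lambda>x. x"]) auto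
  next
    case (sparse_insert A x y)
    let ?R = "uadj (A \<inter> Z \<times> Z)"
    let ?R' = "uadj (insert (x, y) A \<inter> Z \<times> Z)"
    obtain f :: "nat \<Rightarrow> nat" where f0: "\<forall>u\<in>Z. \<forall>v\<in>Z. f u = f v \<longrightarrow> (u, v) \<in> ?R\<^sup>*" "card (A \<inter> Z \<times> Z) + card (f ` Z) \<le> card Z"
      using sparse_insert.IH by (elim exE conjE) (rule that)
    have f: "\<And>u v. u \<in> Z \<Longrightarrow> v \<in> Z \<Longrightarrow> f u = f v \<Longrightarrow> (u, v) \<in> ?R\<^sup>*" "card (A \<inter> Z \<times> Z) + card (f ` Z) \<le> card Z"
      using f0 by simp_all
    have fA: "finite (A \<inter> Z \<times> Z)" using sparse_finite[OF sparse_insert(1)] by simp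
    have mono: "?R \<subseteq> ?R'" by (auto simp: uadj_def)
    then have mono': "?R\<^sup>* \<subseteq> ?R'\<^sup>*" by (rule rtrancl_mono)
    show ?case
    proof (cases "x \<in> Z \<and> y \<in> Z")
      case False
      then have "insert (x, y) A \<inter> Z \<times> Z = A \<inter> Z \<times> Z" by auto
      then show ?thesis using f by auto
    next
      case True
      have neq: "f x \<noteq> f y"
      proof
        assume "f x = f y"
        then have "(x, y) \<in> ?R\<^sup>*" using f(1) True by blast
        then obtain j where j: "j \<le> card ?R" "(x, y) \<in> ?R ^^ j"
          using rtrancl_finite_eq_relpow[of ?R] fA by auto
        have "card ?R \<le> card (Z \<times> Z)" using assms(2) by (intro card_mono) (auto simp: uadj_def)
        then have "j \<le> l" using j(1) assms(3) by (simp add: card_cartesian_product)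
        moreover have "?R ^^ j \<subseteq> uadj A ^^ j" by (rule relpow_mono') (auto simp: uadj_def)
        ultimately show False using sparse_insert.hyps(5) j(2) by blast
      qed
      define f' where "f' z = (if f z = f x then f y else f z)" for z
      have "f' ` Z \<subseteq> f ` Z - {f x}" using True neq by (auto simp: f'_def)
      then have "card (f' ` Z) \<le> card (f ` Z - {f x})" using assms(2) by (intro card_mono) auto
      also have "\<dots> < card (f ` Z)" using True assms(2) by (intro card_Diff1_less) auto
      finally have c: "card (f' ` Z) < card (f ` Z)" .
      have "insert (x, y) A \<inter> Z \<times> Z = insert (x, y) (A \<inter> Z \<times> Z)" using True by auto
      then have "card (insert (x, y) A \<inter> Z \<times> Z) \<le> Suc (card (A \<inter> Z \<times> Z))" using fA by (simp add: card_insert_if)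
      then have "card (insert (x, y) A \<inter> Z \<times> Z) + card (f' ` Z) \<le> card Z" using c f(2) by linarith
      moreover have xy: "(x, y) \<in> ?R'" "(y, x) \<in> ?R'" using True by (auto simp: uadj_def)
      have "(u, v) \<in> ?R'\<^sup>*" if uv: "u \<in> Z" "v \<in> Z" "f' u = f' v" for u v
      proof -
        consider "f u = f v" | "f u = f x" "f v = f y" | "f u = f y" "f v = f x"
          using uv(3) unfolding f'_def by (auto split: if_splits)
        then show ?thesis
        proof cases
          case 1
          then show ?thesis using f(1)[OF uv(1,2)] mono' by blast
        next
          case 2
          then have "(u, x) \<in> ?R'\<^sup>*" "(y, v) \<in> ?R'\<^sup>*"
            using f(1)[of u x] f(1)[of y v] uv True mono' by auto
          then show ?thesis using xy by (meson converse_rtrancl_into_rtrancl rtrancl_trans)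
        next
          case 3
          then have "(u, y) \<in> ?R'\<^sup>*" "(x, v) \<in> ?R'\<^sup>*"
            using f(1)[of u y] f(1)[of x v] uv True mono' by auto
          then show ?thesis using xy by (meson converse_rtrancl_into_rtrancl rtrancl_trans)
        qed
      qed
      ultimately show ?thesis by (intro exI[of _ f']) auto
    qed
  qed
  then show ?thesis by auto
qed

lemma card_relpow_image:
  assumes "finite A" "\<And>z. dg A z \<le> d"
  shows "finite ((uadj A ^^ j) `` {x}) \<and> card ((uadj A ^^ j) `` {x}) \<le> d ^ j"
proof (induction j)
  case (Suc j)
  let ?B = "(uadj A ^^ j) `` {x}"
  have eq: "(uadj A ^^ Suc j) `` {x} = (\<Union>z\<in>?B. uadj A `` {z})" by auto
  have fin: "finite (uadj A `` {z})" for z using assms(1) by (simp add: finite_Image)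
  have "card (\<Union>z\<in>?B. uadj A `` {z}) \<le> (\<Sum>z\<in>?B. card (uadj A `` {z}))" using Suc by (intro card_UN_le) simp
  also have "\<dots> \<le> (\<Sum>z\<in>?B. d)" using card_uadj_image[OF assms(1)] assms(2) by (intro sum_mono) (meson order_trans)
  also have "\<dots> \<le> d ^ Suc j" using Suc by simp
  finally show ?case using eq Suc fin by auto
qed simp

section \<open>Subdivisions\<close>

text \<open>The graph F on X has a 1-subdivision in E with subdividing vertices y. Listing pairs in
  increasing order counts each edge once. The subdivision need not be induced, since a separator of
  the induced graph on the same vertices separates it as well.\<close>

definition subdiv :: "(nat \<times> nat) set \<Rightarrow> nat set \<Rightarrow> nat set \<Rightarrow> (nat \<times> nat) set \<Rightarrow> (nat \<times> nat \<Rightarrow> nat) \<Rightarrow> bool" where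
  "subdiv E V X F y \<longleftrightarrow> X \<subseteq> V \<and> F \<subseteq> X \<times> X \<and> (\<forall>e\<in>F. fst e < snd e) \<and> inj_on y F \<and> y ` F \<subseteq> V - X \<and>
     (\<forall>e\<in>F. (y e, fst e) \<in> E \<and> (y e, snd e) \<in> E)"

lemma subdiv_restrict: "subdiv E V X F y \<Longrightarrow> Z \<subseteq> X \<Longrightarrow> subdiv E V Z (F \<inter> Z \<times> Z) y"
  unfolding subdiv_def by (auto intro: inj_on_subset)

text \<open>Here F attains the largest ratio \<rho> of edges to the power 1 + \<eta> of the number
  of vertices. Cut X into at most 2m/a blocks of size at most a. Every edge at A lies in the union
  of A and some block, which carries at most \<rho> (2a)^(1 + \<eta>) edges. In total this is at
  most 8 (a/m)^\<eta> |F|, and 1/32 is chosen to leave |F| / 4.\<close>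

lemma incident_few:
  assumes X: "finite X" "card X = m" and F: "finite F" "F \<subseteq> X \<times> X"
    and \<eta>: "0 < \<eta>" "\<eta> \<le> 1" and \<rho>: "0 \<le> \<rho>" "real (card F) = \<rho> * real m powr (1 + \<eta>)"
    and sub: "\<And>Z. Z \<subseteq> X \<Longrightarrow> real (card (F \<inter> Z \<times> Z)) \<le> \<rho> * real (card Z) powr (1 + \<eta>)"
    and a: "1 \<le> a" "a \<le> m" "(real a / real m) powr \<eta> \<le> 1 / 32"
    and A: "A \<subseteq> X" "card A \<le> a"
  shows "real (card {e \<in> F. fst e \<in> A \<or> snd e \<in> A}) \<le> real (card F) / 4"
proof -
  obtain f where f: "bij_betw f X {..<m}" using ex_bij_betw_finite_nat[OF X(1)] X(2) by (auto simp: atLeast0LessThan)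
  define B where "B j = {x \<in> X. f x div a = j}" for j
  have cB: "card (B j) \<le> a" for j
  proof -
    have "inj_on f (B j)" using f by (auto simp: bij_betw_def B_def inj_on_def)
    moreover have "f ` B j \<subseteq> {j * a..<j * a + a}"
    proof
      fix z assume "z \<in> f ` B j"
      then have "z div a = j" by (auto simp: B_def)
      then have "z = j * a + z mod a" using div_mult_mod_eq[of z a] by simp
      moreover have "z mod a < a" using a(1) by simp
      ultimately show "z \<in> {j * a..<j * a + a}" by (metis atLeastLessThan_iff le_add1 nat_add_left_cancel_less)
    qed
    ultimately show ?thesis using card_inj_on_le[of f "B j" "{j * a..<j * a + a}"] by simp
  qed
  let ?nb = "m div a + 1"
  have "{e \<in> F. fst e \<in> A \<or> snd e \<in> A} \<subseteq> (\<Union>j<?nb. F \<inter> (A \<union> B j) \<times> (A \<union> B j))"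
  proof
    fix e assume e: "e \<in> {e \<in> F. fst e \<in> A \<or> snd e \<in> A}"
    then have ex: "fst e \<in> X" "snd e \<in> X" using F(2) by auto
    have lt: "f x div a < ?nb" if "x \<in> X" for x
    proof -
      have "f x < m" using f that by (auto simp: bij_betw_def)
      then show ?thesis using div_le_mono[of "f x" m a] by linarith
    qed
    define x where "x = (if fst e \<in> A then snd e else fst e)"
    have "x \<in> X" "e \<in> F \<inter> (A \<union> B (f x div a)) \<times> (A \<union> B (f x div a))"
      using e ex by (cases e; auto simp: x_def B_def)+
    then show "e \<in> (\<Union>j<?nb. F \<inter> (A \<union> B j) \<times> (A \<union> B j))" using lt by blast
  qed
  then have "card {e \<in> F. fst e \<in> A \<or> snd e \<in> A} \<le> card (\<Union>j<?nb. F \<inter> (A \<union> B j) \<times> (A \<union> B j))"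
    using F(1) by (intro card_mono) auto
  also have "\<dots> \<le> (\<Sum>j<?nb. card (F \<inter> (A \<union> B j) \<times> (A \<union> B j)))" by (rule card_UN_le) simp
  finally have "real (card {e \<in> F. fst e \<in> A \<or> snd e \<in> A}) \<le> real (\<Sum>j<?nb. card (F \<inter> (A \<union> B j) \<times> (A \<union> B j)))"
    by (rule of_nat_mono)
  also have "\<dots> = (\<Sum>j<?nb. real (card (F \<inter> (A \<union> B j) \<times> (A \<union> B j))))" by (rule of_nat_sum)
  also have "\<dots> \<le> (\<Sum>j<?nb. \<rho> * (2 * real a) powr (1 + \<eta>))"
  proof (rule sum_mono)
    fix j
    have "card (A \<union> B j) \<le> 2 * a" using card_Un_le[of A "B j"] A(2) cB[of j] by linarith
    then have "real (card (A \<union> B j)) powr (1 + \<eta>) \<le> (2 * real a) powr (1 + \<eta>)"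
      using \<eta> by (intro powr_mono2) auto
    then have "\<rho> * real (card (A \<union> B j)) powr (1 + \<eta>) \<le> \<rho> * (2 * real a) powr (1 + \<eta>)"
      using \<rho>(1) by (rule mult_left_mono)
    moreover have "A \<union> B j \<subseteq> X" using A(1) by (auto simp: B_def)
    ultimately show "real (card (F \<inter> (A \<union> B j) \<times> (A \<union> B j))) \<le> \<rho> * (2 * real a) powr (1 + \<eta>)"
      using sub by (meson order_trans)
  qed
  also have "\<dots> = real ?nb * (\<rho> * (2 * real a) powr (1 + \<eta>))" by simp
  also have "\<dots> \<le> (2 * real m / real a) * (\<rho> * (2 * real a) powr (1 + \<eta>))"
  proof (rule mult_right_mono)
    have "real (m div a) \<le> real m / real a" 
    proof -
      have "m div a * a \<le> m" by (rule div_times_less_eq_dividend)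
      then have "real (m div a) * real a \<le> real m" unfolding of_nat_mult[symmetric] by (rule of_nat_mono)
      then show ?thesis using a(1) by (simp add: pos_le_divide_eq)
    qed
    moreover have "1 \<le> real m / real a" using a by (simp add: field_simps)
    ultimately show "real ?nb \<le> 2 * real m / real a" by simp
  qed (use \<rho> in simp)
  also have "\<dots> = 4 * 2 powr \<eta> * (\<rho> * real m * real a powr \<eta>)"
    using a by (simp add: powr_add powr_mult field_simps)
  also have "real a powr \<eta> = (real a / real m) powr \<eta> * real m powr \<eta>"
    using a by (simp add: powr_divide)
  also have "\<rho> * real m * ((real a / real m) powr \<eta> * real m powr \<eta>) = (real a / real m) powr \<eta> * real (card F)"
    using a \<rho>(2) by (simp add: powr_add field_simps)
  also have "4 * 2 powr \<eta> * ((real a / real m) powr \<eta> * real (card F)) \<le> 8 * (1 / 32 * real (card F))"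
  proof (rule mult_mono)
    have "2 powr \<eta> \<le> 2 powr (1::real)" using \<eta> by (intro powr_mono) auto
    then show "4 * 2 powr \<eta> \<le> (8::real)" by simp
    show "(real a / real m) powr \<eta> * real (card F) \<le> 1 / 32 * real (card F)"
      using a(3) by (rule mult_right_mono) simp
  qed auto
  finally show ?thesis by simp
qed

section \<open>Density of subdivisions\<close>

lemma sparse_maximal:
  assumes "finite F"
  shows "\<exists>A. sparse F d l A \<and>
    (\<forall>x y. (x, y) \<in> F \<longrightarrow> (x, y) \<in> A \<or> d \<le> dg A x \<or> d \<le> dg A y \<or> (\<exists>j\<le>l. (x, y) \<in> uadj A ^^ j))"
proof -
  have "\<exists>A. sparse F d l A \<and> (\<forall>B. sparse F d l B \<longrightarrow> card B \<le> card A)"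
  proof (rule ex_has_greatest_nat[of "sparse F d l" "{}" card "Suc (card F)"])
    show "sparse F d l {}" by (rule sparse_empty)
    show "\<forall>B. sparse F d l B \<longrightarrow> card B < Suc (card F)"
    proof (intro allI impI)
      fix B assume "sparse F d l B"
      then have "card B \<le> card F" by (intro card_mono[OF assms] sparse_subset)
      then show "card B < Suc (card F)" by (rule le_imp_less_Suc)
    qed
  qed
  then obtain A where A: "sparse F d l A" "\<And>B. sparse F d l B \<Longrightarrow> card B \<le> card A" by auto
  have "(x, y) \<in> A \<or> d \<le> dg A x \<or> d \<le> dg A y \<or> (\<exists>j\<le>l. (x, y) \<in> uadj A ^^ j)" if "(x, y) \<in> F" for x y
  proof (rule ccontr)
    assume H: "\<not> ((x, y) \<in> A \<or> d \<le> dg A x \<or> d \<le> dg A y \<or> (\<exists>j\<le>l. (x, y) \<in> uadj A ^^ j))"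
    then have "sparse F d l (insert (x, y) A)" 
    proof (intro sparse_insert[OF A(1) that])
      show "dg A x < d" "dg A y < d" using H by linarith+
      show "(x, y) \<notin> uadj A ^^ j" if "j \<le> l" for j using H that by blast
    qed
    then have "card (insert (x, y) A) \<le> card A" by (rule A(2))
    then show False using H sparse_finite[OF A(1)] by simp
  qed
  then show ?thesis using A(1) by auto
qed

lemma card_near:
  assumes "finite A" "\<And>z. dg A z \<le> d" "finite X" "F \<subseteq> X \<times> X" "1 \<le> d"
  shows "card {e \<in> F. \<exists>j\<le>l. e \<in> uadj A ^^ j} \<le> card X * ((l + 1) * d ^ l)"
proof -
  let ?N = "\<lambda>j x. (uadj A ^^ j) `` {x}"
  have N: "finite (?N j x)" "card (?N j x) \<le> d ^ j" for j x
    using card_relpow_image[OF assms(1,2), of j x] by simp_all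
  have "{e \<in> F. \<exists>j\<le>l. e \<in> uadj A ^^ j} \<subseteq> (\<Union>x\<in>X. Pair x ` (\<Union>j\<in>{..l}. ?N j x))"
  proof
    fix e assume "e \<in> {e \<in> F. \<exists>j\<le>l. e \<in> uadj A ^^ j}"
    then obtain j where j: "e \<in> F" "j \<le> l" "e \<in> uadj A ^^ j" by blast
    have "fst e \<in> X" using j(1) assms(4) by auto
    moreover have "e = (fst e, snd e)" by simp
    moreover have "snd e \<in> ?N j (fst e)" using j(3) by simp
    ultimately show "e \<in> (\<Union>x\<in>X. Pair x ` (\<Union>j\<in>{..l}. ?N j x))" using j(2) by blast
  qed
  then have "card {e \<in> F. \<exists>j\<le>l. e \<in> uadj A ^^ j} \<le> card (\<Union>x\<in>X. Pair x ` (\<Union>j\<in>{..l}. ?N j x))"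
    using assms(3) N(1) by (intro card_mono) auto
  also have "\<dots> \<le> (\<Sum>x\<in>X. card (Pair x ` (\<Union>j\<in>{..l}. ?N j x)))" by (rule card_UN_le[OF assms(3)])
  also have "\<dots> \<le> (\<Sum>x\<in>X. (l + 1) * d ^ l)"
  proof (rule sum_mono)
    fix x
    have "card (Pair x ` (\<Union>j\<in>{..l}. ?N j x)) \<le> card (\<Union>j\<in>{..l}. ?N j x)"
      using N(1) by (intro card_image_le) auto
    also have "\<dots> \<le> (\<Sum>j\<le>l. card (?N j x))" by (rule card_UN_le) simp
    also have "\<dots> \<le> (\<Sum>j\<le>l. d ^ l)"
    proof (rule sum_mono)
      fix j assume "j \<in> {..l}"
      then have "d ^ j \<le> d ^ l" using assms(5) by (intro power_increasing) auto
      then show "card (?N j x) \<le> d ^ l" using N(2)[of j x] by (rule order_trans[rotated])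
    qed
    finally show "card (Pair x ` (\<Union>j\<in>{..l}. ?N j x)) \<le> (l + 1) * d ^ l" by simp
  qed
  finally show ?thesis by simp
qed

text \<open>Every piece of a fragmentation carries a forest, and few edges are destroyed.\<close>

lemma sparse_few:
  assumes sub: "subdiv E V X F y" and fV: "finite V" and A: "sparse F d (r * r) A"
    and W: "W = X \<union> y ` A" and S: "S \<subseteq> W" "(d + 1) * card S \<le> card X"
    and K: "parts_of E (W - S) K" "\<And>P. P \<in> K \<Longrightarrow> card P \<le> r"
  shows "card A \<le> 2 * card X"
proof -
  have fX: "finite X" using sub fV finite_subset by (auto simp: subdiv_def)
  have AF: "A \<subseteq> F" by (rule sparse_subset[OF A])
  have fA: "finite A" by (rule sparse_finite[OF A])
  have fW: "finite W" using W fX fA by simp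
  have fS: "finite S" by (rule finite_subset[OF S(1) fW])
  have inj: "inj_on y A" using sub AF by (auto simp: subdiv_def intro: inj_on_subset)
  have KW: "P \<subseteq> W" if "P \<in> K" for P using parts_of_subset[OF K(1) that] by auto
  have fK: "finite K" by (rule finite_subset[of _ "Pow W"]) (use KW fW in auto)
  have fP: "finite P" if "P \<in> K" for P by (rule finite_subset[OF KW[OF that] fW])
  let ?A1 = "\<Union>s\<in>S. {e \<in> A. fst e = s \<or> snd e = s}"
  let ?A2 = "{e \<in> A. y e \<in> S}"
  let ?A3 = "\<Union>P\<in>K. A \<inter> (P \<inter> X) \<times> (P \<inter> X)"
  have "card ?A1 \<le> (\<Sum>s\<in>S. card {e \<in> A. fst e = s \<or> snd e = s})" by (rule card_UN_le[OF fS])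
  also have "\<dots> \<le> (\<Sum>s\<in>S. d)" using sparse_dg[OF A] unfolding dg_def by (intro sum_mono)
  finally have c1: "card ?A1 \<le> d * card S" by (simp add: mult.commute)
  have "inj_on y ?A2" using inj by (rule inj_on_subset) auto
  then have c2: "card ?A2 \<le> card S" using fS by (intro card_inj_on_le[of y]) auto
  have "card ?A3 \<le> (\<Sum>P\<in>K. card (A \<inter> (P \<inter> X) \<times> (P \<inter> X)))" by (rule card_UN_le[OF fK])
  also have "\<dots> \<le> (\<Sum>P\<in>K. card (P \<inter> X))"
  proof (rule sum_mono)
    fix P assume P: "P \<in> K"
    have "card (P \<inter> X) \<le> card P" using fP[OF P] by (intro card_mono) auto
    then have "card (P \<inter> X) \<le> r" using K(2)[OF P] by linarith
    then have "card (P \<inter> X) * card (P \<inter> X) \<le> r * r" by (rule mult_le_mono)  (use \<open>card (P \<inter> X) \<le> r\<close> in simp)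
    then show "card (A \<inter> (P \<inter> X) \<times> (P \<inter> X)) \<le> card (P \<inter> X)"
      using fX by (intro sparse_forest[OF A]) simp_all
  qed
  also have "\<dots> = card (\<Union>P\<in>K. P \<inter> X)"
  proof (rule card_UN_disjoint[symmetric])
    show "\<forall>P\<in>K. \<forall>Q\<in>K. P \<noteq> Q \<longrightarrow> P \<inter> X \<inter> (Q \<inter> X) = {}"
    proof (intro ballI impI)
      fix P Q assume "P \<in> K" "Q \<in> K" "P \<noteq> Q"
      then have "P \<inter> Q = {}" using K(1) by (auto simp: parts_of_def pairwise_def disjnt_def)
      then show "P \<inter> X \<inter> (Q \<inter> X) = {}" by auto
    qed
  qed (use fK fX in auto)
  also have "\<dots> \<le> card X" using fX by (intro card_mono) auto
  finally have c3: "card ?A3 \<le> card X" .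
  have "A \<subseteq> ?A1 \<union> ?A2 \<union> ?A3"
  proof
    fix e assume e: "e \<in> A"
    then have eF: "e \<in> F" using AF by blast
    have m: "fst e \<in> X" "snd e \<in> X" "(y e, fst e) \<in> E" "(y e, snd e) \<in> E"
      using sub eF by (auto simp: subdiv_def)
    show "e \<in> ?A1 \<union> ?A2 \<union> ?A3"
    proof (cases "fst e \<in> S \<or> snd e \<in> S \<or> y e \<in> S")
      case True
      then show ?thesis using e by auto
    next
      case False
      then have w: "y e \<in> W - S" "fst e \<in> W - S" "snd e \<in> W - S" using W e m by auto
      have "\<Union>K = W - S" using K(1) by (simp add: parts_of_def)
      then obtain P where P: "P \<in> K" "y e \<in> P" using w(1) by (metis UnionE)
      have cl: "v \<in> P" if "(y e, v) \<in> E" "v \<in> W - S" for v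
        using K(1) P that unfolding parts_of_def by blast
      have "fst e \<in> P" "snd e \<in> P" using cl w m by simp_all
      then have "e \<in> A \<inter> (P \<inter> X) \<times> (P \<inter> X)" using e m by (simp add: mem_Times_iff)
      then show ?thesis using P(1) by blast
    qed
  qed
  then have "card A \<le> card (?A1 \<union> ?A2 \<union> ?A3)" using fA fS fK by (intro card_mono) auto
  also have "\<dots> \<le> card ?A1 + card ?A2 + card ?A3"
    using card_Un_le[of "?A1 \<union> ?A2" ?A3] card_Un_le[of ?A1 ?A2] by linarith
  finally show ?thesis using c1 c2 c3 S(2) by simp
qed

text \<open>An edge outside the maximal sparse A has an end in the set T of saturated vertices, or
  its ends are already close in A. As A and the close pairs are linear in |X|, a small T would leave
  too few edges. So |T| >= \<epsilon> |X| / 2, and degree D >= 12 / \<epsilon> on T gives A at least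
  3 |X| edges. The subdivision of A has at most (D + 1) |X| vertices, so cutting with parameter 1 /
  (D + 1)^2 costs |S| <= |X| / (D + 1), and then A has at most 2 |X| edges.\<close>

lemma density_aux:
  assumes \<epsilon>: "0 < (\<epsilon>::real)" "\<epsilon> \<le> 1" and D: "12 / \<epsilon> \<le> real D"
    and C: "2 * (real D + real ((r * r + 1) * D ^ (r * r))) + 2 / \<epsilon> + 1 \<le> C"
    and sub: "subdiv E V X F y" and fV: "finite V" and big: "C * real (card X) < real (card F)"
    and inc: "\<And>A. A \<subseteq> X \<Longrightarrow> card A \<le> nat \<lfloor>\<epsilon> * real (card X)\<rfloor> \<Longrightarrow>
      real (card {e \<in> F. fst e \<in> A \<or> snd e \<in> A}) \<le> real (card F) / 4"
    and frag: "\<And>W. W \<subseteq> V \<Longrightarrow> \<exists>S K. S \<subseteq> W \<and> parts_of E (W - S) K \<and> (\<forall>A\<in>K. card A \<le> r) \<and>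
      real (card S) \<le> 1 / (real D + 1)^2 * real (card W)"
    and m: "1 \<le> card X" "2 \<le> \<epsilon> * real (card X)"
  shows False
proof -
  let ?m = "card X" and ?l = "r * r"
  have fX: "finite X" and FX: "F \<subseteq> X \<times> X" using sub fV finite_subset by (auto simp: subdiv_def)
  have fF: "finite F" using fX FX finite_subset by blast
  have "12 / \<epsilon> \<ge> 12 / 1" using \<epsilon> by (intro divide_left_mono) auto
  then have D1: "12 \<le> D" using D by linarith
  obtain A where A: "sparse F D ?l A" and max: "\<And>x y. (x, y) \<in> F \<Longrightarrow> (x, y) \<in> A \<or> D \<le> dg A x \<or> D \<le> dg A y \<or> (\<exists>j\<le>?l. (x, y) \<in> uadj A ^^ j)"
    using sparse_maximal[OF fF, of D ?l] by blast
  have fA: "finite A" and AF: "A \<subseteq> F" using sparse_finite[OF A] sparse_subset[OF A] .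
  then have AX: "A \<subseteq> X \<times> X" using FX by blast
  define T where "T = {x \<in> X. D \<le> dg A x}"
  have TX: "T \<subseteq> X" by (auto simp: T_def)
  have fT: "finite T" by (rule finite_subset[OF TX fX])
  have "card A = (\<Sum>x\<in>X. card {e \<in> A. fst e = x})" using fA fX AX by (intro card_fibres[symmetric]) auto
  also have "\<dots> \<le> (\<Sum>x\<in>X. D)" using dg_fst[OF fA] sparse_dg[OF A] by (intro sum_mono) (meson order_trans)
  finally have cA: "card A \<le> ?m * D" by simp
  let ?I = "{e \<in> F. fst e \<in> T \<or> snd e \<in> T}" and ?N = "{e \<in> F. \<exists>j\<le>?l. e \<in> uadj A ^^ j}"
  have "F \<subseteq> A \<union> ?I \<union> ?N"
  proof
    fix e assume e: "e \<in> F"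
    obtain u v where uv: "e = (u, v)" by (cases e)
    have "u \<in> X" "v \<in> X" using e FX uv by auto
    moreover have "e \<in> A \<or> D \<le> dg A u \<or> D \<le> dg A v \<or> (\<exists>j\<le>?l. e \<in> uadj A ^^ j)"
      using max[of u v] e uv by simp
    ultimately show "e \<in> A \<union> ?I \<union> ?N" using e uv unfolding T_def by fastforce
  qed
  then have "card F \<le> card (A \<union> ?I \<union> ?N)" using fA fF by (intro card_mono) auto
  also have "\<dots> \<le> card A + card ?I + card ?N"
    using card_Un_le[of "A \<union> ?I" ?N] card_Un_le[of A ?I] by linarith
  finally have F: "card F \<le> card A + card ?I + card ?N" .
  have N: "card ?N \<le> ?m * ((?l + 1) * D ^ ?l)"
    using fA sparse_dg[OF A] fX FX D1 by (intro card_near) auto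
  have "\<epsilon> * real ?m / 2 \<le> real (card T)"
  proof (rule ccontr)
    assume "\<not> \<epsilon> * real ?m / 2 \<le> real (card T)"
    then have "real (card T) \<le> \<epsilon> * real ?m - 1" using m(2) by linarith
    then have "int (card T) \<le> \<lfloor>\<epsilon> * real ?m\<rfloor>" by linarith
    then have "card T \<le> nat \<lfloor>\<epsilon> * real ?m\<rfloor>" by linarith
    then have I: "real (card ?I) \<le> real (card F) / 4" using TX by (intro inc)
    have "real (card F) \<le> real (card A + card ?I + card ?N)" using F by (rule of_nat_mono)
    also have "\<dots> \<le> real (?m * D + ?m * ((?l + 1) * D ^ ?l)) + real (card F) / 4"
      using I of_nat_mono[OF cA, where 'a=real] of_nat_mono[OF N, where 'a=real] by simp
    finally have "real (card F) * (3 / 4) \<le> real ?m * (real D + real ((?l + 1) * D ^ ?l))"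
      by (simp add: algebra_simps)
    also have "\<dots> \<le> real ?m * (C / 2)"
    proof (rule mult_left_mono)
      have aux: "x \<le> C / 2" if "2 * x + z + 1 \<le> C" "0 < z" for x z using that by linarith
      show "real D + real ((?l + 1) * D ^ ?l) \<le> C / 2" by (rule aux[OF C]) (use \<epsilon> in simp)
    qed simp
    finally have "real (card F) * (3 / 4) \<le> C * real ?m / 2" by (simp add: mult.commute)
    moreover have "0 \<le> real (card F)" by simp
    ultimately show False using big by linarith
  qed
  have "D * card T = (\<Sum>x\<in>T. D)" by simp
  also have "\<dots> \<le> (\<Sum>x\<in>T. dg A x)" by (rule sum_mono) (simp add: T_def)
  also have "\<dots> \<le> (\<Sum>x\<in>X. dg A x)" by (rule sum_mono2[OF fX TX]) simp
  also have "\<dots> \<le> 2 * card A" by (rule sum_dg[OF fA fX AX])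
  finally have "real (D * card T) \<le> real (2 * card A)" by (rule of_nat_mono)
  moreover have "(12 / \<epsilon>) * (\<epsilon> * real ?m / 2) \<le> real D * real (card T)"
    using D \<open>\<epsilon> * real ?m / 2 \<le> real (card T)\<close> \<epsilon> by (intro mult_mono) auto
  ultimately have big3: "3 * real ?m \<le> real (card A)" using \<epsilon> by simp
  let ?W = "X \<union> y ` A"
  have "X \<subseteq> V" "y ` F \<subseteq> V - X" using sub by (simp_all add: subdiv_def)
  then have "?W \<subseteq> V" using AF by blast
  from frag[OF this] obtain S K where SK: "S \<subseteq> ?W" "parts_of E (?W - S) K" "\<forall>P\<in>K. card P \<le> r" "real (card S) \<le> 1 / (real D + 1)^2 * real (card ?W)"
    by (elim exE conjE) (rule that)
  have "card ?W \<le> card X + card (y ` A)" by (rule card_Un_le)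
  also have "\<dots> \<le> ?m * (D + 1)" using cA card_image_le[OF fA, of y] by simp
  finally have "real (card ?W) \<le> real ?m * (real D + 1)" using of_nat_mono[of "card ?W" "?m * (D + 1)", where 'a=real] by (simp add: algebra_simps)
  then have "1 / (real D + 1)^2 * real (card ?W) \<le> 1 / (real D + 1)^2 * (real ?m * (real D + 1))"
    by (rule mult_left_mono) simp
  also have "\<dots> = real ?m / (real D + 1)" by (simp add: power2_eq_square)
  finally have "real (card S) \<le> real ?m / (real D + 1)" using SK(4) by linarith
  then have "real ((D + 1) * card S) \<le> real ?m" by (simp add: field_simps)
  then have "(D + 1) * card S \<le> ?m" by linarith
  then have "card A \<le> 2 * ?m" using SK by (intro sparse_few[OF sub fV A refl SK(1)]) auto
  then show False using big3 m(1) by linarith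
qed

text \<open>A graph that violates the bound is replaced by one of the largest ratio inside V. Its
  restrictions compete for the maximum, which supplies the hypothesis of
  \<open>incident_few\<close>.\<close>

lemma density:
  assumes "0 \<le> \<delta>" "\<delta> < 1" "0 < \<beta>" and \<eta>: "0 < \<eta>" "\<eta> \<le> (1::real)"
  shows "\<exists>C>0. \<forall>E V X F y. sepprop (\<lambda>n. \<beta> * real n powr \<delta>) E V \<longrightarrow> subdiv E V X F y \<longrightarrow>
    real (card F) \<le> C * real (card X) powr (1 + \<eta>)"
proof -
  define \<epsilon> where "\<epsilon> = (1 / 32 :: real) powr (1 / \<eta>)"
  have \<epsilon>: "0 < \<epsilon>" "\<epsilon> \<le> 1" "\<epsilon> powr \<eta> = 1 / 32"
    using \<eta> by (auto simp: \<epsilon>_def powr_powr intro!: powr_le1)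
  define D where "D = nat \<lceil>12 / \<epsilon>\<rceil>"
  have D: "12 / \<epsilon> \<le> real D" unfolding D_def by (rule real_nat_ceiling_ge)
  have "0 < 1 / (real D + 1)^2" by simp
  then obtain r where r: "\<And>E V W. sepprop (\<lambda>n. \<beta> * real n powr \<delta>) E V \<Longrightarrow> W \<subseteq> V \<Longrightarrow>
    \<exists>S K. S \<subseteq> W \<and> parts_of E (W - S) K \<and> (\<forall>A\<in>K. card A \<le> r) \<and> real (card S) \<le> 1 / (real D + 1)^2 * real (card W)"
    using fragmentation[OF assms(1-3)] by meson
  \<comment> \<open>The first term makes A and the close pairs fewer than half of the edges. The
    term 2 / \<epsilon> forces \<epsilon> m >= 2 for the densest graph, since C m < |F| <=
    m^2.\<close>
  define C where "C = 2 * (real D + real ((r * r + 1) * D ^ (r * r))) + 2 / \<epsilon> + 1"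
  then have Cge: "2 * (real D + real ((r * r + 1) * D ^ (r * r))) + 2 / \<epsilon> + 1 \<le> C" by simp
  have C: "0 < C" "2 / \<epsilon> \<le> C" using \<epsilon> by (auto simp: C_def add_nonneg_pos)
  have "real (card F) \<le> C * real (card X) powr (1 + \<eta>)" if sp: "sepprop (\<lambda>n. \<beta> * real n powr \<delta>) E V" and sub: "subdiv E V X F y" for E V X F y
  proof (rule ccontr)
    assume neg: "\<not> ?thesis"
    have fV: "finite V" using sp by (simp add: sepprop_def)
    define Q where "Q = {(X, F). X \<noteq> {} \<and> (\<exists>y. subdiv E V X F y)}"
    define q where "q p = real (card (snd p)) / real (card (fst p)) powr (1 + \<eta>)" for p :: "nat set \<times> (nat \<times> nat) set"
    have "Q \<subseteq> Pow V \<times> Pow (V \<times> V)" by (auto simp: Q_def subdiv_def)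
    then have fQ: "finite Q" by (rule finite_subset) (use fV in simp)
    have "X \<noteq> {}"
    proof
      assume "X = {}"
      then have "F = {}" using sub by (auto simp: subdiv_def)
      then show False using neg \<open>X = {}\<close> by simp
    qed
    then have XF: "(X, F) \<in> Q" using sub by (auto simp: Q_def)
    obtain p where p: "p \<in> Q" "q p = Max (q ` Q)" using Max_in[of "q ` Q"] fQ XF by fastforce
    have pmax: "q p' \<le> q p" if "p' \<in> Q" for p' using p(2) fQ that by simp
    obtain X' F' y' where p': "p = (X', F')" "X' \<noteq> {}" "subdiv E V X' F' y'" using p(1) by (auto simp: Q_def)
    define \<rho> where "\<rho> = q p"
    have fX: "finite X'" and FX: "F' \<subseteq> X' \<times> X'" using p'(3) fV finite_subset by (auto simp: subdiv_def)
    have fF: "finite F'" using fX FX finite_subset by blast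
    define m where "m = card X'"
    have m1: "1 \<le> m" using fX p'(2) by (simp add: m_def Suc_le_eq card_gt_0_iff)
    have \<rho>e: "real (card F') = \<rho> * real m powr (1 + \<eta>)" using m1 by (simp add: \<rho>_def q_def p'(1) m_def)
    have "0 < card X" using \<open>X \<noteq> {}\<close> sub fV finite_subset by (auto simp: subdiv_def card_gt_0_iff)
    then have "C < q (X, F)" using neg by (simp add: q_def field_simps)
    then have \<rho>: "C < \<rho>" using pmax[OF XF] by (simp add: \<rho>_def)
    have "C * real m \<le> C * real m powr (1 + \<eta>)"
      using C m1 \<eta> powr_mono[of 1 "1 + \<eta>" "real m"] by (intro mult_left_mono) auto
    also have "\<dots> < \<rho> * real m powr (1 + \<eta>)" using \<rho> m1 by (intro mult_strict_right_mono) auto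
    finally have big: "C * real (card X') < real (card F')" using \<rho>e by (simp add: m_def)
    have "card F' \<le> m * m" using card_mono[OF _ FX] fX by (simp add: m_def card_cartesian_product)
    then have "real (card F') \<le> real m * real m" using of_nat_mono by fastforce
    then have "C * real m \<le> real m * real m" using big by (simp add: m_def)
    then have Cm: "C \<le> real m" using m1 by simp
    then have "2 / \<epsilon> \<le> real m" using C by linarith
    then have \<epsilon>m: "2 \<le> \<epsilon> * real m" using \<epsilon> by (simp add: field_simps)
    define a where "a = nat \<lfloor>\<epsilon> * real m\<rfloor>"
    have a: "1 \<le> a" "real a \<le> \<epsilon> * real m" unfolding a_def using \<epsilon>m by linarith+
    have "\<epsilon> * real m \<le> 1 * real m" using \<epsilon> by (intro mult_right_mono) auto
    then have am: "a \<le> m" using a by linarith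
    have "real a / real m \<le> \<epsilon>" using a m1 by (simp add: field_simps)
    then have "(real a / real m) powr \<eta> \<le> \<epsilon> powr \<eta>" using \<eta> by (intro powr_mono2) auto
    then have apow: "(real a / real m) powr \<eta> \<le> 1 / 32" using \<epsilon> by simp
    have subZ: "real (card (F' \<inter> Z \<times> Z)) \<le> \<rho> * real (card Z) powr (1 + \<eta>)" if Z: "Z \<subseteq> X'" for Z
    proof (cases "Z = {}")
      case False
      then have "(Z, F' \<inter> Z \<times> Z) \<in> Q" using subdiv_restrict[OF p'(3) Z] by (auto simp: Q_def)
      then have "q (Z, F' \<inter> Z \<times> Z) \<le> \<rho>" using pmax by (simp add: \<rho>_def)
      moreover have "0 < card Z" using False Z fX finite_subset by (auto simp: card_gt_0_iff)
      ultimately show ?thesis by (simp add: q_def field_simps)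
    qed simp
    show False
    proof (rule density_aux[OF \<epsilon>(1,2) D Cge p'(3) fV big])
      fix A assume A: "A \<subseteq> X'" "card A \<le> nat \<lfloor>\<epsilon> * real (card X')\<rfloor>"
      have \<rho>0: "0 \<le> \<rho>" using C \<rho> by linarith
      have "card A \<le> a" using A(2) by (simp add: a_def m_def)
      then show "real (card {e \<in> F'. fst e \<in> A \<or> snd e \<in> A}) \<le> real (card F') / 4"
        using subZ by (intro incident_few[OF fX m_def[symmetric] fF FX \<eta> \<rho>0 \<rho>e _ a(1) am apow A(1)])
    next
      fix W assume "W \<subseteq> V"
      then show "\<exists>S K. S \<subseteq> W \<and> parts_of E (W - S) K \<and> (\<forall>A\<in>K. card A \<le> r) \<and> real (card S) \<le> 1 / (real D + 1)^2 * real (card W)"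
        by (rule r[OF sp])
    qed (use m1 \<epsilon>m in \<open>simp_all add: m_def\<close>)
  qed
  then show ?thesis using C(1) by blast
qed

section \<open>Almost linear neighborhood complexity\<close>

definition cliques :: "(nat \<times> nat) set \<Rightarrow> nat set \<Rightarrow> nat set set" where
  "cliques F Z = {Q. Q \<subseteq> Z \<and> (\<forall>u\<in>Q. \<forall>v\<in>Q. u < v \<longrightarrow> (u, v) \<in> F)}"

lemma finite_cliques [simp]: "finite Z \<Longrightarrow> finite (cliques F Z)"
  by (rule finite_subset[of _ "Pow Z"]) (auto simp: cliques_def)

lemma exists_low_degree:
  assumes "finite Z" "Z \<noteq> {}" "finite F" "2 * real (card (F \<inter> Z \<times> Z)) \<le> \<Delta> * real (card Z)"
  shows "\<exists>x\<in>Z. real (dg (F \<inter> Z \<times> Z) x) \<le> \<Delta>"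
proof (rule ccontr)
  assume H: "\<not> ?thesis"
  have "(\<Sum>x\<in>Z. \<Delta>) < (\<Sum>x\<in>Z. real (dg (F \<inter> Z \<times> Z) x))"
    using assms(1,2) H by (intro sum_strict_mono) auto
  also have "\<dots> \<le> real (2 * card (F \<inter> Z \<times> Z))"
    unfolding of_nat_sum[symmetric] using assms(1,3) by (intro of_nat_mono sum_dg) auto
  finally show False using assms(4) by (simp add: mult.commute)
qed

text \<open>A clique through x is the set of a list of length exactly \<omega> over x and its
  neighbors, shorter lists being padded with x.\<close>

lemma card_cliques_at:
  assumes "finite F" "x \<in> Z" "finite Z" "\<And>Q. Q \<in> cliques F Z \<Longrightarrow> card Q \<le> \<omega>"
  shows "card {Q \<in> cliques F Z. x \<in> Q} \<le> (dg (F \<inter> Z \<times> Z) x + 1) ^ \<omega>"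
proof -
  let ?N = "insert x (uadj (F \<inter> Z \<times> Z) `` {x})"
  let ?L = "{xs. set xs \<subseteq> ?N \<and> length xs = \<omega>}"
  have fN: "finite ?N" using assms(1) by (auto simp: finite_Image)
  have "{Q \<in> cliques F Z. x \<in> Q} \<subseteq> set ` ?L"
  proof
    fix Q assume "Q \<in> {Q \<in> cliques F Z. x \<in> Q}"
    then have Q: "Q \<in> cliques F Z" "x \<in> Q" by auto
    then have QZ: "Q \<subseteq> Z" and cl: "\<And>u v. u \<in> Q \<Longrightarrow> v \<in> Q \<Longrightarrow> u < v \<Longrightarrow> (u, v) \<in> F"
      by (auto simp: cliques_def)
    have QN: "Q \<subseteq> ?N"
    proof
      fix v assume v: "v \<in> Q"
      consider "v = x" | "x < v" | "v < x" by linarith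
      then show "v \<in> ?N"
      proof cases
        case 2
        then have "(x, v) \<in> F" by (rule cl[OF Q(2) v])
        then show ?thesis using v QZ assms(2) by (auto simp: uadj_def)
      next
        case 3
        then have "(v, x) \<in> F" by (rule cl[OF v Q(2)])
        then show ?thesis using v QZ assms(2) by (auto simp: uadj_def)
      qed simp
    qed
    have fQ: "finite Q" using QZ assms(3) finite_subset by blast
    obtain ys where ys: "set ys = Q" "distinct ys" using finite_distinct_list[OF fQ] by blast
    have len: "length ys \<le> \<omega>" using assms(4)[OF Q(1)] ys distinct_card by fastforce
    let ?xs = "ys @ replicate (\<omega> - length ys) x"
    have "set ?xs = Q" using ys Q(2) by auto
    moreover have "length ?xs = \<omega>" using len by simp
    ultimately show "Q \<in> set ` ?L" using QN by blast
  qed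
  then have "card {Q \<in> cliques F Z. x \<in> Q} \<le> card (set ` ?L)"
    using finite_lists_length_eq[OF fN] by (intro card_mono) auto
  also have "\<dots> \<le> card ?L" using finite_lists_length_eq[OF fN] by (intro card_image_le) auto
  also have "\<dots> = card ?N ^ \<omega>" by (rule card_lists_length_eq[OF fN])
  also have "\<dots> \<le> (dg (F \<inter> Z \<times> Z) x + 1) ^ \<omega>"
  proof (rule power_mono)
    have "card (uadj (F \<inter> Z \<times> Z) `` {x}) \<le> dg (F \<inter> Z \<times> Z) x" using assms(1) by (intro card_uadj_image) auto
    then show "card ?N \<le> dg (F \<inter> Z \<times> Z) x + 1"
      using card_insert_le_m1[of "dg (F \<inter> Z \<times> Z) x + 1" "uadj (F \<inter> Z \<times> Z) `` {x}" x] by simp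
  qed simp
  finally show ?thesis .
qed

text \<open>The hypothesis bounds the average degree of every restriction, so a vertex of degree at
  most \<Delta> can be removed again and again. Cliques are counted at the first of their vertices
  to be removed; the summand 1 is the empty clique.\<close>

lemma card_cliques:
  assumes "finite X" "finite F" "0 \<le> \<Delta>"
    and "\<And>Z. Z \<subseteq> X \<Longrightarrow> 2 * real (card (F \<inter> Z \<times> Z)) \<le> \<Delta> * real (card Z)"
    and "\<And>Q. Q \<in> cliques F X \<Longrightarrow> card Q \<le> \<omega>"
  shows "real (card (cliques F X)) \<le> 1 + real (card X) * (\<Delta> + 1) ^ \<omega>"
proof -
  have "real (card (cliques F Z)) \<le> 1 + real (card Z) * (\<Delta> + 1) ^ \<omega>" if "card Z = m" "Z \<subseteq> X" for Z m
    using that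
  proof (induction m arbitrary: Z)
    case 0
    then have "Z = {}" using finite_subset[OF _ assms(1)] by auto
    then have "cliques F Z = {{}}" by (auto simp: cliques_def)
    then show ?case using 0 by simp
  next
    case (Suc m)
    have fZ: "finite Z" by (rule finite_subset[OF Suc.prems(2) assms(1)])
    have "Z \<noteq> {}" using Suc.prems by auto
    then obtain x where x: "x \<in> Z" "real (dg (F \<inter> Z \<times> Z) x) \<le> \<Delta>"
      using exists_low_degree[OF fZ _ assms(2) assms(4)[OF Suc.prems(2)]] by blast
    have w: "card Q \<le> \<omega>" if "Q \<in> cliques F Z" for Q
      using that Suc.prems(2) by (intro assms(5)) (auto simp: cliques_def)
    have "real (card {Q \<in> cliques F Z. x \<in> Q}) \<le> real ((dg (F \<inter> Z \<times> Z) x + 1) ^ \<omega>)"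
      by (rule of_nat_mono, rule card_cliques_at[OF assms(2) x(1) fZ w])
    also have "\<dots> = (real (dg (F \<inter> Z \<times> Z) x) + 1) ^ \<omega>" by (simp add: add.commute)
    also have "\<dots> \<le> (\<Delta> + 1) ^ \<omega>" using x(2) by (intro power_mono) auto
    finally have 1: "real (card {Q \<in> cliques F Z. x \<in> Q}) \<le> (\<Delta> + 1) ^ \<omega>" .
    have "cliques F Z \<subseteq> cliques F (Z - {x}) \<union> {Q \<in> cliques F Z. x \<in> Q}" by (auto simp: cliques_def)
    then have "card (cliques F Z) \<le> card (cliques F (Z - {x}) \<union> {Q \<in> cliques F Z. x \<in> Q})"
      using fZ by (intro card_mono) auto
    also have "\<dots> \<le> card (cliques F (Z - {x})) + card {Q \<in> cliques F Z. x \<in> Q}" by (rule card_Un_le)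
    finally have "real (card (cliques F Z)) \<le> real (card (cliques F (Z - {x}))) + real (card {Q \<in> cliques F Z. x \<in> Q})"
      by linarith
    moreover have cm: "card (Z - {x}) = m" using x(1) Suc.prems(1) fZ by simp
    then have "real (card (cliques F (Z - {x}))) \<le> 1 + real m * (\<Delta> + 1) ^ \<omega>"
      using Suc.IH[OF cm] Suc.prems(2) by auto
    ultimately show ?case using 1 Suc.prems(1) by (simp add: algebra_simps)
  qed
  then show ?thesis by blast
qed

lemma card_ordered_pairs: "finite (Q :: nat set) \<Longrightarrow> 2 * card {e \<in> Q \<times> Q. fst e < snd e} = card Q * (card Q - 1)"
proof -
  assume fQ: "finite Q"
  let ?A = "{e \<in> Q \<times> Q. fst e < snd e}" and ?B = "{e \<in> Q \<times> Q. snd e < fst e}" and ?D = "(\<lambda>x. (x, x)) ` Q"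
  have AB: "card ?B = card ?A" by (rule bij_betw_same_card[of prod.swap]) (auto simp: bij_betw_def inj_on_def image_iff)
  have "Q \<times> Q = ?A \<union> ?B \<union> ?D" by (auto simp: image_iff)
  then have "card (Q \<times> Q) = card (?A \<union> ?B \<union> ?D)" by simp
  also have "\<dots> = card ?A + card ?B + card ?D"
  proof -
    have d: "(?A \<union> ?B) \<inter> ?D = {}" "?A \<inter> ?B = {}" by auto
    have f: "finite ?A" "finite ?B" "finite ?D" using fQ by auto
    show ?thesis using card_Un_disjoint[OF _ f(3) d(1)] card_Un_disjoint[OF f(1,2) d(2)] f by simp
  qed
  finally have QQ: "card (Q \<times> Q) = card ?A + card ?B + card ?D" .
  have "card ?D = card Q" by (rule card_image) (auto simp: inj_on_def)
  with AB QQ have "card Q * card Q = 2 * card ?A + card Q" by (simp add: card_cartesian_product)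
  then show ?thesis by (cases "card Q") auto
qed

text \<open>All q(q - 1)/2 pairs of a clique are edges, so density with exponent 3/2 gives q - 1 <=
  2 C sqrt q. The clique number is thus bounded by a constant of the class.\<close>

lemma clique_bound:
  assumes "real q * (real q - 1) \<le> 2 * (C * real q powr (1 + 1 / 2))" "0 < C"
  shows "real q \<le> (2 * C + 1)^2"
proof (cases "q = 0")
  case False
  define s where "s = sqrt (real q)"
  have s: "1 \<le> s" "s * s = real q" using False by (auto simp: s_def)
  have "real q powr (1 + 1 / 2) = real q * s" using False by (subst powr_add) (simp add: powr_half_sqrt s_def)
  then have "real q * (real q - 1) \<le> real q * (2 * C * s)" using assms(1) by (simp add: algebra_simps)
  then have "real q - 1 \<le> 2 * C * s" using False by simp
  then have "s * s \<le> (2 * C + 1) * s" using s by (simp add: algebra_simps)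
  then have "s \<le> 2 * C + 1" using s(1) by simp
  then have "s * s \<le> (2 * C + 1) * (2 * C + 1)" using s by (intro mult_mono) auto
  then show ?thesis using s(2) by (simp add: power2_eq_square)
qed (use assms in simp)

lemma max_subdiv:
  assumes "finite V" "Y \<subseteq> V - X" "X \<subseteq> V"
  shows "\<exists>F y. subdiv E V X F y \<and> y ` F \<subseteq> Y \<and> (\<forall>F' y'. subdiv E V X F' y' \<and> y' ` F' \<subseteq> Y \<longrightarrow> card F' \<le> card F)"
proof -
  let ?P = "\<lambda>p. subdiv E V X (fst p) (snd p) \<and> snd p ` fst p \<subseteq> Y"
  have fX: "finite X" by (rule finite_subset[OF assms(3,1)])
  have "\<exists>p. ?P p \<and> (\<forall>p'. ?P p' \<longrightarrow> card (fst p') \<le> card (fst p))"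
  proof (rule ex_has_greatest_nat)
    show "?P ({}, \<lambda>e. 0)" using assms(3) by (simp add: subdiv_def)
    show "\<forall>p. ?P p \<longrightarrow> card (fst p) < Suc (card (X \<times> X))"
    proof (intro allI impI)
      fix p assume "?P p"
      then have "fst p \<subseteq> X \<times> X" by (simp add: subdiv_def)
      then have "card (fst p) \<le> card (X \<times> X)" by (intro card_mono) (use fX in simp)
      then show "card (fst p) < Suc (card (X \<times> X))" by (rule le_imp_less_Suc)
    qed
  qed
  then obtain p where p: "?P p" "\<And>p'. ?P p' \<Longrightarrow> card (fst p') \<le> card (fst p)" by blast
  have "card F' \<le> card (fst p)" if "subdiv E V X F' y'" "y' ` F' \<subseteq> Y" for F' y'
    using p(2)[of "(F', y')"] that by simp
  then show ?thesis using p(1) by blast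
qed

lemma trace_clique:
  assumes fV: "finite V" and XV: "X \<subseteq> V" and Y: "Y \<subseteq> V - X" and sub: "subdiv E V X F y" "y ` F \<subseteq> Y"
    and max: "\<And>F' y'. subdiv E V X F' y' \<Longrightarrow> y' ` F' \<subseteq> Y \<Longrightarrow> card F' \<le> card F"
    and v: "v \<in> Y" "v \<notin> y ` F"
  shows "{u \<in> X. (v, u) \<in> E} \<in> cliques F X"
proof -
  have "(u, w) \<in> F" if u: "u \<in> X" "(v, u) \<in> E" and w: "w \<in> X" "(v, w) \<in> E" and lt: "u < w" for u w
  proof (rule ccontr)
    assume n: "(u, w) \<notin> F"
    let ?F = "insert (u, w) F" and ?y = "y((u, w) := v)"
    have im: "?y ` ?F = insert v (y ` F)" using n by (auto simp: image_iff)
    have inj: "inj_on ?y ?F"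
    proof (rule inj_onI)
      fix e e' assume e: "e \<in> ?F" "e' \<in> ?F" "?y e = ?y e'"
      have i: "inj_on y F" using sub(1) by (simp add: subdiv_def)
      show "e = e'"
        using e v(2) inj_onD[OF i, of e e'] by (auto split: if_splits)
    qed
    have old: "(?y e, fst e) \<in> E \<and> (?y e, snd e) \<in> E" if "e \<in> F" for e
      using sub(1) that n by (auto simp: subdiv_def)
    have "subdiv E V X ?F ?y"
      unfolding subdiv_def im using sub(1) u w lt v(1) Y XV old inj
      by (auto simp: subdiv_def)
    moreover have "?y ` ?F \<subseteq> Y" unfolding im using sub(2) v(1) by simp
    ultimately have "card ?F \<le> card F" by (rule max)
    moreover have "F \<subseteq> X \<times> X" using sub(1) by (simp add: subdiv_def)
    then have "finite F" by (rule finite_subset) (use finite_subset[OF XV fV] in simp)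
    ultimately show False using n by simp
  qed
  then show ?thesis by (auto simp: cliques_def)
qed

lemma card_traces_le:
  assumes fV: "finite V" and XV: "X \<subseteq> V" and B: "\<And>F y. subdiv E V X F y \<Longrightarrow> real (card F) + real (card (cliques F X)) \<le> B"
  shows "real (card ((\<lambda>v. {u \<in> X. (v, u) \<in> E}) ` V)) \<le> real (card X) + B"
proof -
  let ?tr = "\<lambda>v. {u \<in> X. (v, u) \<in> E}"
  have fX: "finite X" by (rule finite_subset[OF XV fV])
  obtain Y where Y: "Y \<subseteq> V - X" "inj_on ?tr Y" "?tr ` (V - X) = ?tr ` Y"
    using subset_image_inj[of "?tr ` (V - X)" ?tr "V - X"] by auto
  from max_subdiv[OF fV Y(1) XV, of E] obtain F y where Fy: "subdiv E V X F y" "y ` F \<subseteq> Y"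
    and Fmax: "\<forall>F' y'. subdiv E V X F' y' \<and> y' ` F' \<subseteq> Y \<longrightarrow> card F' \<le> card F"
    by (elim exE conjE) (rule that)
  have "F \<subseteq> X \<times> X" using Fy(1) by (simp add: subdiv_def)
  then have fF: "finite F" by (rule finite_subset) (use fX in simp)
  have sub: "?tr ` V \<subseteq> ?tr ` X \<union> (?tr ` (y ` F) \<union> cliques F X)"
  proof
    fix t assume "t \<in> ?tr ` V"
    then obtain v where v: "v \<in> V" "t = ?tr v" by blast
    show "t \<in> ?tr ` X \<union> (?tr ` (y ` F) \<union> cliques F X)"
    proof (cases "v \<in> X")
      case False
      then have "t \<in> ?tr ` Y" using v Y(3) by blast
      then obtain w where w: "w \<in> Y" "t = ?tr w" by blast
      show ?thesis
      proof (cases "w \<in> y ` F")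
        case False
        have "?tr w \<in> cliques F X" by (rule trace_clique[OF fV XV Y(1) Fy Fmax[rule_format, OF conjI] w(1) False])
        then show ?thesis using w(2) by simp
      qed (use w(2) in simp)
    qed (use v(2) in simp)
  qed
  have "card (?tr ` V) \<le> card (?tr ` X \<union> (?tr ` (y ` F) \<union> cliques F X))"
    by (rule card_mono[OF _ sub]) (use fX fF in simp)
  also have "\<dots> \<le> card (?tr ` X) + (card (?tr ` (y ` F)) + card (cliques F X))"
    by (rule order_trans[OF card_Un_le]) (rule add_left_mono[OF card_Un_le])
  also have "\<dots> \<le> card X + (card F + card (cliques F X))"
    using card_image_le[OF fX, of ?tr] card_image_le[OF fF, of "?tr \<circ> y"]
    by (simp add: image_comp)
  finally have "real (card (?tr ` V)) \<le> real (card X + (card F + card (cliques F X)))" by (rule of_nat_mono)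
  then show ?thesis using B[OF Fy(1)] by simp
qed

lemma traces_bound:
  assumes \<delta>: "0 \<le> \<delta>" "\<delta> < 1" "0 < \<beta>" and \<eta>: "0 < \<eta>" "\<eta> \<le> (1::real)"
  shows "\<exists>C>0. \<forall>E V X. sepprop (\<lambda>n. \<beta> * real n powr \<delta>) E V \<longrightarrow> X \<subseteq> V \<longrightarrow> X \<noteq> {} \<longrightarrow>
    real (card ((\<lambda>v. {u \<in> X. (v, u) \<in> E}) ` V)) \<le> C * real (card X) powr (1 + \<eta>)"
proof -
  have h: "(0::real) < 1 / 2" "(1 / 2 :: real) \<le> 1" by simp_all
  from density[OF \<delta> h] obtain C1 where C1: "0 < C1" "\<forall>E V X F y. sepprop (\<lambda>n. \<beta> * real n powr \<delta>) E V \<longrightarrow> subdiv E V X F y \<longrightarrow>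
    real (card F) \<le> C1 * real (card X) powr (1 + 1 / 2)"
    by (elim exE conjE) (rule that)
  define \<omega> where "\<omega> = nat \<lceil>(2 * C1 + 1)^2\<rceil>"
  have \<omega>: "(2 * C1 + 1)^2 \<le> real \<omega>" unfolding \<omega>_def by (rule real_nat_ceiling_ge)
  \<comment> \<open>The clique number \<omega> has to be fixed first, by density with exponent 3/2.
    A second use of density with \<theta> bounds degrees by a multiple of m^\<theta>, and \<theta>
    \<omega> <= \<eta> keeps the number of cliques below the required power.\<close>
  define \<theta> where "\<theta> = \<eta> / (real \<omega> + 1)"
  have \<theta>: "0 < \<theta>" "\<theta> \<le> \<eta>" "\<theta> * real \<omega> \<le> \<eta>" using \<eta> by (auto simp: \<theta>_def field_simps mult_left_le)
  have \<theta>1: "\<theta> \<le> 1" using \<theta> \<eta> by linarith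
  from density[OF \<delta> \<theta>(1) \<theta>1] obtain C2 where C2: "0 < C2" "\<forall>E V X F y. sepprop (\<lambda>n. \<beta> * real n powr \<delta>) E V \<longrightarrow> subdiv E V X F y \<longrightarrow>
    real (card F) \<le> C2 * real (card X) powr (1 + \<theta>)"
    by (elim exE conjE) (rule that)
  define C where "C = 1 + (C2 + (1 + (2 * C2 + 1) ^ \<omega>))"
  have "real (card ((\<lambda>v. {u \<in> X. (v, u) \<in> E}) ` V)) \<le> C * real (card X) powr (1 + \<eta>)"
    if sp: "sepprop (\<lambda>n. \<beta> * real n powr \<delta>) E V" and X: "X \<subseteq> V" "X \<noteq> {}" for E V X
  proof -
    have fV: "finite V" using sp by (simp add: sepprop_def)
    have fX: "finite X" by (rule finite_subset[OF X(1) fV])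
    define m where "m = real (card X)"
    have m: "1 \<le> m" using fX X(2) by (simp add: m_def Suc_le_eq card_gt_0_iff)
    let ?p = "m powr (1 + \<eta>)"
    have p1: "1 \<le> ?p" using m \<eta> by (intro ge_one_powr_ge_zero) auto
    have pm: "m \<le> ?p" using powr_mono[of 1 "1 + \<eta>" m] m \<eta> by simp
    have B: "real (card F) + real (card (cliques F X)) \<le> (C2 + (1 + (2 * C2 + 1) ^ \<omega>)) * ?p" if sub: "subdiv E V X F y" for F y
    proof -
      have FX: "F \<subseteq> X \<times> X" and Flt: "\<forall>e\<in>F. fst e < snd e" using sub by (simp_all add: subdiv_def)
      have fF: "finite F" by (rule finite_subset[OF FX]) (use fX in simp)
      define \<Delta> where "\<Delta> = 2 * C2 * m powr \<theta>"
      have \<Delta>: "0 \<le> \<Delta>" using C2(1) by (simp add: \<Delta>_def)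
      have "real (card F) \<le> C2 * m powr (1 + \<theta>)" using C2(2)[rule_format, OF sp sub] by (simp add: m_def)
      also have "\<dots> \<le> C2 * ?p" using C2(1) m \<theta> by (intro mult_left_mono powr_mono) auto
      finally have 1: "real (card F) \<le> C2 * ?p" .
      have deg: "2 * real (card (F \<inter> Z \<times> Z)) \<le> \<Delta> * real (card Z)" if Z: "Z \<subseteq> X" for Z
      proof (cases "card Z = 0")
        case True
        then have "Z = {}" using finite_subset[OF Z fX] by simp
        then show ?thesis by simp
      next
        case False
        have "real (card (F \<inter> Z \<times> Z)) \<le> C2 * real (card Z) powr (1 + \<theta>)"
          by (rule C2(2)[rule_format, OF sp subdiv_restrict[OF sub Z]])
        also have "\<dots> = C2 * real (card Z) * real (card Z) powr \<theta>" using False by (simp add: powr_add)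
        also have "\<dots> \<le> C2 * real (card Z) * m powr \<theta>"
          using C2(1) \<theta> card_mono[OF fX Z] by (intro mult_left_mono powr_mono2) (auto simp: m_def)
        finally show ?thesis by (simp add: \<Delta>_def algebra_simps)
      qed
      have clq: "card Q \<le> \<omega>" if Q: "Q \<in> cliques F X" for Q
      proof -
        have QX: "Q \<subseteq> X" using Q by (simp add: cliques_def)
        have fQ: "finite Q" by (rule finite_subset[OF QX fX])
        have "F \<inter> Q \<times> Q = {e \<in> Q \<times> Q. fst e < snd e}" using Q Flt by (auto simp: cliques_def)
        then have "2 * card (F \<inter> Q \<times> Q) = card Q * (card Q - 1)" using card_ordered_pairs[OF fQ] by simp
        then have "2 * real (card (F \<inter> Q \<times> Q)) = real (card Q * (card Q - 1))"
          by (metis of_nat_mult of_nat_numeral)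
        also have "\<dots> = real (card Q) * (real (card Q) - 1)" by (cases "card Q") (auto simp: algebra_simps)
        finally have "real (card Q) * (real (card Q) - 1) \<le> 2 * (C1 * real (card Q) powr (1 + 1 / 2))"
          using C1(2)[rule_format, OF sp subdiv_restrict[OF sub QX]] by linarith
        then have "real (card Q) \<le> (2 * C1 + 1)^2" using C1(1) by (rule clique_bound)
        then show ?thesis using \<omega> by linarith
      qed
      have "real (card (cliques F X)) \<le> 1 + m * (\<Delta> + 1) ^ \<omega>"
        unfolding m_def by (rule card_cliques[OF fX fF \<Delta> deg clq])
      also have "m * (\<Delta> + 1) ^ \<omega> \<le> m * ((2 * C2 + 1) * m powr \<theta>) ^ \<omega>"
      proof (intro mult_left_mono power_mono)
        have "1 \<le> m powr \<theta>" using m \<theta> by (intro ge_one_powr_ge_zero) auto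
        then show "\<Delta> + 1 \<le> (2 * C2 + 1) * m powr \<theta>" by (simp add: \<Delta>_def algebra_simps)
      qed (use m \<Delta> in auto)
      also have "\<dots> = (2 * C2 + 1) ^ \<omega> * (m * m powr (\<theta> * real \<omega>))"
        using m by (simp add: power_mult_distrib powr_powr[symmetric] powr_realpow)
      also have "m * m powr (\<theta> * real \<omega>) = m powr (1 + \<theta> * real \<omega>)" using m by (simp add: powr_add)
      also have "(2 * C2 + 1) ^ \<omega> * m powr (1 + \<theta> * real \<omega>) \<le> (2 * C2 + 1) ^ \<omega> * ?p"
        using C2(1) m \<theta> by (intro mult_left_mono powr_mono) auto
      finally have "real (card (cliques F X)) \<le> 1 + (2 * C2 + 1) ^ \<omega> * ?p" by simp
      then have "real (card F) + real (card (cliques F X)) \<le> C2 * ?p + (?p + (2 * C2 + 1) ^ \<omega> * ?p)"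
        using 1 p1 by linarith
      also have "\<dots> = (C2 + (1 + (2 * C2 + 1) ^ \<omega>)) * ?p" by (simp add: algebra_simps)
      finally show ?thesis .
    qed
    have "real (card ((\<lambda>v. {u \<in> X. (v, u) \<in> E}) ` V)) \<le> m + (C2 + (1 + (2 * C2 + 1) ^ \<omega>)) * ?p"
      unfolding m_def by (rule card_traces_le[OF fV X(1)]) (use B in \<open>simp add: m_def\<close>)
    also have "\<dots> \<le> 1 * ?p + (C2 + (1 + (2 * C2 + 1) ^ \<omega>)) * ?p" using pm by simp
    also have "\<dots> = C * ?p" by (simp only: C_def distrib_right)
    finally show ?thesis by (simp add: m_def)
  qed
  moreover have "0 < C" using C2(1) by (simp add: C_def add_pos_pos add_pos_nonneg)
  ultimately show ?thesis by blast
qed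

section \<open>Running time\<close>

lemma exists_pow2_above: "\<exists>l. (N::nat) < 2 ^ l \<and> 2 ^ l \<le> 2 * (N + 1)"
proof (induction N)
  case 0
  show ?case by (intro exI[of _ 0]) simp
next
  case (Suc N)
  then obtain l where l: "N < 2 ^ l" "2 ^ l \<le> 2 * (N + 1)" by blast
  show ?case
  proof (cases "Suc N < 2 ^ l")
    case True
    then show ?thesis using l by (intro exI[of _ l]) simp
  next
    case False
    then have "2 ^ l = Suc N" using l by simp
    then show ?thesis by (intro exI[of _ "Suc l"]) simp
  qed
qed

text \<open>With N < 2^l take h = 2l: then 4^l N < 8^l <= 9^l. As 2^h is polynomial in N, a forest
  of depth b h costs only N^O(b).\<close>

lemma exists_height: "\<exists>h. 2 ^ h * N < (3::nat) ^ h \<and> 2 ^ h \<le> 4 * (N + 1)^2"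
proof -
  obtain l where l: "N < 2 ^ l" "2 ^ l \<le> 2 * (N + 1)" using exists_pow2_above by blast
  have h: "(a::nat) ^ (2 * l) = (a * a) ^ l" for a by (simp add: power_mult power2_eq_square)
  have "(2::nat) ^ (2 * l) * N < 2 ^ (2 * l) * 2 ^ l" using l(1) by simp
  also have "\<dots> = 8 ^ l" unfolding h by (simp add: power_mult_distrib[symmetric])
  also have "\<dots> \<le> 3 ^ (2 * l)" unfolding h by (intro power_mono) auto
  finally have 1: "2 ^ (2 * l) * N < (3::nat) ^ (2 * l)" .
  have "(2::nat) ^ (2 * l) = (2 ^ l)^2" by (simp add: power_mult[symmetric] mult.commute)
  also have "\<dots> \<le> (2 * (N + 1))^2" by (rule power_mono[OF l(2)]) simp
  also have "\<dots> = 4 * (N + 1)^2" by (simp add: power2_eq_square)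
  finally show ?thesis using 1 by blast
qed

text \<open>All bounds are powers of k + 2, which is at least 2 also for k = 0, so a constant factor
  2^a adds a to the exponent.\<close>

lemma two_power_mult_le:
  assumes "2 \<le> (q::nat)"
  shows "2 ^ a * q ^ b \<le> q ^ (a + b)"
  using power_mono[OF assms, of a] by (simp add: power_add)

text \<open>The bound |R| + k |R|^2 on the kernel with the largest possible |R|, that for b = 1. It
  serves all rounds of the loop.\<close>

definition bigN :: "nat \<Rightarrow> nat" where
  "bigN k = (5 * k + 6 * k\<^sup>2) + k * (5 * k + 6 * k\<^sup>2)\<^sup>2"

lemma bigN_le: "bigN k + 1 \<le> (k + 2) ^ 11"
proof -
  define q where "q = k + 2"
  have q: "2 \<le> q" "k \<le> q" by (simp_all add: q_def)
  have a: "5 * k + 6 * k\<^sup>2 \<le> 6 * q\<^sup>2" by (simp add: q_def power2_eq_square)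
  have "k * (5 * k + 6 * k\<^sup>2)\<^sup>2 \<le> q * (6 * q\<^sup>2)\<^sup>2" by (intro mult_mono power_mono a q) auto
  also have "q * (6 * q\<^sup>2)\<^sup>2 = 36 * q ^ Suc (2 * 2)" unfolding power_Suc power_mult by (simp add: power_mult_distrib)
  also have "Suc (2 * 2) = 5" by simp
  finally have b: "k * (5 * k + 6 * k\<^sup>2)\<^sup>2 \<le> 36 * q ^ 5" .
  have c: "q\<^sup>2 \<le> q ^ 5" using q by (intro power_increasing) auto
  have d: "1 \<le> q ^ 5" using q by simp
  have "bigN k + 1 \<le> 2 ^ 6 * q ^ 5" unfolding bigN_def using a b c d by simp
  also have "\<dots> \<le> q ^ (6 + 5)" by (rule two_power_mult_le[OF q(1)])
  finally show ?thesis by (simp add: q_def)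
qed

lemma leafT_bound:
  assumes h: "2 ^ h \<le> 4 * (bigN k + 1)^2"
  shows "leafT L (bigN k) B h \<le> (k + 2) ^ (27 + 24 * B) * (L + 2) ^ 5000"
proof -
  define q where "q = k + 2"
  define N where "N = bigN k"
  have q: "2 \<le> q" by (simp add: q_def)
  have N: "N + 1 \<le> q ^ 11" using bigN_le by (simp add: q_def N_def)
  have NB: "(N + 1) ^ B \<le> q ^ (11 * B)" using power_mono[OF N, of B] by (simp add: power_mult)
  have N2: "(N + 1)^2 \<le> q ^ 22" using power_mono[OF N, of 2] by (simp add: power_mult[symmetric])
  have "6 * N\<^sup>2 + 3 \<le> 2 ^ 3 * (N + 1)^2" by (simp add: power2_eq_square)
  also have "\<dots> \<le> 2 ^ 3 * q ^ 22" using N2 by simp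
  also have "\<dots> \<le> q ^ (3 + 22)" by (rule two_power_mult_le[OF q])
  finally have a: "6 * N\<^sup>2 + 3 \<le> q ^ 25" by simp
  have "2 * (N + 1) ^ B \<le> 2 ^ 1 * q ^ (11 * B)" using NB by simp
  also have "\<dots> \<le> q ^ (1 + 11 * B)" by (rule two_power_mult_le[OF q])
  finally have "(6 * N\<^sup>2 + 3) * (2 * (N + 1) ^ B) \<le> q ^ 25 * q ^ (1 + 11 * B)" by (rule mult_le_mono[OF a])
  also have "\<dots> = q ^ (26 + 11 * B)" by (subst power_add[symmetric]) simp
  also have "\<dots> \<le> q ^ (26 + 24 * B)" using q by (intro power_increasing) auto
  finally have b: "(6 * N\<^sup>2 + 3) * (2 * (N + 1) ^ B) \<le> q ^ (26 + 24 * B)" .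
  have "2 ^ h \<le> 2 ^ 2 * q ^ 22" using h N2 by (simp add: N_def)
  also have "\<dots> \<le> q ^ (2 + 22)" by (rule two_power_mult_le[OF q])
  finally have hq: "2 ^ h \<le> q ^ 24" by simp
  have "(2::nat) ^ (B * h + 1) = 2 ^ 1 * (2 ^ h) ^ B" by (simp add: power_mult[symmetric] mult.commute)
  also have "\<dots> \<le> 2 ^ 1 * q ^ (24 * B)" using power_mono[OF hq, of B] by (simp add: power_mult)
  also have "\<dots> \<le> q ^ (1 + 24 * B)" by (rule two_power_mult_le[OF q])
  finally have "(N + 1) * 2 ^ (B * h + 1) \<le> q ^ 11 * q ^ (1 + 24 * B)" by (rule mult_le_mono[OF N])
  also have "\<dots> = q ^ (12 + 24 * B)" by (subst power_add[symmetric]) simp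
  also have "\<dots> \<le> q ^ (26 + 24 * B)" using q by (intro power_increasing) auto
  finally have "(6 * N\<^sup>2 + 3) * (2 * (N + 1) ^ B) + (N + 1) * 2 ^ (B * h + 1) \<le> 2 ^ 1 * q ^ (26 + 24 * B)"
    using b by simp
  also have "\<dots> \<le> q ^ (1 + (26 + 24 * B))" by (rule two_power_mult_le[OF q])
  finally show ?thesis unfolding leafT_def N_def[symmetric] q_def[symmetric] by (intro mult_right_mono) simp_all
qed

section \<open>Correctness on a graph class\<close>

locale input_graph =
  fixes n k :: nat and E :: "(nat \<times> nat) set"
  assumes sub: "E \<subseteq> {..<n} \<times> {..<n}" and E_sym': "(u, v) \<in> E \<Longrightarrow> (v, u) \<in> E" and E_irrefl': "(u, u) \<notin> E"
begin

text \<open>A single power of n + k + 3 meets all demands on \<open>L\<close>; the strongest ones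
  are the number of listed triangles and the sums of values in the solver.\<close>

lemma L_large:
  "(n + 2) * (k + 1) + n \<le> (n + k + 3) ^ 5" "k < (n + k + 3) ^ 5" "n * (n * n) \<le> (n + k + 3) ^ 5"
  "3 \<le> (n + k + 3) ^ 5" "n * n \<le> (n + k + 3) ^ 5" "n \<le> (n + k + 3) ^ 5" "5 * k + 6 * k\<^sup>2 \<le> (n + k + 3) ^ 5"
  "3 * k \<le> (n + k + 3) ^ 5" "2 * n \<le> (n + k + 3) ^ 5"
proof -
  define s where "s = n + k + 3"
  have s: "3 \<le> s" "n \<le> s" "k \<le> s" by (simp_all add: s_def)
  have s2: "j * s \<le> s * s * j" for j using s by simp
  have c: "27 * (s * s) \<le> s ^ 5"
  proof -
    have "27 * (s * s) \<le> s ^ 3 * (s * s)" using power_mono[OF s(1), of 3] by (intro mult_le_mono) simp_all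
    also have "\<dots> = s ^ 5" by (simp add: eval_nat_numeral)
    finally show ?thesis .
  qed
  have d: "3 * s \<le> s * s" using s by simp
  have nn: "n * n \<le> s * s" using s by (intro mult_le_mono)
  have kk: "k * k \<le> s * s" using s by (intro mult_le_mono)
  have "(n + 2) * (k + 1) \<le> s * s" by (intro mult_le_mono) (simp_all add: s_def)
  then show "(n + 2) * (k + 1) + n \<le> (n + k + 3) ^ 5" using c d s unfolding s_def[symmetric] by linarith
  have "n * (n * n) \<le> s * (s * s)" using s by (intro mult_le_mono)
  also have "\<dots> = s ^ 3" by (simp add: eval_nat_numeral)
  also have "\<dots> \<le> s ^ 5" using s by (intro power_increasing) auto
  finally show "n * (n * n) \<le> (n + k + 3) ^ 5" unfolding s_def[symmetric] .
  show "5 * k + 6 * k\<^sup>2 \<le> (n + k + 3) ^ 5"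
    using kk c d s unfolding s_def[symmetric] power2_eq_square by linarith
  show "k < (n + k + 3) ^ 5" "3 \<le> (n + k + 3) ^ 5" "n * n \<le> (n + k + 3) ^ 5" "n \<le> (n + k + 3) ^ 5"
    "3 * k \<le> (n + k + 3) ^ 5" "2 * n \<le> (n + k + 3) ^ 5"
    using nn c d s unfolding s_def[symmetric] by linarith+
qed

sublocale sgraph_ctx n E "(n + k + 3) ^ 5"
  using sub E_sym' E_irrefl' L_large(6,9) by unfold_locales auto

text \<open>The exponent 27 B is 3 B from the branching, as 3k + 2 <= (k + 2)^3, and 24 B from the
  leaves. The 30000 is 6 times 5000, as L + 2 <= (n + k + 3)^6, and n + k + 3 <= (n + 2)(k + 2)
  separates n from k. The number of rounds is paid by one factor n, hence the condition B <=
  n.\<close>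

lemma time_bound:
  assumes h: "2 ^ h \<le> 4 * (bigN k + 1)^2" and B: "B \<le> n"
  shows "B * iterT k (bigN k) h B + ((n + k + 3) ^ 5 + 2) ^ 5000 \<le> (k + 2) ^ (27 * B + 30032) * (n + 2) ^ 30001"
proof -
  define q where "q = k + 2"
  define L where "L = (n + k + 3) ^ 5"
  define P where "P = (L + 2) ^ 5000"
  have q: "2 \<le> q" by (simp add: q_def)
  have one: "1 \<le> q ^ j" for j using q by simp
  have "3 * k + 2 \<le> 2 ^ 2 * q ^ 1" by (simp add: q_def)
  also have "\<dots> \<le> q ^ (2 + 1)" by (rule two_power_mult_le[OF q])
  finally have "(3 * k + 2) ^ (B + 1) \<le> (q ^ 3) ^ (B + 1)" by (intro power_mono) simp_all
  then have a: "(3 * k + 2) ^ (B + 1) \<le> q ^ (3 * (B + 1))" by (simp only: power_mult)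
  have "leafT L (bigN k) B h + P \<le> q ^ (27 + 24 * B) * P + 1 * P"
    using leafT_bound[OF h, of L B] by (simp add: q_def P_def)
  also have "\<dots> \<le> q ^ (27 + 24 * B) * P + q ^ (27 + 24 * B) * P" by (intro add_left_mono mult_right_mono one) simp
  also have "\<dots> = 2 ^ 1 * q ^ (27 + 24 * B) * P" by simp
  also have "\<dots> \<le> q ^ (1 + (27 + 24 * B)) * P" by (intro mult_right_mono two_power_mult_le[OF q]) simp
  finally have "(3 * k + 2) ^ (B + 1) * (leafT L (bigN k) B h + P) \<le> q ^ (3 * (B + 1)) * (q ^ (1 + (27 + 24 * B)) * P)"
    by (rule mult_le_mono[OF a])
  also have "\<dots> = q ^ (3 * (B + 1) + (1 + (27 + 24 * B))) * P" by (simp only: power_add mult.assoc)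
  also have "3 * (B + 1) + (1 + (27 + 24 * B)) = 31 + 27 * B" by simp
  finally have "iterT k (bigN k) h B \<le> q ^ (31 + 27 * B) * P + 1 * P"
    unfolding iterT_def unfolding L_def[symmetric] unfolding P_def[symmetric] mult_1 by (rule add_right_mono)
  also have "\<dots> \<le> q ^ (31 + 27 * B) * P + q ^ (31 + 27 * B) * P" by (intro add_left_mono mult_right_mono one) simp
  also have "\<dots> = 2 ^ 1 * q ^ (31 + 27 * B) * P" by simp
  also have "\<dots> \<le> q ^ (1 + (31 + 27 * B)) * P" by (intro mult_right_mono two_power_mult_le[OF q]) simp
  finally have i: "iterT k (bigN k) h B \<le> q ^ (1 + (31 + 27 * B)) * P" .
  have "B * iterT k (bigN k) h B + P \<le> n * (q ^ (1 + (31 + 27 * B)) * P) + 1 * P" using mult_le_mono[OF B i] by simp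
  also have "\<dots> \<le> n * (q ^ (1 + (31 + 27 * B)) * P) + q ^ (1 + (31 + 27 * B)) * P"
    by (intro add_left_mono mult_right_mono one) simp
  also have "\<dots> = (n + 1) * q ^ (1 + (31 + 27 * B)) * P" by (simp add: algebra_simps)
  also have "\<dots> \<le> (n + 2) * q ^ (1 + (31 + 27 * B)) * ((n + 2) * q) ^ 30000"
  proof (intro mult_le_mono)
    define s where "s = n + k + 3"
    have s: "2 \<le> s" by (simp add: s_def)
    have "2 \<le> s ^ 5" using s self_le_power[of s 5] by linarith
    then have "L + 2 \<le> 2 ^ 1 * s ^ 5" by (simp add: L_def s_def)
    also have "\<dots> \<le> s ^ (1 + 5)" by (rule two_power_mult_le[OF s])
    finally have "P \<le> (s ^ 6) ^ 5000" unfolding P_def by (intro power_mono) simp_all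
    also have "\<dots> = s ^ 30000" by (subst power_mult[symmetric]) simp
    also have "\<dots> \<le> ((n + 2) * q) ^ 30000" by (rule power_mono) (simp_all add: s_def q_def)
    finally show "P \<le> ((n + 2) * q) ^ 30000" .
  qed simp_all
  also have "\<dots> = (q ^ (1 + (31 + 27 * B)) * q ^ 30000) * ((n + 2) * (n + 2) ^ 30000)"
    by (simp only: power_mult_distrib ac_simps)
  also have "\<dots> = q ^ (1 + (31 + 27 * B) + 30000) * (n + 2) ^ Suc 30000" by (simp only: power_add power_Suc)
  also have "1 + (31 + 27 * B) + 30000 = 27 * B + 30032" by simp
  also have "Suc 30000 = (30001::nat)" by simp
  finally show ?thesis by (simp only: P_def q_def L_def)
qed

lemma runs_bound:
  assumes "1 \<le> B" "B \<le> n" "\<not> fails k B"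
  shows "runs [SCons g (enc_nat k)] (ECall 0 [EVar 0]) (enc_bool (has_hs k)) ((k + 2) ^ (27 * B + 30032) * (n + 2) ^ 30001)"
proof -
  obtain h where h: "2 ^ h * bigN k < 3 ^ h" "2 ^ h \<le> 4 * (bigN k + 1)^2" using exists_height by blast
  have "n * B \<le> n * n" using assms(2) by simp
  then have nB: "n * B \<le> (n + k + 3) ^ 5" using L_large(5) by (rule order_trans)
  have BL: "B \<le> (n + k + 3) ^ 5" using assms(2) L_large(6) by (rule order_trans)
  have n: "1 \<le> n" using assms by linarith
  have N: "(5 * k + 6 * k\<^sup>2) + k * (5 * k + 6 * k\<^sup>2)\<^sup>2 \<le> bigN k" by (simp add: bigN_def)
  show ?thesis
    by (rule runs_mono[OF runs_main[OF L_large(1-4) nB BL L_large(7,8) N h(1) assms(1,3) n] time_bound[OF h(2) assms(2)]])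
qed

lemma enc_graph_eq: "pverts G = {..<n} \<Longrightarrow> parcs G = E \<Longrightarrow> enc_graph G = g"
  by (simp add: enc_graph_def g_def EL_def)

lemma triangle_hitting_iff:
  assumes "pverts G = {..<n}" "parcs G = E"
  shows "triangle_hitting G k' \<longleftrightarrow> has_hs k'"
proof -
  have "(\<forall>T. is_triangle G T \<longrightarrow> S \<inter> T \<noteq> {}) \<longleftrightarrow> hits S" for S
  proof
    assume H: "\<forall>T. is_triangle G T \<longrightarrow> S \<inter> T \<noteq> {}"
    show "hits S"
      unfolding hits_def
    proof
      fix t assume "t \<in> set TT"
      then obtain u v w where t: "t = [u, v, w]" "(u, v) \<in> E" "(v, w) \<in> E" "(u, w) \<in> E" unfolding in_TT by blast
      have "u \<noteq> v" "v \<noteq> w" "u \<noteq> w" using t E_irrefl by auto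
      then have "is_triangle G {u, v, w}"
        using t(2-4) assms sub unfolding is_triangle_def
        by (intro exI[of _ u] exI[of _ v] exI[of _ w] conjI) auto
      then have "S \<inter> {u, v, w} \<noteq> {}" by (rule H[rule_format])
      then show "set t \<inter> S \<noteq> {}" using t(1) by auto
    qed
  next
    assume H: "hits S"
    show "\<forall>T. is_triangle G T \<longrightarrow> S \<inter> T \<noteq> {}"
    proof (intro allI impI)
      fix T assume "is_triangle G T"
      then obtain u v w where T: "T = {u, v, w}" "(u, v) \<in> E" "(v, w) \<in> E" "(u, w) \<in> E"
        using assms(2) unfolding is_triangle_def by blast
      then show "S \<inter> T \<noteq> {}" using hitsD[OF H T(2-4)] by auto
    qed
  qed
  then show ?thesis by (simp add: triangle_hitting_def has_hs_def assms(1))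
qed

text \<open>A vertex set is a separator of itself, so b = n never fails, in any graph.\<close>

lemma not_fails_n: "\<not> fails k n"
proof
  assume "fails k n"
  then obtain W where W: "W \<subseteq> {..<n}" "\<forall>S. balS W S \<longrightarrow> n < card S"
    unfolding fails_def bad_def by (elim exE conjE) (rule that)
  have "balS W W" by (simp add: balS_def)
  then have "n < card W" by (rule W(2)[rule_format])
  moreover have "card W \<le> n" using card_mono[OF _ W(1)] by simp
  ultimately show False by simp
qed

lemma ntr_empty: "ntr {} \<le> 1"
  unfolding ntr_def by (rule order_trans[OF card_mono[of "{{}}"]]) auto

text \<open>The alternative \<open>w \<le> b\<close> covers sets so small that they are their own
  separators. This also settles X = {}, where W has at most one vertex; nothing has to be assumed
  about traces on the empty set.\<close>

lemma not_fails:
  assumes sep: "sepprop f E {..<n}" and b: "1 \<le> b"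
    and f: "\<And>X w. X \<subseteq> {..<n} \<Longrightarrow> X \<noteq> {} \<Longrightarrow> card X * b \<le> 5 * k * b + 6 * k\<^sup>2 \<Longrightarrow> w \<le> card X + ntr X \<Longrightarrow>
      w \<le> b \<or> f w \<le> real b"
  shows "\<not> fails k b"
proof
  assume "fails k b"
  then obtain X W where XW: "X \<subseteq> {..<n}" "card X * b \<le> 5 * k * b + 6 * k\<^sup>2" "W \<subseteq> {..<n}" "card W \<le> card X + ntr X"
    and W: "\<forall>S. balS W S \<longrightarrow> b < card S"
    unfolding fails_def bad_def by (elim exE conjE) (rule that)
  have "card W \<le> b \<or> f (card W) \<le> real b"
  proof (cases "X = {}")
    case True
    then show ?thesis using XW(4) ntr_empty b by simp
  next
    case False
    then show ?thesis by (rule f[OF XW(1) _ XW(2,4)])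
  qed
  then show False
  proof
    assume "card W \<le> b"
    moreover have "balS W W" by (simp add: balS_def)
    ultimately show False using W[rule_format, of W] by simp
  next
    assume fb: "f (card W) \<le> real b"
    from sep XW(3) obtain S K where SK: "S \<subseteq> W" "parts_of E (W - S) K"
      "\<forall>A\<in>K. real (card A) \<le> 2 / 3 * real (card W)" "real (card S) \<le> f (card W)"
      unfolding sepprop_def by meson
    have "balS W S"
      unfolding balS_def
    proof (intro conjI ballI)
      fix x assume "x \<in> W - S"
      then obtain A where A: "A \<in> K" "x \<in> A" using SK(2) unfolding parts_of_def by blast
      have "A \<subseteq> W - S" by (rule parts_of_subset[OF SK(2) A(1)])
      moreover have "3 * card A \<le> 2 * card W" using SK(3) A(1) by (force simp: field_simps)
      moreover have "\<forall>u\<in>A. \<forall>v\<in>W - S. (u, v) \<in> E \<longrightarrow> v \<in> A" using SK(2) A(1) unfolding parts_of_def by blast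
      ultimately show "\<exists>A\<subseteq>W - S. x \<in> A \<and> (\<forall>u\<in>A. \<forall>v\<in>W - S. (u, v) \<in> E \<longrightarrow> v \<in> A) \<and> 3 * card A \<le> 2 * card W"
        using A(2) by blast
    qed (rule SK(1))
    then have "b < card S" by (rule W[rule_format])
    then show False using SK(4) fb by linarith
  qed
qed

end

lemma input_graph_of:
  assumes "pair_graph G" "pverts G = {..<n}"
  shows "input_graph n (parcs G)"
proof -
  interpret pair_graph G by (rule assms(1))
  show ?thesis
  proof
    show "parcs G \<subseteq> {..<n} \<times> {..<n}"
      using arc_fst_in_verts arc_snd_in_verts assms(2) by force
    show "(v, u) \<in> parcs G" if "(u, v) \<in> parcs G" for u v by (rule parcs_sym[OF assms(1) that])
    show "(u, u) \<notin> parcs G" for u using pair_no_loops[of "(u, u)"] by auto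
  qed
qed

section \<open>Choice of the order b and the final estimates\<close>

definition ntrace :: "(nat \<times> nat) set \<Rightarrow> nat set \<Rightarrow> nat set \<Rightarrow> nat" where
  "ntrace E V X = card ((\<lambda>v. {u \<in> X. (v, u) \<in> E}) ` V)"

lemma solves_if:
  assumes her: "hereditary \<G>"
    and B: "\<And>n k G. G \<in> \<G> \<Longrightarrow> pverts G = {..<n} \<Longrightarrow> 1 \<le> n \<Longrightarrow>
      \<exists>f B. sepprop f (parcs G) {..<n} \<and> 1 \<le> B \<and>
        (\<forall>X w. X \<subseteq> {..<n} \<and> X \<noteq> {} \<and> card X * B \<le> 5 * k * B + 6 * k\<^sup>2 \<and> w \<le> card X + ntrace (parcs G) {..<n} X \<longrightarrow>
          w \<le> B \<or> f w \<le> real B) \<and>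
        real (k + 2) ^ (27 * B + 30032) * real (n + 2) ^ 30001 \<le> T n k"
    and T0: "\<And>k. 20 \<le> T 0 k"
  shows "solves_triangle_hitting_on prog \<G> T"
  unfolding solves_triangle_hitting_on_def
proof (intro allI ballI impI)
  fix n k G assume G: "G \<in> \<G>" "pverts G = {..<n}"
  have "\<forall>G\<in>\<G>. pair_graph G" using her unfolding hereditary_def graph_class_def by (elim conjE)
  then have pg: "pair_graph G" using G(1) by (rule bspec)
  interpret input_graph n k "parcs G" by (rule input_graph_of[OF pg G(2)])
  have enc: "enc_instance G k = SCons g (enc_nat k)" using enc_graph_eq[OF G(2) refl] by (simp add: enc_instance_def)
  have th: "triangle_hitting G k \<longleftrightarrow> has_hs k" by (rule triangle_hitting_iff[OF G(2) refl])
  have "\<exists>t. runs [SCons g (enc_nat k)] (ECall 0 [EVar 0]) (enc_bool (has_hs k)) t \<and> real t \<le> T n k"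
  proof (cases "n = 0")
    case True
    have "parcs G = {}" using sub True by auto
    then have "TT = []" using in_TT by (cases TT) auto
    then have "has_hs k" unfolding has_hs_def hits_def by (intro exI[of _ "{}"]) simp
    moreover have "g = SNil" unfolding g_def using True by simp
    ultimately show ?thesis using runs_main_empty T0[of k] True by (intro exI[of _ 20]) simp
  next
    case False
    then have n: "1 \<le> n" by simp
    from B[OF G n, of k] obtain f B where fB: "sepprop f (parcs G) {..<n}" "1 \<le> B"
      "\<forall>X w. X \<subseteq> {..<n} \<and> X \<noteq> {} \<and> card X * B \<le> 5 * k * B + 6 * k\<^sup>2 \<and> w \<le> card X + ntrace (parcs G) {..<n} X \<longrightarrow>
          w \<le> B \<or> f w \<le> real B"
      "real (k + 2) ^ (27 * B + 30032) * real (n + 2) ^ 30001 \<le> T n k"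
      by (elim exE conjE) (rule that)
    have nf: "\<not> fails k B"
      using fB(3) by (intro not_fails[OF fB(1,2)]) (simp add: ntrace_def ntr_def)
    \<comment> \<open>The order n never fails either. Using the smaller of the two keeps the number
      of loop rounds at most n, as \<open>runs_bound\<close> requires.\<close>
    define b where "b = min n B"
    have b: "1 \<le> b" "b \<le> n" "\<not> fails k b" using n fB(2) nf not_fails_n by (auto simp: b_def min_def)
    have "(k + 2) ^ (27 * b + 30032) * (n + 2) ^ 30001 \<le> (k + 2) ^ (27 * B + 30032) * (n + 2) ^ 30001"
      by (intro mult_right_mono power_increasing) (auto simp: b_def)
    then have "real ((k + 2) ^ (27 * b + 30032) * (n + 2) ^ 30001) \<le> real ((k + 2) ^ (27 * B + 30032) * (n + 2) ^ 30001)"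
      by (rule of_nat_mono)
    also have "\<dots> = real (k + 2) ^ (27 * B + 30032) * real (n + 2) ^ 30001" by (simp only: of_nat_mult of_nat_power)
    also note fB(4)
    finally show ?thesis using runs_bound[OF b] by (intro exI conjI)
  qed
  then obtain t where "runs [SCons g (enc_nat k)] (ECall 0 [EVar 0]) (enc_bool (has_hs k)) t" "real t \<le> T n k" by blast
  then obtain t' where "eval prog [SCons g (enc_nat k)] (ECall 0 [EVar 0]) (enc_bool (has_hs k)) t'" "real t' \<le> T n k"
    unfolding runs_def by (meson of_nat_mono order_trans)
  then show "\<exists>t. computes_in_time prog (enc_instance G k) (enc_bool (triangle_hitting G k)) t \<and> real t \<le> T n k"
    unfolding computes_in_time_def enc th by blast
qed

text \<open>Here |X| <= 5k + 6 k^2 / b, where k^2 / b <= k^(2 - \<tau>) by the lower bound on b and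
  k <= k^(2 - \<tau>) because \<tau> <= 1. The 11 is 5 + 6.\<close>

lemma card_X_bound:
  assumes k: "1 \<le> k" and \<tau>: "real k powr \<tau> \<le> real b" "\<tau> \<le> 1" and x: "x * b \<le> 5 * k * b + 6 * k\<^sup>2"
  shows "real x \<le> 11 * real k powr (2 - \<tau>)"
proof -
  let ?p = "real k powr (2 - \<tau>)"
  have kp: "0 < real k powr \<tau>" using k by simp
  then have b: "0 < real b" using \<tau> by linarith
  have k2: "real k * real k = ?p * real k powr \<tau>" using k by (simp add: powr_add[symmetric] power2_eq_square)
  have "?p * real k powr \<tau> \<le> ?p * real b" using \<tau>(1) by (rule mult_left_mono) simp
  then have kk: "real k * real k \<le> ?p * real b" unfolding k2 .
  have "real k powr 1 \<le> ?p" using k \<tau>(2) by (intro powr_mono) auto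
  then have kp: "real k * real b \<le> ?p * real b" using k b by (intro mult_right_mono) auto
  have "real (x * b) \<le> real (5 * k * b + 6 * k\<^sup>2)" using x by (rule of_nat_mono)
  then have "real x * real b \<le> 5 * (real k * real b) + 6 * (real k * real k)" by (simp add: power2_eq_square)
  also have "\<dots> \<le> (11 * ?p) * real b" using kk kp by linarith
  finally show ?thesis using b by (rule mult_right_le_imp_le)
qed

text \<open>A bound of the form O(n^\<delta>) holds only from some \<open>n0\<close> on. Smaller
  sets are separated by all their vertices, which \<beta> >= n0 allows.\<close>

lemma sepprop_weaken:
  assumes "sepprop f E V" "\<And>m. n0 \<le> m \<Longrightarrow> f m \<le> \<beta> * real m powr \<delta>" "real n0 \<le> \<beta>" "0 \<le> \<delta>"
  shows "sepprop (\<lambda>m. \<beta> * real m powr \<delta>) E V"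
  unfolding sepprop_def
proof (intro conjI allI impI)
  show fV: "finite V" using assms(1) by (simp add: sepprop_def)
  fix W assume W: "W \<subseteq> V"
  show "\<exists>S K. S \<subseteq> W \<and> parts_of E (W - S) K \<and> (\<forall>A\<in>K. real (card A) \<le> 2 / 3 * real (card W)) \<and>
    real (card S) \<le> \<beta> * real (card W) powr \<delta>"
  proof (cases "n0 \<le> card W")
    case True
    from assms(1) W obtain S K where "S \<subseteq> W" "parts_of E (W - S) K"
      "\<forall>A\<in>K. real (card A) \<le> 2 / 3 * real (card W)" "real (card S) \<le> f (card W)"
      unfolding sepprop_def by blast
    moreover have "f (card W) \<le> \<beta> * real (card W) powr \<delta>" using True by (rule assms(2))
    ultimately show ?thesis by (meson order_trans)
  next
    case False
    have "real (card W) \<le> \<beta> * real (card W) powr \<delta>"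
    proof (cases "card W = 0")
      case F: False
      then have "1 \<le> real (card W) powr \<delta>" using assms(4) by (intro ge_one_powr_ge_zero) auto
      then have "real n0 * 1 \<le> \<beta> * real (card W) powr \<delta>" using assms(3) by (intro mult_mono) auto
      then show ?thesis using False by simp
    qed simp
    moreover have "parts_of E (W - W) {}" by (simp add: parts_of_def)
    ultimately show ?thesis by (intro exI[of _ W] exI[of _ "{}"]) simp
  qed
qed

text \<open>In a one-vertex graph the vertex must be in the separator, since a component of size 1
  exceeds 2/3. Hence \<beta> >= 1, which later makes the real threshold for b at least 1.\<close>

lemma sepprop_singleton:
  assumes "sepprop (\<lambda>m. \<beta> * real m powr \<delta>) E V" "V \<noteq> {}"
  shows "1 \<le> \<beta>"
proof -
  obtain v where v: "{v} \<subseteq> V" using assms(2) by blast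
  with assms(1) obtain S K where SK: "S \<subseteq> {v}" "parts_of E ({v} - S) K"
    "\<forall>A\<in>K. real (card A) \<le> 2 / 3 * real (card {v})" "real (card S) \<le> \<beta> * real (card {v}) powr \<delta>"
    unfolding sepprop_def by blast
  have "v \<in> S"
  proof (rule ccontr)
    assume n: "v \<notin> S"
    then have "{v} - S = {v}" by blast
    then have "\<Union>K = {v}" using SK(2) unfolding parts_of_def by simp
    then obtain A where A: "A \<in> K" "v \<in> A" "A \<subseteq> {v}" by blast
    then have "A = {v}" by blast
    then show False using SK(3) A(1) by auto
  qed
  then have "S = {v}" using SK(1) by blast
  then show ?thesis using SK(4) by simp
qed

lemma ntrace_eq: "X \<subseteq> V \<Longrightarrow> V = pverts G \<Longrightarrow> {neighborhood G v \<inter> X |v. v \<in> pverts G} = (\<lambda>v. {u \<in> X. (v, u) \<in> parcs G}) ` V"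
  by (auto simp: neighborhood_def image_iff)

lemma ntrace_le_pow: "finite X \<Longrightarrow> ntrace E V X \<le> 2 ^ card X"
proof -
  assume "finite X"
  then have "ntrace E V X \<le> card (Pow X)" unfolding ntrace_def by (intro card_mono) auto
  then show ?thesis using \<open>finite X\<close> by (simp add: card_Pow)
qed

lemma powr_pow: "(2 powr x) ^ m = 2 powr (x * real m)"
  by (simp add: powr_powr[symmetric] powr_realpow)

text \<open>For k >= 2 one has k + 2 <= k^2, which gives a factor 2 in the exponent. Rounding b up
  and absorbing the constants into B0 >= 1 gives 27 + 27 + 30032 = 30086, and 60172 is twice
  this.\<close>

lemma bound_large_k:
  assumes k: "2 \<le> k" and B0: "1 \<le> B0" "real B \<le> B0 + 1"
  shows "real (k + 2) ^ (27 * B + 30032) \<le> 2 powr (60172 * (B0 * log 2 (real k)))"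
proof -
  have lg: "0 \<le> log 2 (real k)" using k by simp
  have "k + 2 \<le> k * k" using k mult_le_mono1[of 2 k k] by linarith
  then have "real (k + 2) \<le> real (k * k)" by (rule of_nat_mono)
  also have "\<dots> = 2 powr (2 * log 2 (real k))"
  proof -
    have "2 powr (2 * log 2 (real k)) = 2 powr (log 2 (real k) + log 2 (real k))" by simp
    also have "\<dots> = real k * real k" unfolding powr_add using k by simp
    finally show ?thesis by simp
  qed
  finally have "real (k + 2) ^ (27 * B + 30032) \<le> (2 powr (2 * log 2 (real k))) ^ (27 * B + 30032)"
    by (rule power_mono) simp
  also have "\<dots> = 2 powr (2 * log 2 (real k) * real (27 * B + 30032))" by (rule powr_pow)
  also have "\<dots> \<le> 2 powr (60172 * (B0 * log 2 (real k)))"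
  proof (rule powr_mono)
    have "real (27 * B + 30032) \<le> 30086 * B0" using B0 by simp
    then have "2 * log 2 (real k) * real (27 * B + 30032) \<le> 2 * log 2 (real k) * (30086 * B0)"
      using lg by (intro mult_left_mono) auto
    then show "2 * log 2 (real k) * real (27 * B + 30032) \<le> 60172 * (B0 * log 2 (real k))" by (simp add: algebra_simps)
  qed simp
  finally show ?thesis .
qed


lemma twenty_le:
  assumes "1 \<le> (p::real)" "5 \<le> d"
  shows "20 \<le> p * real (0 + 2) ^ d"
proof -
  have "(2::real) ^ 5 \<le> 2 ^ d" using assms(2) by (rule power_increasing) simp
  then have "1 * 20 \<le> p * 2 ^ d" using assms(1) by (intro mult_mono) auto
  then show ?thesis by simp
qed

lemma time_bound_precise:
  assumes her: "hereditary \<G>" and \<beta>: "0 < \<beta>" and \<delta>: "0 \<le> \<delta>" "\<delta> < 1"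
    and sep: "has_separators \<G> (\<lambda>n. \<beta> * real n powr \<delta>)" and lnc: "linear_neighborhood_complexity \<G> c"
  shows "solves_triangle_hitting_on prog \<G>
    (\<lambda>n k. 2 powr (60172 * (\<beta> * 22 powr \<delta> * c powr \<delta> * real k powr (2 * \<delta> / (1 + \<delta>)) * log 2 (real k))) * real (n + 2) ^ 201251)"
proof (rule solves_if[OF her])
  fix n k G assume G: "G \<in> \<G>" "pverts G = {..<n}" and n: "1 \<le> n"
  let ?f = "\<lambda>m. \<beta> * real m powr \<delta>"
  let ?E = "parcs G"
  define \<tau> where "\<tau> = 2 * \<delta> / (1 + \<delta>)"
  have sp: "sepprop ?f ?E {..<n}" using class_sepprop[OF her sep G(1)] G(2) by simp
  have tr: "real (ntrace ?E {..<n} X) \<le> c * real (card X)" if "X \<subseteq> {..<n}" "X \<noteq> {}" for X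
  proof -
    have "\<forall>X. X \<subseteq> pverts G \<and> X \<noteq> {} \<longrightarrow> real (card {neighborhood G v \<inter> X |v. v \<in> pverts G}) \<le> c * real (card X)"
      using lnc G(1) unfolding linear_neighborhood_complexity_def by (rule bspec)
    moreover have "X \<subseteq> pverts G \<and> X \<noteq> {}" using that G(2) by simp
    ultimately have "real (card {neighborhood G v \<inter> X |v. v \<in> pverts G}) \<le> c * real (card X)" by blast
    then show ?thesis unfolding ntrace_eq[OF that(1) G(2)[symmetric]] ntrace_def .
  qed
  have "0 \<in> {..<n}" using n by simp
  then have ne: "{..<n} \<noteq> {}" by blast
  have \<beta>1: "1 \<le> \<beta>" by (rule sepprop_singleton[OF sp ne])
  \<comment> \<open>A single vertex has at least one trace, so c >= 1 whenever the class has a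
    nonempty graph.\<close>
  have "0 < ntrace ?E {..<n} {0}" using ne unfolding ntrace_def by (subst card_gt_0_iff) blast
  then have c1: "1 \<le> c" using tr[of "{0}"] n by simp
  have npos: "1 \<le> real (n + 2) ^ j" for j by simp
  show "\<exists>f B. sepprop f ?E {..<n} \<and> 1 \<le> B \<and>
        (\<forall>X w. X \<subseteq> {..<n} \<and> X \<noteq> {} \<and> card X * B \<le> 5 * k * B + 6 * k\<^sup>2 \<and> w \<le> card X + ntrace ?E {..<n} X \<longrightarrow>
          w \<le> B \<or> f w \<le> real B) \<and>
        real (k + 2) ^ (27 * B + 30032) * real (n + 2) ^ 30001
        \<le> 2 powr (60172 * (\<beta> * 22 powr \<delta> * c powr \<delta> * real k powr (2 * \<delta> / (1 + \<delta>)) * log 2 (real k))) * real (n + 2) ^ 201251"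
  proof (cases "k \<le> 1")
    case True
    \<comment> \<open>For k <= 1 the logarithm is 0, with the value 0 also at k = 0, so the bound
      has to be polynomial in n alone. Then |X| <= 11, and 2059 = 11 + 2^11 bounds the kernel by
      counting all subsets as traces. The exponent 201251 is 2 * 85625 + 30001, where 85625 = 27 *
      2059 + 30032.\<close>
    have "w \<le> 2059" if X: "X \<subseteq> {..<n}" "card X * 2059 \<le> 5 * k * 2059 + 6 * k\<^sup>2" "w \<le> card X + ntrace ?E {..<n} X" for X w
    proof -
      have "k\<^sup>2 \<le> 1" using power_mono[OF True, of 2] by simp
      then have x: "card X \<le> 11" using X(2) True by linarith
      have "ntrace ?E {..<n} X \<le> 2 ^ card X" using finite_subset[OF X(1)] by (intro ntrace_le_pow) simp
      also have "\<dots> \<le> 2 ^ 11" using x by (intro power_increasing) auto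
      finally show ?thesis using X(3) x by simp
    qed
    moreover have "real (k + 2) ^ (27 * 2059 + 30032) * real (n + 2) ^ 30001
      \<le> 2 powr (60172 * (\<beta> * 22 powr \<delta> * c powr \<delta> * real k powr (2 * \<delta> / (1 + \<delta>)) * log 2 (real k))) * real (n + 2) ^ 201251"
    proof -
      have "real (k + 2) ^ 85625 \<le> (real (n + 2) ^ 2) ^ 85625"
      proof (rule power_mono)
        have "(2::real) ^ 2 \<le> real (n + 2) ^ 2" by (rule power_mono) auto
        then show "real (k + 2) \<le> real (n + 2) ^ 2" using True by simp
      qed simp
      then have "real (k + 2) ^ 85625 * real (n + 2) ^ 30001 \<le> real (n + 2) ^ (2 * 85625) * real (n + 2) ^ 30001"
        unfolding power_mult by (rule mult_right_mono) simp
      also have "\<dots> = 1 * real (n + 2) ^ 201251" by (subst power_add[symmetric]) simp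
      also have "\<dots> \<le> 2 powr (60172 * (\<beta> * 22 powr \<delta> * c powr \<delta> * real k powr (2 * \<delta> / (1 + \<delta>)) * log 2 (real k))) * real (n + 2) ^ 201251"
      proof (rule mult_right_mono)
        have "log 2 (real k) = 0" using True by (cases "k = 0") (auto simp: log_def)
        then show "1 \<le> 2 powr (60172 * (\<beta> * 22 powr \<delta> * c powr \<delta> * real k powr (2 * \<delta> / (1 + \<delta>)) * log 2 (real k)))" by simp
      qed simp
      finally show ?thesis by simp
    qed
    ultimately show ?thesis using sp by (intro exI[of _ ?f] exI[of _ 2059]) auto
  next
    case False
    then have k: "2 \<le> k" by simp
    \<comment> \<open>The order of a separator of the kernel: |X| + c |X| <= 2c |X| <= 22 c k^(2 -
      \<tau>), raised to the power \<delta> and multiplied by \<beta>. The universal constant 22 is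
      2 times 11.\<close>
    define B0 where "B0 = \<beta> * 22 powr \<delta> * c powr \<delta> * real k powr \<tau>"
    define B where "B = nat \<lceil>B0\<rceil>"
    have \<tau>: "0 \<le> \<tau>" "\<tau> \<le> 1" "2 - \<tau> = 2 / (1 + \<delta>)" "(2 - \<tau>) * \<delta> = \<tau>" "1 \<le> 2 - \<tau>" using \<delta> by (auto simp: \<tau>_def field_simps)
    have one: "1 \<le> 22 powr \<delta>" "1 \<le> c powr \<delta>" "1 \<le> real k powr \<tau>" using \<delta> c1 k \<tau> by (auto intro!: ge_one_powr_ge_zero)
    have "1 * 1 * 1 \<le> \<beta> * 22 powr \<delta> * c powr \<delta>" using \<beta>1 one by (intro mult_mono) auto
    then have "1 * real k powr \<tau> \<le> B0" unfolding B0_def by (intro mult_right_mono) auto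
    then have kB0: "real k powr \<tau> \<le> B0" by simp
    then have B01: "1 \<le> B0" using one(3) by linarith
    have B: "B0 \<le> real B" "real B \<le> B0 + 1" unfolding B_def using B01 by linarith+
    have B1: "1 \<le> B" using B(1) B01 by linarith
    have kB: "real k powr \<tau> \<le> real B" using kB0 B(1) by linarith
    have "?f w \<le> real B" if X: "X \<subseteq> {..<n}" "X \<noteq> {}" "card X * B \<le> 5 * k * B + 6 * k\<^sup>2" "w \<le> card X + ntrace ?E {..<n} X" for X w
    proof -
      have x: "real (card X) \<le> 11 * real k powr (2 - \<tau>)" by (rule card_X_bound[OF _ kB \<tau>(2) X(3)]) (use k in simp)
      have "real w \<le> real (card X + ntrace ?E {..<n} X)" using X(4) by (rule of_nat_mono)
      also have "\<dots> \<le> 1 * real (card X) + c * real (card X)" using tr[OF X(1,2)] by simp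
      also have "\<dots> \<le> c * real (card X) + c * real (card X)" using c1 by (intro add_right_mono mult_right_mono) auto
      also have "\<dots> = 2 * c * real (card X)" by simp
      also have "\<dots> \<le> 2 * c * (11 * real k powr (2 - \<tau>))" using x c1 by (intro mult_left_mono) auto
      finally have "real w powr \<delta> \<le> (22 * c * real k powr (2 - \<tau>)) powr \<delta>" using \<delta> by (intro powr_mono2) auto
      also have "\<dots> = 22 powr \<delta> * c powr \<delta> * real k powr ((2 - \<tau>) * \<delta>)" using c1 by (simp add: powr_mult powr_powr)
      also have "\<dots> = 22 powr \<delta> * c powr \<delta> * real k powr \<tau>" unfolding \<tau>(4) ..
      finally have "?f w \<le> \<beta> * (22 powr \<delta> * c powr \<delta> * real k powr \<tau>)" using \<beta> by (intro mult_left_mono) auto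
      then show ?thesis using B(1) by (simp add: B0_def mult.assoc)
    qed
    moreover have "real (k + 2) ^ (27 * B + 30032) * real (n + 2) ^ 30001 \<le> 2 powr (60172 * (B0 * log 2 (real k))) * real (n + 2) ^ 201251"
      by (intro mult_mono bound_large_k[OF k B01 B(2)] power_increasing) auto
    ultimately show ?thesis using sp B1 unfolding B0_def \<tau>_def by (intro exI[of _ ?f] exI[of _ B]) auto
  qed
next
  fix k :: nat
  have "0 \<le> log 2 (real k)" by (cases "k = 0") (auto simp: log_def)
  then have "2 powr 0 \<le> 2 powr (60172 * (\<beta> * 22 powr \<delta> * c powr \<delta> * real k powr (2 * \<delta> / (1 + \<delta>)) * log 2 (real k)))"
    using \<beta> by (intro powr_mono) auto
  then have p: "1 \<le> 2 powr (60172 * (\<beta> * 22 powr \<delta> * c powr \<delta> * real k powr (2 * \<delta> / (1 + \<delta>)) * log 2 (real k)))" by simp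
  show "20 \<le> 2 powr (60172 * (\<beta> * 22 powr \<delta> * c powr \<delta> * real k powr (2 * \<delta> / (1 + \<delta>)) * log 2 (real k))) * real (0 + 2) ^ 201251"
    by (rule twenty_le[OF p]) simp
qed

lemma sublinear_exponent:
  fixes A \<epsilon> :: real
  assumes "0 < \<epsilon>" "\<epsilon> < 1"
  shows "(\<lambda>k::nat. log 2 (real k + 2) * (27 * (A * real k powr (1 - \<epsilon>) + 2) + 30032)) \<in> o(\<lambda>k. real k)"
  using assms by real_asymp

lemma solves_subexponential:
  assumes her: "hereditary \<G>" and sss: "strongly_sublinear_separators \<G>"
  shows "\<exists>T. subexponential_parameterized T \<and> solves_triangle_hitting_on prog \<G> T"
proof -
  obtain f0 \<delta> where \<delta>: "0 \<le> \<delta>" "\<delta> < 1" and f0: "f0 \<in> O(\<lambda>n. real n powr \<delta>)" "has_separators \<G> f0"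
    using sss unfolding strongly_sublinear_separators_def by (elim exE conjE) (rule that)
  obtain \<beta>0 where \<beta>0: "eventually (\<lambda>n. norm (f0 n) \<le> \<beta>0 * norm (real n powr \<delta>)) sequentially"
    using f0(1) by (elim landau_o.bigE) 
  then obtain n0 where n0: "\<And>m. n0 \<le> m \<Longrightarrow> norm (f0 m) \<le> \<beta>0 * norm (real m powr \<delta>)"
    unfolding eventually_sequentially by (elim exE) (rule that, rule mp, erule spec)
  define \<beta> where "\<beta> = max (max \<beta>0 (real n0)) 1"
  have \<beta>: "0 < \<beta>" "real n0 \<le> \<beta>" "\<beta>0 \<le> \<beta>" by (auto simp: \<beta>_def)
  have f0\<beta>: "f0 m \<le> \<beta> * real m powr \<delta>" if "n0 \<le> m" for m
  proof -
    have "f0 m \<le> \<beta>0 * real m powr \<delta>" using n0[OF that] by simp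
    also have "\<dots> \<le> \<beta> * real m powr \<delta>" using \<beta>(3) by (intro mult_right_mono) auto
    finally show ?thesis .
  qed
  let ?f = "\<lambda>m. \<beta> * real m powr \<delta>"
  \<comment> \<open>For b about k^(1 - \<epsilon>) the relevant set has O(k^(1 + \<epsilon>))
    vertices, and with almost linearly many traces the kernel has size O(k^((1 + \<epsilon>)(1 +
    \<epsilon>))). A quarter of the gap 1 - \<delta> suffices to bring the separator order down to
    k^(1 - \<epsilon>) again.\<close>
  define \<epsilon> where "\<epsilon> = (1 - \<delta>) / 4"
  have \<epsilon>: "0 < \<epsilon>" "\<epsilon> \<le> 1 / 4" "\<epsilon> \<le> 1" "\<epsilon> < 1" "\<delta> = 1 - 4 * \<epsilon>" using \<delta> unfolding \<epsilon>_def by (simp_all add: field_simps)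
  have expo: "(1 + \<epsilon>) * (1 + \<epsilon>) * \<delta> \<le> 1 - \<epsilon>"
  proof -
    have "\<epsilon> * \<epsilon> \<le> \<epsilon> * 1" using \<epsilon> by (intro mult_left_mono) auto
    then have "(1 + \<epsilon>) * (1 + \<epsilon>) \<le> 1 + 3 * \<epsilon>" by (simp add: algebra_simps)
    then have "(1 + \<epsilon>) * (1 + \<epsilon>) * \<delta> \<le> (1 + 3 * \<epsilon>) * \<delta>" using \<delta> by (intro mult_right_mono) auto
    moreover have "3 * \<epsilon> * \<delta> \<le> 3 * \<epsilon> * 1" using \<epsilon> \<delta> by (intro mult_left_mono) auto
    moreover have "(1 + 3 * \<epsilon>) * \<delta> = \<delta> + 3 * \<epsilon> * \<delta>" by (simp add: distrib_right)
    ultimately show ?thesis using \<epsilon>(5) by linarith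
  qed
  from traces_bound[OF \<delta> \<beta>(1) \<epsilon>(1,3)] obtain C where C: "0 < C" and tr: "\<forall>E V X. sepprop ?f E V \<longrightarrow> X \<subseteq> V \<longrightarrow> X \<noteq> {} \<longrightarrow>
    real (card ((\<lambda>v. {u \<in> X. (v, u) \<in> E}) ` V)) \<le> C * real (card X) powr (1 + \<epsilon>)"
    by (elim exE conjE) (rule that)
  define A where "A = max 1 (\<beta> * ((1 + C) * 11 powr (1 + \<epsilon>)) powr \<delta>)"
  have A: "1 \<le> A" "\<beta> * ((1 + C) * 11 powr (1 + \<epsilon>)) powr \<delta> \<le> A" by (auto simp: A_def)
  define gk where "gk k = log 2 (real k + 2) * (27 * (A * real k powr (1 - \<epsilon>) + 2) + 30032)" for k :: nat
  define T where "T n k = 2 powr gk k * real (n + 2) ^ 30001" for n k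
  have "gk \<in> o(\<lambda>k. real k)" unfolding gk_def by (rule sublinear_exponent[OF \<epsilon>(1,4)])
  then have "subexponential_parameterized T" unfolding subexponential_parameterized_def T_def by blast
  moreover have "solves_triangle_hitting_on prog \<G> T"
  proof (rule solves_if[OF her])
    fix n k G assume G: "G \<in> \<G>" "pverts G = {..<n}" and n: "1 \<le> n"
    let ?E = "parcs G"
    have "sepprop f0 ?E {..<n}" using class_sepprop[OF her f0(2) G(1)] G(2) by simp
    then have sp: "sepprop ?f ?E {..<n}" by (rule sepprop_weaken[OF _ f0\<beta> \<beta>(2) \<delta>(1)])
    \<comment> \<open>The additional 1 ensures B >= 1 for k = 0, where the power vanishes.\<close>
    define B where "B = nat \<lceil>A * real k powr (1 - \<epsilon>)\<rceil> + 1"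
    have "0 \<le> A * real k powr (1 - \<epsilon>)" using A by simp
    then have B: "A * real k powr (1 - \<epsilon>) \<le> real B" "real B \<le> A * real k powr (1 - \<epsilon>) + 2" unfolding B_def by linarith+
    have B1: "1 \<le> B" by (simp add: B_def)
    have "?f w \<le> real B" if X: "X \<subseteq> {..<n}" "X \<noteq> {}" "card X * B \<le> 5 * k * B + 6 * k\<^sup>2" "w \<le> card X + ntrace ?E {..<n} X" for X w
    proof -
      have fX: "finite X" using finite_subset[OF X(1)] by simp
      then have x1: "1 \<le> real (card X)" using X(2) by (simp add: Suc_le_eq card_gt_0_iff)
      have k: "1 \<le> k"
      proof (rule ccontr)
        assume "\<not> 1 \<le> k"
        then have "k = 0" by simp
        then have "card X * B = 0" using X(3) by simp
        then show False using x1 B1 by simp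
      qed
      have "1 * real k powr (1 - \<epsilon>) \<le> A * real k powr (1 - \<epsilon>)" using A(1) by (rule mult_right_mono) simp
      then have kB: "real k powr (1 - \<epsilon>) \<le> real B" using B(1) by simp
      have x: "real (card X) \<le> 11 * real k powr (2 - (1 - \<epsilon>))" by (rule card_X_bound[OF k kB _ X(3)]) (use \<epsilon> in simp)
      then have x: "real (card X) \<le> 11 * real k powr (1 + \<epsilon>)" by simp
      let ?x = "real (card X) powr (1 + \<epsilon>)"
      have "real (card X) powr 1 \<le> ?x" using x1 \<epsilon> by (intro powr_mono) auto
      then have xx: "real (card X) \<le> ?x" using x1 by simp
      have "real (ntrace ?E {..<n} X) \<le> C * ?x" unfolding ntrace_def by (rule tr[rule_format, OF sp X(1,2)])
      then have "real w \<le> ?x + C * ?x" using xx of_nat_mono[OF X(4), where 'a=real] by simp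
      also have "\<dots> = (1 + C) * ?x" by (simp add: algebra_simps)
      also have "\<dots> \<le> (1 + C) * (11 * real k powr (1 + \<epsilon>)) powr (1 + \<epsilon>)"
        using x \<epsilon> C by (intro mult_left_mono powr_mono2) auto
      also have "\<dots> = (1 + C) * 11 powr (1 + \<epsilon>) * real k powr ((1 + \<epsilon>) * (1 + \<epsilon>))"
        by (simp add: powr_mult powr_powr)
      finally have "real w powr \<delta> \<le> ((1 + C) * 11 powr (1 + \<epsilon>) * real k powr ((1 + \<epsilon>) * (1 + \<epsilon>))) powr \<delta>"
        using \<delta> by (intro powr_mono2) auto
      also have "\<dots> = ((1 + C) * 11 powr (1 + \<epsilon>)) powr \<delta> * real k powr ((1 + \<epsilon>) * (1 + \<epsilon>) * \<delta>)"
        using C by (simp add: powr_mult powr_powr)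
      also have "\<dots> \<le> ((1 + C) * 11 powr (1 + \<epsilon>)) powr \<delta> * real k powr (1 - \<epsilon>)"
        using expo k by (intro mult_left_mono powr_mono) auto
      finally have "?f w \<le> \<beta> * (((1 + C) * 11 powr (1 + \<epsilon>)) powr \<delta> * real k powr (1 - \<epsilon>))"
        using \<beta> by (intro mult_left_mono) auto
      also have "\<dots> \<le> A * real k powr (1 - \<epsilon>)"
        unfolding mult.assoc[symmetric] using A(2) by (intro mult_right_mono) (auto simp: mult.assoc)
      finally show ?thesis using B(1) by linarith
    qed
    moreover have "real (k + 2) ^ (27 * B + 30032) * real (n + 2) ^ 30001 \<le> T n k"
      unfolding T_def
    proof (rule mult_right_mono)
      have "real (k + 2) = 2 powr log 2 (real k + 2)" by simp
      then have "real (k + 2) ^ (27 * B + 30032) = 2 powr (log 2 (real k + 2) * real (27 * B + 30032))"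
        by (simp only: powr_pow)
      also have "\<dots> \<le> 2 powr gk k"
        unfolding gk_def using B(2) by (intro powr_mono mult_left_mono) auto
      finally show "real (k + 2) ^ (27 * B + 30032) \<le> 2 powr gk k" .
    qed simp
    ultimately show "\<exists>f B. sepprop f ?E {..<n} \<and> 1 \<le> B \<and>
        (\<forall>X w. X \<subseteq> {..<n} \<and> X \<noteq> {} \<and> card X * B \<le> 5 * k * B + 6 * k\<^sup>2 \<and> w \<le> card X + ntrace ?E {..<n} X \<longrightarrow>
          w \<le> B \<or> f w \<le> real B) \<and>
        real (k + 2) ^ (27 * B + 30032) * real (n + 2) ^ 30001 \<le> T n k"
      using sp B1 by (intro exI[of _ ?f] exI[of _ B]) auto
  next
    fix k
    have "0 \<le> gk k" using A unfolding gk_def by (intro mult_nonneg_nonneg add_nonneg_nonneg) auto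
    then have "2 powr 0 \<le> 2 powr gk k" by (intro powr_mono) auto
    then have p: "1 \<le> 2 powr gk k" by simp
    show "20 \<le> T 0 k" unfolding T_def by (rule twenty_le[OF p]) simp
  qed
  ultimately show ?thesis by blast
qed

theorem theorem61:
  shows "\<exists>\<gamma>::real. \<exists>C::real. \<exists>d::nat. \<gamma> > 0 \<and> C > 0 \<and>
    (\<forall>\<G> :: nat pair_pre_digraph set.
       hereditary \<G> \<and> strongly_sublinear_separators \<G> \<longrightarrow>
       (\<exists>P :: program.
          (\<exists>T. subexponential_parameterized T \<and> solves_triangle_hitting_on P \<G> T) \<and>
          (\<forall>\<beta> \<delta> c :: real.
             \<beta> > 0 \<and> 0 \<le> \<delta> \<and> \<delta> < 1 \<and>
             has_separators \<G> (\<lambda>n. \<beta> * real n powr \<delta>) \<and>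
             linear_neighborhood_complexity \<G> c \<longrightarrow>
             solves_triangle_hitting_on P \<G>
               (\<lambda>n k. 2 powr (C * (\<beta> * \<gamma> powr \<delta> * c powr \<delta> *
                                   real k powr (2 * \<delta> / (1 + \<delta>)) * log 2 (real k)))
                      * real (n + 2) ^ d))))"
proof (rule exI[of _ 22], rule exI[of _ 60172], rule exI[of _ 201251], intro conjI allI impI)
  show "0 < (22::real)" "0 < (60172::real)" by simp_all
  fix \<G> :: "nat pair_pre_digraph set"
  assume "hereditary \<G> \<and> strongly_sublinear_separators \<G>"
  then have \<G>: "hereditary \<G>" "strongly_sublinear_separators \<G>" by simp_all
  show "\<exists>P :: program. (\<exists>T. subexponential_parameterized T \<and> solves_triangle_hitting_on P \<G> T) \<and>
    (\<forall>\<beta> \<delta> c :: real. \<beta> > 0 \<and> 0 \<le> \<delta> \<and> \<delta> < 1 \<and> has_separators \<G> (\<lambda>n. \<beta> * real n powr \<delta>) \<and>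
      linear_neighborhood_complexity \<G> c \<longrightarrow> solves_triangle_hitting_on P \<G>
        (\<lambda>n k. 2 powr (60172 * (\<beta> * 22 powr \<delta> * c powr \<delta> * real k powr (2 * \<delta> / (1 + \<delta>)) * log 2 (real k))) * real (n + 2) ^ 201251))"
  \<comment> \<open>One fixed program satisfies both bounds, for all choices of \<beta>, \<delta>
    and c at once.\<close>
  proof (intro exI[of _ prog] conjI allI impI solves_subexponential[OF \<G>])
    fix \<beta> \<delta> c :: real
    assume "\<beta> > 0 \<and> 0 \<le> \<delta> \<and> \<delta> < 1 \<and> has_separators \<G> (\<lambda>n. \<beta> * real n powr \<delta>) \<and> linear_neighborhood_complexity \<G> c"
    then show "solves_triangle_hitting_on prog \<G>
      (\<lambda>n k. 2 powr (60172 * (\<beta> * 22 powr \<delta> * c powr \<delta> * real k powr (2 * \<delta> / (1 + \<delta>)) * log 2 (real k))) * real (n + 2) ^ 201251)"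
      using \<G>(1) by (intro time_bound_precise) simp_all
  qed
qed

end
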